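(* Let $0\le\alpha<n$, let $1\le p_0\le p\le q<q_0\le\infty$ satisfy $\frac1p-\frac1q=\frac{\alpha}{nq_0'}$, and let $T\in S^{\alpha}(p_0,q_0)$ be an operator on $\mathbf{R}^n$ with sparsity parameter $0<\eta\le 1$. Let $w$ be a weight such that $w^{p_0}\in A^{\mathcal R}_{p/p_0,\,q/p_0}$ and $w^{q}\in RH_{(q_0/q)'}$. Then $$\|T\|_{L^{p,1}(w^p)\to L^{q,\infty}(w^q)}\lesssim [w^{p_0}]_{A^{\mathcal R}_{p/p_0,\,q/p_0}}^{\frac1{p_0}}\,[w^q]_{RH_{(q_0/q)'}}^{\left(\frac{q_0}{q}\right)'+\frac1q}\,D^{\eta}_{w^q}\left(D^{2^{-n}}_{w^q}\right)^{\frac1q},$$ where $[w^q]_{RH_1}=1$ and, for $0<\delta\le1$, $$D^{\delta}_{w^q}=\sup\left\{\frac{w^q(Q)}{w^q(E)}:\ Q\text{ is a shifted dyadic cube},\ E\subseteq Q \text{ measurable},\ |E|\ge\delta|Q|\right\}.$$ Moreover, $D^{\eta}_{w^q}\lesssim [w^{p_0}]_{A^{\mathcal R}_{p/p_0,\,q/p_0}}^{\frac{q}{p_0}}$. The implicit constants are independent of $w$.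
   Context: Notation. $\mathbf{R}^n$ carries Lebesgue measure; $|E|$ is the measure of $E$, $p'=p/(p-1)$ (with $1'=\infty$, $\infty'=1$; if $q_0=\infty$ then $(q_0/q)'=1$), and $\langle f,g\rangle=\int fg\,dx$. Cubes have sides parallel to the axes. A weight is a non-negative locally integrable function $w$, with $w(E)=\int_E w\,dx$; $L^p(w)$ etc. denote the spaces with respect to the measure $w\,dx$. For $0\le\alpha<n$, $1\le r<\infty$, $$\langle f\rangle_{\alpha,r,Q}=\Big(\frac1{|Q|^{1-\alpha/n}}\int_Q|f|^r\,dx\Big)^{1/r},\qquad \langle f\rangle_{r,Q}=\langle f\rangle_{0,r,Q},\qquad \langle f\rangle_Q=\langle f\rangle_{1,Q}.$$ The notation $a\lesssim b$ means $a\le Cb$ with $C$ independent of the important parameters; here $C$ may depend on $n,\alpha,p,q,p_0,q_0$, on $\eta$, and on the number $N$ and the implicit constant in the sparse domination of $T$, but not on $w$ or the functions. Dyadic grids and sparse families. A dyadic grid $\mathcal D$ is a collection of cubes such that: each side length is $2^k$ for some $k\in\mathbf{Z}$; $Q\cap R\in\{\varnothing,Q,R\}$ for all $Q,R\in\mathcal D$; the cubes of a fixed side length $2^k$ partition $\mathbf{R}^n$. The shifted dyadic cubes are the members of $\mathcal D^a=\{2^{-k}([0,1)^n+m+(-1)^k\frac a3):k\in\mathbf{Z},m\in\mathbf{Z}^n\}$, $a\in\{0,1,2\}^n$. A collection $\mathcal S\subseteq\mathcal D$ is $\eta$-sparse ($0<\eta\le1$) if there are pairwise disjoint sets $(E_Q)_{Q\in\mathcal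 S}$ with $E_Q\subseteq Q$ and $|E_Q|\ge\eta|Q|$. The class $S^\alpha(p_0,q_0)$. Let $0\le\alpha<n$ and $1\le p_0<q_0\le\infty$ with $\frac1{p_0}-\frac1{q_0}>\frac{\alpha}{nq_0'}$ (standing assumption). A (sub)linear operator $T$, initially defined on $C_c^\infty$, belongs to $S^\alpha(p_0,q_0)$ if there are a positive integer $N$ and $0<\eta\le1$ (the sparsity parameter) such that for all $f,g\in C_c^\infty$ there exist $\eta$-sparse collections $\mathcal S_1,\dots,\mathcal S_N$ with $$|\langle Tf,g\rangle|\lesssim\sum_{j=1}^N\sum_{Q\in\mathcal S_j}\langle f\rangle_{p_0,Q}\,\langle g\rangle_{\alpha,q_0',Q}\,|Q|,$$ with implicit constant independent of $f,g$. Operator norm. $\|T\|_{X\to Y}$ is the least $K$ with $\|Tf\|_Y\le K\|f\|_X$, where $T$, initially defined on $C_c^\infty$, is as usual extended by density. Lorentz norms: $\|f\|_{L^{p,1}(u)}=p\int_0^\infty u(\{|f|>y\})^{1/p}dy$, $\|f\|_{L^{p,\infty}(u)}=\sup_{y>0}y\,u(\{|f|>y\})^{1/p}$. Weight classes. For $1\le a\le b<\infty$ with $0\le\frac1a-\frac1b<1$, $v\in A^{\mathcal R}_{a,b}$ means $$[v]_{A^{\mathcal R}_{a,b}}:=\sup_Q\sup_{E\subseteq Q}\frac{|E|}{|Q|^{1-\left(\frac1a-\frac1b\right)}}\,\frac{(v^b(Q))^{1/b}}{(v^a(E))^{1/a}}<\infty ,$$ the suprema over cubes $Q$ and measurable $E\subseteq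 Q$ of positive measure. For $1<s<\infty$, $v\in RH_s$ means $[v]_{RH_s}:=\sup_Q\langle v\rangle_{s,Q}/\langle v\rangle_Q<\infty$. For $s=1$, $RH_1:=A_\infty=\bigcup_{r\ge1}A_r$ (union of the Muckenhoupt classes) and $[v]_{RH_1}:=1$. *)

theory Defs
  imports "HOL-Analysis.Analysis"
begin

text \<open>
  The ambient space is \<open>real ^ 'n\<close>, so that \<open>n = CARD('n)\<close>. Test functions take values
  in a type \<open>'k\<close> of sort \<open>{real_normed_field, euclidean_space}\<close>, which covers both
  real- and complex-valued functions.
  All sizes (measures, averages, norms, weight characteristics) live in \<open>ennreal\<close>, where
  \<open>0 / 0 = 0\<close>, \<open>x / 0 = \<infinity>\<close> for \<open>x \<noteq> 0\<close>, and \<open>0 * \<infinity> = 0\<close>.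
\<close>

text \<open>Real powers on \<open>ennreal\<close>; used for positive exponents only.\<close>

definition epow :: "ennreal \<Rightarrow> real \<Rightarrow> ennreal" where
  "epow x a = (if x = \<infinity> then \<infinity> else ennreal (enn2real x powr a))"

text \<open>The conjugate \<open>r'\<close> of an exponent \<open>1 < r \<le> \<infinity>\<close>.\<close>

definition conj_exp :: "ennreal \<Rightarrow> real" where
  "conj_exp r = (if r = \<infinity> then 1 else enn2real r / (enn2real r - 1))"

text \<open>All cubes are half-open, as the members of a dyadic grid have to be in order to partition
  the space; for the weight characteristics the choice of faces is immaterial.\<close>

definition cube_at :: "real ^ 'n \<Rightarrow> real \<Rightarrow> (real ^ 'n) set" where
  "cube_at c l = {x. \<forall>i. c $ i \<le> x $ i \<and> x $ i < c $ i + l}"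

definition cubes :: "(real ^ 'n) set set" where
  "cubes = {cube_at c l | c l. 0 < l}"

definition dyadic_grid :: "(real ^ 'n) set set \<Rightarrow> bool" where
  "dyadic_grid D \<longleftrightarrow>
     (\<forall>Q\<in>D. \<exists>c (k::int). Q = cube_at c (2 powi k)) \<and>
     (\<forall>Q\<in>D. \<forall>R\<in>D. Q \<inter> R \<in> {{}, Q, R}) \<and>
     (\<forall>k::int. partition_on UNIV {Q \<in> D. \<exists>c. Q = cube_at c (2 powi k)})"

definition shifted_grid :: "('n \<Rightarrow> nat) \<Rightarrow> (real ^ 'n) set set" where
  "shifted_grid a =
     {cube_at (\<chi> i. 2 powi (- k) * (of_int (m i) + (- 1) powi k * (real (a i) / 3))) (2 powi (- k))
      | (k::int) (m :: 'n \<Rightarrow> int). True}"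

definition shifted_dyadic_cubes :: "(real ^ 'n) set set" where
  "shifted_dyadic_cubes = (\<Union>a \<in> {a. \<forall>i. a i \<in> {0, 1, 2}}. shifted_grid a)"

definition sparse :: "real \<Rightarrow> (real ^ 'n) set set \<Rightarrow> bool" where
  "sparse \<eta> S \<longleftrightarrow>
     (\<exists>D. dyadic_grid D \<and> S \<subseteq> D) \<and>
     (\<exists>E. disjoint_family_on E S \<and>
        (\<forall>Q\<in>S. E Q \<in> sets lebesgue \<and> E Q \<subseteq> Q \<and>
           emeasure lebesgue (E Q) \<ge> ennreal \<eta> * emeasure lebesgue Q))"

definition avg :: "real \<Rightarrow> real \<Rightarrow> (real ^ 'n \<Rightarrow> 'k::real_normed_vector) \<Rightarrow> (real ^ 'n) set \<Rightarrow> ennreal"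
  where
  "avg \<alpha> r f Q =
     epow ((\<integral>\<^sup>+x\<in>Q. ennreal (norm (f x) powr r) \<partial>lebesgue)
             / epow (emeasure lebesgue Q) (1 - \<alpha> / real CARD('n))) (1 / r)"

fun C_k :: "nat \<Rightarrow> (real ^ 'n \<Rightarrow> 'k::real_normed_vector) \<Rightarrow> bool" where
  "C_k 0 f \<longleftrightarrow> continuous_on UNIV f"
| "C_k (Suc k) f \<longleftrightarrow> (\<forall>x. f differentiable (at x)) \<and>
     (\<forall>v. C_k k (\<lambda>x. frechet_derivative f (at x) v))"

definition test_functions :: "(real ^ 'n \<Rightarrow> 'k::real_normed_vector) set" where
  "test_functions = {f. (\<forall>k. C_k k f) \<and> compact (closure {x. f x \<noteq> 0})}"

definition locally_integrable :: "(real ^ 'n \<Rightarrow> 'k::euclidean_space) \<Rightarrow> bool" where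
  "locally_integrable f \<longleftrightarrow> (\<forall>K. compact K \<longrightarrow> f absolutely_integrable_on K)"

text \<open>Linear operators are a special case. Identities between values of \<open>T\<close> are understood
  almost everywhere; values of \<open>T\<close> off the test functions are irrelevant.\<close>

definition sublinear_op ::
  "((real ^ 'n \<Rightarrow> 'k::real_normed_field) \<Rightarrow> (real ^ 'n \<Rightarrow> 'k)) \<Rightarrow> bool" where
  "sublinear_op T \<longleftrightarrow>
     (\<forall>f\<in>test_functions. \<forall>g\<in>test_functions.
        AE x in lebesgue. norm (T (\<lambda>y. f y + g y) x) \<le> norm (T f x) + norm (T g x)) \<and>
     (\<forall>f\<in>test_functions. \<forall>c.
        AE x in lebesgue. norm (T (\<lambda>y. c * f y) x) = norm c * norm (T f x))"

text \<open>The number \<open>N\<close> of sparse collections, the sparsity parameter \<open>\<eta>\<close> and the implicit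
  constant \<open>A\<close> of the domination are kept as parameters, because the constants in the weighted
  bounds may depend on them. Local integrability of \<open>T f\<close> is what gives the
  pairing of \<open>T f\<close> with arbitrary test functions a meaning.\<close>

definition S_class ::
  "real \<Rightarrow> real \<Rightarrow> ennreal \<Rightarrow> nat \<Rightarrow> real \<Rightarrow> real
   \<Rightarrow> ((real ^ 'n \<Rightarrow> 'k::{real_normed_field, euclidean_space}) \<Rightarrow> (real ^ 'n \<Rightarrow> 'k)) \<Rightarrow> bool" where
  "S_class \<alpha> p\<^sub>0 q\<^sub>0 N \<eta> A T \<longleftrightarrow>
     0 \<le> \<alpha> \<and> \<alpha> < real CARD('n) \<and> 1 \<le> p\<^sub>0 \<and> ennreal p\<^sub>0 < q\<^sub>0 \<and>
     1 / p\<^sub>0 - enn2real (1 / q\<^sub>0) > \<alpha> / (real CARD('n) * conj_exp q\<^sub>0) \<and>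
     0 < N \<and> 0 < \<eta> \<and> \<eta> \<le> 1 \<and>
     sublinear_op T \<and> (\<forall>f\<in>test_functions. locally_integrable (T f)) \<and>
     (\<forall>f\<in>test_functions. \<forall>g\<in>test_functions. \<exists>S. (\<forall>j<N. sparse \<eta> (S j)) \<and>
        ennreal (norm (\<integral>x. T f x * g x \<partial>lebesgue))
          \<le> ennreal A *
            (\<Sum>j<N. \<Sum>\<^sub>\<infinity>Q\<in>S j. avg 0 p\<^sub>0 f Q * avg \<alpha> (conj_exp q\<^sub>0) g Q * emeasure lebesgue Q))"

definition weight :: "(real ^ 'n \<Rightarrow> real) \<Rightarrow> bool" where
  "weight w \<longleftrightarrow> (\<forall>x. 0 \<le> w x) \<and> locally_integrable w"

definition wmeas :: "(real ^ 'n \<Rightarrow> real) \<Rightarrow> (real ^ 'n) set \<Rightarrow> ennreal" where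
  "wmeas w E = (\<integral>\<^sup>+x\<in>E. ennreal (w x) \<partial>lebesgue)"

definition wpow :: "(real ^ 'n \<Rightarrow> real) \<Rightarrow> real \<Rightarrow> (real ^ 'n \<Rightarrow> real)" where
  "wpow w a = (\<lambda>x. w x powr a)"

definition AR_const :: "real \<Rightarrow> real \<Rightarrow> (real ^ 'n \<Rightarrow> real) \<Rightarrow> ennreal" where
  "AR_const a b v =
     (SUP Q\<in>cubes. SUP E\<in>{E \<in> sets lebesgue. E \<subseteq> Q \<and> 0 < emeasure lebesgue E}.
        (emeasure lebesgue E / epow (emeasure lebesgue Q) (1 - (1 / a - 1 / b)))
          * (epow (wmeas (wpow v b) Q) (1 / b) / epow (wmeas (wpow v a) E) (1 / a)))"

definition AR_class :: "real \<Rightarrow> real \<Rightarrow> (real ^ 'n \<Rightarrow> real) \<Rightarrow> bool" where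
  "AR_class a b v \<longleftrightarrow>
     1 \<le> a \<and> a \<le> b \<and> 1 / a - 1 / b < 1 \<and> weight v \<and> AR_const a b v < \<infinity>"

text \<open>For \<open>r > 1\<close>, the negative power of the weight is taken in \<open>ennreal\<close>, so that it is infinite
  where the weight vanishes (whereas \<open>0 powr (- t) = 0\<close> in the reals).\<close>

definition muckenhoupt :: "real \<Rightarrow> (real ^ 'n \<Rightarrow> real) \<Rightarrow> bool" where
  "muckenhoupt r v \<longleftrightarrow> 1 \<le> r \<and> weight v \<and>
     (if r = 1
      then \<exists>K::real. \<forall>Q\<in>cubes. AE x in lebesgue. x \<in> Q \<longrightarrow> avg 0 1 v Q \<le> ennreal (K * v x)
      else (SUP Q\<in>cubes. avg 0 1 v Q *
              epow ((\<integral>\<^sup>+x\<in>Q. epow (inverse (ennreal (v x))) (1 / (r - 1)) \<partial>lebesgue)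
                      / emeasure lebesgue Q) (r - 1)) < \<infinity>)"

definition A_infty :: "(real ^ 'n \<Rightarrow> real) \<Rightarrow> bool" where
  "A_infty v \<longleftrightarrow> (\<exists>r\<ge>1. muckenhoupt r v)"

definition RH_const :: "real \<Rightarrow> (real ^ 'n \<Rightarrow> real) \<Rightarrow> ennreal" where
  "RH_const s v = (if s = 1 then 1 else (SUP Q\<in>cubes. avg 0 s v Q / avg 0 1 v Q))"

definition RH_class :: "real \<Rightarrow> (real ^ 'n \<Rightarrow> real) \<Rightarrow> bool" where
  "RH_class s v \<longleftrightarrow> weight v \<and>
     (if s = 1 then A_infty v else 1 < s \<and> RH_const s v < \<infinity>)"

definition D_const :: "real \<Rightarrow> (real ^ 'n \<Rightarrow> real) \<Rightarrow> ennreal" where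
  "D_const \<delta> u =
     (SUP Q\<in>shifted_dyadic_cubes.
      SUP E\<in>{E \<in> sets lebesgue. E \<subseteq> Q \<and> emeasure lebesgue E \<ge> ennreal \<delta> * emeasure lebesgue Q}.
        wmeas u Q / wmeas u E)"

definition lorentz_p1 :: "real \<Rightarrow> (real ^ 'n \<Rightarrow> real) \<Rightarrow> (real ^ 'n \<Rightarrow> 'k::real_normed_vector) \<Rightarrow> ennreal"
  where
  "lorentz_p1 p u f =
     ennreal p * (\<integral>\<^sup>+y\<in>{0<..}. epow (wmeas u {x. y < norm (f x)}) (1 / p) \<partial>lborel)"

definition lorentz_weak :: "real \<Rightarrow> (real ^ 'n \<Rightarrow> real) \<Rightarrow> (real ^ 'n \<Rightarrow> 'k::real_normed_vector) \<Rightarrow> ennreal"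
  where
  "lorentz_weak p u f = (SUP y\<in>{0<..}. ennreal y * epow (wmeas u {x. y < norm (f x)}) (1 / p))"

text \<open>\<open>h\<close> is a value at \<open>f\<close> of the extension of \<open>T\<close> by density from the test functions: \<open>f\<close> is
  a limit of test functions in the first norm and \<open>h\<close> the limit of their images in the second.
  Taking constant sequences, \<open>T f\<close> is such a value when \<open>f\<close> is a test function.\<close>

definition density_extension ::
  "((real ^ 'n \<Rightarrow> 'k::real_normed_field) \<Rightarrow> ennreal) \<Rightarrow> ((real ^ 'n \<Rightarrow> 'k) \<Rightarrow> ennreal)
   \<Rightarrow> ((real ^ 'n \<Rightarrow> 'k) \<Rightarrow> (real ^ 'n \<Rightarrow> 'k)) \<Rightarrow> (real ^ 'n \<Rightarrow> 'k) \<Rightarrow> (real ^ 'n \<Rightarrow> 'k) \<Rightarrow> bool" where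
  "density_extension normX normY T f h \<longleftrightarrow>
     f \<in> borel_measurable lebesgue \<and> h \<in> borel_measurable lebesgue \<and>
     (\<exists>\<phi>. (\<forall>k::nat. \<phi> k \<in> test_functions) \<and>
        (\<lambda>k. normX (\<lambda>x. \<phi> k x - f x)) \<longlonglongrightarrow> 0 \<and>
        (\<lambda>k. normY (\<lambda>x. T (\<phi> k) x - h x)) \<longlonglongrightarrow> 0)"

definition op_norm ::
  "((real ^ 'n \<Rightarrow> 'k::real_normed_field) \<Rightarrow> ennreal) \<Rightarrow> ((real ^ 'n \<Rightarrow> 'k) \<Rightarrow> ennreal)
   \<Rightarrow> ((real ^ 'n \<Rightarrow> 'k) \<Rightarrow> (real ^ 'n \<Rightarrow> 'k)) \<Rightarrow> ennreal" where
  "op_norm normX normY T =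
     Inf {K. \<forall>f h. density_extension normX normY T f h \<longrightarrow> normY h \<le> K * normX f}"

end

theory Submission
  imports Defs
begin

text \<open>
  Put \<open>u = w^q\<close>, \<open>v = w^p\<close>, \<open>r = q\<^sub>0'\<close>, \<open>s = (q\<^sub>0/q)'\<close> and \<open>\<beta> = 1/p - 1/q = \<alpha>/(n r)\<close>. Moving the
  fractional factor from the average of \<open>g\<close> to that of \<open>f\<close>, a summand of the sparse form becomes
  \<open>pavg p\<^sub>0 \<beta> f Q * pavg r 1 g Q\<close>. By duality (\<open>weak_type_of_form_bound\<close>), the weak type bound for
  \<open>T f\<close> follows if the form is at most a multiple of \<open>u(G)^(1 - 1/q)\<close> for all \<open>g\<close> with
  \<open>|g| \<le> u\<close> on \<open>G'\<close> and \<open>g = 0\<close> elsewhere, where \<open>G'\<close> is a part of a bounded set \<open>G\<close> that carries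
  half of its mass. Three facts give this.

  \<^item> Averages of \<open>f\<close>. Minkowski's inequality reduces \<open>f\<close> to the indicators of its level sets, and for
  an indicator the class \<open>A\<^sup>R\<close> says exactly what is needed; so
  \<open>(\<Sum>Q. pavg p\<^sub>0 \<beta> f Q ^ q * u(Q)) \<le> L^q\<close> over disjoint cubes, where \<open>L\<close> is the \<open>A\<^sup>R\<close> constant to the
  power \<open>1/p\<^sub>0\<close>, times the Lorentz norm of \<open>f\<close> (\<open>disjoint_cubes_pavg_sum\<close>). Consequently the shifted dyadic
  cubes with average above a multiple of \<open>L * u(G)^(-1/q)\<close> cover at most half of \<open>G\<close>
  (\<open>exceptional_set\<close>); \<open>G'\<close> is what they leave.

  \<^item> Averages of \<open>g\<close>. The reverse Hoelder inequality with constant \<open>Rc\<close>, together with doubling, makes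
  \<open>u^s\<close> decay: \<open>u^s(G) \<le> 4 * (u(G)/u(Q))^\<delta> * u^s(Q)\<close> for \<open>G \<subseteq> Q\<close> and shifted dyadic
  \<open>Q\<close>, where \<open>\<delta>\<close> is comparable to
  \<open>1 / (Rc^s * ln (2 * d2))\<close> and \<open>d2\<close> is the doubling constant (\<open>decay_measurable\<close>). Interpolating
  \<open>L\<^sup>r\<close> between \<open>L\<^sup>1\<close> and \<open>L\<^sup>s\<close> yields
  \<open>pavg r 1 g Q \<le> 4 * Rc^(1/q) * \<rho>^(1 - 1/q + \<epsilon>) * u(Q)\<close> with \<open>\<rho> = u(G' \<inter> Q)/u(Q)\<close> and
  \<open>\<epsilon> = \<delta>/(s q)\<close> (\<open>pavg_interpolation\<close>).

  \<^item> Packing. A stopping time argument shows that a sparse family satisfies a Carleson condition for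
  \<open>u\<close> with constant linear in \<open>D\<^sup>\<eta>\<close> (\<open>carleson_of_sparse\<close>). The cubes of the family with
  \<open>pavg p\<^sub>0 \<beta> f Q \<ge> t\<close>, or with \<open>\<rho> \<ge> t\<close>, are therefore controlled by disjoint ones, and
  the numbers \<open>pavg p\<^sub>0 \<beta> f Q\<close> and \<open>\<rho>\<close> are of weak type \<open>q\<close> and \<open>1\<close> for the masses \<open>u(Q)\<close>. Thanks to
  the gain \<open>\<epsilon>\<close>, and to the cap on the averages of \<open>f\<close> over the cubes that meet \<open>G'\<close>, summing
  their product costs only a factor \<open>1 + 1/\<epsilon>\<close> (\<open>sum_product_le_of_weak_types\<close>).

  The constant collects \<open>L\<close> and \<open>D\<^sup>\<eta>\<close> from the first and the third fact, \<open>Rc^(1/q)\<close> from the second, and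
  \<open>Rc^s * d2^(1/q)\<close> from \<open>1/\<epsilon>\<close>, because \<open>ln (2 * d2) \<le> q * (2 * d2)^(1/q)\<close>.

  The sparse families live in arbitrary dyadic grids; every cube lies in a shifted dyadic cube of
  comparable volume (\<open>one_third_trick\<close>), so that only shifted cubes enter the constants. For \<open>\<eta> = 1\<close>
  the stopping argument degenerates, but then the cubes are disjoint and Hoelder's inequality is
  enough (\<open>form_sum_disjoint\<close>). The bound \<open>D\<^sup>\<eta> \<lesssim> [w^p\<^sub>0]^(q/p\<^sub>0)\<close> is Hoelder's inequality for
  \<open>v(E)\<close> inserted in the definition of \<open>A\<^sup>R\<close> (\<open>D_const_bound\<close>).
\<close>

section \<open>Inequalities for integrals and sums\<close>

text \<open>Normalised by \<open>A\<close> and \<open>B\<close>, the integrand lies below the convex combination of \<open>F / A\<close> and \<open>G / B\<close>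
  by Young's inequality, which integrates to at most 1.\<close>

lemma nn_integral_holder:
  fixes F G :: "'a \<Rightarrow> real"
  assumes [measurable]: "F \<in> borel_measurable M" "G \<in> borel_measurable M"
    and nn: "\<And>x. 0 \<le> F x" "\<And>x. 0 \<le> G x" and th: "0 \<le> \<theta>" "\<theta> \<le> 1"
    and FA: "(\<integral>\<^sup>+x. ennreal (F x) \<partial>M) \<le> ennreal A" and GB: "(\<integral>\<^sup>+x. ennreal (G x) \<partial>M) \<le> ennreal B"
    and AB: "0 \<le> A" "0 \<le> B"
  shows "(\<integral>\<^sup>+x. ennreal (F x powr (1 - \<theta>) * G x powr \<theta>) \<partial>M) \<le> ennreal (A powr (1 - \<theta>) * B powr \<theta>)"
proof (cases "A = 0 \<or> B = 0")
  case True
  have "AE x in M. ennreal (F x powr (1 - \<theta>) * G x powr \<theta>) = 0"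
  proof (cases "A = 0")
    case True
    then have "(\<integral>\<^sup>+x. ennreal (F x) \<partial>M) = 0" using FA by simp
    then have "AE x in M. ennreal (F x) = 0" by (subst (asm) nn_integral_0_iff_AE) auto
    then have "AE x in M. F x = 0" by eventually_elim (auto intro!: antisym simp: ennreal_eq_0_iff nn)
    then show ?thesis by eventually_elim simp
  next
    case False
    then have "(\<integral>\<^sup>+x. ennreal (G x) \<partial>M) = 0" using GB \<open>A = 0 \<or> B = 0\<close> by simp
    then have "AE x in M. ennreal (G x) = 0" by (subst (asm) nn_integral_0_iff_AE) auto
    then have "AE x in M. G x = 0" by eventually_elim (auto intro!: antisym simp: ennreal_eq_0_iff nn)
    then show ?thesis by eventually_elim simp
  qed
  then have "(\<integral>\<^sup>+x. ennreal (F x powr (1 - \<theta>) * G x powr \<theta>) \<partial>M) = 0"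
    by (subst nn_integral_0_iff_AE) auto
  then show ?thesis by simp
next
  case False
  then have pos: "A > 0" "B > 0" using AB by auto
  define c where "c = A powr (1 - \<theta>) * B powr \<theta>"
  have c: "c > 0" using pos by (simp add: c_def)
  have pt: "F x powr (1 - \<theta>) * G x powr \<theta> \<le> c * ((1 - \<theta>) / A) * F x + c * (\<theta> / B) * G x" for x
  proof (cases "F x = 0 \<or> G x = 0")
    case True
    then show ?thesis using c pos th nn[of x] by auto
  next
    case False
    then have p: "F x > 0" "G x > 0" using nn[of x] by auto
    have "(F x / A) powr (1 - \<theta>) * (G x / B) powr \<theta> \<le> (1 - \<theta>) * (F x / A) + \<theta> * (G x / B)"
      using Youngs_inequality_0[of "1 - \<theta>" \<theta> "F x / A" "G x / B"] th p pos by simp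
    then have "c * ((F x / A) powr (1 - \<theta>) * (G x / B) powr \<theta>) \<le> c * ((1 - \<theta>) * (F x / A) + \<theta> * (G x / B))"
      using c by simp
    moreover have "c * ((F x / A) powr (1 - \<theta>) * (G x / B) powr \<theta>) = F x powr (1 - \<theta>) * G x powr \<theta>"
      using pos p by (simp add: c_def powr_divide)
    ultimately show ?thesis by (simp add: algebra_simps)
  qed
  have "(\<integral>\<^sup>+x. ennreal (F x powr (1 - \<theta>) * G x powr \<theta>) \<partial>M)
      \<le> (\<integral>\<^sup>+x. ennreal (c * ((1 - \<theta>) / A)) * ennreal (F x) + ennreal (c * (\<theta> / B)) * ennreal (G x) \<partial>M)"
  proof (intro nn_integral_mono)
    fix x
    have "ennreal (F x powr (1 - \<theta>) * G x powr \<theta>) \<le> ennreal (c * ((1 - \<theta>) / A) * F x + c * (\<theta> / B) * G x)"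
      by (intro ennreal_leI pt)
    also have "\<dots> = ennreal (c * ((1 - \<theta>) / A)) * ennreal (F x) + ennreal (c * (\<theta> / B)) * ennreal (G x)"
      using c pos th nn by (subst ennreal_plus) (auto simp: ennreal_mult[symmetric])
    finally show "ennreal (F x powr (1 - \<theta>) * G x powr \<theta>) \<le> ennreal (c * ((1 - \<theta>) / A)) * ennreal (F x) + ennreal (c * (\<theta> / B)) * ennreal (G x)" .
  qed
  also have "\<dots> = ennreal (c * ((1 - \<theta>) / A)) * (\<integral>\<^sup>+x. ennreal (F x) \<partial>M) + ennreal (c * (\<theta> / B)) * (\<integral>\<^sup>+x. ennreal (G x) \<partial>M)"
    by (simp add: nn_integral_add nn_integral_cmult)
  also have "\<dots> \<le> ennreal (c * ((1 - \<theta>) / A)) * ennreal A + ennreal (c * (\<theta> / B)) * ennreal B"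
    by (intro add_mono mult_left_mono FA GB) auto
  also have "\<dots> = ennreal (c * ((1 - \<theta>) / A) * A + c * (\<theta> / B) * B)"
    using c pos th by (simp add: ennreal_mult ennreal_plus del: times_divide_eq_left times_divide_eq_right)
  also have "c * ((1 - \<theta>) / A) * A + c * (\<theta> / B) * B = c"
    using pos by (simp add: field_simps)
  finally show ?thesis by (simp add: c_def)
qed

text \<open>One writes \<open>H^r\<close> as \<open>H^(r - 1)\<close> times the integral of \<open>h\<close>, exchanges the integrals and applies
  Hoelder's inequality in \<open>x\<close>; this leaves \<open>J \<le> J^(1 - 1/r) * (\<integral> \<phi>)\<close>, and finiteness of \<open>J\<close> allows
  to divide.\<close>

lemma minkowski_integral:
  fixes h :: "'a \<Rightarrow> real \<Rightarrow> real"
  assumes sf: "sigma_finite_measure M"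
    and [measurable]: "(\<lambda>(x,y). h x y) \<in> borel_measurable (M \<Otimes>\<^sub>M lborel)" "H \<in> borel_measurable M"
       "\<phi> \<in> borel_measurable borel"
    and nn: "\<And>x y. 0 \<le> h x y" "\<And>x. 0 \<le> H x" "\<And>y. 0 \<le> \<phi> y" and r: "1 \<le> r"
    and H: "\<And>x. x \<in> space M \<Longrightarrow> ennreal (H x) = (\<integral>\<^sup>+y. ennreal (h x y) \<partial>lborel)"
    and J: "(\<integral>\<^sup>+x. ennreal (H x powr r) \<partial>M) = ennreal J" "0 \<le> J"
    and \<phi>: "\<And>y. (\<integral>\<^sup>+x. ennreal (h x y powr r) \<partial>M) \<le> ennreal (\<phi> y powr r)"
  shows "ennreal (J powr (1 / r)) \<le> (\<integral>\<^sup>+y. ennreal (\<phi> y) \<partial>lborel)"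
proof (cases "J = 0")
  case False
  then have Jp: "J > 0" using J by simp
  interpret M: sigma_finite_measure M by (rule sf)
  interpret P: pair_sigma_finite M lborel ..
  have inner: "(\<integral>\<^sup>+x. ennreal (H x powr (r - 1)) * ennreal (h x y) \<partial>M) \<le> ennreal (J powr (1 - 1 / r)) * ennreal (\<phi> y)" for y
  proof -
    have [measurable]: "(\<lambda>x. h x y) \<in> borel_measurable M"
      using measurable_compose[OF measurable_Pair2'[of y lborel M] assms(2)] by (simp add: comp_def)
    have eq: "H x powr (r - 1) * h x y = (H x powr r) powr (1 - 1 / r) * (h x y powr r) powr (1 / r)" for x
      using r nn by (simp add: powr_powr algebra_simps diff_divide_distrib)
    have "(\<integral>\<^sup>+x. ennreal (H x powr (r - 1)) * ennreal (h x y) \<partial>M)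
      = (\<integral>\<^sup>+x. ennreal ((H x powr r) powr (1 - 1 / r) * (h x y powr r) powr (1 / r)) \<partial>M)"
      by (simp add: ennreal_mult[symmetric] nn eq)
    also have "\<dots> \<le> ennreal (J powr (1 - 1 / r) * (\<phi> y powr r) powr (1 / r))"
      using r J by (intro nn_integral_holder \<phi>) auto
    also have "(\<phi> y powr r) powr (1 / r) = \<phi> y" using r nn by (simp add: powr_powr)
    finally show ?thesis by (simp add: ennreal_mult nn)
  qed
  have "ennreal J = (\<integral>\<^sup>+x. ennreal (H x powr (r - 1)) * ennreal (H x) \<partial>M)"
  proof -
    have "H x powr r = H x powr (r - 1) * H x" for x
      using nn(2)[of x] by (cases "H x = 0") (auto simp: powr_diff)
    then show ?thesis by (simp add: J(1)[symmetric] ennreal_mult nn)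
  qed
  also have "\<dots> = (\<integral>\<^sup>+x. (\<integral>\<^sup>+y. ennreal (H x powr (r - 1)) * ennreal (h x y) \<partial>lborel) \<partial>M)"
  proof (intro nn_integral_cong)
    fix x assume x: "x \<in> space M"
    have "(\<lambda>y. h x y) \<in> borel_measurable lborel"
      using measurable_compose[OF measurable_Pair1' assms(2), of x] x by (simp add: comp_def)
    then show "ennreal (H x powr (r - 1)) * ennreal (H x) = (\<integral>\<^sup>+y. ennreal (H x powr (r - 1)) * ennreal (h x y) \<partial>lborel)"
      unfolding H[OF x] by (subst nn_integral_cmult) auto
  qed
  also have "\<dots> = (\<integral>\<^sup>+y. (\<integral>\<^sup>+x. ennreal (H x powr (r - 1)) * ennreal (h x y) \<partial>M) \<partial>lborel)"
    by (rule P.Fubini'[symmetric]) measurable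
  also have "\<dots> \<le> (\<integral>\<^sup>+y. ennreal (J powr (1 - 1 / r)) * ennreal (\<phi> y) \<partial>lborel)"
    by (intro nn_integral_mono inner)
  also have "\<dots> = ennreal (J powr (1 - 1 / r)) * (\<integral>\<^sup>+y. ennreal (\<phi> y) \<partial>lborel)"
    by (rule nn_integral_cmult) measurable
  finally have "ennreal (J powr (1 / r - 1)) * ennreal J
     \<le> ennreal (J powr (1 / r - 1)) * (ennreal (J powr (1 - 1 / r)) * (\<integral>\<^sup>+y. ennreal (\<phi> y) \<partial>lborel))"
    by (rule mult_left_mono) simp
  moreover have "J powr (1 / r - 1) * J = J powr (1 / r)"
    using Jp by (simp add: powr_diff)
  moreover have "J powr (1 / r - 1) * J powr (1 - 1 / r) = 1"
    using Jp by (simp add: powr_add[symmetric])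
  ultimately show ?thesis
    using Jp by (simp add: mult.assoc[symmetric] ennreal_mult[symmetric])
qed simp

text \<open>Layer cake: \<open>b^m\<close> is the integral of \<open>m t^(m - 1)\<close> over \<open>[0, b]\<close>. The weak type bound turns the
  sum into the integral of \<open>X m t^(m - r - 1)\<close> over \<open>[0, B]\<close>, which converges at \<open>0\<close> because \<open>m\<close> exceeds \<open>r\<close>.\<close>

lemma sum_powr_le_of_weak_type:
  fixes b u :: "'i \<Rightarrow> real"
  assumes fin: "finite I" and b: "\<And>i. i \<in> I \<Longrightarrow> 0 \<le> b i" "\<And>i. i \<in> I \<Longrightarrow> b i \<le> B" and u: "\<And>i. i \<in> I \<Longrightarrow> 0 \<le> u i"
    and X: "0 \<le> X" and B: "0 \<le> B" and r: "0 < r" "r < m"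
    and weak: "\<And>t. 0 < t \<Longrightarrow> (\<Sum>i\<in>{i\<in>I. t \<le> b i}. u i) \<le> X * t powr (- r)"
  shows "(\<Sum>i\<in>I. b i powr m * u i) \<le> X * (m / (m - r)) * B powr (m - r)"
proof -
  have pow: "(\<integral>\<^sup>+t. ennreal (m * t powr (m - 1)) * indicator {0..c} t \<partial>lborel) = ennreal (c powr m)" if "0 \<le> c" for c :: real
  proof -
    have "((\<lambda>t. m * t powr (m - 1)) has_integral m * (c powr (m - 1 + 1) / (m - 1 + 1))) {0..c}"
      using r that by (intro has_integral_mult_right has_integral_powr_from_0) auto
    then show ?thesis using r by (subst nn_integral_has_integral_lebesgue') auto
  qed
  have pow2: "(\<integral>\<^sup>+t. ennreal (X * m * t powr (m - r - 1)) * indicator {0..B} t \<partial>lborel) = ennreal (X * (m / (m - r)) * B powr (m - r))"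
  proof -
    have "((\<lambda>t. X * m * t powr (m - r - 1)) has_integral X * m * (B powr (m - r - 1 + 1) / (m - r - 1 + 1))) {0..B}"
      using r B by (intro has_integral_mult_right has_integral_powr_from_0) auto
    then show ?thesis using r X by (subst nn_integral_has_integral_lebesgue') auto
  qed
  have "ennreal (\<Sum>i\<in>I. b i powr m * u i) = (\<Sum>i\<in>I. ennreal (u i) * ennreal (b i powr m))"
    using u by (subst sum_ennreal[symmetric]) (auto simp: ennreal_mult mult.commute)
  also have "\<dots> = (\<Sum>i\<in>I. \<integral>\<^sup>+t. ennreal (u i) * (ennreal (m * t powr (m - 1)) * indicator {0..b i} t) \<partial>lborel)"
    by (intro sum.cong refl, subst nn_integral_cmult) (auto simp: pow b)
  also have "\<dots> = (\<integral>\<^sup>+t. (\<Sum>i\<in>I. ennreal (u i) * (ennreal (m * t powr (m - 1)) * indicator {0..b i} t)) \<partial>lborel)"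
    by (subst nn_integral_sum) auto
  also have "\<dots> \<le> (\<integral>\<^sup>+t. ennreal (X * m * t powr (m - r - 1)) * indicator {0..B} t \<partial>lborel)"
  proof (intro nn_integral_mono)
    fix t :: real
    show "(\<Sum>i\<in>I. ennreal (u i) * (ennreal (m * t powr (m - 1)) * indicator {0..b i} t)) \<le> ennreal (X * m * t powr (m - r - 1)) * indicator {0..B} t"
    proof (cases "0 < t \<and> t \<le> B")
      case True
      have "(\<Sum>i\<in>I. ennreal (u i) * (ennreal (m * t powr (m - 1)) * indicator {0..b i} t))
         = (\<Sum>i\<in>{i\<in>I. t \<le> b i}. ennreal (u i * (m * t powr (m - 1))))"
        using fin u True r by (intro sum.mono_neutral_cong_right) (auto simp: ennreal_mult indicator_def)
      also have "\<dots> = ennreal ((\<Sum>i\<in>{i\<in>I. t \<le> b i}. u i) * (m * t powr (m - 1)))"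
        using u r by (subst sum_ennreal) (auto simp: sum_distrib_right)
      also have "\<dots> \<le> ennreal (X * t powr (- r) * (m * t powr (m - 1)))"
        using True weak[of t] r by (intro ennreal_leI mult_right_mono) auto
      also have "X * t powr (- r) * (m * t powr (m - 1)) = X * m * (t powr (- r) * t powr (m - 1))" by simp
      also have "t powr (- r) * t powr (m - 1) = t powr (m - r - 1)"
        by (simp add: powr_add[symmetric] algebra_simps)
      finally show ?thesis using True by simp
    next
      case False
      have "ennreal (u i) * (ennreal (m * t powr (m - 1)) * indicator {0..b i} t) = 0" if "i \<in> I" for i
        using False b(2)[OF that] by (cases "t = 0") (auto simp: indicator_def)
      then show ?thesis by (subst sum.neutral) auto
    qed
  qed
  also have "\<dots> = ennreal (X * (m / (m - r)) * B powr (m - r))" by (rule pow2)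
  finally show ?thesis using X r by (subst (asm) ennreal_le_iff) auto
qed

text \<open>At \<open>\<epsilon> = 0\<close> the two weak type bounds just fail to control the sum. With
  \<open>A = a * g^(1/q) / L\<close>, comparing \<open>A\<close> with \<open>\<rho>^(1/q)\<close> gives
  \<open>A * \<rho>^(1 - 1/q + \<epsilon>) \<le> A^(q (1 + \<epsilon>)) + \<rho>^(1 + \<epsilon>)\<close>: both powers exceed the exponents \<open>q\<close> of \<open>A\<close> and \<open>1\<close> of
  \<open>\<rho>\<close> by the factor \<open>1 + \<epsilon>\<close>, so each sum converges with constant \<open>1 + 1/\<epsilon>\<close>. The bounds
  \<open>A \<le> c\<close> and \<open>\<rho> \<le> 1\<close> cut off the large values.\<close>

lemma sum_product_le_of_weak_types:
  fixes a \<rho> u :: "'i \<Rightarrow> real"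
  assumes fin: "finite I" and a: "\<And>i. i \<in> I \<Longrightarrow> 0 \<le> a i" and \<rho>: "\<And>i. i \<in> I \<Longrightarrow> 0 \<le> \<rho> i" "\<And>i. i \<in> I \<Longrightarrow> \<rho> i \<le> 1"
    and u: "\<And>i. i \<in> I \<Longrightarrow> 0 \<le> u i"
    and pos: "0 \<le> \<Theta>" "0 < L" "0 < g" "1 \<le> q" "0 < \<epsilon>" "0 < c"
    and W1: "\<And>t. 0 < t \<Longrightarrow> (\<Sum>i\<in>{i\<in>I. t \<le> a i}. u i) \<le> \<Theta> * (L / t) powr q"
    and W2: "\<And>t. 0 < t \<Longrightarrow> (\<Sum>i\<in>{i\<in>I. t \<le> \<rho> i}. u i) \<le> \<Theta> * (g / t)"
    and ac: "\<And>i. i \<in> I \<Longrightarrow> a i \<le> c * L * g powr (- 1 / q)"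
  shows "(\<Sum>i\<in>I. a i * \<rho> i powr (1 - 1 / q + \<epsilon>) * u i)
     \<le> \<Theta> * L * g powr (1 - 1 / q) * ((1 + 1 / \<epsilon>) * (1 + c powr (q * \<epsilon>)))"
proof -
  define k where "k = L * g powr (- 1 / q)"
  have k: "k > 0" using pos by (simp add: k_def)
  define A where "A i = a i / k" for i
  have A0: "0 \<le> A i" if "i \<in> I" for i using a[OF that] k by (simp add: A_def)
  have Ac: "A i \<le> c" if "i \<in> I" for i using ac[OF that] k by (simp add: A_def k_def divide_le_eq mult.assoc)
  have "(\<Sum>i\<in>I. A i powr (q * (1 + \<epsilon>)) * u i) \<le> (\<Theta> * g) * (q * (1 + \<epsilon>) / (q * (1 + \<epsilon>) - q)) * c powr (q * (1 + \<epsilon>) - q)"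
  proof (rule sum_powr_le_of_weak_type[OF fin A0 Ac u])
    fix t :: real assume t: "0 < t"
    have "{i \<in> I. t \<le> A i} = {i \<in> I. t * k \<le> a i}" using k by (auto simp: A_def le_divide_eq)
    then have "sum u {i \<in> I. t \<le> A i} \<le> \<Theta> * (L / (t * k)) powr q" using W1[of "t * k"] t k by simp
    also have "L / (t * k) = g powr (1 / q) / t" using pos t by (simp add: k_def powr_minus field_simps)
    also have "(g powr (1 / q) / t) powr q = g * t powr (- q)"
      using pos t by (simp add: powr_divide powr_powr powr_minus_divide)
    finally show "sum u {i \<in> I. t \<le> A i} \<le> \<Theta> * g * t powr - q" by (simp add: mult.assoc)
  qed (use pos in \<open>auto simp: algebra_simps\<close>)
  also have "q * (1 + \<epsilon>) / (q * (1 + \<epsilon>) - q) = 1 + 1 / \<epsilon>" using pos by (simp add: field_simps)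
  also have "q * (1 + \<epsilon>) - q = q * \<epsilon>" by (simp add: algebra_simps)
  finally have S1: "(\<Sum>i\<in>I. A i powr (q * (1 + \<epsilon>)) * u i) \<le> \<Theta> * g * (1 + 1 / \<epsilon>) * c powr (q * \<epsilon>)" .
  have "(\<Sum>i\<in>I. \<rho> i powr (1 + \<epsilon>) * u i) \<le> (\<Theta> * g) * ((1 + \<epsilon>) / ((1 + \<epsilon>) - 1)) * 1 powr ((1 + \<epsilon>) - 1)"
  proof (rule sum_powr_le_of_weak_type[OF fin \<rho> u])
    fix t :: real assume t: "0 < t"
    show "sum u {i \<in> I. t \<le> \<rho> i} \<le> \<Theta> * g * t powr - 1" using W2[OF t] t by (simp add: powr_minus divide_inverse mult.assoc)
  qed (use pos in auto)
  also have "(1 + \<epsilon>) / ((1 + \<epsilon>) - 1) = 1 + 1 / \<epsilon>" using pos by (simp add: field_simps)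
  finally have S2: "(\<Sum>i\<in>I. \<rho> i powr (1 + \<epsilon>) * u i) \<le> \<Theta> * g * (1 + 1 / \<epsilon>)" by simp
  have pt: "A i * \<rho> i powr (1 - 1 / q + \<epsilon>) \<le> A i powr (q * (1 + \<epsilon>)) + \<rho> i powr (1 + \<epsilon>)" if i: "i \<in> I" for i
  proof (cases "A i \<le> \<rho> i powr (1 / q)")
    case True
    have "A i * \<rho> i powr (1 - 1 / q + \<epsilon>) \<le> \<rho> i powr (1 / q) * \<rho> i powr (1 - 1 / q + \<epsilon>)"
      using True by (intro mult_right_mono) auto
    also have "\<dots> = \<rho> i powr (1 + \<epsilon>)" by (simp add: powr_add[symmetric])
    also have "\<dots> \<le> A i powr (q * (1 + \<epsilon>)) + \<rho> i powr (1 + \<epsilon>)" by simp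
    finally show ?thesis .
  next
    case False
    then have Ap: "A i > 0" by (smt (verit) powr_ge_zero)
    have "\<rho> i = (\<rho> i powr (1 / q)) powr q" using pos \<rho>(1)[OF i] by (simp add: powr_powr)
    also have "\<dots> \<le> A i powr q" using False pos by (intro powr_mono2) auto
    finally have "\<rho> i powr (1 - 1 / q + \<epsilon>) \<le> (A i powr q) powr (1 - 1 / q + \<epsilon>)"
      using pos \<rho>(1)[OF i] by (intro powr_mono2) auto
    then have "A i * \<rho> i powr (1 - 1 / q + \<epsilon>) \<le> A i powr 1 * (A i powr q) powr (1 - 1 / q + \<epsilon>)"
      using Ap by (simp add: mult_left_mono)
    also have "\<dots> = A i powr (q * (1 + \<epsilon>))"
      using pos by (simp only: powr_powr powr_add[symmetric]) (simp add: algebra_simps)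
    finally show ?thesis by (smt (verit) powr_ge_zero)
  qed
  have "(\<Sum>i\<in>I. a i * \<rho> i powr (1 - 1 / q + \<epsilon>) * u i) = k * (\<Sum>i\<in>I. A i * \<rho> i powr (1 - 1 / q + \<epsilon>) * u i)"
    unfolding sum_distrib_left using k by (intro sum.cong) (auto simp: A_def)
  also have "\<dots> \<le> k * (\<Sum>i\<in>I. (A i powr (q * (1 + \<epsilon>)) + \<rho> i powr (1 + \<epsilon>)) * u i)"
    using k by (intro mult_left_mono sum_mono mult_right_mono pt u) auto
  also have "\<dots> \<le> k * (\<Theta> * g * (1 + 1 / \<epsilon>) * c powr (q * \<epsilon>) + \<Theta> * g * (1 + 1 / \<epsilon>))"
    using k S1 S2 by (intro mult_left_mono) (auto simp: distrib_right sum.distrib)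
  also have "\<dots> = \<Theta> * L * (g powr (- 1 / q) * g) * ((1 + 1 / \<epsilon>) * (1 + c powr (q * \<epsilon>)))"
    by (simp add: k_def algebra_simps)
  also have "g powr (- 1 / q) * g = g powr (1 - 1 / q)"
    using pos powr_add[of g "- 1 / q" 1] by (simp add: add.commute)
  finally show ?thesis .
qed

section \<open>Laminar families and Carleson packing\<close>

text \<open>The combinatorial part of being a dyadic grid; in contrast to the latter, it passes to subfamilies.\<close>

definition laminar :: "'a set set \<Rightarrow> bool" where
  "laminar F \<longleftrightarrow> (\<forall>Q\<in>F. \<forall>R\<in>F. Q \<inter> R \<in> {{}, Q, R})"

lemma laminar_subset: "laminar F \<Longrightarrow> G \<subseteq> F \<Longrightarrow> laminar G"
  unfolding laminar_def by blast

lemma laminar_maximal: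
  assumes "finite F" "laminar F"
  obtains M where "M \<subseteq> F" "disjoint M" "\<And>Q. Q \<in> F \<Longrightarrow> \<exists>R\<in>M. Q \<subseteq> R"
proof (rule that[of "{Q\<in>F. \<forall>R\<in>F. Q \<subseteq> R \<longrightarrow> R = Q}"])
  show "disjoint {Q\<in>F. \<forall>R\<in>F. Q \<subseteq> R \<longrightarrow> R = Q}"
  proof (rule disjointI)
    fix Q R assume Q: "Q \<in> {Q\<in>F. \<forall>R\<in>F. Q \<subseteq> R \<longrightarrow> R = Q}" and R: "R \<in> {Q\<in>F. \<forall>R\<in>F. Q \<subseteq> R \<longrightarrow> R = Q}"
      and ne: "Q \<noteq> R"
    then have "Q \<inter> R \<in> {{}, Q, R}" using assms(2) unfolding laminar_def by blast
    moreover have "Q \<inter> R \<noteq> Q" "Q \<inter> R \<noteq> R"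
      using Q R ne by (simp_all add: Int_absorb1 inf.orderI) (metis inf.cobounded1 inf.cobounded2)+
    ultimately show "Q \<inter> R = {}" by blast
  qed
  fix Q assume "Q \<in> F"
  then obtain m where "m \<in> F" "Q \<subseteq> m" "\<forall>b\<in>F. m \<subseteq> b \<longrightarrow> m = b"
    using finite_has_maximal2[OF assms(1), of Q] by blast
  then show "\<exists>R\<in>{Q\<in>F. \<forall>R\<in>F. Q \<subseteq> R \<longrightarrow> R = Q}. Q \<subseteq> R" by blast
qed auto

text \<open>Every selected set lies in a maximal one, and the maximal ones are disjoint. A Carleson condition thus
  turns bounds for disjoint families into bounds for arbitrary subfamilies. The sets are indexed because
  several members of a sparse family may be enlarged to the same shifted cube.\<close>

lemma carleson_sum_le_maximal:
  fixes \<mu> :: "'a set \<Rightarrow> real"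
  assumes fin: "finite I" and lam: "laminar (R ` I)" and \<mu>: "\<And>i. i \<in> I \<Longrightarrow> 0 \<le> \<mu> (R i)"
    and carl: "\<And>Q. Q \<in> R ` I \<Longrightarrow> (\<Sum>i\<in>{i\<in>I. R i \<subseteq> Q}. \<mu> (R i)) \<le> \<Theta> * \<mu> Q"
    and J: "J \<subseteq> I"
  obtains M where "M \<subseteq> R ` J" "disjoint M" "(\<Sum>i\<in>J. \<mu> (R i)) \<le> \<Theta> * (\<Sum>Q\<in>M. \<mu> Q)"
proof -
  have finJ: "finite J" using J fin finite_subset by blast
  obtain M where M: "M \<subseteq> R ` J" "disjoint M" "\<And>Q. Q \<in> R ` J \<Longrightarrow> \<exists>S\<in>M. Q \<subseteq> S"
    using laminar_maximal[of "R ` J"] finJ laminar_subset[OF lam] J by (metis finite_imageI image_mono)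
  have finM: "finite M" using M(1) finJ finite_subset by blast
  have "(\<Sum>i\<in>J. \<mu> (R i)) \<le> (\<Sum>i\<in>J. \<Sum>Q\<in>{Q\<in>M. R i \<subseteq> Q}. \<mu> (R i))"
  proof (intro sum_mono)
    fix i assume i: "i \<in> J"
    then have ne: "{Q\<in>M. R i \<subseteq> Q} \<noteq> {}" using M(3) by blast
    then have "1 \<le> card {Q\<in>M. R i \<subseteq> Q}" using finM by (simp add: Suc_leI card_gt_0_iff)
    then show "\<mu> (R i) \<le> (\<Sum>Q\<in>{Q\<in>M. R i \<subseteq> Q}. \<mu> (R i))"
      using \<mu>[of i] i J mult_right_mono[of 1 "real (card {Q\<in>M. R i \<subseteq> Q})" "\<mu> (R i)"] by auto
  qed
  also have "\<dots> \<le> (\<Sum>i\<in>I. \<Sum>Q\<in>{Q\<in>M. R i \<subseteq> Q}. \<mu> (R i))"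
    using J fin \<mu> by (intro sum_mono2 sum_nonneg) auto
  also have "\<dots> = (\<Sum>Q\<in>M. \<Sum>i\<in>{i\<in>I. R i \<subseteq> Q}. \<mu> (R i))"
    using fin finM by (rule sum.swap_restrict)
  also have "\<dots> \<le> (\<Sum>Q\<in>M. \<Theta> * \<mu> Q)"
    using M(1) J by (intro sum_mono carl) auto
  finally show ?thesis using that[OF M(1,2)] by (simp add: sum_distrib_left)
qed

section \<open>Cubes and shifted dyadic grids\<close>

lemma cube_at_between: "box c (\<chi> i. c $ i + l) \<subseteq> cube_at c l" "cube_at c l \<subseteq> cbox c (\<chi> i. c $ i + l)"
  by (auto simp: cube_at_def mem_box_cart less_eq_real_def)

lemma cube_at_borel: "cube_at c l \<in> sets borel"
proof -
  have "cube_at c l = {x. \<forall>i\<in>UNIV. c $ i \<le> x $ i \<and> x $ i < c $ i + l}" by (auto simp: cube_at_def)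
  also have "\<dots> \<in> sets borel" by measurable
  finally show ?thesis .
qed

lemma cube_at_lebesgue: "cube_at c l \<in> sets lebesgue"
  by (metis cube_at_borel sets_completionI_sets sets_lborel)

lemma emeasure_cube_at:
  fixes c :: "real ^ 'n"
  assumes "0 < l"
  shows "emeasure lebesgue (cube_at c l) = ennreal (l ^ CARD('n))"
proof -
  have p: "prod (\<lambda>x. ((\<chi> i. c $ i + l) - c) \<bullet> x) (Basis :: (real^'n) set) = l ^ CARD('n)"
  proof -
    have "((\<chi> i. c $ i + l) - c) \<bullet> x = l" if "x \<in> Basis" for x :: "real^'n"
      using that by (auto simp: Basis_vec_def inner_axis)
    then show ?thesis by simp
  qed
  have le: "c \<bullet> b \<le> (\<chi> i. c $ i + l) \<bullet> b" if "b \<in> Basis" for b :: "real^'n"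
    using that assms by (auto simp: Basis_vec_def inner_axis)
  have "emeasure lebesgue (cube_at c l) \<le> emeasure lborel (cbox c (\<chi> i. c $ i + l))"
    using emeasure_mono[OF cube_at_between(2)[of c l], where M=lebesgue] by simp
  moreover have "emeasure lborel (box c (\<chi> i. c $ i + l)) \<le> emeasure lebesgue (cube_at c l)"
    using emeasure_mono[OF cube_at_between(1)[of c l] cube_at_lebesgue] by simp
  ultimately show ?thesis
    using le p by (simp add: emeasure_lborel_cbox_eq emeasure_lborel_box_eq)
qed

lemma measure_cube_at:
  fixes c :: "real ^ 'n"
  assumes "0 < l" shows "measure lebesgue (cube_at c l) = l ^ CARD('n)"
  using assms by (simp add: measure_def emeasure_cube_at)

lemma cube_facts:
  fixes Q :: "(real ^ 'n) set"
  assumes "Q \<in> cubes"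
  shows "Q \<in> sets lebesgue" "bounded Q" "0 < measure lebesgue Q" "emeasure lebesgue Q = ennreal (measure lebesgue Q)" "Q \<noteq> {}"
proof -
  obtain c l where Q: "Q = cube_at c l" "0 < l" using assms by (auto simp: cubes_def)
  show "Q \<in> sets lebesgue" by (simp add: Q cube_at_lebesgue)
  show "bounded Q" using bounded_subset[OF bounded_cbox cube_at_between(2)] by (simp add: Q)
  show "0 < measure lebesgue Q" using Q by (simp add: measure_cube_at)
  show "emeasure lebesgue Q = ennreal (measure lebesgue Q)" using Q by (simp add: measure_cube_at emeasure_cube_at)
  have "c \<in> Q" using Q by (simp add: cube_at_def)
  then show "Q \<noteq> {}" by auto
qed

definition cell :: "('n \<Rightarrow> nat) \<Rightarrow> int \<Rightarrow> ('n \<Rightarrow> int) \<Rightarrow> (real ^ 'n) set" where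
  "cell a k m = cube_at (\<chi> i. 2 powi (- k) * (of_int (m i) + (- 1) powi k * (real (a i) / 3))) (2 powi (- k))"

text \<open>The cells of generation \<open>k\<close> are the fibres of this function (\<open>mem_cell\<close>); nesting of cells becomes
  arithmetic of integers.\<close>

definition cell_index :: "('n \<Rightarrow> nat) \<Rightarrow> int \<Rightarrow> real ^ 'n \<Rightarrow> 'n \<Rightarrow> int" where
  "cell_index a k x i = \<lfloor>2 powi k * x $ i - (- 1) powi k * (real (a i) / 3)\<rfloor>"

lemma shifted_grid_eq: "shifted_grid a = {cell a k m | k m. True}"
  by (simp add: shifted_grid_def cell_def)

lemma mem_cell: "x \<in> cell a k m \<longleftrightarrow> m = cell_index a k x"
proof -
  have "x \<in> cell a k m \<longleftrightarrow> (\<forall>i. m i = cell_index a k x i)"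
    unfolding cell_def cube_at_def mem_Collect_eq
  proof (intro all_cong1)
    fix i
    define s where "s = (- 1) powi k * (real (a i) / 3)"
    have p: "(0::real) < 2 powi k" by simp
    have "2 powi (- k) * (real_of_int (m i) + s) \<le> x $ i \<longleftrightarrow> real_of_int (m i) + s \<le> 2 powi k * x $ i"
      using p by (simp add: power_int_minus field_simps)
    moreover have "x $ i < 2 powi (- k) * (real_of_int (m i) + s) + 2 powi (- k) \<longleftrightarrow> 2 powi k * x $ i < real_of_int (m i) + s + 1"
      using p by (simp add: power_int_minus field_simps)
    ultimately show "((\<chi> i. 2 powi (- k) * (real_of_int (m i) + (- 1) powi k * (real (a i) / 3))) $ i \<le> x $ i \<and>
          x $ i < (\<chi> i. 2 powi (- k) * (real_of_int (m i) + (- 1) powi k * (real (a i) / 3))) $ i + 2 powi (- k)) =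
         (m i = cell_index a k x i)"
      unfolding cell_index_def vec_lambda_beta s_def[symmetric]
      by (auto simp: floor_eq_iff eq_commute[of "m i"])
  qed
  then show ?thesis by (auto simp: fun_eq_iff)
qed

lemma cell_nonempty: "cell a k m \<noteq> {}"
proof -
  have "(\<chi> i. 2 powi (- k) * (of_int (m i) + (- 1) powi k * (real (a i) / 3))) \<in> cell a k m"
    by (simp add: cell_def cube_at_def)
  then show ?thesis by blast
qed

lemma cell_cubes: "cell a k m \<in> cubes"
  unfolding cubes_def cell_def mem_Collect_eq by (intro exI conjI, rule refl) simp

lemma shifted_grid_cubes: "Q \<in> shifted_grid a \<Longrightarrow> Q \<in> cubes"
  by (auto simp: shifted_grid_eq cell_cubes)

lemma measure_cell:
  fixes m :: "'n::finite \<Rightarrow> int"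
  shows "measure lebesgue (cell a k m) = (2 powi (- k)) ^ CARD('n)"
  unfolding cell_def by (rule measure_cube_at) simp

text \<open>This is where the sign \<open>(- 1)^k\<close> of the shift matters: with \<open>\<sigma> = (- 1)^k\<close>, twice the shift
  \<open>- \<sigma> a / 3\<close> of generation \<open>k - 1\<close> differs from the shift \<open>\<sigma> a / 3\<close> by the integer \<open>\<sigma> a\<close>, so
  the index of the parent is a function of the index of the child.\<close>

lemma cell_index_pred:
  "cell_index a (k - 1) x i = (cell_index a k x i + (if even k then 1 else - 1) * int (a i)) div 2"
proof -
  define s :: int where "s = (if even k then 1 else - 1)"
  have s: "(- 1 :: real) powi k = of_int s" by (simp add: s_def power_int_minus_left)
  have s1: "(- 1 :: real) powi (k - 1) = - of_int s" by (simp add: s_def power_int_minus_left)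
  have "2 powi (k - 1) * x $ i - (- 1) powi (k - 1) * (real (a i) / 3)
     = (2 powi k * x $ i - (- 1) powi k * (real (a i) / 3) + of_int (s * int (a i))) / of_int 2"
    unfolding s s1 by (simp add: power_int_diff field_simps)
  then have "cell_index a (k - 1) x i = \<lfloor>2 powi k * x $ i - (- 1) powi k * (real (a i) / 3) + of_int (s * int (a i))\<rfloor> div 2"
    unfolding cell_index_def by (simp only: floor_divide_real_eq_div)
  then show ?thesis unfolding floor_add_int[symmetric] by (simp only: cell_index_def s_def)
qed

lemma cell_index_coarser:
  assumes "l \<le> k" "cell_index a k x = cell_index a k y"
  shows "cell_index a l x = cell_index a l y"
  using assms
proof (induction l rule: int_le_induct)
  case (step i)
  then show ?case by (simp add: fun_eq_iff cell_index_pred)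
qed

lemma cell_subset:
  assumes "l \<le> k" "cell a k m \<inter> cell a l m' \<noteq> {}"
  shows "cell a k m \<subseteq> cell a l m'"
proof
  fix y assume y: "y \<in> cell a k m"
  obtain x where x: "x \<in> cell a k m" "x \<in> cell a l m'" using assms(2) by blast
  have "cell_index a k x = cell_index a k y" using x(1) y unfolding mem_cell by simp
  then have "cell_index a l x = cell_index a l y" by (rule cell_index_coarser[OF assms(1)])
  then show "y \<in> cell a l m'" using x(2) unfolding mem_cell by simp
qed

lemma laminar_shifted_grid: "laminar (shifted_grid a)"
  unfolding laminar_def shifted_grid_eq
proof clarsimp
  fix k m l m'
  assume "cell a k m \<inter> cell a l m' \<noteq> {}" "cell a k m \<inter> cell a l m' \<noteq> cell a l m'"
  then show "cell a k m \<inter> cell a l m' = cell a k m"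
    using cell_subset[of l k a m m'] cell_subset[of k l a m' m] by (cases "l \<le> k") (auto simp: Int_commute)
qed

text \<open>Climbing through the ancestors of \<open>Q\<close> towards \<open>P\<close>, the property is lost between some cube and its parent.\<close>

lemma cell_ascent:
  fixes P Q :: "(real ^ 'n) set"
  assumes "P \<in> shifted_grid a" "Q \<in> shifted_grid a" "Q \<subseteq> P" "good Q" "\<not> good P"
  obtains Q1 Q2 where "Q1 \<in> shifted_grid a" "Q2 \<in> shifted_grid a" "Q \<subseteq> Q1" "Q1 \<subseteq> Q2" "Q2 \<subseteq> P"
    "good Q1" "\<not> good Q2" "measure lebesgue Q2 = 2 ^ CARD('n) * measure lebesgue Q1"
proof -
  obtain l m' where P: "P = cell a l m'" using assms by (auto simp: shifted_grid_eq)
  have *: "\<exists>Q1 Q2. Q1 \<in> shifted_grid a \<and> Q2 \<in> shifted_grid a \<and> Q \<subseteq> Q1 \<and> Q1 \<subseteq> Q2 \<and> Q2 \<subseteq> P \<and>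
    good Q1 \<and> \<not> good Q2 \<and> measure lebesgue Q2 = 2 ^ CARD('n) * measure lebesgue Q1"
    if "Q = cell a (l + int j) m" "Q \<subseteq> P" "good Q" for j Q m
    using that
  proof (induction j arbitrary: Q m)
    case 0
    then have "Q \<inter> P \<noteq> {}" using cell_nonempty[of a] by (auto simp: Int_absorb2)
    then have "P \<subseteq> Q" using cell_subset[of l l a m' m] 0 P by (auto simp: Int_commute)
    then have "P = Q" using 0(2) by blast
    then show ?case using 0(3) assms(5) by simp
  next
    case (Suc j)
    obtain x where x: "x \<in> Q" using Suc.prems(1) cell_nonempty[of a "l + int (Suc j)" m] by auto
    define Q' where "Q' = cell a (l + int j) (cell_index a (l + int j) x)"
    have x': "x \<in> Q'" by (simp add: Q'_def mem_cell)
    have QQ': "Q \<subseteq> Q'" unfolding Suc.prems(1) Q'_def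
      by (rule cell_subset) (use x x' Suc.prems(1) Q'_def in auto)
    have Q'P: "Q' \<subseteq> P" unfolding P Q'_def
      by (rule cell_subset) (use x x' Suc.prems(2) P Q'_def in auto)
    have ms: "measure lebesgue Q' = 2 ^ CARD('n) * measure lebesgue Q"
    proof -
      have "2 powi (- (l + int j)) = 2 * (2 powi (- (l + int (Suc j))) :: real)"
        by (simp add: power_int_diff power_int_add power_int_minus field_simps)
      then show ?thesis unfolding Q'_def Suc.prems(1) measure_cell by (simp add: power_mult_distrib)
    qed
    show ?case
    proof (cases "good Q'")
      case True
      then show ?thesis using Suc.IH[OF Q'_def Q'P] QQ' by (meson order_trans)
    next
      case False
      have "Q \<in> shifted_grid a" "Q' \<in> shifted_grid a" using Suc.prems(1) Q'_def by (auto simp: shifted_grid_eq)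
      then show ?thesis using False Suc.prems QQ' Q'P ms by blast
    qed
  qed
  obtain k m where Q: "Q = cell a k m" using assms by (auto simp: shifted_grid_eq)
  have "l \<le> k"
  proof (rule ccontr)
    assume "\<not> l \<le> k"
    then have lt: "k < l" by simp
    have "measure lebesgue Q \<le> measure lebesgue P"
      using assms(3) cube_facts[OF shifted_grid_cubes[OF assms(1)]] cube_facts[OF shifted_grid_cubes[OF assms(2)]]
      by (intro measure_mono_fmeasurable) (auto simp: fmeasurable_def)
    moreover have "(2::real) powi (- l) < 2 powi (- k)" using lt by (intro power_int_strict_increasing) auto
    ultimately show False unfolding P Q measure_cell
      by (simp add: power_mono_iff)
  qed
  then show ?thesis using *[of Q "nat (k - l)" m] assms Q that by auto
qed

lemma countable_shifted_grid: "countable (shifted_grid a)"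
proof -
  have "shifted_grid a = (\<lambda>(k, m). cell a k m) ` UNIV" by (auto simp: shifted_grid_eq)
  then show ?thesis by (simp only:) (rule countable_image, rule countableI_type)
qed

text \<open>Makes the open subsets of a cell unions of cells of the same grid.\<close>

lemma ex_small_cell:
  fixes x :: "real ^ 'n"
  assumes U: "open U" "x \<in> U" and P: "P \<in> shifted_grid a" "x \<in> P"
  shows "\<exists>Q\<in>shifted_grid a. x \<in> Q \<and> Q \<subseteq> U \<inter> P"
proof -
  obtain l m' where Peq: "P = cell a l m'" using P by (auto simp: shifted_grid_eq)
  obtain e where e: "0 < e" "ball x e \<subseteq> U" using U open_contains_ball by blast
  define d where "d = e / real CARD('n)"
  have d: "0 < d" using e by (simp add: d_def)
  obtain j where j: "(1/2 :: real) ^ j < d" using real_arch_pow_inv[OF d, of "1/2"] by auto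
  define k where "k = max l (int j)"
  have sk: "(2::real) powi (- k) < d"
  proof -
    have "(2::real) powi (- k) \<le> 2 powi (- int j)" by (intro power_int_increasing) (auto simp: k_def)
    also have "\<dots> = (1/2) ^ j" by (simp add: power_int_minus power_one_over inverse_eq_divide)
    finally show ?thesis using j by simp
  qed
  define Q where "Q = cell a k (cell_index a k x)"
  have xQ: "x \<in> Q" by (simp add: Q_def mem_cell)
  have "Q \<subseteq> U"
  proof
    fix y assume "y \<in> Q"
    then have yd: "\<bar>y $ i - x $ i\<bar> < d" for i
      using xQ sk by (auto simp: Q_def cell_def cube_at_def) (smt (verit))
    have "norm (y - x) \<le> (\<Sum>i\<in>UNIV. \<bar>(y - x) $ i\<bar>)" by (rule norm_le_l1_cart)
    also have "\<dots> < (\<Sum>i\<in>(UNIV::'n set). d)" using yd by (intro sum_strict_mono) auto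
    also have "\<dots> = e" by (simp add: d_def)
    finally show "y \<in> U" using e by (auto simp: dist_norm norm_minus_commute)
  qed
  moreover have "Q \<subseteq> P" unfolding Q_def Peq
    by (rule cell_subset) (use xQ P Peq in \<open>auto simp: k_def Q_def\<close>)
  ultimately show ?thesis using xQ by (auto simp: shifted_grid_eq Q_def)
qed

text \<open>Take the generation whose cells have side between \<open>3 l\<close> and \<open>6 l\<close>, so that \<open>l\<close> is at most a third of a
  cell. A coordinate interval of \<open>Q\<close> stays in the cell of its left end if that end lies in the first two
  thirds of the cell; if it does not, a shift by a third of a cell, to either side, moves it there.\<close>

lemma one_third_trick:
  fixes Q :: "(real ^ 'n) set"
  assumes "Q \<in> cubes"
  obtains a R where "\<And>i. a i \<in> {0,1,2}" "R \<in> shifted_grid a" "Q \<subseteq> R" "measure lebesgue R \<le> 6 ^ CARD('n) * measure lebesgue Q"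
proof -
  obtain c l where Q: "Q = cube_at c l" "0 < l" using assms by (auto simp: cubes_def)
  define k where "k = \<lfloor>log 2 (1 / (3 * l))\<rfloor>"
  have k1: "2 powi k \<le> 1 / (3 * l)"
  proof -
    have "2 powr (of_int k) \<le> 2 powr (log 2 (1 / (3 * l)))" unfolding k_def by (intro powr_mono) auto
    then show ?thesis using Q by (simp add: powr_real_of_int')
  qed
  have k2: "1 / (3 * l) < 2 powi k * 2"
  proof -
    have "2 powr (log 2 (1 / (3 * l))) < 2 powr (of_int k + 1)" unfolding k_def by (intro powr_less_mono) auto
    then show ?thesis using Q by (simp add: powr_real_of_int' powr_add)
  qed
  have p: "(0::real) < 2 powi k" by simp
  have w: "2 powi k * l \<le> 1/3" using k1 Q by (simp add: field_simps)
  define s :: real where "s = (- 1) powi k"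
  have s: "s = 1 \<or> s = - 1" by (auto simp: s_def power_int_minus_left)
  have "\<exists>a::nat. a \<in> {0,1,2} \<and> frac (2 powi k * c $ i - s * (real a / 3)) \<le> 2/3" for i
  proof (cases "frac (2 powi k * c $ i) \<le> 2/3")
    case True
    then show ?thesis by (intro exI[of _ 0]) auto
  next
    case False
    define z where "z = 2 powi k * c $ i"
    have z: "2/3 < z - of_int \<lfloor>z\<rfloor>" "z - of_int \<lfloor>z\<rfloor> < 1" using False by (auto simp: z_def frac_def) linarith
    \<comment> \<open>The side of the shift depends on the parity of the generation, but both sides work.\<close>
    have "frac (z - s * (1 / 3)) \<le> 2/3"
      using s
    proof
      assume "s = 1"
      moreover have "\<lfloor>z - 1/3\<rfloor> = \<lfloor>z\<rfloor>" using z by linarith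
      ultimately show ?thesis using z by (simp add: frac_def)
    next
      assume "s = - 1"
      moreover have "\<lfloor>z + 1/3\<rfloor> = \<lfloor>z\<rfloor> + 1" using z by linarith
      ultimately show ?thesis using z by (simp add: frac_def)
    qed
    then show ?thesis by (intro exI[of _ 1]) (simp add: z_def)
  qed
  then obtain a :: "'n \<Rightarrow> nat" where a: "\<And>i. a i \<in> {0,1,2}" "\<And>i. frac (2 powi k * c $ i - s * (real (a i) / 3)) \<le> 2/3"
    by metis
  define R where "R = cell a k (cell_index a k c)"
  have "Q \<subseteq> R"
  proof
    fix x assume x: "x \<in> Q"
    have "cell_index a k c i = cell_index a k x i" for i
    proof -
      define y where "y = 2 powi k * c $ i - s * (real (a i) / 3)"
      have y: "y - of_int \<lfloor>y\<rfloor> \<le> 2/3" using a(2)[of i] by (simp add: y_def frac_def)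
      have "c $ i \<le> x $ i" "x $ i < c $ i + l" using x Q by (auto simp: cube_at_def)
      then have "2 powi k * c $ i \<le> 2 powi k * x $ i" "2 powi k * x $ i < 2 powi k * (c $ i + l)"
        using p by (auto intro: mult_left_mono mult_strict_left_mono)
      then have "y \<le> 2 powi k * x $ i - s * (real (a i) / 3)" "2 powi k * x $ i - s * (real (a i) / 3) < y + 1/3"
        using w by (auto simp: y_def algebra_simps)
      then have "\<lfloor>2 powi k * x $ i - s * (real (a i) / 3)\<rfloor> = \<lfloor>y\<rfloor>" using y by linarith
      then show ?thesis by (simp add: cell_index_def y_def s_def)
    qed
    then show "x \<in> R" unfolding R_def mem_cell by auto
  qed
  moreover have "measure lebesgue R \<le> 6 ^ CARD('n) * measure lebesgue Q"
  proof -
    have "2 powi (- k) \<le> 6 * l" using k2 p Q by (simp add: power_int_minus field_simps)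
    then have "(2 powi (- k)) ^ CARD('n) \<le> (6 * l) ^ CARD('n)" by (intro power_mono) auto
    then show ?thesis unfolding R_def measure_cell by (simp add: Q measure_cube_at power_mult_distrib)
  qed
  ultimately show ?thesis using that[of a R] a(1) by (auto simp: R_def shifted_grid_eq)
qed

lemma dyadic_grid_facts:
  assumes "dyadic_grid D"
  shows "laminar D" "D \<subseteq> cubes"
proof -
  have 1: "\<forall>Q\<in>D. \<exists>c (k::int). Q = cube_at c (2 powi k)"
    using assms unfolding dyadic_grid_def by (rule conjunct1)
  have 2: "\<forall>Q\<in>D. \<forall>R\<in>D. Q \<inter> R \<in> {{}, Q, R}"
    using assms unfolding dyadic_grid_def by (rule conjunct2[THEN conjunct1])
  show "laminar D" using 2 by (simp only: laminar_def)
  show "D \<subseteq> cubes"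
  proof
    fix Q assume "Q \<in> D"
    with 1 obtain c and k :: int where Q: "Q = cube_at c (2 powi k)" by meson
    have "(0::real) < 2 powi k" by simp
    then show "Q \<in> cubes" unfolding cubes_def Q mem_Collect_eq by (intro exI conjI) (rule refl)
  qed
qed

section \<open>Weighted volumes and averages\<close>

definition locally_finite_weight :: "(real ^ 'n \<Rightarrow> real) \<Rightarrow> bool" where
  "locally_finite_weight \<omega> \<longleftrightarrow> \<omega> \<in> borel_measurable lebesgue \<and> (\<forall>x. 0 \<le> \<omega> x) \<and>
     (\<forall>E\<in>sets lebesgue. bounded E \<longrightarrow> wmeas \<omega> E < \<infinity>)"

text \<open>On bounded measurable sets this is the real number underlying \<open>wmeas\<close>.\<close>

definition wvol :: "(real ^ 'n \<Rightarrow> real) \<Rightarrow> (real ^ 'n) set \<Rightarrow> real" where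
  "wvol \<omega> E = measure (density lebesgue (\<lambda>x. ennreal (\<omega> x))) E"

lemma wmeas_eq_emeasure:
  assumes "\<omega> \<in> borel_measurable lebesgue" "E \<in> sets lebesgue"
  shows "wmeas \<omega> E = emeasure (density lebesgue (\<lambda>x. ennreal (\<omega> x))) E"
  using assms by (simp add: wmeas_def emeasure_density)

context
  fixes \<omega> :: "real ^ 'n \<Rightarrow> real"
  assumes lf: "locally_finite_weight \<omega>"
begin

lemma lfw_meas: "\<omega> \<in> borel_measurable lebesgue" and lfw_nonneg: "0 \<le> \<omega> x"
  using lf by (auto simp: locally_finite_weight_def)

lemma wvol_nonneg: "0 \<le> wvol \<omega> E" by (simp add: wvol_def)

lemma fmeasurable_wvol:
  assumes "E \<in> sets lebesgue" "bounded E"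
  shows "E \<in> fmeasurable (density lebesgue (\<lambda>x. ennreal (\<omega> x)))"
  using assms lf by (auto simp: fmeasurable_def locally_finite_weight_def wmeas_eq_emeasure)

lemma wmeas_eq_wvol:
  assumes "E \<in> sets lebesgue" "bounded E"
  shows "wmeas \<omega> E = ennreal (wvol \<omega> E)"
  using fmeasurable_wvol[OF assms] lfw_meas assms
  by (simp add: wvol_def wmeas_eq_emeasure emeasure_eq_measure2)

lemma wvol_mono:
  assumes "E \<in> sets lebesgue" "F \<in> sets lebesgue" "bounded F" "E \<subseteq> F"
  shows "wvol \<omega> E \<le> wvol \<omega> F"
  unfolding wvol_def using assms fmeasurable_wvol[of F]
  by (intro measure_mono_fmeasurable) auto

lemma wvol_UN_disjoint:
  assumes "finite I" "\<And>i. i \<in> I \<Longrightarrow> E i \<in> sets lebesgue" "\<And>i. i \<in> I \<Longrightarrow> bounded (E i)" "disjoint_family_on E I"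
  shows "wvol \<omega> (\<Union>i\<in>I. E i) = (\<Sum>i\<in>I. wvol \<omega> (E i))"
  unfolding wvol_def using assms fmeasurable_wvol[of "E _"]
  by (intro measure_finite_Union) (auto simp: fmeasurable_def less_top)

lemma wvol_sum_disjoint_le:
  assumes "finite I" "\<And>i. i \<in> I \<Longrightarrow> E i \<in> sets lebesgue" "disjoint_family_on E I"
    and F: "F \<in> sets lebesgue" "bounded F" "\<And>i. i \<in> I \<Longrightarrow> E i \<subseteq> F"
  shows "(\<Sum>i\<in>I. wvol \<omega> (E i)) \<le> wvol \<omega> F"
proof -
  have b: "bounded (E i)" if "i \<in> I" for i using F that bounded_subset by blast
  have "(\<Sum>i\<in>I. wvol \<omega> (E i)) = wvol \<omega> (\<Union>i\<in>I. E i)"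
    using assms b by (intro wvol_UN_disjoint[symmetric]) auto
  also have "\<dots> \<le> wvol \<omega> F" using assms by (intro wvol_mono) (auto intro: sets.finite_UN)
  finally show ?thesis .
qed

lemma wvol_diff:
  assumes "E \<in> sets lebesgue" "F \<in> sets lebesgue" "bounded F" "E \<subseteq> F"
  shows "wvol \<omega> (F - E) = wvol \<omega> F - wvol \<omega> E"
proof -
  have "bounded E" using assms bounded_subset by blast
  then show ?thesis unfolding wvol_def using assms fmeasurable_wvol[of F] fmeasurable_wvol[of E]
    by (intro measure_Diff) (auto simp: fmeasurable_def less_top)
qed

lemma wvol_UN_le:
  assumes "finite I" "\<And>i. i \<in> I \<Longrightarrow> E i \<in> sets lebesgue" "\<And>i. i \<in> I \<Longrightarrow> bounded (E i)"
  shows "wvol \<omega> (\<Union>i\<in>I. E i) \<le> (\<Sum>i\<in>I. wvol \<omega> (E i))"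
  unfolding wvol_def using assms fmeasurable_wvol[of "E _"]
  by (intro measure_UNION_le) (auto simp: fmeasurable_def)

lemma wvol_null:
  assumes "E \<in> sets lebesgue" "bounded E" "measure lebesgue E = 0"
  shows "wvol \<omega> E = 0"
proof -
  have "emeasure lebesgue E = 0"
    using assms lmeasurable_iff_has_integral bounded_set_imp_lmeasurable[OF assms(2,1)]
    by (simp add: emeasure_eq_measure2)
  then have "E \<in> null_sets lebesgue" using assms by (simp add: null_sets_def)
  then have "E \<in> null_sets (density lebesgue (\<lambda>x. ennreal (\<omega> x)))"
    using lfw_meas absolutely_continuousI_density[of "\<lambda>x. ennreal (\<omega> x)" lebesgue]
    by (auto simp: absolutely_continuous_def)
  then show ?thesis by (simp add: wvol_def measure_def null_setsD1)
qed

end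

text \<open>For \<open>\<beta> = \<alpha> / (n r)\<close>, a summand \<open>avg 0 p\<^sub>0 f Q * avg \<alpha> r g Q * |Q|\<close> of the sparse form equals
  \<open>pavg p\<^sub>0 \<beta> f Q * pavg r 1 g Q\<close>.\<close>

definition pavg :: "real \<Rightarrow> real \<Rightarrow> (real ^ 'n \<Rightarrow> 'k::real_normed_vector) \<Rightarrow> (real ^ 'n) set \<Rightarrow> real" where
  "pavg s \<beta> f Q = enn2real (\<integral>\<^sup>+x\<in>Q. ennreal (norm (f x) powr s) \<partial>lebesgue) powr (1 / s) * measure lebesgue Q powr (\<beta> - 1 / s)"

definition level :: "(real ^ 'n \<Rightarrow> 'k::real_normed_vector) \<Rightarrow> real \<Rightarrow> (real ^ 'n) set" where
  "level f y = {x. y < norm (f x)}"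

lemma level_sets:
  assumes [measurable]: "f \<in> borel_measurable lebesgue"
  shows "level f y \<in> sets lebesgue"
proof -
  have "{x \<in> space lebesgue. y < norm (f x)} \<in> sets lebesgue" by measurable
  then show ?thesis by (simp add: level_def)
qed

section \<open>Weak type of the fractional maximal function\<close>

lemma sum_powr_le_powr_sum:
  fixes x :: "'i \<Rightarrow> real"
  assumes "finite I" "\<And>i. i \<in> I \<Longrightarrow> 0 \<le> x i" "1 \<le> s"
  shows "(\<Sum>i\<in>I. x i powr s) \<le> (\<Sum>i\<in>I. x i) powr s"
proof -
  define S where "S = (\<Sum>i\<in>I. x i)"
  have xS: "x i \<le> S" if "i \<in> I" for i unfolding S_def using assms that by (intro member_le_sum) auto
  have S0: "0 \<le> S" unfolding S_def using assms by (intro sum_nonneg) auto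
  have e: "z powr s = z * z powr (s - 1)" if "0 \<le> z" for z :: real
    using that by (cases "z = 0") (auto simp: powr_diff)
  have "(\<Sum>i\<in>I. x i powr s) \<le> (\<Sum>i\<in>I. x i * S powr (s - 1))"
    using assms xS by (intro sum_mono) (auto simp: e intro!: mult_left_mono powr_mono2)
  also have "\<dots> = S * S powr (s - 1)" by (simp add: S_def sum_distrib_right)
  also have "\<dots> = S powr s" by (rule e[OF S0, symmetric])
  finally show ?thesis by (simp add: S_def)
qed

lemma antimono_borel_measurable:
  fixes \<psi> :: "real \<Rightarrow> real"
  assumes "\<And>x y. x \<le> y \<Longrightarrow> \<psi> y \<le> \<psi> x"
  shows "\<psi> \<in> borel_measurable borel"
proof -
  have "(\<lambda>x. - \<psi> x) \<in> borel_measurable borel" by (rule borel_measurable_mono) (simp add: mono_def assms)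
  then have "(\<lambda>x. - (- \<psi> x)) \<in> borel_measurable borel" by measurable
  then show ?thesis by simp
qed

lemma norm_layer_cake:
  "ennreal (norm z) = (\<integral>\<^sup>+y. ennreal (indicator {0<..<norm z} y) \<partial>lborel)"
  by (simp add: ennreal_indicator)

text \<open>Minkowski's inequality for \<open>|f|\<close>, written as the integral of the indicators of its level sets. The
  passage to indicators is what brings in Lorentz norms with second exponent 1.\<close>

lemma power_integral_le_layers:
  fixes f :: "real ^ 'n \<Rightarrow> 'k::{real_normed_vector, second_countable_topology}"
  assumes f: "f \<in> borel_measurable lebesgue" and Q: "Q \<in> sets lebesgue" "bounded Q" and s: "1 \<le> s"
    and fin: "(\<integral>\<^sup>+x\<in>Q. ennreal (norm (f x) powr s) \<partial>lebesgue) < \<infinity>"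
  shows "ennreal (enn2real (\<integral>\<^sup>+x\<in>Q. ennreal (norm (f x) powr s) \<partial>lebesgue) powr (1 / s))
     \<le> (\<integral>\<^sup>+y\<in>{0<..}. ennreal (measure lebesgue (level f y \<inter> Q) powr (1 / s)) \<partial>lborel)"
proof -
  define J where "J = enn2real (\<integral>\<^sup>+x\<in>Q. ennreal (norm (f x) powr s) \<partial>lebesgue)"
  define \<psi> where "\<psi> y = measure lebesgue (level f y \<inter> Q) powr (1 / s)" for y
  note [measurable] = f
  have Ql: "Q \<in> lmeasurable" using Q bounded_set_imp_lmeasurable by blast
  have lm: "level f y \<inter> Q \<in> lmeasurable" for y
    using Ql level_sets[OF f] by (simp add: fmeasurable_Int_fmeasurable Int_commute)
  have sf: "sigma_finite_measure (lebesgue_on Q)"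
  proof -
    interpret finite_measure "lebesgue_on Q" by (rule finite_measure_lebesgue_on[OF Ql])
    show ?thesis ..
  qed
  have fQ [measurable]: "f \<in> borel_measurable (lebesgue_on Q)" using f by (rule measurable_restrict_space1)
  have \<psi>m: "\<psi> \<in> borel_measurable borel"
    unfolding \<psi>_def using s lm
    by (intro antimono_borel_measurable powr_mono2 measure_mono_fmeasurable) (auto simp: level_def)
  have "ennreal (J powr (1 / s)) \<le> (\<integral>\<^sup>+y. ennreal (indicator {0<..} y * \<psi> y) \<partial>lborel)"
  proof (rule minkowski_integral[OF sf, where h = "\<lambda>x y. indicator {0<..<norm (f x)} y" and H = "\<lambda>x. norm (f x)" and r = s])
    show "(\<lambda>(x, y). indicator {0<..<norm (f x)} y) \<in> borel_measurable (lebesgue_on Q \<Otimes>\<^sub>M lborel)"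
      unfolding indicator_def case_prod_beta greaterThanLessThan_iff by measurable
    show "(\<lambda>y. indicator {0<..} y * \<psi> y) \<in> borel_measurable borel" using \<psi>m by measurable
    show "(\<integral>\<^sup>+x. ennreal (norm (f x) powr s) \<partial>lebesgue_on Q) = ennreal J"
      using fin Q unfolding J_def by (subst nn_integral_restrict_space) (auto simp: less_top)
    fix y :: real
    show "(\<integral>\<^sup>+x. ennreal (indicator {0<..<norm (f x)} y powr s) \<partial>lebesgue_on Q) \<le> ennreal ((indicator {0<..} y * \<psi> y) powr s)"
    proof (cases "0 < y")
      case True
      have "(\<integral>\<^sup>+x. ennreal (indicator {0<..<norm (f x)} y powr s) \<partial>lebesgue_on Q) = (\<integral>\<^sup>+x. indicator (level f y \<inter> Q) x \<partial>lebesgue)"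
        using Q by (subst nn_integral_restrict_space, simp, intro nn_integral_cong)
          (use True s in \<open>auto simp: indicator_def level_def\<close>)
      also have "\<dots> = ennreal (measure lebesgue (level f y \<inter> Q))"
        using lm[of y] by (subst nn_integral_indicator) (auto simp: emeasure_eq_measure2)
      also have "measure lebesgue (level f y \<inter> Q) = (indicator {0<..} y * \<psi> y) powr s"
        using True s by (simp add: \<psi>_def powr_powr)
      finally show ?thesis by simp
    qed simp
  qed (use s in \<open>auto simp: norm_layer_cake \<psi>_def J_def\<close>)
  then show ?thesis unfolding J_def \<psi>_def
    by (simp add: ennreal_mult' ennreal_indicator mult.commute)
qed

text \<open>Restricted to cubes with averages above \<open>t\<close> it says \<open>t^q u(\<Union>F) \<le> L^q\<close>, the weak type bound of the maximal
  function \<open>SUP Q. pavg p\<^sub>0 \<beta> f Q\<close>. On a single cube, Minkowski's inequality reduces \<open>f\<close> to its level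
  sets, where \<open>AR\<close> replaces \<open>|E|\<close> by \<open>v(E)\<close>. A second application, now in \<open>l\<^sup>q\<close> over the cubes, reduces
  the sum to a single level set \<open>E\<close>, and there \<open>(\<Sum>Q. v(E \<inter> Q)^(q/p)) \<le> v(E)^(q/p)\<close> because \<open>p \<le> q\<close>.\<close>

lemma disjoint_cubes_pavg_sum:
  fixes f :: "real ^ 'n \<Rightarrow> 'k::{real_normed_vector, second_countable_topology}"
  assumes u: "locally_finite_weight u" and v: "locally_finite_weight v"
    and f: "f \<in> borel_measurable lebesgue" and supp: "B \<in> sets lebesgue" "bounded B" "\<And>x. x \<notin> B \<Longrightarrow> f x = 0"
    and exps: "1 \<le> p\<^sub>0" "p\<^sub>0 \<le> p" "p \<le> q" and \<kappa>: "0 < \<kappa>" and L: "0 \<le> L"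
    and fin: "\<And>Q. Q \<in> cubes \<Longrightarrow> (\<integral>\<^sup>+x\<in>Q. ennreal (norm (f x) powr p\<^sub>0) \<partial>lebesgue) < \<infinity>"
    and AR: "\<And>Q E. Q \<in> cubes \<Longrightarrow> E \<in> sets lebesgue \<Longrightarrow> E \<subseteq> Q \<Longrightarrow>
       measure lebesgue E powr (1 / p\<^sub>0) * measure lebesgue Q powr (\<beta> - 1 / p\<^sub>0) * wvol u Q powr (1 / q) \<le> \<kappa> * wvol v E powr (1 / p)"
    and N: "ennreal \<kappa> * (\<integral>\<^sup>+y\<in>{0<..}. ennreal (wvol v (level f y \<inter> B) powr (1 / p)) \<partial>lborel) \<le> ennreal L"
    and F: "finite F" "F \<subseteq> cubes" "disjoint F"
  shows "(\<Sum>Q\<in>F. pavg p\<^sub>0 \<beta> f Q powr q * wvol u Q) \<le> L powr q"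
proof -
  have q1: "1 \<le> q" "0 < p" "0 < p\<^sub>0" using exps by auto
  define ps where "ps A y = wvol v (level f y \<inter> A) powr (1 / p)" for A y
  define NQ where "NQ Q = (\<integral>\<^sup>+y\<in>{0<..}. ennreal (ps Q y) \<partial>lborel)" for Q
  define N where "N = (\<integral>\<^sup>+y\<in>{0<..}. ennreal (ps B y) \<partial>lborel)"
  have Qs: "Q \<in> sets lebesgue" "bounded Q" if "Q \<in> F" for Q using F that cube_facts(1,2) by blast+
  have lev: "level f y \<inter> A \<in> sets lebesgue" if "A \<in> sets lebesgue" for y A using level_sets[OF f] that by auto
  have bl: "bounded (level f y \<inter> A)" if "bounded A" for y A using that bounded_subset by blast
  have levB: "level f y \<inter> A \<subseteq> level f y \<inter> B" if "0 < y" for y A using that supp(3) by (force simp: level_def)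
  have NQ_le: "NQ Q \<le> N" if "Q \<in> F" for Q
    unfolding NQ_def N_def ps_def using q1
    by (intro nn_integral_mono)
      (auto simp: indicator_def intro!: ennreal_leI powr_mono2 wvol_mono[OF v] lev Qs[OF that] supp bl wvol_nonneg[OF v] levB)
  have N_fin: "N < \<infinity>"
  proof (rule ccontr)
    assume "\<not> N < \<infinity>"
    then have "N = \<infinity>" using less_top[of N] by auto
    then show False using N \<kappa> by (simp add: N_def[unfolded ps_def, symmetric] ennreal_mult_top top_unique)
  qed
  have ie: "ennreal (indicator {0<..} y * z) = ennreal z * indicator {0<..} y" for y z :: real
    by (simp add: indicator_def)
  define n where "n Q = enn2real (NQ Q)" for Q
  have n0: "0 \<le> n Q" for Q by (simp add: n_def)
  have nN: "ennreal (n Q) = NQ Q" if "Q \<in> F" for Q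
    using NQ_le[OF that] N_fin unfolding n_def by (simp add: order_le_less_trans)
  have psm: "ps A \<in> borel_measurable borel" if "A \<in> sets lebesgue" "bounded A" for A
    unfolding ps_def using q1 by (intro antimono_borel_measurable powr_mono2 wvol_mono[OF v] lev bl that)
      (auto simp: level_def wvol_nonneg[OF v])
  have step: "pavg p\<^sub>0 \<beta> f Q powr q * wvol u Q \<le> \<kappa> powr q * n Q powr q" if Q: "Q \<in> F" for Q
  proof -
    have Qc: "Q \<in> cubes" using F Q by blast
    define c where "c = measure lebesgue Q powr (\<beta> - 1 / p\<^sub>0) * wvol u Q powr (1 / q)"
    have c0: "0 \<le> c" by (simp add: c_def)
    define I where "I = enn2real (\<integral>\<^sup>+x\<in>Q. ennreal (norm (f x) powr p\<^sub>0) \<partial>lebesgue) powr (1 / p\<^sub>0)"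
    have "ennreal (c * I) = ennreal c * ennreal I" using c0 by (simp add: ennreal_mult I_def)
    also have "\<dots> \<le> ennreal c * (\<integral>\<^sup>+y\<in>{0<..}. ennreal (measure lebesgue (level f y \<inter> Q) powr (1 / p\<^sub>0)) \<partial>lborel)"
      unfolding I_def by (intro mult_left_mono power_integral_le_layers f Qs Q fin Qc exps) auto
    also have "\<dots> = (\<integral>\<^sup>+y. ennreal c * (ennreal (measure lebesgue (level f y \<inter> Q) powr (1 / p\<^sub>0)) * indicator {0<..} y) \<partial>lborel)"
    proof (rule nn_integral_cmult[symmetric])
      have "(\<lambda>y. measure lebesgue (level f y \<inter> Q) powr (1 / p\<^sub>0)) \<in> borel_measurable borel"
        using q1 Qs[OF Q] by (intro antimono_borel_measurable powr_mono2 measure_mono_fmeasurable bounded_set_imp_lmeasurable lev bl)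
          (auto simp: level_def)
      then show "(\<lambda>y. ennreal (measure lebesgue (level f y \<inter> Q) powr (1 / p\<^sub>0)) * indicator {0<..} y) \<in> borel_measurable lborel"
        by measurable
    qed
    also have "\<dots> \<le> (\<integral>\<^sup>+y. ennreal \<kappa> * (ennreal (ps Q y) * indicator {0<..} y) \<partial>lborel)"
    proof (intro nn_integral_mono)
      fix y :: real
      have "c * measure lebesgue (level f y \<inter> Q) powr (1 / p\<^sub>0) \<le> \<kappa> * ps Q y"
        using AR[OF Qc lev[OF Qs(1)[OF Q], of y]] by (simp add: c_def ac_simps ps_def)
      then show "ennreal c * (ennreal (measure lebesgue (level f y \<inter> Q) powr (1 / p\<^sub>0)) * indicator {0<..} y)
         \<le> ennreal \<kappa> * (ennreal (ps Q y) * indicator {0<..} y)"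
        using c0 \<kappa> by (auto simp: indicator_def ps_def ennreal_mult[symmetric] intro!: ennreal_leI)
    qed
    also have "\<dots> = ennreal \<kappa> * NQ Q"
      unfolding NQ_def
    proof (rule nn_integral_cmult)
      show "(\<lambda>y. ennreal (ps Q y) * indicator {0<..} y) \<in> borel_measurable lborel"
        using psm[OF Qs[OF Q]] by simp
    qed
    also have "\<dots> = ennreal (\<kappa> * n Q)" using \<kappa> by (simp add: nN[OF Q, symmetric] ennreal_mult n0)
    finally have le: "c * I \<le> \<kappa> * n Q" using \<kappa> by (subst (asm) ennreal_le_iff) (auto simp: n_def)
    have "pavg p\<^sub>0 \<beta> f Q powr q * wvol u Q = (c * I) powr q"
      using q1 wvol_nonneg[OF u, of Q]
      by (simp add: pavg_def c_def I_def powr_mult powr_powr)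
    also have "\<dots> \<le> (\<kappa> * n Q) powr q" using le c0 q1 by (intro powr_mono2) (auto simp: I_def)
    also have "\<dots> = \<kappa> powr q * n Q powr q" using \<kappa> by (simp add: powr_mult n_def)
    finally show ?thesis .
  qed
  have "ennreal ((\<Sum>Q\<in>F. n Q powr q) powr (1 / q)) \<le> (\<integral>\<^sup>+y. ennreal (indicator {0<..} y * ps B y) \<partial>lborel)"
  proof (rule minkowski_integral[where M = "count_space F" and h = "\<lambda>Q y. indicator {0<..} y * ps Q y" and H = n and r = q])
    show "sigma_finite_measure (count_space F)"
      using F by (simp add: sigma_finite_measure_count_space_finite)
    show "(\<lambda>(Q, y). indicator {0<..} y * ps Q y) \<in> borel_measurable (count_space F \<Otimes>\<^sub>M lborel)"
      using F psm[OF Qs] by (intro measurable_pair_measure_countable1 countable_finite) (auto intro!: borel_measurable_times)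
    show "(\<lambda>y. indicator {0<..} y * ps B y) \<in> borel_measurable borel"
      using psm[OF supp(1,2)] by measurable
    show "ennreal (n Q) = (\<integral>\<^sup>+y. ennreal (indicator {0<..} y * ps Q y) \<partial>lborel)"
      if "Q \<in> space (count_space F)" for Q
      using that by (simp add: nN) (simp only: NQ_def ie)
    show "(\<integral>\<^sup>+Q. ennreal (n Q powr q) \<partial>count_space F) = ennreal (\<Sum>Q\<in>F. n Q powr q)"
      using F by (simp add: nn_integral_count_space_finite)
    fix y :: real
    show "(\<integral>\<^sup>+Q. ennreal ((indicator {0<..} y * ps Q y) powr q) \<partial>count_space F)
        \<le> ennreal ((indicator {0<..} y * ps B y) powr q)"
    proof (cases "0 < y")
      case True
      have "(\<Sum>Q\<in>F. (ps Q y) powr q) = (\<Sum>Q\<in>F. wvol v (level f y \<inter> Q) powr (q / p))"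
        by (simp add: powr_powr ps_def)
      also have "\<dots> \<le> (\<Sum>Q\<in>F. wvol v (level f y \<inter> Q)) powr (q / p)"
        using F exps q1 by (intro sum_powr_le_powr_sum wvol_nonneg[OF v]) auto
      also have "\<dots> \<le> wvol v (level f y \<inter> B) powr (q / p)"
        using exps q1 F True
        by (intro powr_mono2 wvol_sum_disjoint_le[OF v] sum_nonneg wvol_nonneg[OF v] lev bl levB Qs supp)
           (auto simp: disjoint_family_on_def disjoint_def)
      also have "\<dots> = (ps B y) powr q" by (simp add: powr_powr ps_def)
      finally show ?thesis using True F by (simp add: nn_integral_count_space_finite)
    qed (use F in \<open>simp add: nn_integral_count_space_finite\<close>)
  qed (use q1 in \<open>auto simp: n_def ps_def intro!: sum_nonneg\<close>)
  also have "\<dots> = N" by (simp only: N_def ie)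
  finally have "ennreal (\<kappa> * (\<Sum>Q\<in>F. n Q powr q) powr (1 / q)) \<le> ennreal \<kappa> * N"
    using \<kappa> by (simp add: ennreal_mult mult_left_mono)
  also have "\<dots> \<le> ennreal L" using N by (simp add: N_def ps_def)
  finally have le: "\<kappa> * (\<Sum>Q\<in>F. n Q powr q) powr (1 / q) \<le> L" using L by simp
  have S0: "0 \<le> (\<Sum>Q\<in>F. n Q powr q)" by (intro sum_nonneg) auto
  have "(\<Sum>Q\<in>F. pavg p\<^sub>0 \<beta> f Q powr q * wvol u Q) \<le> (\<Sum>Q\<in>F. \<kappa> powr q * n Q powr q)"
    by (intro sum_mono step)
  also have "\<dots> = (\<kappa> * (\<Sum>Q\<in>F. n Q powr q) powr (1 / q)) powr q"
    using \<kappa> q1 S0 by (simp add: powr_mult powr_powr sum_distrib_left)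
  also have "\<dots> \<le> L powr q" using le \<kappa> q1 by (intro powr_mono2) auto
  finally show ?thesis .
qed

section \<open>Packing of sparse families\<close>

lemma locally_finite_weight_one: "locally_finite_weight (\<lambda>_ :: real ^ 'n. 1)"
proof -
  have "wmeas (\<lambda>_. 1) E < \<infinity>" if "E \<in> sets lebesgue" "bounded E" for E :: "(real^'n) set"
    using bounded_set_imp_lmeasurable[OF that(2,1)] that by (simp add: wmeas_def fmeasurable_def)
  then show ?thesis by (simp add: locally_finite_weight_def)
qed

lemma wvol_one: "wvol (\<lambda>_. 1) E = measure lebesgue E"
  by (simp add: wvol_def density_1)

lemma wvol_countable_Union_le:
  assumes lf: "locally_finite_weight \<omega>" and F: "countable F" "F \<subseteq> sets lebesgue" and B: "B \<in> sets lebesgue" "bounded B"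
    and X: "0 \<le> X" and fin: "\<And>G. finite G \<Longrightarrow> G \<subseteq> F \<Longrightarrow> wvol \<omega> (\<Union>G \<inter> B) \<le> X"
  shows "wvol \<omega> (\<Union>F \<inter> B) \<le> X"
proof (cases "F = {}")
  case True
  then show ?thesis using fin[of "{}"] by simp
next
  case False
  define e where "e = from_nat_into F"
  have eF: "e n \<in> F" for n using False by (simp add: e_def from_nat_into)
  have Fe: "F = range e" using range_from_nat_into[OF False F(1)] by (simp add: e_def)
  define A where "A n = (\<Union>i\<le>n. e i) \<inter> B" for n
  have As: "A n \<in> sets lebesgue" for n using eF F(2) B by (auto simp: A_def intro!: sets.Int sets.finite_UN)
  let ?M = "density lebesgue (\<lambda>x. ennreal (\<omega> x))"
  have "(\<lambda>n. measure ?M (A n)) \<longlonglongrightarrow> measure ?M (\<Union>n. A n)"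
  proof (rule Lim_measure_incseq)
    show "range A \<subseteq> sets ?M" using As by auto
    show "incseq A" by (fastforce simp: incseq_def A_def)
    have "(\<Union>n. A n) \<subseteq> B" by (auto simp: A_def)
    then have "emeasure ?M (\<Union>n. A n) \<le> emeasure ?M B" using B by (intro emeasure_mono) auto
    also have "\<dots> < \<infinity>" using fmeasurable_wvol[OF lf B] by (simp add: fmeasurable_def)
    finally show "emeasure ?M (\<Union>n. A n) \<noteq> \<infinity>" by simp
  qed
  moreover have "measure ?M (A n) \<le> X" for n
  proof -
    have "wvol \<omega> (\<Union>(e ` {..n}) \<inter> B) \<le> X" using eF by (intro fin) auto
    then show ?thesis by (simp add: wvol_def A_def)
  qed
  ultimately have "measure ?M (\<Union>n. A n) \<le> X" by (intro LIMSEQ_le_const2) auto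
  moreover have "(\<Union>n. A n) = \<Union>F \<inter> B" unfolding Fe by (auto simp: A_def)
  ultimately show ?thesis by (simp add: wvol_def)
qed

text \<open>The cubes \<open>R i\<close> are enlargements of cubes of an \<open>\<eta>\<close>-sparse family and only \<open>\<eta>'\<close>-sparse themselves.
  Summing \<open>u(R i) \<le> B' u(E i)\<close> would need a constant \<open>B'\<close> for the smaller proportion \<open>\<eta>'\<close>; the aim is
  a bound through \<open>B\<close>, which belongs to \<open>\<eta>\<close>. To this end, stop at the maximal cubes whose \<open>u\<close>-average
  exceeds the one of \<open>Q0\<close> by more than the factor \<open>1 / (1 - \<eta>)\<close>. Cubes with smaller average have \<open>u\<close>-mass at
  most a multiple of \<open>|E i|\<close>, hence contribute \<open>C u(Q0)\<close> with \<open>C = 1 / ((1 - \<eta>) \<eta>')\<close>. The stopping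
  cubes fill at most the part \<open>1 - \<eta>\<close> of \<open>Q0\<close>, so their mass is at most \<open>(1 - 1/B) u(Q0)\<close>, and by
  induction they contribute \<open>C B (1 - 1/B) u(Q0)\<close>. The total is \<open>C B u(Q0)\<close>.\<close>

lemma carleson_of_sparse:
  assumes lf: "locally_finite_weight u" and pos: "\<And>Q. Q \<in> cubes \<Longrightarrow> 0 < wvol u Q"
    and G: "G \<subseteq> cubes" "laminar G" and I: "finite I" "R ` I \<subseteq> G"
    and E: "disjoint_family_on E I" "\<And>i. i \<in> I \<Longrightarrow> E i \<in> sets lebesgue" "\<And>i. i \<in> I \<Longrightarrow> E i \<subseteq> R i"
      "\<And>i. i \<in> I \<Longrightarrow> \<eta>' * measure lebesgue (R i) \<le> measure lebesgue (E i)"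
    and \<eta>: "0 < \<eta>" "\<eta> < 1" "0 < \<eta>'"
    and D: "\<And>Q S. Q \<in> G \<Longrightarrow> S \<in> sets lebesgue \<Longrightarrow> S \<subseteq> Q \<Longrightarrow> \<eta> * measure lebesgue Q \<le> measure lebesgue S \<Longrightarrow> wvol u Q \<le> B * wvol u S"
    and Q0: "Q0 \<in> G"
  shows "(\<Sum>i\<in>{i\<in>I. R i \<subseteq> Q0}. wvol u (R i)) \<le> B / ((1 - \<eta>) * \<eta>') * wvol u Q0"
  using Q0
proof (induction "card {Q \<in> R ` I. Q \<subset> Q0}" arbitrary: Q0 rule: less_induct)
  case less
  have Qf: "Q \<in> sets lebesgue" "bounded Q" "0 < measure lebesgue Q" if "Q \<in> G" for Q using cube_facts G that by blast+
  have up: "0 < wvol u Q" if "Q \<in> G" for Q using pos G that by blast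
  have RG: "R i \<in> G" if "i \<in> I" for i using I that by auto
  define C where "C = 1 / ((1 - \<eta>) * \<eta>')"
  have C: "0 < C" using \<eta> by (simp add: C_def)
  define ave where "ave Q = wvol u Q / measure lebesgue Q" for Q
  define Bad where "Bad = {Q \<in> R ` I. Q \<subseteq> Q0 \<and> ave Q0 < (1 - \<eta>) * ave Q}"
  have ave0: "0 < ave Q0" using up[OF less.prems] Qf[OF less.prems] by (simp add: ave_def)
  have finBad: "finite Bad" using I by (simp add: Bad_def)
  have BadG: "Bad \<subseteq> G" using I by (auto simp: Bad_def)
  obtain M where M: "M \<subseteq> Bad" "disjoint M" "\<And>Q. Q \<in> Bad \<Longrightarrow> \<exists>S\<in>M. Q \<subseteq> S"
    using laminar_maximal[OF finBad laminar_subset[OF G(2) BadG]] by metis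
  have finM: "finite M" using M(1) finBad finite_subset by blast
  have MG: "Q \<in> G" and MQ0: "Q \<subset> Q0" and Mave: "ave Q0 < (1 - \<eta>) * ave Q" if "Q \<in> M" for Q
  proof -
    have Q: "Q \<in> Bad" using that M by blast
    then show "Q \<in> G" using BadG by blast
    show "ave Q0 < (1 - \<eta>) * ave Q" using Q by (simp add: Bad_def)
    moreover have "(1 - \<eta>) * ave Q0 \<le> 1 * ave Q0" using \<eta> ave0 by (intro mult_right_mono) auto
    ultimately have "Q \<noteq> Q0" by auto
    then show "Q \<subset> Q0" using Q by (auto simp: Bad_def)
  qed
  have Mdis: "disjoint_family_on (\<lambda>Q. Q) M" using M(2) by (auto simp: disjoint_family_on_def disjoint_def)
  have sumM: "(\<Sum>Q\<in>M. \<Sum>i\<in>{i\<in>I. R i \<subseteq> Q}. wvol u (R i)) \<le> C * B * (\<Sum>Q\<in>M. wvol u Q)"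
    unfolding sum_distrib_left
  proof (intro sum_mono)
    fix Q assume Q: "Q \<in> M"
    have "card {Q' \<in> R ` I. Q' \<subset> Q} < card {Q' \<in> R ` I. Q' \<subset> Q0}"
    proof (rule psubset_card_mono)
      show "finite {Q' \<in> R ` I. Q' \<subset> Q0}" using I by simp
      have "Q \<in> R ` I" using Q M(1) by (auto simp: Bad_def)
      then show "{Q' \<in> R ` I. Q' \<subset> Q} \<subset> {Q' \<in> R ` I. Q' \<subset> Q0}" using MQ0[OF Q] by blast
    qed
    from less.hyps[OF this MG[OF Q]] show "(\<Sum>i\<in>{i\<in>I. R i \<subseteq> Q}. wvol u (R i)) \<le> C * B * wvol u Q"
      by (simp add: C_def)
  qed
  \<comment> \<open>The stopped cubes miss a fraction of \<open>Q0\<close> that carries at least \<open>1 / B\<close> of its mass.\<close>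
  have UM: "\<Union>M \<in> sets lebesgue" "\<Union>M \<subseteq> Q0" using MG MQ0 Qf finM by (auto intro!: sets.finite_Union)
  have mM: "measure lebesgue (\<Union>M) \<le> (1 - \<eta>) * measure lebesgue Q0"
  proof -
    have "measure lebesgue (\<Union>M) = (\<Sum>Q\<in>M. measure lebesgue Q)"
      using wvol_UN_disjoint[OF locally_finite_weight_one finM _ _ Mdis] Qf MG by (simp add: wvol_one)
    also have "\<dots> \<le> (\<Sum>Q\<in>M. (1 - \<eta>) * wvol u Q / ave Q0)"
    proof (intro sum_mono)
      fix Q assume Q: "Q \<in> M"
      show "measure lebesgue Q \<le> (1 - \<eta>) * wvol u Q / ave Q0"
        using Mave[OF Q] Qf(3)[OF MG[OF Q]] ave0 by (simp add: ave_def[of Q] field_simps)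
    qed
    also have "\<dots> = (1 - \<eta>) * (\<Sum>Q\<in>M. wvol u Q) / ave Q0" by (simp add: sum_distrib_left sum_divide_distrib)
    also have "\<dots> \<le> (1 - \<eta>) * wvol u Q0 / ave Q0"
      using \<eta> ave0 finM Mdis MG MQ0 Qf less.prems
      by (intro divide_right_mono mult_left_mono wvol_sum_disjoint_le[OF lf]) auto
    also have "\<dots> = (1 - \<eta>) * measure lebesgue Q0" using up[OF less.prems] Qf[OF less.prems] by (simp add: ave_def)
    finally show ?thesis .
  qed
  have BM: "B * (\<Sum>Q\<in>M. wvol u Q) \<le> B * wvol u Q0 - wvol u Q0"
  proof -
    have "measure lebesgue (Q0 - \<Union>M) = measure lebesgue Q0 - measure lebesgue (\<Union>M)"
      using wvol_diff[OF locally_finite_weight_one UM(1) _ _ UM(2)] Qf[OF less.prems] by (simp add: wvol_one)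
    then have "\<eta> * measure lebesgue Q0 \<le> measure lebesgue (Q0 - \<Union>M)" using mM by (simp add: algebra_simps)
    then have "wvol u Q0 \<le> B * wvol u (Q0 - \<Union>M)"
      using Qf[OF less.prems] UM by (intro D less.prems) auto
    also have "wvol u (Q0 - \<Union>M) = wvol u Q0 - wvol u (\<Union>M)"
      using wvol_diff[OF lf UM(1) _ _ UM(2)] Qf[OF less.prems] by simp
    also have "wvol u (\<Union>M) = (\<Sum>Q\<in>M. wvol u Q)"
      using wvol_UN_disjoint[OF lf finM _ _ Mdis] Qf MG by simp
    finally show ?thesis by (simp add: algebra_simps)
  qed
  define J where "J = {i\<in>I. R i \<subseteq> Q0 \<and> R i \<notin> Bad}"
  have sumJ: "(\<Sum>i\<in>J. wvol u (R i)) \<le> C * wvol u Q0"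
  proof -
    have "(\<Sum>i\<in>J. wvol u (R i)) \<le> (\<Sum>i\<in>J. C * ave Q0 * measure lebesgue (E i))"
    proof (intro sum_mono)
      fix i assume i: "i \<in> J"
      then have iI: "i \<in> I" by (simp add: J_def)
      have "(1 - \<eta>) * ave (R i) \<le> ave Q0" using i by (auto simp: J_def Bad_def)
      then have "(1 - \<eta>) * wvol u (R i) \<le> ave Q0 * measure lebesgue (R i)"
        using Qf(3)[OF RG[OF iI]] by (simp add: ave_def[of "R i"] field_simps)
      then have "wvol u (R i) \<le> ave Q0 / (1 - \<eta>) * measure lebesgue (R i)" using \<eta> by (simp add: field_simps)
      also have "\<dots> \<le> ave Q0 / (1 - \<eta>) * (measure lebesgue (E i) / \<eta>')"
        using E(4)[OF iI] \<eta> ave0 by (intro mult_left_mono) (auto simp: field_simps)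
      finally show "wvol u (R i) \<le> C * ave Q0 * measure lebesgue (E i)" by (simp add: C_def)
    qed
    also have "\<dots> = C * ave Q0 * (\<Sum>i\<in>J. measure lebesgue (E i))" by (simp add: sum_distrib_left)
    also have "\<dots> \<le> C * ave Q0 * measure lebesgue Q0"
    proof (intro mult_left_mono)
      have "disjoint_family_on E J" using E(1) by (auto simp: J_def disjoint_family_on_def)
      then have "(\<Sum>i\<in>J. wvol (\<lambda>_. 1) (E i)) \<le> wvol (\<lambda>_. 1) Q0"
        using I E Qf[OF less.prems] by (intro wvol_sum_disjoint_le[OF locally_finite_weight_one]) (auto simp: J_def, blast)
      then show "(\<Sum>i\<in>J. measure lebesgue (E i)) \<le> measure lebesgue Q0" by (simp add: wvol_one)
    qed (use C ave0 in auto)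
    also have "\<dots> = C * wvol u Q0" using Qf[OF less.prems] by (simp add: ave_def)
    finally show ?thesis .
  qed
  have "(\<Sum>i\<in>{i\<in>I. R i \<subseteq> Q0}. wvol u (R i)) \<le> (\<Sum>i\<in>J. wvol u (R i)) + (\<Sum>i\<in>{i\<in>I. R i \<in> Bad}. wvol u (R i))"
  proof -
    have "{i\<in>I. R i \<subseteq> Q0} = J \<union> {i\<in>I. R i \<in> Bad}" by (auto simp: J_def Bad_def)
    moreover have "J \<inter> {i\<in>I. R i \<in> Bad} = {}" by (auto simp: J_def)
    ultimately show ?thesis using I by (simp add: sum.union_disjoint J_def)
  qed
  also have "(\<Sum>i\<in>{i\<in>I. R i \<in> Bad}. wvol u (R i)) \<le> (\<Sum>i\<in>(\<Union>Q\<in>M. {i\<in>I. R i \<subseteq> Q}). wvol u (R i))"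
    using M(3) I finM by (intro sum_mono2) (auto simp: wvol_nonneg[OF lf])
  also have "\<dots> = (\<Sum>Q\<in>M. \<Sum>i\<in>{i\<in>I. R i \<subseteq> Q}. wvol u (R i))"
  proof (rule sum.UNION_disjoint)
    show "\<forall>Q\<in>M. \<forall>Q'\<in>M. Q \<noteq> Q' \<longrightarrow> {i \<in> I. R i \<subseteq> Q} \<inter> {i \<in> I. R i \<subseteq> Q'} = {}"
    proof (intro ballI impI)
      fix Q Q' assume QQ: "Q \<in> M" "Q' \<in> M" "Q \<noteq> Q'"
      then have "Q \<inter> Q' = {}" using M(2) by (auto simp: disjoint_def)
      moreover have "R i \<noteq> {}" if "i \<in> I" for i using cube_facts(5) RG[OF that] G by blast
      ultimately show "{i \<in> I. R i \<subseteq> Q} \<inter> {i \<in> I. R i \<subseteq> Q'} = {}" by blast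
    qed
  qed (use finM I in auto)
  finally have "(\<Sum>i\<in>{i\<in>I. R i \<subseteq> Q0}. wvol u (R i)) \<le> C * wvol u Q0 + C * (B * (\<Sum>Q\<in>M. wvol u Q))"
    using sumJ sumM by (simp add: mult.assoc)
  also have "\<dots> \<le> C * wvol u Q0 + C * (B * wvol u Q0 - wvol u Q0)"
    using BM C by (intro add_left_mono mult_left_mono) auto
  also have "\<dots> = B / ((1 - \<eta>) * \<eta>') * wvol u Q0" by (simp add: C_def algebra_simps)
  finally show ?case .
qed

lemma carleson_of_sparse_unweighted:
  fixes R E :: "'i \<Rightarrow> (real ^ 'n) set"
  assumes I: "finite I" and E: "disjoint_family_on E I" "\<And>i. i \<in> I \<Longrightarrow> E i \<in> sets lebesgue" "\<And>i. i \<in> I \<Longrightarrow> E i \<subseteq> R i"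
      "\<And>i. i \<in> I \<Longrightarrow> \<eta> * measure lebesgue (R i) \<le> measure lebesgue (E i)"
    and \<eta>: "0 < \<eta>" and Q0: "Q0 \<in> sets lebesgue" "bounded Q0"
  shows "(\<Sum>i\<in>{i\<in>I. R i \<subseteq> Q0}. measure lebesgue (R i)) \<le> 1 / \<eta> * measure lebesgue Q0"
proof -
  have "(\<Sum>i\<in>{i\<in>I. R i \<subseteq> Q0}. measure lebesgue (R i)) \<le> (\<Sum>i\<in>{i\<in>I. R i \<subseteq> Q0}. 1 / \<eta> * wvol (\<lambda>_. 1) (E i))"
    using E(4) \<eta> by (intro sum_mono) (auto simp: wvol_one field_simps)
  also have "\<dots> = 1 / \<eta> * (\<Sum>i\<in>{i\<in>I. R i \<subseteq> Q0}. wvol (\<lambda>_. 1) (E i))" by (rule sum_distrib_left[symmetric])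
  also have "\<dots> \<le> 1 / \<eta> * wvol (\<lambda>_. 1) Q0"
    using I E Q0 \<eta> by (intro mult_left_mono wvol_sum_disjoint_le[OF locally_finite_weight_one])
      (auto simp: disjoint_family_on_def, blast)
  finally show ?thesis by (simp add: wvol_one)
qed

section \<open>Quantitative absolute continuity from the reverse Hoelder inequality\<close>

text \<open>From each cube of \<open>F\<close> ascend to the first ancestor of which \<open>\<Union>F\<close> fills at most half, in terms of
  \<open>u\<close>. One generation below it fills more than half, so passing to the union of the ancestors multiplies
  \<open>u\<close> by at most \<open>2 * D2\<close>, whereas in each ancestor \<open>half\<close> gains the factor \<open>1 - c\<close> for \<open>z\<close>. The
  smallness of \<open>u(\<Union>F)\<close> leaves room for \<open>k\<close> such steps inside \<open>P\<close>.\<close>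

lemma decay_iteration:
  fixes P :: "(real ^ 'n) set"
  assumes u: "locally_finite_weight u" and z: "locally_finite_weight z"
    and pos: "\<And>Q. Q \<in> cubes \<Longrightarrow> 0 < wvol u Q"
    and D: "\<And>Q Q'. Q \<in> shifted_grid a \<Longrightarrow> Q' \<in> shifted_grid a \<Longrightarrow> Q \<subseteq> Q' \<Longrightarrow>
       measure lebesgue Q' = 2 ^ CARD('n) * measure lebesgue Q \<Longrightarrow> wvol u Q' \<le> D2 * wvol u Q"
    and D2: "1 \<le> D2" and c: "0 < c" "c \<le> 1"
    and half: "\<And>Q G. Q \<in> cubes \<Longrightarrow> G \<in> sets lebesgue \<Longrightarrow> G \<subseteq> Q \<Longrightarrow> wvol u G \<le> wvol u Q / 2 \<Longrightarrow> wvol z G \<le> (1 - c) * wvol z Q"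
    and P: "P \<in> shifted_grid a"
    and F: "finite F" "F \<subseteq> shifted_grid a" "\<Union>F \<subseteq> P" "2 * (2 * D2) ^ k * wvol u (\<Union>F) \<le> wvol u P"
  shows "wvol z (\<Union>F) \<le> (1 - c) ^ k * wvol z P"
  using F
proof (induction k arbitrary: F)
  case 0
  have "\<Union>F \<in> sets lebesgue" using 0 cube_facts(1)[OF shifted_grid_cubes[of _ a]] by (auto intro!: sets.finite_Union)
  then show ?case using 0 cube_facts[OF shifted_grid_cubes[OF P]] by (auto intro!: wvol_mono[OF z])
next
  case (Suc k)
  have cf: "Q \<in> sets lebesgue" "bounded Q" "Q \<in> cubes" if "Q \<in> shifted_grid a" for Q
    using cube_facts shifted_grid_cubes that by blast+
  define G where "G = \<Union>F"
  have Gs: "G \<in> sets lebesgue" using Suc.prems cf unfolding G_def by (auto intro!: sets.finite_Union)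
  have GP: "G \<subseteq> P" using Suc.prems by (simp add: G_def)
  define good where "good Q \<longleftrightarrow> wvol u Q / 2 < wvol u (G \<inter> Q)" for Q
  have goodF: "good Q" if "Q \<in> F" for Q
  proof -
    have "G \<inter> Q = Q" using that by (auto simp: G_def)
    then show ?thesis using pos[of Q] cf(3)[of Q] that Suc.prems by (auto simp: good_def)
  qed
  have uG0: "0 \<le> wvol u G" by (rule wvol_nonneg[OF u])
  have HD: "1 \<le> (2 * D2) ^ k * (2 * D2)" using D2 one_le_power[of "2 * D2" "Suc k"] by (simp add: mult.commute)
  have badP: "\<not> good P"
  proof -
    have "1 * wvol u G \<le> (2 * D2) ^ k * (2 * D2) * wvol u G"
      by (rule mult_right_mono[OF HD uG0])
    then have "2 * wvol u G \<le> 2 * ((2 * D2) ^ k * (2 * D2) * wvol u G)" by linarith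
    also have "\<dots> \<le> wvol u P" using Suc.prems(4) by (simp only: G_def power_Suc mult.assoc mult.left_commute mult.commute)
    finally show ?thesis using GP by (simp add: good_def Int_absorb2)
  qed
  have "\<forall>Q\<in>F. \<exists>Q1 Q2. Q1 \<in> shifted_grid a \<and> Q2 \<in> shifted_grid a \<and> Q \<subseteq> Q1 \<and> Q1 \<subseteq> Q2 \<and> Q2 \<subseteq> P \<and>
    good Q1 \<and> \<not> good Q2 \<and> measure lebesgue Q2 = 2 ^ CARD('n) * measure lebesgue Q1"
  proof
    fix Q assume Q: "Q \<in> F"
    then have "Q \<in> shifted_grid a" "Q \<subseteq> P" using Suc.prems by auto
    from cell_ascent[OF P this goodF[OF Q] badP]
    show "\<exists>Q1 Q2. Q1 \<in> shifted_grid a \<and> Q2 \<in> shifted_grid a \<and> Q \<subseteq> Q1 \<and> Q1 \<subseteq> Q2 \<and> Q2 \<subseteq> P \<and>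
      good Q1 \<and> \<not> good Q2 \<and> measure lebesgue Q2 = 2 ^ CARD('n) * measure lebesgue Q1" by metis
  qed
  then obtain f g where fg: "\<And>Q. Q \<in> F \<Longrightarrow> f Q \<in> shifted_grid a \<and> g Q \<in> shifted_grid a \<and> Q \<subseteq> f Q \<and> f Q \<subseteq> g Q \<and> g Q \<subseteq> P \<and>
      good (f Q) \<and> \<not> good (g Q) \<and> measure lebesgue (g Q) = 2 ^ CARD('n) * measure lebesgue (f Q)" by metis
  have gF: "finite (g ` F)" "g ` F \<subseteq> shifted_grid a" using Suc.prems fg by auto
  obtain M where M: "M \<subseteq> g ` F" "disjoint M" "\<And>Q. Q \<in> g ` F \<Longrightarrow> \<exists>R\<in>M. Q \<subseteq> R"
    using laminar_maximal[OF gF(1) laminar_subset[OF laminar_shifted_grid gF(2)]] by metis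
  have finM: "finite M" using M(1) gF(1) finite_subset by blast
  have MG: "R \<in> shifted_grid a" if "R \<in> M" for R using that M(1) gF(2) by blast
  have Mdis: "disjoint_family_on (\<lambda>Q. Q) M" using M(2) by (auto simp: disjoint_family_on_def disjoint_def)
  have GM: "G \<subseteq> \<Union>M" unfolding G_def
  proof
    fix x assume "x \<in> \<Union>F"
    then obtain Q where Q: "Q \<in> F" "x \<in> Q" by blast
    then have "x \<in> g Q" using fg by blast
    then show "x \<in> \<Union>M" using M(3) Q by blast
  qed
  have GRdis: "disjoint_family_on (\<lambda>R. G \<inter> R) M" using Mdis by (auto simp: disjoint_family_on_def)
  have GR: "G \<inter> R \<in> sets lebesgue" "bounded (G \<inter> R)" if "R \<in> M" for R
    using Gs cf MG[OF that] bounded_subset[of R] by auto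
  have Gb: "bounded G" using GP cf(2)[OF P] bounded_subset by blast
  have "wvol u (\<Union>M) = (\<Sum>R\<in>M. wvol u R)"
    using wvol_UN_disjoint[OF u finM _ _ Mdis] cf MG by simp
  also have "\<dots> \<le> (\<Sum>R\<in>M. (2 * D2) * wvol u (G \<inter> R))"
  proof (intro sum_mono)
    fix R assume R: "R \<in> M"
    then obtain Q where Q: "Q \<in> F" "R = g Q" using M(1) by blast
    have "wvol u R \<le> D2 * wvol u (f Q)" using fg[OF Q(1)] Q by (intro D) auto
    also have "\<dots> \<le> D2 * (2 * wvol u (G \<inter> f Q))" using fg[OF Q(1)] D2 by (intro mult_left_mono) (auto simp: good_def)
    also have "\<dots> \<le> D2 * (2 * wvol u (G \<inter> R))"
      using fg[OF Q(1)] D2 Q Gs cf GR[OF R] by (intro mult_left_mono wvol_mono[OF u]) auto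
    finally show "wvol u R \<le> (2 * D2) * wvol u (G \<inter> R)" by simp
  qed
  also have "\<dots> = (2 * D2) * (\<Sum>R\<in>M. wvol u (G \<inter> R))" by (simp add: sum_distrib_left)
  also have "\<dots> \<le> (2 * D2) * wvol u G"
    using D2 finM GR GRdis Gs Gb by (intro mult_left_mono wvol_sum_disjoint_le[OF u]) auto
  finally have uM: "wvol u (\<Union>M) \<le> (2 * D2) * wvol u G" .
  have "2 * (2 * D2) ^ k * wvol u (\<Union>M) \<le> 2 * (2 * D2) ^ k * ((2 * D2) * wvol u G)"
    using uM D2 by (intro mult_left_mono) auto
  also have "\<dots> \<le> wvol u P" using Suc.prems(4) by (simp add: G_def algebra_simps)
  finally have "wvol z (\<Union>M) \<le> (1 - c) ^ k * wvol z P"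
    using finM MG M(1) fg by (intro Suc.IH) auto
  moreover have "wvol z G \<le> (1 - c) * wvol z (\<Union>M)"
  proof -
    have "G = (\<Union>R\<in>M. G \<inter> R)" using GM by blast
    then have "wvol z G = (\<Sum>R\<in>M. wvol z (G \<inter> R))"
      using wvol_UN_disjoint[OF z finM GR GRdis] by simp
    also have "\<dots> \<le> (\<Sum>R\<in>M. (1 - c) * wvol z R)"
    proof (intro sum_mono half)
      fix R assume R: "R \<in> M"
      then obtain Q where Q: "Q \<in> F" "R = g Q" using M(1) by blast
      then show "wvol u (G \<inter> R) \<le> wvol u R / 2" using fg[OF Q(1)] by (auto simp: good_def)
    qed (use GR cf MG in auto)
    also have "\<dots> = (1 - c) * wvol z (\<Union>M)"
      using wvol_UN_disjoint[OF z finM _ _ Mdis] cf MG by (simp add: sum_distrib_left)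
    finally show ?thesis .
  qed
  ultimately have "wvol z G \<le> (1 - c) * ((1 - c) ^ k * wvol z P)"
    using c by (meson diff_ge_0_iff_ge mult_left_mono order_trans)
  then show ?case by (simp add: G_def)
qed

lemma wmeas_holder:
  fixes \<omega> :: "real ^ 'n \<Rightarrow> real"
  assumes 1: "locally_finite_weight \<omega>\<^sub>1" and 2: "locally_finite_weight \<omega>\<^sub>2" and \<theta>: "0 \<le> \<theta>" "\<theta> \<le> 1"
    and le: "\<And>x. \<omega> x \<le> \<omega>\<^sub>1 x powr (1 - \<theta>) * \<omega>\<^sub>2 x powr \<theta>" and E: "E \<in> sets lebesgue" "bounded E"
  shows "wmeas \<omega> E \<le> ennreal (wvol \<omega>\<^sub>1 E powr (1 - \<theta>) * wvol \<omega>\<^sub>2 E powr \<theta>)"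
proof -
  note [measurable] = lfw_meas[OF 1] lfw_meas[OF 2] E(1)
  have w: "wmeas \<omega>' E = (\<integral>\<^sup>+x. ennreal (\<omega>' x * indicator E x) \<partial>lebesgue)" for \<omega>' :: "real ^ 'n \<Rightarrow> real"
    unfolding wmeas_def by (intro nn_integral_cong) (auto simp: indicator_def)
  have "wmeas \<omega> E \<le> (\<integral>\<^sup>+x. ennreal ((\<omega>\<^sub>1 x * indicator E x) powr (1 - \<theta>) * (\<omega>\<^sub>2 x * indicator E x) powr \<theta>) \<partial>lebesgue)"
    unfolding wmeas_def using le by (intro nn_integral_mono) (auto simp: indicator_def intro!: ennreal_leI)
  also have "\<dots> \<le> ennreal (wvol \<omega>\<^sub>1 E powr (1 - \<theta>) * wvol \<omega>\<^sub>2 E powr \<theta>)"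
    using \<theta> wmeas_eq_wvol[OF 1 E] wmeas_eq_wvol[OF 2 E] lfw_nonneg[OF 1] lfw_nonneg[OF 2]
    by (intro nn_integral_holder) (auto simp: w wvol_nonneg[OF 1] wvol_nonneg[OF 2])
  finally show ?thesis .
qed

lemma wvol_holder:
  assumes "locally_finite_weight \<omega>\<^sub>1" "locally_finite_weight \<omega>\<^sub>2" "locally_finite_weight \<omega>" "0 \<le> \<theta>" "\<theta> \<le> 1"
    "\<And>x. \<omega> x \<le> \<omega>\<^sub>1 x powr (1 - \<theta>) * \<omega>\<^sub>2 x powr \<theta>" "E \<in> sets lebesgue" "bounded E"
  shows "wvol \<omega> E \<le> wvol \<omega>\<^sub>1 E powr (1 - \<theta>) * wvol \<omega>\<^sub>2 E powr \<theta>"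
  using wmeas_holder[OF assms(1,2,4-8)] wmeas_eq_wvol[OF assms(3,7,8)] by simp

lemma wvol_jensen:
  assumes u: "locally_finite_weight u" and z: "locally_finite_weight (\<lambda>x. u x powr s)" and s: "1 \<le> s"
    and E: "E \<in> sets lebesgue" "bounded E"
  shows "wvol u E powr s \<le> wvol (\<lambda>x. u x powr s) E * measure lebesgue E powr (s - 1)"
proof -
  have "wvol u E \<le> wvol (\<lambda>x. u x powr s) E powr (1 - (1 - 1 / s)) * wvol (\<lambda>_. 1) E powr (1 - 1 / s)"
    using s lfw_nonneg[OF u] by (intro wvol_holder[OF z locally_finite_weight_one u] E) (auto simp: powr_powr)
  then have "wvol u E powr s \<le> (wvol (\<lambda>x. u x powr s) E powr (1 / s) * measure lebesgue E powr (1 - 1 / s)) powr s"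
    using s by (intro powr_mono2) (auto simp: wvol_one wvol_nonneg[OF u])
  also have "\<dots> = wvol (\<lambda>x. u x powr s) E * measure lebesgue E powr (s - 1)"
    using s wvol_nonneg[OF z] by (simp add: powr_mult powr_powr left_diff_distrib)
  finally show ?thesis .
qed

text \<open>The rest \<open>Q - G\<close> has at least half of the mass of \<open>u\<close>; Jensen's inequality turns this into mass of
  \<open>u^s\<close>, which the reverse Hoelder inequality compares with the total on \<open>Q\<close>.\<close>

lemma reverse_holder_half:
  assumes u: "locally_finite_weight u" and z: "locally_finite_weight (\<lambda>x. u x powr s)" and s: "1 \<le> s" and Rc: "1 \<le> Rc"
    and Q: "Q \<in> cubes" and RH: "wvol (\<lambda>x. u x powr s) Q * measure lebesgue Q powr (s - 1) \<le> (Rc * wvol u Q) powr s"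
    and pos: "0 < wvol u Q" and G: "G \<in> sets lebesgue" "G \<subseteq> Q" "wvol u G \<le> wvol u Q / 2"
  shows "wvol (\<lambda>x. u x powr s) G \<le> (1 - (2 * Rc) powr (- s)) * wvol (\<lambda>x. u x powr s) Q"
proof -
  let ?z = "\<lambda>x. u x powr s"
  note Qf = cube_facts[OF Q]
  have D: "Q - G \<in> sets lebesgue" "bounded (Q - G)" using Qf G bounded_subset[of Q "Q - G"] by auto
  define m where "m = measure lebesgue Q"
  have m: "0 < m" using Qf by (simp add: m_def)
  have mD: "measure lebesgue (Q - G) \<le> m" unfolding m_def
    using Qf D bounded_set_imp_lmeasurable by (intro measure_mono_fmeasurable) auto
  have "wvol ?z Q * m powr (s - 1) \<le> (2 * Rc) powr s * (wvol u Q / 2) powr s"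
    using RH Rc pos by (simp add: m_def powr_mult powr_divide)
  also have "\<dots> \<le> (2 * Rc) powr s * (wvol u (Q - G)) powr s"
    using wvol_diff[OF u G(1) Qf(1,2) G(2)] G(3) pos s by (intro mult_left_mono powr_mono2) auto
  also have "\<dots> \<le> (2 * Rc) powr s * (wvol ?z (Q - G) * measure lebesgue (Q - G) powr (s - 1))"
    by (intro mult_left_mono wvol_jensen[OF u z s] D) auto
  also have "\<dots> \<le> (2 * Rc) powr s * (wvol ?z (Q - G) * m powr (s - 1))"
    using s mD by (intro mult_left_mono powr_mono2 wvol_nonneg[OF z]) auto
  finally have "wvol ?z Q \<le> (2 * Rc) powr s * wvol ?z (Q - G)"
    using m by (simp add: mult.assoc[symmetric])
  then have "(2 * Rc) powr (- s) * wvol ?z Q \<le> (2 * Rc) powr (- s) * ((2 * Rc) powr s * wvol ?z (Q - G))"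
    by (intro mult_left_mono) auto
  also have "\<dots> = wvol ?z Q - wvol ?z G"
    using Rc wvol_diff[OF z G(1) Qf(1,2) G(2)] by (simp add: powr_minus mult.assoc[symmetric])
  finally show ?thesis by (simp add: algebra_simps)
qed

context
  fixes u z :: "real ^ 'n \<Rightarrow> real" and a :: "'n \<Rightarrow> nat" and D2 c :: real
  assumes u: "locally_finite_weight u" and z: "locally_finite_weight z"
    and pos: "\<And>Q. Q \<in> cubes \<Longrightarrow> 0 < wvol u Q"
    and D: "\<And>Q Q'. Q \<in> shifted_grid a \<Longrightarrow> Q' \<in> shifted_grid a \<Longrightarrow> Q \<subseteq> Q' \<Longrightarrow>
       measure lebesgue Q' = 2 ^ CARD('n) * measure lebesgue Q \<Longrightarrow> wvol u Q' \<le> D2 * wvol u Q"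
    and D2: "1 \<le> D2" and c: "0 < c" "c \<le> 1 / 2"
    and half: "\<And>Q G. Q \<in> cubes \<Longrightarrow> G \<in> sets lebesgue \<Longrightarrow> G \<subseteq> Q \<Longrightarrow> wvol u G \<le> wvol u Q / 2 \<Longrightarrow> wvol z G \<le> (1 - c) * wvol z Q"
begin

lemma decay_exponent: "0 < c / ln (2 * D2)" "c / ln (2 * D2) \<le> 1"
proof -
  have "ln 2 \<le> ln (2 * D2)" using D2 by simp
  then have "2 / 3 \<le> ln (2 * D2)" using ln2_ge_two_thirds by linarith
  then show "0 < c / ln (2 * D2)" "c / ln (2 * D2) \<le> 1" using c by (auto simp: divide_le_eq)
qed

text \<open>About \<open>log (u(P) / u(\<Union>F)) / log (2 * D2)\<close> steps of \<open>decay_iteration\<close> are possible, and each gains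
  \<open>1 - c \<le> exp (- c)\<close>; hence the exponent \<open>c / ln (2 * D2)\<close>. The constant 4 absorbs the rounding of the
  number of steps and the case where no step is possible.\<close>

lemma decay_finite_union:
  assumes P: "P \<in> shifted_grid a" and F: "finite F" "F \<subseteq> shifted_grid a" "\<Union>F \<subseteq> P"
  shows "wvol z (\<Union>F) \<le> 4 * (wvol u (\<Union>F) / wvol u P) powr (c / ln (2 * D2)) * wvol z P"
proof (cases "F = {}")
  case True
  then show ?thesis using wvol_nonneg[OF z] by (simp add: wvol_def)
next
  case False
  define \<delta> where "\<delta> = c / ln (2 * D2)"
  note \<delta> = decay_exponent[folded \<delta>_def]
  define \<rho> where "\<rho> = wvol u (\<Union>F) / wvol u P"
  have cf: "Q \<in> sets lebesgue" "bounded Q" "Q \<in> cubes" if "Q \<in> shifted_grid a" for Q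
    using cube_facts shifted_grid_cubes that by blast+
  have uP: "0 < wvol u P" using pos cf(3)[OF P] by blast
  have Us: "\<Union>F \<in> sets lebesgue" using F cf by (auto intro!: sets.finite_Union)
  obtain Q where Q: "Q \<in> F" using False by blast
  have Ub: "bounded (\<Union>F)" using F cf(2)[OF P] bounded_subset by blast
  have "0 < wvol u Q" using pos cf(3) Q F by blast
  also have "\<dots> \<le> wvol u (\<Union>F)" using Q F cf Us Ub by (intro wvol_mono[OF u]) auto
  finally have \<rho>0: "0 < \<rho>" using uP by (simp add: \<rho>_def)
  have zle: "wvol z (\<Union>F) \<le> wvol z P" using F cf[OF P] Us by (intro wvol_mono[OF z]) auto
  have zP: "0 \<le> wvol z P" by (rule wvol_nonneg[OF z])
  show ?thesis unfolding \<rho>_def[symmetric] \<delta>_def[symmetric]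
  proof (cases "1 / 2 < \<rho>")
    case True
    have "(1/2 :: real) powr 1 \<le> (1/2) powr \<delta>" using \<delta> by (intro powr_mono') auto
    also have "\<dots> \<le> \<rho> powr \<delta>" using True \<delta> by (intro powr_mono2) auto
    finally have "1 \<le> 4 * \<rho> powr \<delta>" by simp
    then have "1 * wvol z P \<le> 4 * \<rho> powr \<delta> * wvol z P" using zP by (intro mult_right_mono)
    then show "wvol z (\<Union>F) \<le> 4 * \<rho> powr \<delta> * wvol z P" using zle by simp
  next
    case False
    define H where "H = 2 * D2"
    have H: "2 \<le> H" using D2 by (simp add: H_def)
    define x where "x = 1 / (2 * \<rho>)"
    have x: "1 \<le> x" using False \<rho>0 by (simp add: x_def)
    define k where "k = nat \<lfloor>log H x\<rfloor>"
    have l0: "0 \<le> log H x" using H x by simp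
    have k: "real k \<le> log H x" "log H x < real k + 1" using l0 by (auto simp: k_def)
    have "H powr real k \<le> H powr (log H x)" using k H by (intro powr_mono) auto
    then have "H ^ k \<le> x" using H x by (simp add: powr_realpow)
    then have "2 * H ^ k * \<rho> \<le> 1" using \<rho>0 by (simp add: x_def field_simps)
    then have "2 * (2 * D2) ^ k * wvol u (\<Union>F) \<le> wvol u P"
      using uP by (simp add: \<rho>_def H_def field_simps)
    then have "wvol z (\<Union>F) \<le> (1 - c) ^ k * wvol z P"
      using c by (intro decay_iteration[OF u z pos D D2 _ _ half P F]) auto
    also have "\<dots> \<le> 4 * \<rho> powr \<delta> * wvol z P"
    proof (intro mult_right_mono zP)
      have "(1 - c) ^ k \<le> exp (- c) ^ k" using c exp_ge_add_one_self[of "- c"] by (intro power_mono) auto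
      also have "\<dots> = exp c * exp (- c * (real k + 1))" by (simp add: exp_of_nat_mult[symmetric] exp_add[symmetric] algebra_simps)
      also have "\<dots> \<le> 2 * exp (- c * log H x)"
      proof (intro mult_mono)
        have "exp c \<le> 1 + c + c\<^sup>2" using c by (intro exp_bound) auto
        also have "c\<^sup>2 \<le> (1/2)\<^sup>2" using c by (intro power_mono) auto
        finally show "exp c \<le> 2" using c by (simp add: power2_eq_square)
      qed (use k c in auto)
      also have "exp (- c * log H x) = (2 * \<rho>) powr \<delta>"
        using H x \<rho>0 by (simp add: powr_def \<delta>_def H_def[symmetric] log_def x_def ln_div)
      also have "(2 * \<rho>) powr \<delta> = 2 powr \<delta> * \<rho> powr \<delta>" using \<rho>0 by (simp add: powr_mult)
      also have "2 * (2 powr \<delta> * \<rho> powr \<delta>) \<le> 2 * (2 powr 1 * \<rho> powr \<delta>)"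
        using \<delta> by (intro mult_left_mono mult_right_mono powr_mono) auto
      finally show "(1 - c) ^ k \<le> 4 * \<rho> powr \<delta>" by simp
    qed
    finally show "wvol z (\<Union>F) \<le> 4 * \<rho> powr \<delta> * wvol z P" .
  qed
qed

text \<open>An open subset of \<open>P\<close> is a countable union of cells, and \<open>G\<close> differs by a null set from a decreasing
  intersection of open sets.\<close>

lemma decay_measurable:
  assumes P: "P \<in> shifted_grid a" and G: "G \<in> sets lebesgue" "G \<subseteq> P"
  shows "wvol z G \<le> 4 * (wvol u G / wvol u P) powr (c / ln (2 * D2)) * wvol z P"
proof -
  define \<delta> where "\<delta> = c / ln (2 * D2)"
  note \<delta> = decay_exponent[folded \<delta>_def]
  have cf: "Q \<in> sets lebesgue" "bounded Q" "Q \<in> cubes" if "Q \<in> shifted_grid a" for Q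
    using cube_facts shifted_grid_cubes that by blast+
  note Pf = cf[OF P]
  have uP: "0 < wvol u P" using pos Pf by blast
  have zP: "0 \<le> wvol z P" by (rule wvol_nonneg[OF z])
  have opn: "wvol z (U \<inter> P) \<le> 4 * (wvol u (U \<inter> P) / wvol u P) powr \<delta> * wvol z P" if U: "open U" for U
  proof -
    have Us: "U \<inter> P \<in> sets lebesgue" using U Pf by (intro sets.Int) auto
    define F where "F = {Q \<in> shifted_grid a. Q \<subseteq> U \<inter> P}"
    have UF: "\<Union>F = U \<inter> P" using ex_small_cell[OF U _ P] by (auto simp: F_def) blast
    have "wvol z (\<Union>F \<inter> P) \<le> 4 * (wvol u (U \<inter> P) / wvol u P) powr \<delta> * wvol z P"
    proof (rule wvol_countable_Union_le[OF z])
      show "countable F" using countable_shifted_grid[of a] by (rule countable_subset[rotated]) (auto simp: F_def)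
      show "F \<subseteq> sets lebesgue" using cf by (auto simp: F_def)
      fix G assume G: "finite G" "G \<subseteq> F"
      have GP: "\<Union>G \<subseteq> P" "\<Union>G \<subseteq> U \<inter> P" using G by (auto simp: F_def)
      have Gs: "\<Union>G \<in> sets lebesgue" using G cf by (auto simp: F_def intro!: sets.finite_Union)
      have "wvol z (\<Union>G \<inter> P) = wvol z (\<Union>G)" using GP by (simp add: Int_absorb2)
      also have "\<dots> \<le> 4 * (wvol u (\<Union>G) / wvol u P) powr \<delta> * wvol z P"
        unfolding \<delta>_def using G GP by (intro decay_finite_union P) (auto simp: F_def)
      also have "\<dots> \<le> 4 * (wvol u (U \<inter> P) / wvol u P) powr \<delta> * wvol z P"
        using zP uP \<delta> GP Gs Us Pf wvol_nonneg[OF u]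
        by (intro mult_right_mono mult_left_mono powr_mono2 divide_right_mono wvol_mono[OF u])
          (auto intro: bounded_subset)
      finally show "wvol z (\<Union>G \<inter> P) \<le> 4 * (wvol u (U \<inter> P) / wvol u P) powr \<delta> * wvol z P" .
    qed (use Pf zP in auto)
    then show ?thesis using UF by (simp add: Int_absorb2)
  qed
  have "\<exists>T. open T \<and> G \<subseteq> T \<and> T - G \<in> lmeasurable \<and> emeasure lebesgue (T - G) < ennreal ((1/2) ^ k)" for k :: nat
    using sets_lebesgue_outer_open[OF G(1), of "(1/2) ^ k"] by (metis zero_less_divide_1_iff zero_less_numeral zero_less_power)
  then obtain T where T: "\<And>k. open (T k)" "\<And>k. G \<subseteq> T k" "\<And>k::nat. T k - G \<in> lmeasurable"
     "\<And>k. emeasure lebesgue (T k - G) < ennreal ((1/2) ^ k)" by metis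
  define W where "W k = (\<Inter>j\<le>k. T j)" for k
  have Wo: "open (W k)" for k unfolding W_def using T(1) by (intro open_INT) auto
  have WPs: "W k \<inter> P \<in> sets lebesgue" for k using Wo Pf by (intro sets.Int) auto
  have GW: "G \<subseteq> W k \<inter> P" for k using T(2) G(2) by (auto simp: W_def)
  define V where "V = (\<Inter>k. W k \<inter> P)"
  have GV: "G \<subseteq> V" using GW by (auto simp: V_def)
  have Vs: "V \<in> sets lebesgue" unfolding V_def using WPs by (intro sets.countable_INT) auto
  have VP: "V \<subseteq> P" by (auto simp: V_def)
  have Vb: "bounded V" using VP Pf bounded_subset by blast
  have VG: "measure lebesgue (V - G) = 0"
  proof -
    have "measure lebesgue (V - G) \<le> (1/2) ^ k" for k
    proof -
      have "V - G \<subseteq> T k - G" by (auto simp: V_def W_def)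
      then have "measure lebesgue (V - G) \<le> measure lebesgue (T k - G)"
        using Vs G T(3) by (intro measure_mono_fmeasurable) auto
      also have "\<dots> \<le> (1/2) ^ k" using T(3,4)[of k] by (simp add: emeasure_eq_measure2 ennreal_less_iff less_imp_le)
      finally show ?thesis .
    qed
    then have "measure lebesgue (V - G) \<le> 0"
      by (intro LIMSEQ_le_const[OF LIMSEQ_power_zero[of "1/2 :: real"]]) auto
    then show ?thesis by (simp add: antisym)
  qed
  have uV: "wvol u V = wvol u G"
  proof -
    have "wvol u (V - G) = 0" using VG Vs G Vb bounded_subset[of V "V - G"] by (intro wvol_null[OF u]) auto
    then show ?thesis using wvol_diff[OF u G(1) Vs Vb GV] by simp
  qed
  let ?M = "density lebesgue (\<lambda>x. ennreal (u x))"
  have "(\<lambda>k. measure ?M (W k \<inter> P)) \<longlonglongrightarrow> measure ?M (\<Inter>k. W k \<inter> P)"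
  proof (rule Lim_measure_decseq)
    show "range (\<lambda>k. W k \<inter> P) \<subseteq> sets ?M" using WPs by auto
    show "decseq (\<lambda>k. W k \<inter> P)" by (fastforce simp: decseq_def W_def)
    fix k
    have "emeasure ?M (W k \<inter> P) \<le> emeasure ?M P" using Pf by (intro emeasure_mono) auto
    also have "\<dots> < \<infinity>" using fmeasurable_wvol[OF u Pf(1,2)] by (simp add: fmeasurable_def)
    finally show "emeasure ?M (W k \<inter> P) \<noteq> \<infinity>" by simp
  qed
  then have lim: "(\<lambda>k. wvol u (W k \<inter> P)) \<longlonglongrightarrow> wvol u G" using uV by (simp add: wvol_def V_def)
  have "(\<lambda>k. 4 * (wvol u (W k \<inter> P) / wvol u P) powr \<delta> * wvol z P) \<longlonglongrightarrow> 4 * (wvol u G / wvol u P) powr \<delta> * wvol z P"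
    using \<delta> uP wvol_nonneg[OF u] by (intro tendsto_intros tendsto_powr' lim) auto
  moreover have "wvol z G \<le> 4 * (wvol u (W k \<inter> P) / wvol u P) powr \<delta> * wvol z P" for k
  proof -
    have "wvol z G \<le> wvol z (W k \<inter> P)" using GW G WPs Pf by (intro wvol_mono[OF z]) (auto intro: bounded_subset)
    then show ?thesis using opn[OF Wo[of k]] by linarith
  qed
  ultimately show ?thesis unfolding \<delta>_def[symmetric] by (intro LIMSEQ_le_const) auto
qed

end

text \<open>The exponent \<open>r\<close> lies between \<open>1\<close> and \<open>s\<close>: it equals \<open>(1 - \<tau>) + s \<tau>\<close> for
  \<open>\<tau> = (q\<^sub>0 - q) / (q (q\<^sub>0 - 1))\<close>. Since \<open>|g| \<le> u\<close> on \<open>G\<close>, Hoelder's inequality bounds its \<open>L\<^sup>r\<close> norm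
  on \<open>Q\<close> through \<open>u(G \<inter> Q)\<close> and \<open>u^s(G \<inter> Q)\<close>. The latter is at most \<open>\<theta> u^s(Q)\<close>, for which
  the reverse Hoelder inequality is available.\<close>

lemma pavg_interpolation:
  fixes g :: "real ^ 'n \<Rightarrow> 'k::real_normed_vector"
  assumes u: "locally_finite_weight u" and z: "locally_finite_weight (\<lambda>x. u x powr s)"
    and q: "1 \<le> q" "q < q\<^sub>0" and r: "r = q\<^sub>0 / (q\<^sub>0 - 1)" and s: "s = q\<^sub>0 / (q\<^sub>0 - q)" and Rc: "1 \<le> Rc"
    and Q: "Q \<in> cubes" and RH: "wvol (\<lambda>x. u x powr s) Q * measure lebesgue Q powr (s - 1) \<le> (Rc * wvol u Q) powr s"
    and pos: "0 < wvol u Q" and G: "G \<in> sets lebesgue" and g: "\<And>x. norm (g x) \<le> indicator G x * u x"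
    and \<theta>: "0 \<le> \<theta>" "wvol (\<lambda>x. u x powr s) (G \<inter> Q) \<le> \<theta> * wvol (\<lambda>x. u x powr s) Q"
  shows "pavg r 1 g Q \<le> Rc powr (1 / q) * \<theta> powr (1 / (s * q)) * (wvol u (G \<inter> Q) / wvol u Q) powr (1 - 1 / q) * wvol u Q"
proof -
  let ?z = "\<lambda>x. u x powr s"
  note Qf = cube_facts[OF Q]
  have q0: "1 < q\<^sub>0" using q by simp
  have s1: "1 < s" using q by (simp add: s)
  have r0: "1 < r" using q0 by (simp add: r)
  define \<tau> where "\<tau> = (q\<^sub>0 - q) / (q * (q\<^sub>0 - 1))"
  have \<tau>: "0 \<le> \<tau>" "\<tau> \<le> 1"
  proof -
    show "0 \<le> \<tau>" using q by (simp add: \<tau>_def)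
    have "0 \<le> (q - 1) * q\<^sub>0" using q by simp
    then show "\<tau> \<le> 1" using q by (simp add: \<tau>_def divide_le_eq algebra_simps)
  qed
  have r\<tau>: "r = (1 - \<tau>) + s * \<tau>"
  proof -
    have "s - 1 = q / (q\<^sub>0 - q)" using q by (simp add: s field_simps)
    then have "(s - 1) * \<tau> = 1 / (q\<^sub>0 - 1)" using q q0 by (simp add: \<tau>_def)
    moreover have "r = 1 + 1 / (q\<^sub>0 - 1)" using q0 by (simp add: r field_simps)
    ultimately show ?thesis by (simp add: algebra_simps)
  qed
  have e1: "(1 - \<tau>) / r = 1 - 1 / q" using q q0 by (simp add: r \<tau>_def field_simps)
  have e2: "\<tau> / r = 1 / (s * q)" using q q0 by (simp add: r s \<tau>_def field_simps)
  have e3: "1 - 1 / r = 1 / q\<^sub>0" using q q0 by (simp add: r field_simps)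
  have e4: "(s - 1) / (s * q) = 1 / q\<^sub>0" using q q0 by (simp add: s field_simps)
  have GQ: "G \<inter> Q \<in> sets lebesgue" "bounded (G \<inter> Q)" using G Qf bounded_subset[of Q] by auto
  define m where "m = measure lebesgue Q"
  have m: "0 < m" using Qf by (simp add: m_def)
  define U where "U = wvol u (G \<inter> Q)"
  define Z where "Z = wvol ?z (G \<inter> Q)"
  have UZ: "0 \<le> U" "0 \<le> Z" by (auto simp: U_def Z_def wvol_nonneg[OF u] wvol_nonneg[OF z])
  have "(\<integral>\<^sup>+x\<in>Q. ennreal (norm (g x) powr r) \<partial>lebesgue) \<le> wmeas (\<lambda>x. u x powr r) (G \<inter> Q)"
    unfolding wmeas_def
  proof (intro nn_integral_mono)
    fix x
    have "norm (g x) powr r \<le> (indicator G x * u x) powr r" using g r0 by (intro powr_mono2) auto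
    then show "ennreal (norm (g x) powr r) * indicator Q x \<le> ennreal (u x powr r) * indicator (G \<inter> Q) x"
      by (auto simp: indicator_def intro!: ennreal_leI split: if_splits)
  qed
  also have "\<dots> \<le> ennreal (U powr (1 - \<tau>) * Z powr \<tau>)" unfolding U_def Z_def
    using r\<tau> \<tau> by (intro wmeas_holder[OF u z] GQ) (auto simp: powr_powr powr_add[symmetric])
  finally have "enn2real (\<integral>\<^sup>+x\<in>Q. ennreal (norm (g x) powr r) \<partial>lebesgue) \<le> U powr (1 - \<tau>) * Z powr \<tau>"
    by (intro enn2real_leI) auto
  then have "pavg r 1 g Q \<le> (U powr (1 - \<tau>) * Z powr \<tau>) powr (1 / r) * m powr (1 - 1 / r)"
    unfolding pavg_def m_def using r0 by (intro mult_right_mono powr_mono2) auto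
  also have "\<dots> = U powr (1 - 1 / q) * (Z powr (1 / (s * q)) * m powr (1 / q\<^sub>0))"
    using UZ by (simp add: powr_mult powr_powr e1 e2 e3)
  finally have le: "pavg r 1 g Q \<le> U powr (1 - 1 / q) * (Z powr (1 / (s * q)) * m powr (1 / q\<^sub>0))" .
  have "Z powr (1 / (s * q)) * m powr (1 / q\<^sub>0) = (Z * m powr (s - 1)) powr (1 / (s * q))"
    using UZ m by (simp add: powr_mult powr_powr e4)
  also have "\<dots> \<le> (\<theta> * (Rc * wvol u Q) powr s) powr (1 / (s * q))"
  proof (intro powr_mono2)
    have "Z * m powr (s - 1) \<le> \<theta> * wvol ?z Q * m powr (s - 1)" unfolding Z_def by (intro mult_right_mono \<theta>) auto
    also have "\<dots> \<le> \<theta> * (Rc * wvol u Q) powr s" using mult_left_mono[OF RH \<theta>(1)] by (simp add: m_def mult.assoc)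
    finally show "Z * m powr (s - 1) \<le> \<theta> * (Rc * wvol u Q) powr s" .
  qed (use UZ m s1 q in auto)
  also have "\<dots> = \<theta> powr (1 / (s * q)) * (Rc powr (1 / q) * wvol u Q powr (1 / q))"
    using \<theta>(1) Rc pos s1 by (simp add: powr_mult powr_powr)
  finally have "U powr (1 - 1 / q) * (Z powr (1 / (s * q)) * m powr (1 / q\<^sub>0))
      \<le> U powr (1 - 1 / q) * (\<theta> powr (1 / (s * q)) * (Rc powr (1 / q) * wvol u Q powr (1 / q)))"
    by (rule mult_left_mono) simp
  with le have "pavg r 1 g Q \<le> U powr (1 - 1 / q) * (\<theta> powr (1 / (s * q)) * (Rc powr (1 / q) * wvol u Q powr (1 / q)))"
    by (rule order_trans)
  also have "\<dots> = Rc powr (1 / q) * \<theta> powr (1 / (s * q)) * (U / wvol u Q) powr (1 - 1 / q) * (wvol u Q powr (1 - 1 / q) * wvol u Q powr (1 / q))"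
    using pos UZ by (simp add: powr_divide)
  also have "wvol u Q powr (1 - 1 / q) * wvol u Q powr (1 / q) = wvol u Q"
    using pos by (simp add: powr_add[symmetric])
  finally show ?thesis by (simp add: U_def)
qed

section \<open>Estimates of the sparse form\<close>

text \<open>The Carleson condition carries over the weak type bounds from disjoint families to \<open>R\<close>: for \<open>A\<close> the
  hypothesis \<open>S\<close>, for the densities of \<open>G\<close> the additivity of \<open>u\<close>. Cubes that meet \<open>G\<close> in a \<open>u\<close>-null set
  contribute nothing, so the cap on \<open>A\<close> may be restricted to the others.\<close>

lemma form_sum_carleson:
  fixes R :: "'i \<Rightarrow> (real ^ 'n) set" and A b :: "(real ^ 'n) set \<Rightarrow> real"
  assumes u: "locally_finite_weight u" and pos: "\<And>Q. Q \<in> cubes \<Longrightarrow> 0 < wvol u Q"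
    and I: "finite I" "R ` I \<subseteq> cubes" "laminar (R ` I)"
    and carl: "\<And>Q. Q \<in> R ` I \<Longrightarrow> (\<Sum>i\<in>{i\<in>I. R i \<subseteq> Q}. wvol u (R i)) \<le> \<Theta> * wvol u Q"
    and G: "G \<in> sets lebesgue" "bounded G"
    and A0: "\<And>Q. 0 \<le> A Q"
    and S: "\<And>F. finite F \<Longrightarrow> F \<subseteq> cubes \<Longrightarrow> disjoint F \<Longrightarrow> (\<Sum>Q\<in>F. A Q powr q * wvol u Q) \<le> L powr q"
    and b: "\<And>i. i \<in> I \<Longrightarrow> b (R i) \<le> K * (wvol u (G \<inter> R i) / wvol u (R i)) powr (1 - 1 / q + \<epsilon>) * wvol u (R i)"
    and ac: "\<And>i. i \<in> I \<Longrightarrow> 0 < wvol u (G \<inter> R i) \<Longrightarrow> A (R i) \<le> c * L * wvol u G powr (- 1 / q)"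
    and cs: "0 \<le> \<Theta>" "0 < L" "1 \<le> q" "0 < \<epsilon>" "0 < c" "0 \<le> K"
  shows "(\<Sum>i\<in>I. A (R i) * b (R i)) \<le> K * (\<Theta> * L * wvol u G powr (1 - 1 / q) * ((1 + 1 / \<epsilon>) * (1 + c powr (q * \<epsilon>))))"
proof -
  define J where "J = {i\<in>I. 0 < wvol u (G \<inter> R i)}"
  define \<rho> where "\<rho> i = wvol u (G \<inter> R i) / wvol u (R i)" for i
  have JI: "J \<subseteq> I" by (auto simp: J_def)
  have finJ: "finite J" using JI I(1) finite_subset by blast
  have Rf: "R i \<in> sets lebesgue" "bounded (R i)" "0 < wvol u (R i)" if "i \<in> I" for i
    using I(2) that cube_facts(1,2) pos by blast+
  have GR: "G \<inter> R i \<in> sets lebesgue" if "i \<in> I" for i using G Rf[OF that] by blast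
  have "(\<Sum>i\<in>I. A (R i) * b (R i)) \<le> (\<Sum>i\<in>J. A (R i) * b (R i))"
  proof -
    have "A (R i) * b (R i) \<le> 0" if "i \<in> I - J" for i
    proof -
      have "wvol u (G \<inter> R i) = 0" using that wvol_nonneg[OF u, of "G \<inter> R i"] by (auto simp: J_def)
      then have "b (R i) \<le> 0" using b[of i] that by simp
      then show ?thesis using A0 by (simp add: mult_nonneg_nonpos)
    qed
    then have "(\<Sum>i\<in>I - J. A (R i) * b (R i)) \<le> 0" by (rule sum_nonpos)
    then show ?thesis using sum.subset_diff[OF JI I(1), of "\<lambda>i. A (R i) * b (R i)"] by simp
  qed
  also have "\<dots> \<le> (\<Sum>i\<in>J. K * (A (R i) * \<rho> i powr (1 - 1 / q + \<epsilon>) * wvol u (R i)))"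
  proof (intro sum_mono)
    fix i assume "i \<in> J"
    then have "A (R i) * b (R i) \<le> A (R i) * (K * \<rho> i powr (1 - 1 / q + \<epsilon>) * wvol u (R i))"
      using b[of i] JI A0 by (intro mult_left_mono) (auto simp: \<rho>_def)
    then show "A (R i) * b (R i) \<le> K * (A (R i) * \<rho> i powr (1 - 1 / q + \<epsilon>) * wvol u (R i))" by (simp add: ac_simps)
  qed
  also have "\<dots> = K * (\<Sum>i\<in>J. A (R i) * \<rho> i powr (1 - 1 / q + \<epsilon>) * wvol u (R i))" by (simp add: sum_distrib_left)
  also have "\<dots> \<le> K * (\<Theta> * L * wvol u G powr (1 - 1 / q) * ((1 + 1 / \<epsilon>) * (1 + c powr (q * \<epsilon>))))"
  proof (cases "wvol u G = 0")
    case True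
    have "J = {}"
    proof -
      have "wvol u (G \<inter> R i) \<le> wvol u G" if "i \<in> I" for i using G GR[OF that] by (intro wvol_mono[OF u]) auto
      then show ?thesis using True by (fastforce simp: J_def)
    qed
    then show ?thesis using True cs by simp
  next
    case False
    then have g: "0 < wvol u G" using wvol_nonneg[OF u, of G] by simp
    show ?thesis
    proof (intro mult_left_mono cs(6) sum_product_le_of_weak_types finJ A0 cs(1-5) g)
      fix i assume i: "i \<in> J"
      then have iI: "i \<in> I" using JI by blast
      show "0 \<le> \<rho> i" by (simp add: \<rho>_def wvol_nonneg[OF u])
      show "\<rho> i \<le> 1" using Rf[OF iI] GR[OF iI] by (auto simp: \<rho>_def intro!: wvol_mono[OF u])
      show "0 \<le> wvol u (R i)" by (rule wvol_nonneg[OF u])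
      show "A (R i) \<le> c * L * wvol u G powr (- 1 / q)" using ac[OF iI] i by (simp add: J_def)
    next
      fix t :: real assume t: "0 < t"
      define J' where "J' = {i \<in> J. t \<le> A (R i)}"
      obtain M where M: "M \<subseteq> R ` J'" "disjoint M" "(\<Sum>i\<in>J'. wvol u (R i)) \<le> \<Theta> * (\<Sum>Q\<in>M. wvol u Q)"
        by (rule carleson_sum_le_maximal[OF I(1,3), of "wvol u" \<Theta> J'])
          (use carl JI wvol_nonneg[OF u] in \<open>auto simp: J'_def\<close>)
      have finM: "finite M" using M(1) by (rule finite_subset) (use finJ in \<open>simp add: J'_def\<close>)
      have "t powr q * (\<Sum>Q\<in>M. wvol u Q) \<le> (\<Sum>Q\<in>M. A Q powr q * wvol u Q)"
        unfolding sum_distrib_left using M(1) t cs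
        by (intro sum_mono mult_right_mono powr_mono2 wvol_nonneg[OF u]) (auto simp: J'_def)
      also have "\<dots> \<le> L powr q" using finM M I(2) JI by (intro S) (auto simp: J'_def)
      finally have "(\<Sum>Q\<in>M. wvol u Q) \<le> (L / t) powr q"
        using t cs by (simp add: powr_divide field_simps)
      then show "(\<Sum>i\<in>{i \<in> J. t \<le> A (R i)}. wvol u (R i)) \<le> \<Theta> * (L / t) powr q"
        using M(3) cs(1) by (fold J'_def) (meson mult_left_mono order_trans)
    next
      fix t :: real assume t: "0 < t"
      define J' where "J' = {i \<in> J. t \<le> \<rho> i}"
      obtain M where M: "M \<subseteq> R ` J'" "disjoint M" "(\<Sum>i\<in>J'. wvol u (R i)) \<le> \<Theta> * (\<Sum>Q\<in>M. wvol u Q)"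
        by (rule carleson_sum_le_maximal[OF I(1,3), of "wvol u" \<Theta> J'])
          (use carl JI wvol_nonneg[OF u] in \<open>auto simp: J'_def\<close>)
      have finM: "finite M" using M(1) by (rule finite_subset) (use finJ in \<open>simp add: J'_def\<close>)
      have "t * (\<Sum>Q\<in>M. wvol u Q) \<le> (\<Sum>Q\<in>M. wvol u (G \<inter> Q))"
        unfolding sum_distrib_left
      proof (intro sum_mono)
        fix Q assume "Q \<in> M"
        then obtain i where "i \<in> J'" "Q = R i" using M(1) by blast
        then show "t * wvol u Q \<le> wvol u (G \<inter> Q)" using Rf[of i] JI by (auto simp: J'_def \<rho>_def field_simps)
      qed
      also have "\<dots> \<le> wvol u G"
      proof (intro wvol_sum_disjoint_le[OF u finM _ _ G])
        show "disjoint_family_on ((\<inter>) G) M" using M(2) by (auto simp: disjoint_family_on_def disjoint_def)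
        fix Q assume "Q \<in> M"
        then obtain i where "i \<in> J'" "Q = R i" using M(1) by blast
        then show "G \<inter> Q \<in> sets lebesgue" using GR JI by (auto simp: J'_def)
      qed auto
      finally have "(\<Sum>Q\<in>M. wvol u Q) \<le> wvol u G / t" using t by (simp add: field_simps)
      then show "(\<Sum>i\<in>{i \<in> J. t \<le> \<rho> i}. wvol u (R i)) \<le> \<Theta> * (wvol u G / t)"
        using M(3) cs(1) by (fold J'_def) (meson mult_left_mono order_trans)
    qed
  qed
  finally show ?thesis .
qed

text \<open>For disjoint cubes Hoelder's inequality for sums replaces both the gain \<open>\<epsilon>\<close> and the cap on \<open>A\<close>.\<close>

lemma form_sum_disjoint:
  fixes A b :: "(real ^ 'n) set \<Rightarrow> real"
  assumes u: "locally_finite_weight u" and pos: "\<And>Q. Q \<in> cubes \<Longrightarrow> 0 < wvol u Q"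
    and F: "finite F" "F \<subseteq> cubes" "disjoint F"
    and G: "G \<in> sets lebesgue" "bounded G" and A0: "\<And>Q. 0 \<le> A Q"
    and S: "(\<Sum>Q\<in>F. A Q powr q * wvol u Q) \<le> L powr q"
    and b: "\<And>Q. Q \<in> F \<Longrightarrow> b Q \<le> K * (wvol u (G \<inter> Q) / wvol u Q) powr (1 - 1 / q) * wvol u Q"
    and cs: "0 < L" "1 \<le> q" "0 \<le> K"
  shows "(\<Sum>Q\<in>F. A Q * b Q) \<le> K * (L * wvol u G powr (1 - 1 / q))"
proof -
  have Ff: "Q \<in> sets lebesgue" "bounded Q" "0 < wvol u Q" if "Q \<in> F" for Q
    using F(2) that cube_facts(1,2) pos by blast+
  have gs: "(\<Sum>Q\<in>F. wvol u (G \<inter> Q)) \<le> wvol u G"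
    using F G Ff by (intro wvol_sum_disjoint_le[OF u]) (auto simp: disjoint_family_on_def disjoint_def)
  have g0: "0 \<le> wvol u E" for E by (rule wvol_nonneg[OF u])
  have H: "(\<Sum>Q\<in>F. wvol u (G \<inter> Q) powr (1 - 1 / q) * (A Q powr q * wvol u Q) powr (1 / q))
      \<le> wvol u G powr (1 - 1 / q) * (L powr q) powr (1 / q)"
  proof -
    have "(\<integral>\<^sup>+Q. ennreal (wvol u (G \<inter> Q) powr (1 - 1 / q) * (A Q powr q * wvol u Q) powr (1 / q)) \<partial>count_space F)
       \<le> ennreal (wvol u G powr (1 - 1 / q) * (L powr q) powr (1 / q))"
      using F(1) gs S cs g0
      by (intro nn_integral_holder) (auto simp: nn_integral_count_space_finite sum_ennreal intro!: ennreal_leI)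
    then show ?thesis using F(1) g0
      by (subst (asm) nn_integral_count_space_finite) (auto simp: sum_ennreal sum_nonneg)
  qed
  have "(\<Sum>Q\<in>F. A Q * b Q) \<le> (\<Sum>Q\<in>F. K * (wvol u (G \<inter> Q) powr (1 - 1 / q) * (A Q powr q * wvol u Q) powr (1 / q)))"
  proof (intro sum_mono)
    fix Q assume Q: "Q \<in> F"
    have "A Q * b Q \<le> A Q * (K * (wvol u (G \<inter> Q) / wvol u Q) powr (1 - 1 / q) * wvol u Q)"
      by (intro mult_left_mono b Q A0)
    also have "(wvol u (G \<inter> Q) / wvol u Q) powr (1 - 1 / q) = wvol u (G \<inter> Q) powr (1 - 1 / q) / wvol u Q powr (1 - 1 / q)"
      using g0 by (simp add: powr_divide)
    also have "wvol u Q = wvol u Q powr (1 - 1 / q) * wvol u Q powr (1 / q)"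
      using Ff[OF Q] by (simp add: powr_add[symmetric])
    also have "A Q * (K * (wvol u (G \<inter> Q) powr (1 - 1 / q) / (wvol u Q powr (1 - 1 / q) * wvol u Q powr (1 / q)) powr (1 - 1 / q)) * (wvol u Q powr (1 - 1 / q) * wvol u Q powr (1 / q)))
       = K * (wvol u (G \<inter> Q) powr (1 - 1 / q) * (A Q * wvol u Q powr (1 / q)))"
      using Ff[OF Q] by (simp add: powr_add[symmetric]) (simp add: powr_add powr_diff field_simps)
    also have "A Q * wvol u Q powr (1 / q) = (A Q powr q * wvol u Q) powr (1 / q)"
      using A0[of Q] g0 cs by (simp add: powr_mult powr_powr)
    finally show "A Q * b Q \<le> K * (wvol u (G \<inter> Q) powr (1 - 1 / q) * (A Q powr q * wvol u Q) powr (1 / q))" .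
  qed
  also have "\<dots> = K * (\<Sum>Q\<in>F. wvol u (G \<inter> Q) powr (1 - 1 / q) * (A Q powr q * wvol u Q) powr (1 / q))" by (simp add: sum_distrib_left)
  also have "\<dots> \<le> K * (wvol u G powr (1 - 1 / q) * (L powr q) powr (1 / q))" using cs by (intro mult_left_mono H) auto
  also have "(L powr q) powr (1 / q) = L" using cs by (simp add: powr_powr)
  finally show ?thesis by (simp add: mult.commute)
qed

lemma pavg_nonneg: "0 \<le> pavg s \<beta> f Q"
  by (simp add: pavg_def)

text \<open>The volume enters with an exponent of either sign; a negative one is at least \<open>- 1\<close>, so the ratio \<open>6^n\<close> of the
  volumes suffices as a constant in both cases.\<close>

lemma pavg_enlarge:
  fixes Q R :: "(real ^ 'n) set"
  assumes QR: "Q \<in> cubes" "R \<in> cubes" "Q \<subseteq> R" "measure lebesgue R \<le> 6 ^ CARD('n) * measure lebesgue Q"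
    and fin: "(\<integral>\<^sup>+x\<in>R. ennreal (norm (f x) powr s) \<partial>lebesgue) < \<infinity>"
    and e: "0 \<le> \<beta>" "\<beta> \<le> 1" "1 \<le> s"
  shows "pavg s \<beta> f Q \<le> 6 ^ CARD('n) * pavg s \<beta> f R"
proof -
  define k :: real where "k = 6 ^ CARD('n)"
  have k: "1 \<le> k" by (simp add: k_def)
  note Qf = cube_facts[OF QR(1)] and Rf = cube_facts[OF QR(2)]
  define m where "m = measure lebesgue Q"
  define M where "M = measure lebesgue R"
  have m: "0 < m" "0 < M" "M \<le> k * m" using Qf Rf QR by (auto simp: m_def M_def k_def)
  have mM: "m \<le> M" unfolding m_def M_def using QR Qf Rf bounded_set_imp_lmeasurable
    by (intro measure_mono_fmeasurable) auto
  have "m powr (\<beta> - 1 / s) \<le> k * M powr (\<beta> - 1 / s)"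
  proof (cases "0 \<le> \<beta> - 1 / s")
    case True
    have "m powr (\<beta> - 1 / s) \<le> M powr (\<beta> - 1 / s)" using True m mM by (intro powr_mono2) auto
    also have "\<dots> \<le> k * M powr (\<beta> - 1 / s)" using k mult_right_mono[of 1 k "M powr (\<beta> - 1 / s)"] by simp
    finally show ?thesis .
  next
    case False
    have "m powr (\<beta> - 1 / s) \<le> (M / k) powr (\<beta> - 1 / s)"
      using False m k by (intro powr_mono2') (auto simp: field_simps)
    also have "\<dots> = k powr (1 / s - \<beta>) * M powr (\<beta> - 1 / s)"
      using m k by (simp add: powr_divide powr_diff field_simps)
    also have "\<dots> \<le> k powr 1 * M powr (\<beta> - 1 / s)"
    proof (intro mult_right_mono powr_mono)
      have "1 / s \<le> 1" using e by simp
      then show "1 / s - \<beta> \<le> 1" using e by linarith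
    qed (use k in auto)
    finally show ?thesis using k by simp
  qed
  moreover have "enn2real (\<integral>\<^sup>+x\<in>Q. ennreal (norm (f x) powr s) \<partial>lebesgue) \<le> enn2real (\<integral>\<^sup>+x\<in>R. ennreal (norm (f x) powr s) \<partial>lebesgue)"
    using fin QR(3) by (intro enn2real_mono nn_integral_mono) (auto simp: indicator_def)
  ultimately show ?thesis unfolding pavg_def k_def[symmetric] m_def[symmetric] M_def[symmetric]
    using e mult_mono[of "enn2real (\<integral>\<^sup>+x\<in>Q. ennreal (norm (f x) powr s) \<partial>lebesgue) powr (1 / s)" "enn2real (\<integral>\<^sup>+x\<in>R. ennreal (norm (f x) powr s) \<partial>lebesgue) powr (1 / s)"
      "m powr (\<beta> - 1 / s)" "k * M powr (\<beta> - 1 / s)"]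
    by (simp add: powr_mono2 ac_simps)
qed

definition shifts :: "('n \<Rightarrow> nat) set" where
  "shifts = {a. \<forall>i. a i \<in> {0, 1, 2}}"

lemma finite_shifts: "finite (shifts :: ('n::finite \<Rightarrow> nat) set)" and card_shifts: "0 < card (shifts :: ('n::finite \<Rightarrow> nat) set)"
proof -
  have "finite (Pi\<^sub>E (UNIV :: 'n set) (\<lambda>_. {0, 1, 2 :: nat}))" by (rule finite_PiE) auto
  then show f: "finite (shifts :: ('n::finite \<Rightarrow> nat) set)"
    by (rule finite_subset[rotated]) (auto simp: shifts_def PiE_def Pi_def)
  have "(\<lambda>_. 0) \<in> (shifts :: ('n::finite \<Rightarrow> nat) set)" by (simp add: shifts_def)
  then show "0 < card (shifts :: ('n::finite \<Rightarrow> nat) set)" using f card_gt_0_iff by blast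
qed

lemma shifted_dyadic_cubes_eq: "shifted_dyadic_cubes = (\<Union>a\<in>shifts. shifted_grid a)"
  by (simp add: shifted_dyadic_cubes_def shifts_def)

lemma sparse_facts:
  assumes "sparse \<eta> S" "0 < \<eta>"
  obtains D E where "laminar D" "D \<subseteq> cubes" "S \<subseteq> D" "disjoint_family_on E S"
    "\<forall>Q\<in>S. E Q \<in> sets lebesgue \<and> E Q \<subseteq> Q \<and> \<eta> * measure lebesgue Q \<le> measure lebesgue (E Q)"
proof -
  obtain D E where D: "dyadic_grid D" "S \<subseteq> D" and E: "disjoint_family_on E S"
     "\<And>Q. Q \<in> S \<Longrightarrow> E Q \<in> sets lebesgue \<and> E Q \<subseteq> Q \<and> emeasure lebesgue (E Q) \<ge> ennreal \<eta> * emeasure lebesgue Q"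
    using assms(1) unfolding sparse_def by metis
  note Df = dyadic_grid_facts[OF D(1)]
  have "\<eta> * measure lebesgue Q \<le> measure lebesgue (E Q)" if "Q \<in> S" for Q
  proof -
    have Qc: "Q \<in> cubes" using that D Df by blast
    have EQ: "E Q \<in> sets lebesgue" "E Q \<subseteq> Q" "ennreal \<eta> * emeasure lebesgue Q \<le> emeasure lebesgue (E Q)"
      using E(2)[OF that] by auto
    have "E Q \<in> lmeasurable" using EQ cube_facts[OF Qc] bounded_subset by (intro bounded_set_imp_lmeasurable) auto
    then have "ennreal (\<eta> * measure lebesgue Q) \<le> ennreal (measure lebesgue (E Q))"
      using EQ(3) cube_facts(4)[OF Qc] assms(2) by (simp add: ennreal_mult emeasure_eq_measure2)
    then show ?thesis by simp
  qed
  then show ?thesis using that[OF Df D(2) E(1)] E(2) by blast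
qed

text \<open>If \<open>Q\<close> were properly contained in \<open>R\<close>, the cube \<open>R\<close> would contain disjoint sets of volumes \<open>|Q|\<close> and \<open>|R|\<close>.\<close>

lemma sparse_one_disjoint:
  fixes S :: "(real ^ 'n) set set"
  assumes "sparse 1 S" shows "disjoint S"
proof -
  obtain D E where D: "laminar D" "D \<subseteq> cubes" "S \<subseteq> D" and E0: "disjoint_family_on E S"
    "\<forall>Q\<in>S. E Q \<in> sets lebesgue \<and> E Q \<subseteq> Q \<and> 1 * measure lebesgue Q \<le> measure lebesgue (E Q)"
    by (rule sparse_facts[OF assms zero_less_one])
  then have E: "disjoint_family_on E S"
    "\<And>Q. Q \<in> S \<Longrightarrow> E Q \<in> sets lebesgue" "\<And>Q. Q \<in> S \<Longrightarrow> E Q \<subseteq> Q"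
    "\<And>Q. Q \<in> S \<Longrightarrow> 1 * measure lebesgue Q \<le> measure lebesgue (E Q)" by auto
  have no: False if "Q \<in> S" "R \<in> S" "Q \<noteq> R" "Q \<subseteq> R" for Q R
  proof -
    have Rf: "R \<in> sets lebesgue" "bounded R" "0 < measure lebesgue Q" using that D cube_facts by blast+
    have sub: "E Q \<subseteq> R" "E R \<subseteq> R" using E(3)[OF that(1)] E(3)[OF that(2)] that(4) by auto
    have "(\<Sum>X\<in>{Q, R}. wvol (\<lambda>_. 1) (E X)) \<le> wvol (\<lambda>_. 1) R"
      using that E(1,2) Rf sub
      by (intro wvol_sum_disjoint_le[OF locally_finite_weight_one]) (auto simp: disjoint_family_on_def)
    then have "measure lebesgue (E Q) + measure lebesgue (E R) \<le> measure lebesgue R" using that by (simp add: wvol_one)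
    then show False using E(4)[OF that(1)] E(4)[OF that(2)] Rf by simp
  qed
  show ?thesis
  proof (rule disjointI)
    fix Q R assume QR: "Q \<in> S" "R \<in> S" "Q \<noteq> R"
    then have "Q \<inter> R \<in> {{}, Q, R}" using D unfolding laminar_def by blast
    moreover have "Q \<inter> R \<noteq> Q" "Q \<inter> R \<noteq> R" using no[OF QR] no[OF QR(2,1)] QR by auto
    ultimately show "Q \<inter> R = {}" by blast
  qed
qed

text \<open>Enlarging each cube to a shifted one keeps the disjoint sets and costs the factor \<open>6^n\<close> in their
  proportion. Sorted by their grid, the enlarged cubes form finitely many laminar families.\<close>

lemma sparse_form_bound:
  fixes f :: "real ^ 'n \<Rightarrow> 'k::real_normed_vector" and g :: "real ^ 'n \<Rightarrow> 'l::real_normed_vector"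
  assumes u: "locally_finite_weight u" and pos: "\<And>Q. Q \<in> cubes \<Longrightarrow> 0 < wvol u Q"
    and sp: "sparse \<eta> S" and \<eta>: "0 < \<eta>" "\<eta> < 1"
    and D: "\<And>Q E. Q \<in> shifted_dyadic_cubes \<Longrightarrow> E \<in> sets lebesgue \<Longrightarrow> E \<subseteq> Q \<Longrightarrow> \<eta> * measure lebesgue Q \<le> measure lebesgue E \<Longrightarrow> wvol u Q \<le> B * wvol u E"
    and B: "0 \<le> B"
    and G: "G \<in> sets lebesgue" "bounded G"
    and weak: "\<And>F. finite F \<Longrightarrow> F \<subseteq> cubes \<Longrightarrow> disjoint F \<Longrightarrow> (\<Sum>Q\<in>F. pavg p\<^sub>0 \<beta> f Q powr q * wvol u Q) \<le> L powr q"
    and b: "\<And>Q. Q \<in> shifted_dyadic_cubes \<Longrightarrow> pavg r 1 g Q \<le> K * (wvol u (G \<inter> Q) / wvol u Q) powr (1 - 1 / q + \<epsilon>) * wvol u Q"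
    and ac: "\<And>Q. Q \<in> shifted_dyadic_cubes \<Longrightarrow> 0 < wvol u (G \<inter> Q) \<Longrightarrow> pavg p\<^sub>0 \<beta> f Q \<le> c * L * wvol u G powr (- 1 / q)"
    and fin: "\<And>Q. Q \<in> cubes \<Longrightarrow> (\<integral>\<^sup>+x\<in>Q. ennreal (norm (f x) powr p\<^sub>0) \<partial>lebesgue) < \<infinity>"
      "\<And>Q. Q \<in> cubes \<Longrightarrow> (\<integral>\<^sup>+x\<in>Q. ennreal (norm (g x) powr r) \<partial>lebesgue) < \<infinity>"
    and cs: "0 < L" "1 \<le> q" "0 < \<epsilon>" "0 < c" "0 \<le> K" "1 \<le> p\<^sub>0" "1 \<le> r" "0 \<le> \<beta>" "\<beta> \<le> 1"
    and S0: "finite S0" "S0 \<subseteq> S"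
  shows "(\<Sum>Q\<in>S0. pavg p\<^sub>0 \<beta> f Q * pavg r 1 g Q)
    \<le> 36 ^ CARD('n) * real (card (shifts :: ('n \<Rightarrow> nat) set)) * (6 ^ CARD('n) / ((1 - \<eta>) * \<eta>))
       * (K * (B * L * wvol u G powr (1 - 1 / q) * ((1 + 1 / \<epsilon>) * (1 + c powr (q * \<epsilon>)))))"
proof -
  obtain DD E where DD: "laminar DD" "DD \<subseteq> cubes" "S \<subseteq> DD" and E0: "disjoint_family_on E S"
    "\<forall>Q\<in>S. E Q \<in> sets lebesgue \<and> E Q \<subseteq> Q \<and> \<eta> * measure lebesgue Q \<le> measure lebesgue (E Q)"
    by (rule sparse_facts[OF sp \<eta>(1)])
  then have E: "disjoint_family_on E S"
    "\<And>Q. Q \<in> S \<Longrightarrow> E Q \<in> sets lebesgue" "\<And>Q. Q \<in> S \<Longrightarrow> E Q \<subseteq> Q"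
    "\<And>Q. Q \<in> S \<Longrightarrow> \<eta> * measure lebesgue Q \<le> measure lebesgue (E Q)" by auto
  have Sc: "Q \<in> cubes" if "Q \<in> S" for Q using that DD by blast
  have "\<exists>a R. a \<in> shifts \<and> R \<in> shifted_grid a \<and> Q \<subseteq> R \<and> measure lebesgue R \<le> 6 ^ CARD('n) * measure lebesgue Q" if "Q \<in> S" for Q
    using one_third_trick[OF Sc[OF that]] unfolding shifts_def by (smt (verit, best) mem_Collect_eq)
  then obtain a R where aR: "\<And>Q. Q \<in> S \<Longrightarrow> a Q \<in> shifts \<and> R Q \<in> shifted_grid (a Q) \<and> Q \<subseteq> R Q \<and> measure lebesgue (R Q) \<le> 6 ^ CARD('n) * measure lebesgue Q"
    by metis
  define N where "N = card (shifts :: ('n \<Rightarrow> nat) set)"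
  define \<Theta> where "\<Theta> = B / ((1 - \<eta>) * (\<eta> / 6 ^ CARD('n)))"
  define X where "X = K * (\<Theta> * L * wvol u G powr (1 - 1 / q) * ((1 + 1 / \<epsilon>) * (1 + c powr (q * \<epsilon>))))"
  have \<Theta>0: "0 \<le> \<Theta>" using B \<eta> by (simp add: \<Theta>_def)
  have part: "(\<Sum>Q\<in>{Q\<in>S0. a Q = s}. pavg p\<^sub>0 \<beta> f (R Q) * pavg r 1 g (R Q)) \<le> X" if s: "s \<in> shifts" for s
    unfolding X_def
  proof (rule form_sum_carleson[where b = "pavg r 1 g", OF u pos])
    let ?I = "{Q\<in>S0. a Q = s}"
    have RI: "R ` ?I \<subseteq> shifted_grid s" using aR S0 by auto
    show "finite ?I" using S0 by simp
    show "R ` ?I \<subseteq> cubes" using RI shifted_grid_cubes by blast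
    show "laminar (R ` ?I)" by (rule laminar_subset[OF laminar_shifted_grid RI])
    have sd: "Q \<in> shifted_dyadic_cubes" if "Q \<in> shifted_grid s" for Q using that s by (auto simp: shifted_dyadic_cubes_eq)
    show "pavg r 1 g (R Q) \<le> K * (wvol u (G \<inter> R Q) / wvol u (R Q)) powr (1 - 1 / q + \<epsilon>) * wvol u (R Q)" if "Q \<in> ?I" for Q
      using that RI by (intro b sd) auto
    show "pavg p\<^sub>0 \<beta> f (R Q) \<le> c * L * wvol u G powr (- 1 / q)" if "Q \<in> ?I" "0 < wvol u (G \<inter> R Q)" for Q
      using that RI by (intro ac sd) auto
    fix Q assume Q: "Q \<in> R ` ?I"
    show "(\<Sum>i\<in>{i\<in>?I. R i \<subseteq> Q}. wvol u (R i)) \<le> \<Theta> * wvol u Q"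
      unfolding \<Theta>_def
    proof (rule carleson_of_sparse[OF u pos, where G = "shifted_grid s" and E = E])
      show "shifted_grid s \<subseteq> cubes" using shifted_grid_cubes by blast
      show "disjoint_family_on E ?I" using E(1) S0 by (auto simp: disjoint_family_on_def)
      show "E i \<subseteq> R i" if "i \<in> ?I" for i using E(3)[of i] aR[of i] that S0 by blast
      show "\<eta> / 6 ^ CARD('n) * measure lebesgue (R i) \<le> measure lebesgue (E i)" if "i \<in> ?I" for i
      proof -
        have i: "i \<in> S" using that S0 by auto
        have "\<eta> / 6 ^ CARD('n) * measure lebesgue (R i) \<le> \<eta> / 6 ^ CARD('n) * (6 ^ CARD('n) * measure lebesgue i)"
          using aR[OF i] \<eta> by (intro mult_left_mono) auto
        also have "\<dots> = \<eta> * measure lebesgue i" by simp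
        also have "\<dots> \<le> measure lebesgue (E i)" by (rule E(4)[OF i])
        finally show ?thesis .
      qed
      show "wvol u Q \<le> B * wvol u S" if "Q \<in> shifted_grid s" "S \<in> sets lebesgue" "S \<subseteq> Q" "\<eta> * measure lebesgue Q \<le> measure lebesgue S" for Q S
        using that by (intro D sd) auto
    qed (use RI Q S0 E \<eta> laminar_shifted_grid in auto)
  qed (use G \<Theta>0 cs weak pavg_nonneg in auto)
  have "(\<Sum>Q\<in>S0. pavg p\<^sub>0 \<beta> f Q * pavg r 1 g Q) \<le> (\<Sum>Q\<in>S0. 36 ^ CARD('n) * (pavg p\<^sub>0 \<beta> f (R Q) * pavg r 1 g (R Q)))"
  proof (intro sum_mono)
    fix Q assume "Q \<in> S0"
    then have Q: "Q \<in> S" using S0 by blast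
    have Rc: "R Q \<in> cubes" using aR[OF Q] shifted_grid_cubes by blast
    have "pavg p\<^sub>0 \<beta> f Q * pavg r 1 g Q \<le> (6 ^ CARD('n) * pavg p\<^sub>0 \<beta> f (R Q)) * (6 ^ CARD('n) * pavg r 1 g (R Q))"
      using aR[OF Q] cs Sc[OF Q] Rc
      by (intro mult_mono pavg_enlarge fin) (auto simp: pavg_nonneg)
    also have "\<dots> = (6 * 6) ^ CARD('n) * (pavg p\<^sub>0 \<beta> f (R Q) * pavg r 1 g (R Q))"
      unfolding power_mult_distrib by (simp only: ac_simps)
    finally show "pavg p\<^sub>0 \<beta> f Q * pavg r 1 g Q \<le> 36 ^ CARD('n) * (pavg p\<^sub>0 \<beta> f (R Q) * pavg r 1 g (R Q))" by simp
  qed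
  also have "\<dots> = 36 ^ CARD('n) * (\<Sum>Q\<in>S0. pavg p\<^sub>0 \<beta> f (R Q) * pavg r 1 g (R Q))" by (simp add: sum_distrib_left)
  also have "(\<Sum>Q\<in>S0. pavg p\<^sub>0 \<beta> f (R Q) * pavg r 1 g (R Q)) = (\<Sum>s\<in>shifts. \<Sum>Q\<in>{Q\<in>S0. a Q = s}. pavg p\<^sub>0 \<beta> f (R Q) * pavg r 1 g (R Q))"
    using S0 aR finite_shifts by (intro sum.group[symmetric]) auto
  also have "36 ^ CARD('n) * \<dots> \<le> 36 ^ CARD('n) * (\<Sum>s\<in>(shifts :: ('n \<Rightarrow> nat) set). X)" by (intro mult_left_mono sum_mono part) auto
  also have "\<dots> = 36 ^ CARD('n) * real N * (6 ^ CARD('n) / ((1 - \<eta>) * \<eta>))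
       * (K * (B * L * wvol u G powr (1 - 1 / q) * ((1 + 1 / \<epsilon>) * (1 + c powr (q * \<epsilon>)))))"
    by (simp add: X_def \<Theta>_def N_def)
  finally show ?thesis by (simp add: N_def)
qed

text \<open>In each of the grids the maximal cubes with large average are disjoint.\<close>

lemma exceptional_set:
  fixes A :: "(real ^ 'n) set \<Rightarrow> real"
  assumes u: "locally_finite_weight u" and G: "G \<in> sets lebesgue" "bounded G"
    and weak: "\<And>F. finite F \<Longrightarrow> F \<subseteq> cubes \<Longrightarrow> disjoint F \<Longrightarrow> (\<Sum>Q\<in>F. A Q powr q * wvol u Q) \<le> L powr q"
    and cs: "0 < L" "1 \<le> q" "0 < l"
  defines "\<Omega> \<equiv> \<Union>{Q \<in> shifted_dyadic_cubes. l < A Q}"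
  shows "\<Omega> \<in> sets lebesgue" "wvol u (G \<inter> \<Omega>) \<le> real (card (shifts :: ('n \<Rightarrow> nat) set)) * (L / l) powr q"
proof -
  define F where "F a = {Q \<in> shifted_grid a. l < A Q}" for a :: "'n \<Rightarrow> nat"
  have cf: "Q \<in> sets lebesgue" "bounded Q" "Q \<in> cubes" if "Q \<in> F a" for Q a
    using cube_facts(1,2) shifted_grid_cubes that unfolding F_def by blast+
  have Fc: "countable (F a)" for a
    using countable_shifted_grid[of a] by (rule countable_subset[rotated]) (auto simp: F_def)
  have \<Omega>: "\<Omega> = (\<Union>a\<in>shifts. \<Union>(F a))" by (auto simp: \<Omega>_def F_def shifted_dyadic_cubes_eq)
  have UFs: "\<Union>(F a) \<in> sets lebesgue" for a using Fc cf by (intro sets.countable_Union) auto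
  show "\<Omega> \<in> sets lebesgue" unfolding \<Omega> using finite_shifts UFs by (intro sets.finite_UN) auto
  have one: "wvol u (\<Union>(F a) \<inter> G) \<le> (L / l) powr q" for a
  proof (rule wvol_countable_Union_le[OF u Fc _ G])
    show "F a \<subseteq> sets lebesgue" using cf by blast
    fix H assume H: "finite H" "H \<subseteq> F a"
    obtain M where M: "M \<subseteq> H" "disjoint M" "\<And>Q. Q \<in> H \<Longrightarrow> \<exists>R\<in>M. Q \<subseteq> R"
      using laminar_maximal[OF H(1) laminar_subset[OF laminar_shifted_grid[of a]]] H(2) by (metis (no_types, lifting) F_def mem_Collect_eq subset_iff)
    have finM: "finite M" using M(1) H(1) finite_subset by blast
    have Ms: "Q \<in> sets lebesgue" "bounded Q" "Q \<in> cubes" "l < A Q" if "Q \<in> M" for Q using cf[of Q a] that M H by (auto simp: F_def)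
    have "\<Union>H \<subseteq> \<Union>M" using M(3) by blast
    moreover have "\<Union>H \<in> sets lebesgue" using H cf by (intro sets.finite_Union) blast+
    ultimately have "wvol u (\<Union>H \<inter> G) \<le> wvol u (\<Union>M)" using G Ms finM
      by (intro wvol_mono[OF u] sets.finite_Union bounded_Union) auto
    also have "\<dots> = (\<Sum>Q\<in>M. wvol u Q)"
      using wvol_UN_disjoint[OF u finM, of "\<lambda>Q. Q"] Ms M(2) by (auto simp: disjoint_family_on_def disjoint_def)
    also have "\<dots> \<le> (L / l) powr q"
    proof -
      have "l powr q * (\<Sum>Q\<in>M. wvol u Q) \<le> (\<Sum>Q\<in>M. A Q powr q * wvol u Q)"
        unfolding sum_distrib_left using Ms cs
        by (intro sum_mono mult_right_mono powr_mono2 wvol_nonneg[OF u]) (auto intro: less_imp_le)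
      also have "\<dots> \<le> L powr q" using finM M(2) Ms by (intro weak) auto
      finally show ?thesis using cs by (simp add: powr_divide field_simps)
    qed
    finally show "wvol u (\<Union>H \<inter> G) \<le> (L / l) powr q" .
  qed simp
  have "G \<inter> \<Omega> = (\<Union>a\<in>shifts. \<Union>(F a) \<inter> G)" unfolding \<Omega> by blast
  then have "wvol u (G \<inter> \<Omega>) \<le> (\<Sum>a\<in>shifts. wvol u (\<Union>(F a) \<inter> G))"
    using finite_shifts UFs G bounded_subset[of G] by (simp only:) (intro wvol_UN_le[OF u], auto)
  also have "\<dots> \<le> (\<Sum>a\<in>(shifts :: ('n \<Rightarrow> nat) set). (L / l) powr q)" by (intro sum_mono one)
  finally show "wvol u (G \<inter> \<Omega>) \<le> real (card (shifts :: ('n \<Rightarrow> nat) set)) * (L / l) powr q" by simp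
qed

text \<open>The form is small, uniformly in the sparse family, when it is tested with the indicator of a small set.
  This disposes of the errors in approximating the dual function by test functions. It is the weighted argument for
  the weight 1, for which the exponents are free: \<open>1/q\<close> halfway between \<open>i = 1/q\<^sub>0\<close> and
  \<open>1/p\<^sub>0 - \<beta>\<close> leaves a positive gain \<open>\<epsilon>\<close>.\<close>

lemma unweighted_form_bound:
  fixes f :: "real ^ 'n \<Rightarrow> 'k::{real_normed_vector, second_countable_topology}" and Bd B' :: "(real ^ 'n) set"
  assumes f: "f \<in> borel_measurable lebesgue" "\<And>x. norm (f x) \<le> F" and Bd: "Bd \<in> sets lebesgue" "bounded Bd" "\<And>x. x \<notin> Bd \<Longrightarrow> f x = 0"
    and B': "B' \<in> sets lebesgue" "bounded B'"
    and e: "1 \<le> p\<^sub>0" "0 \<le> i" "i < 1" "0 \<le> \<beta>" "\<beta> + i < 1 / p\<^sub>0" "r = 1 / (1 - i)" and \<eta>: "0 < \<eta>"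
  shows "\<exists>X \<sigma>. 0 \<le> X \<and> 0 < \<sigma> \<and> (\<forall>S S0 Z. sparse \<eta> S \<longrightarrow> finite S0 \<longrightarrow> S0 \<subseteq> S \<longrightarrow> Z \<in> sets lebesgue \<longrightarrow> Z \<subseteq> B' \<longrightarrow>
    (\<Sum>Q\<in>S0. pavg p\<^sub>0 \<beta> f Q * pavg r 1 (indicator Z :: _ \<Rightarrow> real) Q) \<le> X * measure lebesgue Z powr \<sigma>)"
proof -
  let ?w = "\<lambda>_ :: real ^ 'n. 1 :: real"
  note w = locally_finite_weight_one
  define q where "q = 2 / (i + 1 / p\<^sub>0 - \<beta>)"
  define p where "p = 2 / (i + 1 / p\<^sub>0 + \<beta>)"
  define \<epsilon> where "\<epsilon> = (1 / p\<^sub>0 - \<beta> - i) / 2"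
  have p0i: "0 < 1 / p\<^sub>0" "1 / p\<^sub>0 \<le> 1" using e by auto
  have iq: "1 / q = (i + 1 / p\<^sub>0 - \<beta>) / 2" and ip: "1 / p = (i + 1 / p\<^sub>0 + \<beta>) / 2" by (auto simp: q_def p_def)
  have q0: "0 < q" "0 < p" using e p0i by (auto simp: q_def p_def intro!: divide_pos_pos)
  have iqlt1: "1 / q < 1" unfolding iq using e(3,4) p0i(2) by (simp add: field_simps)
  have iqlt2: "1 / p < 1 / p\<^sub>0" unfolding ip using e(2,5) by (simp add: field_simps)
  have iqlt3: "1 / q \<le> 1 / p" unfolding iq ip using e by simp
  note iqlt = iqlt1 iqlt2 iqlt3
  have q1: "1 < q" using iqlt q0 by simp
  have pq: "p \<le> q" using iqlt q0 by (simp add: field_simps)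
  have p0p: "p\<^sub>0 \<le> p" using iqlt q0 e by (simp add: field_simps)
  have \<beta>: "\<beta> = 1 / p - 1 / q" unfolding iq ip by (simp add: field_simps)
  have \<epsilon>: "0 < \<epsilon>" using e by (simp add: \<epsilon>_def)
  have ir: "1 / r = 1 - i" "1 \<le> r" using e by auto
  have exps: "1 - 1 / q + \<epsilon> = 1 / r" unfolding iq ir \<epsilon>_def by (simp add: field_simps)
  have F0: "0 \<le> F" using f(2) norm_ge_zero order_trans by blast
  define m where "m = (measure lebesgue :: (real ^ 'n) set \<Rightarrow> real)"
  have m0: "0 \<le> m E" for E by (simp add: m_def)
  define L where "L = F * m Bd powr (1 / p) + 1"
  have L: "0 < L" using F0 by (simp add: L_def add_nonneg_pos)
  have Jint: "(\<integral>\<^sup>+x\<in>Q. ennreal (norm (f x) powr p\<^sub>0) \<partial>lebesgue) \<le> ennreal (F powr p\<^sub>0 * m E)"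
    if "E \<in> sets lebesgue" "bounded E" "Q \<inter> Bd \<subseteq> E" for E Q
  proof -
    have "(\<integral>\<^sup>+x\<in>Q. ennreal (norm (f x) powr p\<^sub>0) \<partial>lebesgue) \<le> (\<integral>\<^sup>+x. ennreal (F powr p\<^sub>0) * indicator E x \<partial>lebesgue)"
    proof (intro nn_integral_mono)
      fix x
      show "ennreal (norm (f x) powr p\<^sub>0) * indicator Q x \<le> ennreal (F powr p\<^sub>0) * indicator E x"
      proof (cases "x \<in> Q \<inter> Bd")
        case True
        then have "x \<in> E" using that by blast
        then show ?thesis using True f(2)[of x] e by (auto intro!: ennreal_leI powr_mono2)
      next
        case False
        then show ?thesis using Bd(3)[of x] by (cases "x \<in> Q") auto
      qed
    qed
    also have "\<dots> = ennreal (F powr p\<^sub>0) * emeasure lebesgue E" using that by (simp add: nn_integral_cmult_indicator)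
    also have "emeasure lebesgue E = ennreal (m E)"
      using bounded_set_imp_lmeasurable[OF that(2,1)] by (simp add: m_def emeasure_eq_measure2)
    finally show ?thesis by (simp add: ennreal_mult m0)
  qed
  have fin: "(\<integral>\<^sup>+x\<in>Q. ennreal (norm (f x) powr p\<^sub>0) \<partial>lebesgue) < \<infinity>" for Q
    using Jint[OF Bd(1,2), of Q] by (auto intro: order_le_less_trans)
  have weak: "(\<Sum>Q\<in>F'. pavg p\<^sub>0 \<beta> f Q powr q * wvol ?w Q) \<le> L powr q" if "finite F'" "F' \<subseteq> cubes" "disjoint F'" for F'
  proof (rule disjoint_cubes_pavg_sum[OF w w f(1) Bd e(1) p0p pq _ _ fin, where \<kappa> = 1])
    fix Q E :: "(real ^ 'n) set" assume Q: "Q \<in> cubes" and E: "E \<in> sets lebesgue" "E \<subseteq> Q"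
    note Qf = cube_facts[OF Q]
    have EQ: "m E \<le> m Q" unfolding m_def using Qf E bounded_set_imp_lmeasurable by (intro measure_mono_fmeasurable) auto
    have Qp: "0 < m Q" using Qf by (simp add: m_def)
    show "measure lebesgue E powr (1 / p\<^sub>0) * measure lebesgue Q powr (\<beta> - 1 / p\<^sub>0) * wvol ?w Q powr (1 / q) \<le> 1 * wvol ?w E powr (1 / p)"
      unfolding wvol_one m_def[symmetric]
    proof (cases "m E = 0")
      case False
      then have Ep: "0 < m E" using m0[of E] by simp
      have "m E powr (1 / p\<^sub>0) * m Q powr (\<beta> - 1 / p\<^sub>0) * m Q powr (1 / q) = m E powr (1 / p) * (m E powr (1 / p\<^sub>0 - 1 / p) * m Q powr (1 / p - 1 / p\<^sub>0))"
        using Ep Qp unfolding \<beta> by (simp add: powr_diff powr_add[symmetric] field_simps)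
      also have "m E powr (1 / p\<^sub>0 - 1 / p) * m Q powr (1 / p - 1 / p\<^sub>0) = (m E / m Q) powr (1 / p\<^sub>0 - 1 / p)"
        using Ep Qp by (simp add: powr_divide powr_diff)
      also have "m E powr (1 / p) * (m E / m Q) powr (1 / p\<^sub>0 - 1 / p) \<le> m E powr (1 / p) * 1"
        using Ep Qp EQ iqlt by (intro mult_left_mono powr_le1) auto
      finally show "m E powr (1 / p\<^sub>0) * m Q powr (\<beta> - 1 / p\<^sub>0) * m Q powr (1 / q) \<le> 1 * m E powr (1 / p)" by simp
    qed simp
  next
    have "(\<integral>\<^sup>+y\<in>{0<..}. ennreal (wvol ?w (level f y \<inter> Bd) powr (1 / p)) \<partial>lborel) \<le> (\<integral>\<^sup>+y. ennreal (m Bd powr (1 / p)) * indicator {0..F} y \<partial>lborel)"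
    proof (intro nn_integral_mono)
      fix y :: real
      show "ennreal (wvol ?w (level f y \<inter> Bd) powr (1 / p)) * indicator {0<..} y \<le> ennreal (m Bd powr (1 / p)) * indicator {0..F} y"
      proof (cases "0 < y \<and> y \<le> F")
        case True
        have "m (level f y \<inter> Bd) \<le> m Bd" unfolding m_def using Bd level_sets[OF f(1)] bounded_set_imp_lmeasurable
          by (intro measure_mono_fmeasurable) auto
        then show ?thesis using True q0 by (auto simp: wvol_one m_def intro!: ennreal_leI powr_mono2)
      next
        case False
        moreover have "level f y = {}" if "F < y" using f(2) that unfolding level_def by (smt (verit) empty_Collect_eq)
        ultimately have "level f y = {} \<or> y \<le> 0" by linarith
        then show ?thesis by (auto simp: wvol_one)
      qed
    qed
    also have "\<dots> = ennreal (m Bd powr (1 / p)) * ennreal F" using F0 by (simp add: nn_integral_cmult_indicator)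
    also have "\<dots> \<le> ennreal L" using F0 by (simp add: ennreal_mult[symmetric] L_def mult.commute)
    finally show "ennreal 1 * (\<integral>\<^sup>+y\<in>{0<..}. ennreal (wvol ?w (level f y \<inter> Bd) powr (1 / p)) \<partial>lborel) \<le> ennreal L" by simp
  qed (use that L in auto)
  define lam where "lam = (F powr p\<^sub>0 * m Bd) powr (1 / p\<^sub>0) + F + 1"
  have pl: "pavg p\<^sub>0 \<beta> f Q \<le> lam" if Q: "Q \<in> cubes" for Q
  proof -
    note Qf = cube_facts[OF Q]
    have Qp: "0 < m Q" using Qf by (simp add: m_def)
    define I where "I = enn2real (\<integral>\<^sup>+x\<in>Q. ennreal (norm (f x) powr p\<^sub>0) \<partial>lebesgue)"
    have I0: "0 \<le> I" by (simp add: I_def)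
    show ?thesis
    proof (cases "m Q \<le> 1")
      case True
      have "I \<le> F powr p\<^sub>0 * m Q" unfolding I_def using Jint[of Q Q] Qf m0 by (intro enn2real_leI) auto
      then have "I powr (1 / p\<^sub>0) * m Q powr (\<beta> - 1 / p\<^sub>0) \<le> (F powr p\<^sub>0 * m Q) powr (1 / p\<^sub>0) * m Q powr (\<beta> - 1 / p\<^sub>0)"
        using I0 e by (intro mult_right_mono powr_mono2) auto
      also have "\<dots> = F * m Q powr \<beta>" using Qp F0 e by (simp add: powr_mult powr_powr powr_diff)
      also have "\<dots> \<le> F * 1" using True F0 Qp e by (intro mult_left_mono powr_le1) auto
      finally have "pavg p\<^sub>0 \<beta> f Q \<le> F" by (simp add: pavg_def I_def m_def)
      then show ?thesis using powr_ge_zero[of "F powr p\<^sub>0 * m Bd" "1 / p\<^sub>0"] unfolding lam_def by linarith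
    next
      case False
      have "I \<le> F powr p\<^sub>0 * m Bd" unfolding I_def using Jint[OF Bd(1,2)] m0 by (intro enn2real_leI) auto
      then have "I powr (1 / p\<^sub>0) * m Q powr (\<beta> - 1 / p\<^sub>0) \<le> (F powr p\<^sub>0 * m Bd) powr (1 / p\<^sub>0) * m Q powr 0"
        using I0 e False by (intro mult_mono powr_mono2 powr_mono) auto
      then show ?thesis using False F0 Qp by (simp add: pavg_def I_def m_def lam_def)
    qed
  qed
  define b' where "b' = m B' + 1"
  define c where "c = lam * b' powr (1 / q) / L"
  have lam0: "0 < lam" using F0 by (simp add: lam_def add_nonneg_pos)
  have b0: "0 < b'" using m0[of B'] by (simp add: b'_def)
  have c0: "0 < c" using lam0 b0 L by (simp add: c_def)
  define X where "X = 1 / \<eta> * L * ((1 + 1 / \<epsilon>) * (1 + c powr (q * \<epsilon>)))"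
  have X0: "0 \<le> X" using \<eta> L \<epsilon> by (simp add: X_def)
  have main: "(\<Sum>Q\<in>S0. pavg p\<^sub>0 \<beta> f Q * pavg r 1 (indicator Z :: _ \<Rightarrow> real) Q) \<le> X * m Z powr (1 - 1 / q)"
    if sp: "sparse \<eta> S" and S0: "finite S0" "S0 \<subseteq> S" and Z: "Z \<in> sets lebesgue" "Z \<subseteq> B'" for S S0 and Z :: "(real ^ 'n) set"
  proof -
    obtain D E where D: "laminar D" "D \<subseteq> cubes" "S \<subseteq> D" and E0: "disjoint_family_on E S"
      "\<forall>Q\<in>S. E Q \<in> sets lebesgue \<and> E Q \<subseteq> Q \<and> \<eta> * measure lebesgue Q \<le> measure lebesgue (E Q)"
      by (rule sparse_facts[OF sp \<eta>])
    have Zb: "bounded Z" using Z B' bounded_subset by blast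
    have ZB: "m Z \<le> b'"
    proof -
      have "m Z \<le> m B'" unfolding m_def using Z B' bounded_set_imp_lmeasurable by (intro measure_mono_fmeasurable) auto
      then show ?thesis by (simp add: b'_def)
    qed
    have "(\<Sum>Q\<in>S0. pavg p\<^sub>0 \<beta> f Q * pavg r 1 (indicator Z :: _ \<Rightarrow> real) Q)
       \<le> 1 * (1 / \<eta> * L * wvol ?w Z powr (1 - 1 / q) * ((1 + 1 / \<epsilon>) * (1 + c powr (q * \<epsilon>))))"
    proof (rule form_sum_carleson[where R = "\<lambda>Q. Q" and b = "pavg r 1 (indicator Z :: _ \<Rightarrow> real)", OF w])
      show "(\<lambda>Q. Q) ` S0 \<subseteq> cubes" using S0 D by auto
      show "laminar ((\<lambda>Q. Q) ` S0)" using laminar_subset[OF D(1)] S0 D by auto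
      show "0 < wvol ?w Q" if "Q \<in> cubes" for Q using cube_facts(3)[OF that] by (simp add: wvol_one)
      show "(\<Sum>i\<in>{i \<in> S0. i \<subseteq> Q}. wvol ?w i) \<le> 1 / \<eta> * wvol ?w Q" if Q: "Q \<in> (\<lambda>Q. Q) ` S0" for Q
      proof -
        have Qc: "Q \<in> cubes" using Q S0 D by auto
        show ?thesis unfolding wvol_one
          using carleson_of_sparse_unweighted[of S0 E "\<lambda>Q. Q" \<eta> Q] S0 E0 \<eta> cube_facts(1,2)[OF Qc]
          by (auto simp: disjoint_family_on_def subset_iff)
      qed
      show "pavg r 1 (indicator Z :: _ \<Rightarrow> real) Q \<le> 1 * (wvol ?w (Z \<inter> Q) / wvol ?w Q) powr (1 - 1 / q + \<epsilon>) * wvol ?w Q" if "Q \<in> S0" for Q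
      proof -
        have Qc: "Q \<in> cubes" using that S0 D by auto
        note Qf = cube_facts[OF Qc]
        have ZQ: "Z \<inter> Q \<in> lmeasurable" using Z Qf bounded_subset[of Q "Z \<inter> Q"] by (intro bounded_set_imp_lmeasurable) auto
        have "(\<integral>\<^sup>+x\<in>Q. ennreal (norm (indicator Z x :: real) powr r) \<partial>lebesgue) = (\<integral>\<^sup>+x. indicator (Z \<inter> Q) x \<partial>lebesgue)"
          by (intro nn_integral_cong) (auto simp: indicator_def)
        also have "\<dots> = ennreal (m (Z \<inter> Q))" using ZQ by (simp add: m_def emeasure_eq_measure2)
        finally have "pavg r 1 (indicator Z :: _ \<Rightarrow> real) Q = m (Z \<inter> Q) powr (1 / r) * m Q powr (1 - 1 / r)"
          using m0 by (simp add: pavg_def m_def)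
        also have "\<dots> = (m (Z \<inter> Q) / m Q) powr (1 / r) * m Q"
          using Qf m0[of "Z \<inter> Q"] by (simp add: m_def[symmetric] powr_divide powr_diff)
        finally show ?thesis unfolding exps by (simp add: wvol_one m_def)
      qed
      show "pavg p\<^sub>0 \<beta> f Q \<le> c * L * wvol ?w Z powr (- 1 / q)" if Q: "Q \<in> S0" and pz: "0 < wvol ?w (Z \<inter> Q)" for Q
      proof -
        have Qc: "Q \<in> cubes" using Q S0 D by auto
        have "m (Z \<inter> Q) \<le> m Z" unfolding m_def using Z Zb cube_facts(1)[OF Qc] bounded_set_imp_lmeasurable
          by (intro measure_mono_fmeasurable) auto
        then have Zp: "0 < m Z" using pz by (simp add: wvol_one m_def)
        have "pavg p\<^sub>0 \<beta> f Q \<le> lam * 1" using pl[OF Qc] by simp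
        also have "\<dots> \<le> lam * (b' / m Z) powr (1 / q)"
          using lam0 ZB Zp q0 by (intro mult_left_mono ge_one_powr_ge_zero) auto
        also have "\<dots> = c * L * m Z powr (- 1 / q)"
          using L Zp b0 by (simp add: c_def powr_divide powr_minus field_simps)
        finally show ?thesis by (simp add: wvol_one m_def)
      qed
    qed (use S0 Z Zb pavg_nonneg weak L q1 \<epsilon> c0 \<eta> in auto)
    then show ?thesis by (simp add: X_def wvol_one m_def ac_simps)
  qed
  show ?thesis
    using main X0 iqlt unfolding m_def by (intro exI[of _ X] exI[of _ "1 - 1 / q"]) auto
qed

section \<open>Approximation by test functions\<close>

lemma C_k_SucI:
  assumes "\<And>x. (f has_derivative f' x) (at x)" "\<And>v. C_k k (\<lambda>x. f' x v)"
  shows "C_k (Suc k) f"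
proof -
  have "frechet_derivative f (at x) = f' x" for x using frechet_derivative_at[OF assms(1)] by simp
  then show ?thesis using assms by (auto simp: differentiable_def)
qed

lemma C_k_SucE:
  assumes "C_k (Suc k) f"
  shows "(f has_derivative frechet_derivative f (at x)) (at x)" "C_k k (\<lambda>x. frechet_derivative f (at x) v)"
  using assms by (auto simp: frechet_derivative_works)

lemma C_k_SucD: "C_k (Suc k) f \<Longrightarrow> C_k k f"
proof (induction k arbitrary: f)
  case 0
  then have "f differentiable (at x)" for x by simp
  then show ?case by (simp add: continuous_on_eq_continuous_within differentiable_imp_continuous_within)
next
  case (Suc k)
  show ?case
  proof (rule C_k_SucI)
    show "(f has_derivative frechet_derivative f (at x)) (at x)" for x by (rule C_k_SucE[OF Suc.prems])
    show "C_k k (\<lambda>x. frechet_derivative f (at x) v)" for v by (rule Suc.IH[OF C_k_SucE(2)[OF Suc.prems]])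
  qed
qed

lemma C_k_const: "C_k k (\<lambda>_. c)"
proof (induction k arbitrary: c)
  case (Suc k)
  show ?case by (rule C_k_SucI[where f' = "\<lambda>_ _. 0"]) (auto intro: Suc.IH)
qed auto

lemma C_k_bounded_linear: "bounded_linear f \<Longrightarrow> C_k k f"
proof (cases k)
  case (Suc j)
  assume f: "bounded_linear f"
  show ?thesis unfolding Suc
    by (rule C_k_SucI[where f' = "\<lambda>_. f"]) (auto intro: bounded_linear_imp_has_derivative f C_k_const)
qed (auto intro: linear_continuous_on)

lemma C_k_add: "C_k k f \<Longrightarrow> C_k k g \<Longrightarrow> C_k k (\<lambda>x. f x + g x)"
proof (induction k arbitrary: f g)
  case (Suc k)
  show ?case
    by (rule C_k_SucI[OF has_derivative_add[OF C_k_SucE(1)[OF Suc.prems(1)] C_k_SucE(1)[OF Suc.prems(2)]]])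
      (intro Suc.IH C_k_SucE(2)[OF Suc.prems(1)] C_k_SucE(2)[OF Suc.prems(2)])
qed (auto intro: continuous_intros)

lemma C_k_scaleR:
  fixes a :: "real ^ 'n \<Rightarrow> real"
  shows "C_k k a \<Longrightarrow> C_k k g \<Longrightarrow> C_k k (\<lambda>x. a x *\<^sub>R g x)"
proof (induction k arbitrary: a g)
  case (Suc k)
  show ?case
    by (rule C_k_SucI[OF has_derivative_scaleR[OF C_k_SucE(1)[OF Suc.prems(1)] C_k_SucE(1)[OF Suc.prems(2)]]])
      (intro C_k_add Suc.IH C_k_SucE(2)[OF Suc.prems(1)] C_k_SucE(2)[OF Suc.prems(2)] C_k_SucD[OF Suc.prems(1)] C_k_SucD[OF Suc.prems(2)])
qed (auto intro: continuous_intros)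

lemma C_k_mult: "C_k k a \<Longrightarrow> C_k k b \<Longrightarrow> C_k k (\<lambda>x. a x * b x :: real)"
  using C_k_scaleR[of k a b] by simp

lemma C_k_sum: "finite I \<Longrightarrow> (\<And>i. i \<in> I \<Longrightarrow> C_k k (f i)) \<Longrightarrow> C_k k (\<lambda>x. \<Sum>i\<in>I. f i x)"
  by (induction I rule: finite_induct) (auto intro: C_k_add C_k_const)

lemma C_k_prod:
  fixes f :: "'i \<Rightarrow> real ^ 'n \<Rightarrow> real"
  shows "finite I \<Longrightarrow> (\<And>i. i \<in> I \<Longrightarrow> C_k k (f i)) \<Longrightarrow> C_k k (\<lambda>x. \<Prod>i\<in>I. f i x)"
  by (induction I rule: finite_induct) (auto intro: C_k_mult C_k_const)

lemma C_k_real_polynomial_function: "real_polynomial_function f \<Longrightarrow> C_k k f"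
  by (induction rule: real_polynomial_function.induct) (auto intro: C_k_bounded_linear C_k_const C_k_add C_k_mult)

lemma C_k_polynomial_function:
  fixes f :: "real ^ 'n \<Rightarrow> 'k::euclidean_space"
  assumes "polynomial_function f" shows "C_k k f"
proof -
  have "C_k k (\<lambda>x. \<Sum>b\<in>Basis. (f x \<bullet> b) *\<^sub>R b)"
    using assms by (intro C_k_sum C_k_scaleR C_k_const C_k_real_polynomial_function)
      (auto simp: polynomial_function_iff_Basis_inner)
  then show ?thesis by (simp add: euclidean_representation)
qed

text \<open>A partial derivative of the function for \<open>d n\<close> is a multiple of the one for \<open>d (Suc n)\<close>; inducting on \<open>k\<close> for all its members at once
  avoids computing higher derivatives.\<close>

lemma C_k_ridge:
  fixes i :: "'n::finite"
  assumes d: "\<And>n t. (d n has_real_derivative d (Suc n) t) (at t)"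
  shows "C_k k (\<lambda>x :: real ^ 'n. d n (s + c * x $ i))"
proof (induction k arbitrary: n)
  case 0
  have "continuous_on UNIV (d n)" by (meson DERIV_continuous_on d)
  then show ?case by (auto intro!: continuous_on_compose2[of UNIV "d n"] continuous_intros)
next
  case (Suc k)
  show ?case
  proof (rule C_k_SucI)
    fix x :: "real ^ 'n"
    show "((\<lambda>x. d n (s + c * x $ i)) has_derivative (\<lambda>v. (c * v $ i) * d (Suc n) (s + c * x $ i))) (at x)"
      by (rule DERIV_compose_FDERIV[OF d]) (auto intro!: derivative_eq_intros bounded_linear_imp_has_derivative)
  next
    fix v :: "real ^ 'n"
    show "C_k k (\<lambda>x. (c * v $ i) * d (Suc n) (s + c * x $ i))" by (intro C_k_mult C_k_const Suc.IH)
  qed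
qed

lemma poly_times_power_over_exp: "((\<lambda>s. s ^ k * poly p s / exp s) \<longlongrightarrow> (0::real)) at_top"
proof (induction p arbitrary: k)
  case (pCons a p)
  have "((\<lambda>s. a * (s ^ k / exp s) + s ^ Suc k * poly p s / exp s) \<longlongrightarrow> a * 0 + 0) at_top"
    by (intro tendsto_add tendsto_mult tendsto_const tendsto_power_div_exp_0 pCons.IH)
  then show ?case by (simp add: algebra_simps add_divide_distrib)
qed simp

text \<open>The \<open>n\<close>-th derivative of \<open>exp (- 1 / t)\<close> is \<open>exp (- 1 / t)\<close> times this polynomial in \<open>1 / t\<close>.\<close>

primrec bump_poly :: "nat \<Rightarrow> real poly" where
  "bump_poly 0 = 1"
| "bump_poly (Suc n) = [:0, 0, 1:] * (bump_poly n - pderiv (bump_poly n))"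

definition bump_deriv :: "nat \<Rightarrow> real \<Rightarrow> real" where
  "bump_deriv n t = (if 0 < t then poly (bump_poly n) (1 / t) * exp (- (1 / t)) else 0)"

text \<open>At \<open>t = 0\<close> the difference quotient is a polynomial in \<open>1 / t\<close> times \<open>exp (- 1 / t)\<close>, which tends to 0.\<close>

lemma bump_deriv_DERIV: "(bump_deriv n has_real_derivative bump_deriv (Suc n) t) (at t)"
proof -
  consider "0 < t" | "t < 0" | "t = 0" by linarith
  then show ?thesis
  proof cases
    case 1
    have "((\<lambda>t. poly (bump_poly n) (1 / t) * exp (- (1 / t))) has_real_derivative
       poly (pderiv (bump_poly n)) (1 / t) * (- 1 / t\<^sup>2) * exp (- (1 / t)) + poly (bump_poly n) (1 / t) * (exp (- (1 / t)) * (1 / t\<^sup>2))) (at t)"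
      using 1 by (auto intro!: derivative_eq_intros DERIV_chain2[OF poly_DERIV] simp: power2_eq_square)
    also have "poly (pderiv (bump_poly n)) (1 / t) * (- 1 / t\<^sup>2) * exp (- (1 / t)) + poly (bump_poly n) (1 / t) * (exp (- (1 / t)) * (1 / t\<^sup>2)) = bump_deriv (Suc n) t"
      using 1 by (simp add: bump_deriv_def field_simps power2_eq_square)
    finally show ?thesis
    proof (rule has_field_derivative_transform_within_open)
      show "open {0::real<..}" by simp
    qed (use 1 in \<open>auto simp: bump_deriv_def\<close>)
  next
    case 2
    have "((\<lambda>_. 0) has_real_derivative bump_deriv (Suc n) t) (at t)" using 2 by (simp add: bump_deriv_def)
    then show ?thesis
    proof (rule has_field_derivative_transform_within_open)
      show "open {..<0::real}" by simp
    qed (use 2 in \<open>auto simp: bump_deriv_def\<close>)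
  next
    case 3
    have "((\<lambda>y. (bump_deriv n y - bump_deriv n 0) / (y - 0)) \<longlongrightarrow> 0) (at_right 0)"
    proof (rule Lim_transform_eventually)
      show "((\<lambda>y. (inverse y) ^ 1 * poly (bump_poly n) (inverse y) / exp (inverse y)) \<longlongrightarrow> 0) (at_right 0)"
        by (rule filterlim_compose[OF poly_times_power_over_exp filterlim_inverse_at_top_right])
      show "\<forall>\<^sub>F y in at_right 0. inverse y ^ 1 * poly (bump_poly n) (inverse y) / exp (inverse y) = (bump_deriv n y - bump_deriv n 0) / (y - 0)"
        using eventually_at_right_less[of 0]
        by eventually_elim (simp add: bump_deriv_def exp_minus field_simps)
    qed
    moreover have "((\<lambda>y. (bump_deriv n y - bump_deriv n 0) / (y - 0)) \<longlongrightarrow> 0) (at_left 0)"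
    proof (rule Lim_transform_eventually[OF tendsto_const])
      show "\<forall>\<^sub>F y in at_left 0. 0 = (bump_deriv n y - bump_deriv n 0) / (y - 0)"
        unfolding eventually_at_filter by (intro always_eventually) (auto simp: bump_deriv_def)
    qed
    ultimately have "((\<lambda>y. (bump_deriv n y - bump_deriv n 0) / (y - 0)) \<longlongrightarrow> 0) (at 0)"
      by (simp add: filterlim_split_at)
    then show ?thesis using 3 by (simp add: has_field_derivative_iff bump_deriv_def)
  qed
qed

lemma test_function_facts:
  fixes f :: "real ^ 'n \<Rightarrow> 'k::{real_normed_vector, second_countable_topology}"
  assumes "f \<in> test_functions"
  obtains F B where "f \<in> borel_measurable lebesgue" "\<forall>x. norm (f x) \<le> F" "B \<in> sets lebesgue" "bounded B" "\<forall>x. x \<notin> B \<longrightarrow> f x = 0"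
proof -
  have c: "continuous_on UNIV f" using assms C_k.simps(1)[of f] by (auto simp: test_functions_def)
  define B where "B = closure {x. f x \<noteq> 0}"
  have B: "compact B" using assms by (simp add: test_functions_def B_def)
  have z: "f x = 0" if "x \<notin> B" for x using that closure_subset[of "{x. f x \<noteq> 0}"] by (auto simp: B_def)
  have "bounded (f ` B)" using compact_continuous_image[OF continuous_on_subset[OF c] B] compact_imp_bounded by blast
  then obtain F where F: "\<And>x. x \<in> B \<Longrightarrow> norm (f x) \<le> F" by (auto simp: bounded_iff)
  have "norm (f x) \<le> max F 0" for x using F[of x] z[of x] by (cases "x \<in> B") auto
  moreover have "f \<in> borel_measurable lebesgue"
    using borel_measurable_continuous_onI[OF c] by (intro measurable_completion) simp
  moreover have "B \<in> sets lebesgue" using lmeasurable_compact[OF B] by (rule fmeasurableD)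
  ultimately show ?thesis using that[of "max F 0" B] z compact_imp_bounded[OF B] by blast
qed

text \<open>Almost everywhere, \<open>h\<close> is a limit of continuous functions. The nearest point projection to the ball of
  radius \<open>M\<close> makes them bounded, the Stone-Weierstrass theorem replaces them by polynomials on the
  cube \<open>[-l, l]^n\<close>, and smooth cutoffs that increase to the indicator of its interior give them compact support.\<close>

lemma test_function_approximation:
  fixes h :: "real ^ 'n \<Rightarrow> 'k::euclidean_space"
  assumes h: "h \<in> borel_measurable lebesgue" "\<And>x. norm (h x) \<le> M" and l: "0 < l"
    and supp: "\<And>x i. l \<le> \<bar>x $ i\<bar> \<Longrightarrow> h x = 0"
  shows "\<exists>g. (\<forall>m. g m \<in> test_functions) \<and> (\<forall>m x. norm (g m x) \<le> M + 1) \<and> (\<forall>m x i. l \<le> \<bar>x $ i\<bar> \<longrightarrow> g m x = 0) \<and>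
     (AE x in lebesgue. (\<lambda>m. g m x) \<longlonglongrightarrow> h x)"
proof -
  have M: "0 \<le> M" using h(2) norm_ge_zero order_trans by blast
  have "h measurable_on UNIV" using h(1) by (simp add: measurable_on_iff_borel_measurable)
  then obtain N G where N: "negligible N" and G: "\<And>n. continuous_on UNIV (G n)" "\<And>x. x \<notin> N \<Longrightarrow> (\<lambda>n. G n x) \<longlonglongrightarrow> h x"
    unfolding measurable_on_def by auto
  define cl where "cl = closest_point (cball (0::'k) M)"
  have ccl: "continuous_on A cl" for A unfolding cl_def using M by (intro continuous_on_closest_point) auto
  have cln: "norm (cl z) \<le> M" for z using closest_point_in_set[of "cball (0::'k) M" z] M by (simp add: cl_def dist_norm)
  have clh: "cl (h x) = h x" for x unfolding cl_def using h(2)[of x] by (intro closest_point_self) (simp add: dist_norm)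
  define K :: "(real ^ 'n) set" where "K = cbox (\<chi> i. - l) (\<chi> i. l)"
  have "\<exists>P. polynomial_function P \<and> (\<forall>x\<in>K. norm (cl (G m x) - P x) < 1 / (real m + 1))" for m
  proof (rule Stone_Weierstrass_polynomial_function)
    show "continuous_on K (\<lambda>x. cl (G m x))"
      by (rule continuous_on_compose2[OF ccl[of UNIV] continuous_on_subset[OF G(1)]]) auto
  qed (auto simp: K_def)
  then obtain P where P: "\<And>m. polynomial_function (P m)" "\<And>m x. x \<in> K \<Longrightarrow> norm (cl (G m x) - P m x) < 1 / (real m + 1)" by metis
  define ct where "ct m x = (\<Prod>i\<in>UNIV. bump_deriv 0 ((real m + 1) * l + (real m + 1) * x $ i) * bump_deriv 0 ((real m + 1) * l + (- (real m + 1)) * x $ i))"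
    for m and x :: "real ^ 'n"
  have ctC: "C_k k (ct m)" for k m
    unfolding ct_def by (intro C_k_prod C_k_mult C_k_ridge bump_deriv_DERIV) auto
  have b01: "0 \<le> bump_deriv 0 t" "bump_deriv 0 t \<le> 1" for t by (auto simp: bump_deriv_def)
  have bz: "bump_deriv 0 t = 0" if "t \<le> 0" for t using that by (simp add: bump_deriv_def)
  have ct01: "0 \<le> ct m x" "ct m x \<le> 1" for m x
    unfolding ct_def by (auto intro!: prod_nonneg prod_le_1 mult_nonneg_nonneg mult_le_one b01)
  have ct0: "ct m x = 0" if "l \<le> \<bar>x $ i\<bar>" for m x i
  proof -
    have "bump_deriv 0 ((real m + 1) * l + (real m + 1) * x $ i) * bump_deriv 0 ((real m + 1) * l + (- (real m + 1)) * x $ i) = 0"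
    proof (cases "0 \<le> x $ i")
      case True
      then have "(real m + 1) * l \<le> (real m + 1) * x $ i" using that by (intro mult_left_mono) auto
      then have "(real m + 1) * l + (- (real m + 1)) * x $ i \<le> 0" unfolding mult_minus_left by linarith
      then show ?thesis by (simp only: bz mult_zero_right)
    next
      case False
      then have "(real m + 1) * l \<le> (real m + 1) * (- x $ i)" using that by (intro mult_left_mono) auto
      then have "(real m + 1) * l + (real m + 1) * x $ i \<le> 0" unfolding mult_minus_right by linarith
      then show ?thesis by (simp only: bz mult_zero_left)
    qed
    then show ?thesis unfolding ct_def by (intro prod_zero) auto
  qed
  have inK: "x \<in> K" if "\<not> (\<exists>i. l \<le> \<bar>x $ i\<bar>)" for x
    using that by (auto simp: K_def mem_box_cart not_le abs_less_iff less_imp_le) (meson less_imp_le neg_le_iff_le minus_le_iff)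
  have bl: "(\<lambda>m. bump_deriv 0 ((real m + 1) * c)) \<longlonglongrightarrow> 1" if "0 < c" for c
  proof -
    have "(\<lambda>m. 1 / ((real m + 1) * c)) \<longlonglongrightarrow> 0"
      using tendsto_mult[OF LIMSEQ_inverse_real_of_nat tendsto_const[of "1 / c"]] that
      by (simp add: inverse_eq_divide add.commute)
    then have "(\<lambda>m. exp (- (1 / ((real m + 1) * c)))) \<longlonglongrightarrow> exp (- 0)" by (intro tendsto_intros)
    moreover have "bump_deriv 0 ((real m + 1) * c) = exp (- (1 / ((real m + 1) * c)))" for m
      using that by (simp add: bump_deriv_def add_nonneg_pos)
    ultimately show ?thesis by simp
  qed
  have ct1: "(\<lambda>m. ct m x) \<longlonglongrightarrow> 1" if "\<not> (\<exists>i. l \<le> \<bar>x $ i\<bar>)" for x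
  proof -
    have "(\<lambda>m. ct m x) \<longlonglongrightarrow> (\<Prod>i\<in>(UNIV::'n set). 1 * 1)"
      unfolding ct_def
    proof (intro tendsto_prod tendsto_mult)
      fix i
      have "0 < l + x $ i" "0 < l + - x $ i" using that by (auto simp: not_le abs_less_iff) (smt (verit))+
      note pos = this
      have e1: "(real m + 1) * l + (real m + 1) * x $ i = (real m + 1) * (l + x $ i)"
        and e2: "(real m + 1) * l + (- (real m + 1)) * x $ i = (real m + 1) * (l + - x $ i)" for m
        by (simp_all add: algebra_simps)
      from bl[OF pos(1)] bl[OF pos(2)]
      show "(\<lambda>m. bump_deriv 0 ((real m + 1) * l + (real m + 1) * x $ i)) \<longlonglongrightarrow> 1"
        "(\<lambda>m. bump_deriv 0 ((real m + 1) * l + (- (real m + 1)) * x $ i)) \<longlonglongrightarrow> 1"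
        by (simp_all only: e1 e2)
    qed
    then show ?thesis by simp
  qed
  define g where "g m x = ct m x *\<^sub>R P m x" for m x
  have g0: "g m x = 0" if "l \<le> \<bar>x $ i\<bar>" for m x i using ct0[OF that] by (simp add: g_def)
  have gt: "g m \<in> test_functions" for m
  proof -
    have "{x. g m x \<noteq> 0} \<subseteq> K" using g0 inK by blast
    then have "bounded {x. g m x \<noteq> 0}" using bounded_subset[OF bounded_cbox] by (auto simp: K_def)
    moreover have "C_k k (g m)" for k
      unfolding g_def by (intro C_k_scaleR ctC C_k_polynomial_function[OF P(1)])
    ultimately show ?thesis by (simp add: test_functions_def compact_closure)
  qed
  have gM: "norm (g m x) \<le> M + 1" for m x
  proof (cases "\<exists>i. l \<le> \<bar>x $ i\<bar>")
    case True
    then show ?thesis using g0 M by auto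
  next
    case False
    have "norm (P m x) \<le> norm (cl (G m x)) + norm (cl (G m x) - P m x)" using norm_triangle_sub[of "P m x" "cl (G m x)"] by (simp add: norm_minus_commute)
    also have "\<dots> \<le> M + 1" using cln[of "G m x"] P(2)[OF inK[OF False], of m] by (smt (verit) divide_le_eq_1 of_nat_0_le_iff)
    finally have "norm (P m x) \<le> M + 1" .
    then have "ct m x * norm (P m x) \<le> 1 * (M + 1)" using ct01[of m x] by (intro mult_mono) auto
    then show ?thesis using ct01[of m x] by (simp add: g_def)
  qed
  have conv: "(\<lambda>m. g m x) \<longlonglongrightarrow> h x" if xN: "x \<notin> N" for x
  proof (cases "\<exists>i. l \<le> \<bar>x $ i\<bar>")
    case True
    then have "h x = 0" "g m x = 0" for m using g0 supp by blast+
    then show ?thesis by simp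
  next
    case False
    have "isCont cl (h x)" using ccl[of UNIV] by (simp add: continuous_on_eq_continuous_at)
    then have "(\<lambda>m. cl (G m x)) \<longlonglongrightarrow> h x" using isCont_tendsto_compose[OF _ G(2)[OF xN]] clh[of x] by metis
    moreover have "(\<lambda>m. P m x - cl (G m x)) \<longlonglongrightarrow> 0"
    proof (rule Lim_null_comparison)
      show "\<forall>\<^sub>F m in sequentially. norm (P m x - cl (G m x)) \<le> inverse (real (Suc m))"
        using P(2)[OF inK[OF False]] by (intro always_eventually) (auto simp: norm_minus_commute inverse_eq_divide add.commute less_imp_le)
    qed (rule LIMSEQ_inverse_real_of_nat)
    ultimately have "(\<lambda>m. cl (G m x) + (P m x - cl (G m x))) \<longlonglongrightarrow> h x + 0" by (rule tendsto_add)
    then have "(\<lambda>m. P m x) \<longlonglongrightarrow> h x" by simp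
    from tendsto_scaleR[OF ct1[OF False] this] show ?thesis by (simp add: g_def)
  qed
  have "AE x in lebesgue. (\<lambda>m. g m x) \<longlonglongrightarrow> h x"
  proof (rule AE_I')
    show "N \<in> null_sets lebesgue" using N negligible_iff_null_sets by blast
    show "{x \<in> space lebesgue. \<not> (\<lambda>m. g m x) \<longlonglongrightarrow> h x} \<subseteq> N" using conv by blast
  qed
  then show ?thesis using gt gM g0 by blast
qed

section \<open>Duality\<close>

lemma epow_ennreal: "0 \<le> x \<Longrightarrow> epow (ennreal x) a = ennreal (x powr a)"
  by (simp add: epow_def)

lemma epow_mono: "x \<le> y \<Longrightarrow> 0 \<le> a \<Longrightarrow> epow x a \<le> epow y a"
  by (cases x; cases y) (auto simp: epow_def top_unique intro!: ennreal_leI powr_mono2)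

lemma avg_eq_ennreal:
  fixes Q :: "(real ^ 'n) set"
  assumes Q: "Q \<in> cubes" and fin: "(\<integral>\<^sup>+x\<in>Q. ennreal (norm (f x) powr s) \<partial>lebesgue) < \<infinity>" and s: "1 \<le> s"
  shows "avg \<alpha> s f Q = ennreal (enn2real (\<integral>\<^sup>+x\<in>Q. ennreal (norm (f x) powr s) \<partial>lebesgue) powr (1 / s)
     * measure lebesgue Q powr ((\<alpha> / real CARD('n) - 1) / s))"
proof -
  define J where "J = enn2real (\<integral>\<^sup>+x\<in>Q. ennreal (norm (f x) powr s) \<partial>lebesgue)"
  define m where "m = measure lebesgue Q"
  have m: "0 < m" "emeasure lebesgue Q = ennreal m" using cube_facts[OF Q] by (auto simp: m_def)
  have J: "(\<integral>\<^sup>+x\<in>Q. ennreal (norm (f x) powr s) \<partial>lebesgue) = ennreal J" "0 \<le> J" using fin by (auto simp: J_def less_top)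
  have "avg \<alpha> s f Q = ennreal ((J / m powr (1 - \<alpha> / real CARD('n))) powr (1 / s))"
    unfolding avg_def J(1) m(2) using m J by (simp add: epow_ennreal divide_ennreal)
  also have "(J / m powr (1 - \<alpha> / real CARD('n))) powr (1 / s) = J powr (1 / s) * m powr ((\<alpha> / real CARD('n) - 1) / s)"
  proof -
    have e: "(\<alpha> / real CARD('n) - 1) / s = - ((1 - \<alpha> / real CARD('n)) * (1 / s))" using s by (simp add: field_simps)
    have "(J / m powr (1 - \<alpha> / real CARD('n))) powr (1 / s) = J powr (1 / s) / (m powr (1 - \<alpha> / real CARD('n))) powr (1 / s)"
      using J m by (intro powr_divide)
    also have "\<dots> = J powr (1 / s) * m powr (- ((1 - \<alpha> / real CARD('n)) * (1 / s)))"
      by (simp only: powr_minus powr_powr divide_inverse[of "J powr (1 / s)"])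
    finally show ?thesis unfolding e .
  qed
  finally show ?thesis by (simp add: J_def m_def)
qed

lemma avg_product_eq_pavg:
  fixes Q :: "(real ^ 'n) set"
  assumes Q: "Q \<in> cubes" and s: "1 \<le> s" "1 \<le> r"
    and fin: "(\<integral>\<^sup>+x\<in>Q. ennreal (norm (f x) powr s) \<partial>lebesgue) < \<infinity>" "(\<integral>\<^sup>+x\<in>Q. ennreal (norm (g x) powr r) \<partial>lebesgue) < \<infinity>"
  shows "avg 0 s f Q * avg \<alpha> r g Q * emeasure lebesgue Q = ennreal (pavg s (\<alpha> / (real CARD('n) * r)) f Q * pavg r 1 g Q)"
proof -
  define m where "m = measure lebesgue Q"
  have m: "0 < m" "emeasure lebesgue Q = ennreal m" using cube_facts[OF Q] by (auto simp: m_def)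
  have "m powr ((0 / real CARD('n) - 1) / s) * m powr ((\<alpha> / real CARD('n) - 1) / r) * m
    = m powr (\<alpha> / (real CARD('n) * r) - 1 / s) * m powr (1 - 1 / r)"
  proof -
    have "m powr ((0 / real CARD('n) - 1) / s) * m powr ((\<alpha> / real CARD('n) - 1) / r) * m
      = m powr ((0 / real CARD('n) - 1) / s) * m powr ((\<alpha> / real CARD('n) - 1) / r) * m powr 1"
      using m by simp
    also have "\<dots> = m powr ((0 / real CARD('n) - 1) / s + (\<alpha> / real CARD('n) - 1) / r + 1)" by (simp only: powr_add)
    also have "(0 / real CARD('n) - 1) / s + (\<alpha> / real CARD('n) - 1) / r + 1 = (\<alpha> / (real CARD('n) * r) - 1 / s) + (1 - 1 / r)"
      by (simp add: diff_divide_distrib)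
    also have "m powr \<dots> = m powr (\<alpha> / (real CARD('n) * r) - 1 / s) * m powr (1 - 1 / r)" by (rule powr_add)
    finally show ?thesis .
  qed
  then show ?thesis
    unfolding avg_eq_ennreal[OF Q fin(1) s(1)] avg_eq_ennreal[OF Q fin(2) s(2)] m(2) pavg_def
    using m by (simp add: ennreal_mult[symmetric] m_def[symmetric] mult_ac)
qed

lemma powr_add_le:
  fixes x y :: real
  assumes "0 \<le> x" "0 \<le> y" "1 \<le> r"
  shows "(x + y) powr (1 / r) \<le> x powr (1 / r) + y powr (1 / r)"
proof -
  have "(\<Sum>b\<in>{True, False}. (if b then x powr (1 / r) else y powr (1 / r)) powr r) \<le> (\<Sum>b\<in>{True, False}. (if b then x powr (1 / r) else y powr (1 / r))) powr r"
    using assms by (intro sum_powr_le_powr_sum) auto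
  then have "x + y \<le> (x powr (1 / r) + y powr (1 / r)) powr r" using assms by (simp add: powr_powr)
  then have "(x + y) powr (1 / r) \<le> ((x powr (1 / r) + y powr (1 / r)) powr r) powr (1 / r)"
    using assms by (intro powr_mono2) auto
  then show ?thesis using assms by (simp add: powr_powr)
qed

lemma pavg_le_add:
  fixes a b :: "real ^ 'n \<Rightarrow> real"
  assumes le: "\<And>x. norm (g x) \<le> a x + b x" and nn: "\<And>x. 0 \<le> a x" "\<And>x. 0 \<le> b x"
    and [measurable]: "a \<in> borel_measurable lebesgue" "b \<in> borel_measurable lebesgue" and Q: "Q \<in> cubes" and r: "1 \<le> r"
    and fin: "(\<integral>\<^sup>+x\<in>Q. ennreal (norm (a x) powr r) \<partial>lebesgue) < \<infinity>" "(\<integral>\<^sup>+x\<in>Q. ennreal (norm (b x) powr r) \<partial>lebesgue) < \<infinity>"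
  shows "pavg r \<beta> g Q \<le> 2 * (pavg r \<beta> a Q + pavg r \<beta> b Q)"
proof -
  note [measurable] = cube_facts(1)[OF Q]
  define I where "I = enn2real (\<integral>\<^sup>+x\<in>Q. ennreal (norm (a x) powr r) \<partial>lebesgue)"
  define J where "J = enn2real (\<integral>\<^sup>+x\<in>Q. ennreal (norm (b x) powr r) \<partial>lebesgue)"
  have IJ: "(\<integral>\<^sup>+x\<in>Q. ennreal (norm (a x) powr r) \<partial>lebesgue) = ennreal I" "(\<integral>\<^sup>+x\<in>Q. ennreal (norm (b x) powr r) \<partial>lebesgue) = ennreal J"
    "0 \<le> I" "0 \<le> J" using fin by (auto simp: I_def J_def less_top)
  have pt: "norm (g x) powr r \<le> 2 powr r * (norm (a x) powr r + norm (b x) powr r)" for x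
  proof -
    have "norm (g x) \<le> 2 * max (a x) (b x)" using le[of x] by linarith
    then have "norm (g x) powr r \<le> (2 * max (a x) (b x)) powr r" using r by (intro powr_mono2) auto
    also have "\<dots> = 2 powr r * max (a x) (b x) powr r" using nn[of x] by (simp add: powr_mult)
    also have "\<dots> \<le> 2 powr r * (norm (a x) powr r + norm (b x) powr r)"
      using nn[of x] by (intro mult_left_mono) (auto simp: max_def)
    finally show ?thesis .
  qed
  have "(\<integral>\<^sup>+x\<in>Q. ennreal (norm (g x) powr r) \<partial>lebesgue)
     \<le> (\<integral>\<^sup>+x. ennreal (2 powr r) * (ennreal (norm (a x) powr r) * indicator Q x + ennreal (norm (b x) powr r) * indicator Q x) \<partial>lebesgue)"
  proof (intro nn_integral_mono)
    fix x
    have "ennreal (norm (g x) powr r) \<le> ennreal (2 powr r) * (ennreal (norm (a x) powr r) + ennreal (norm (b x) powr r))"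
      using ennreal_leI[OF pt[of x]] by (simp add: ennreal_mult)
    then show "ennreal (norm (g x) powr r) * indicator Q x
      \<le> ennreal (2 powr r) * (ennreal (norm (a x) powr r) * indicator Q x + ennreal (norm (b x) powr r) * indicator Q x)"
      by (auto simp: indicator_def)
  qed
  also have "\<dots> = ennreal (2 powr r) * (ennreal I + ennreal J)"
    unfolding IJ(1,2)[symmetric] by (subst nn_integral_cmult, measurable) (subst nn_integral_add, auto)
  also have "\<dots> = ennreal (2 powr r * (I + J))" using IJ by (simp add: ennreal_mult)
  finally have "enn2real (\<integral>\<^sup>+x\<in>Q. ennreal (norm (g x) powr r) \<partial>lebesgue) \<le> 2 powr r * (I + J)"
    using IJ by (intro enn2real_leI) auto
  then have "enn2real (\<integral>\<^sup>+x\<in>Q. ennreal (norm (g x) powr r) \<partial>lebesgue) powr (1 / r) \<le> (2 powr r * (I + J)) powr (1 / r)"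
    using r by (intro powr_mono2) auto
  also have "\<dots> = 2 * (I + J) powr (1 / r)" using r IJ by (simp add: powr_mult powr_powr)
  also have "\<dots> \<le> 2 * (I powr (1 / r) + J powr (1 / r))" using powr_add_le[OF IJ(3,4) r] by simp
  finally show ?thesis
    unfolding pavg_def I_def[symmetric] J_def[symmetric] distrib_right[symmetric] mult.assoc[symmetric]
    by (rule mult_right_mono) simp
qed

lemma pavg_cmult:
  fixes a :: "real ^ 'n \<Rightarrow> real"
  assumes c: "0 \<le> c" and [measurable]: "a \<in> borel_measurable lebesgue" and Q: "Q \<in> cubes" and r: "1 \<le> r"
  shows "pavg r \<beta> (\<lambda>x. c * a x) Q = c * pavg r \<beta> a Q"
proof -
  note [measurable] = cube_facts(1)[OF Q]
  have "(\<integral>\<^sup>+x\<in>Q. ennreal (norm (c * a x) powr r) \<partial>lebesgue) = (\<integral>\<^sup>+x. ennreal (c powr r) * (ennreal (norm (a x) powr r) * indicator Q x) \<partial>lebesgue)"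
    using c by (intro nn_integral_cong) (auto simp: abs_mult powr_mult ennreal_mult indicator_def)
  also have "\<dots> = ennreal (c powr r) * (\<integral>\<^sup>+x\<in>Q. ennreal (norm (a x) powr r) \<partial>lebesgue)"
    by (rule nn_integral_cmult) measurable
  finally show ?thesis using c r by (simp add: pavg_def enn2real_mult powr_mult powr_powr)
qed

lemma power_integral_finite:
  assumes "\<And>x. norm (f x) \<le> F" "Q \<in> cubes" "0 \<le> s"
  shows "(\<integral>\<^sup>+x\<in>Q. ennreal (norm (f x) powr s) \<partial>lebesgue) < \<infinity>"
proof -
  have "(\<integral>\<^sup>+x\<in>Q. ennreal (norm (f x) powr s) \<partial>lebesgue) \<le> (\<integral>\<^sup>+x. ennreal (F powr s) * indicator Q x \<partial>lebesgue)"
    using assms by (intro nn_integral_mono) (auto simp: indicator_def intro!: ennreal_leI powr_mono2)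
  also have "\<dots> = ennreal (F powr s) * emeasure lebesgue Q" using cube_facts(1)[OF assms(2)] by (simp add: nn_integral_cmult_indicator)
  also have "\<dots> < \<infinity>" using cube_facts(4)[OF assms(2)] by (simp add: ennreal_mult_less_top)
  finally show ?thesis .
qed

text \<open>Duality: pairing \<open>Tf\<close> with the function \<open>h\<close> that is \<open>u\<close> times the inverse of the phase of \<open>Tf\<close> on
  \<open>G'\<close>, and 0 elsewhere, gives the integral of \<open>|Tf| u\<close> over \<open>G'\<close>, which is at least \<open>y u(G')\<close>.
  The sets \<open>G\<close> to be treated are level sets of \<open>Tf\<close>, cut down such that they and the values of \<open>u\<close> on them
  are bounded.
  As \<open>form\<close> only speaks of test functions, \<open>h\<close> is replaced by test functions \<open>g m\<close> that converge to it
  almost everywhere and boundedly. The sparse families in the form depend on \<open>g m\<close>, so that no limit can be taken in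
  the form. Instead \<open>|g m|\<close> is bounded by \<open>|h|\<close>, a small multiple of the indicator of a fixed box, and a
  multiple of the indicator of a set \<open>Z m\<close> whose volume tends to 0; the last two contribute little by
  \<open>unweighted_form_bound\<close>, whichever the sparse family. For the same reason \<open>FB\<close> asks for \<open>G'\<close> before
  \<open>h\<close> and the sparse family.\<close>

lemma weak_type_of_form_bound:
  fixes f Tf :: "real ^ 'n \<Rightarrow> 'k::{real_normed_field, euclidean_space}"
  assumes u: "locally_finite_weight u" and f: "f \<in> test_functions"
    and Tf: "Tf \<in> borel_measurable lebesgue" "\<And>K. compact K \<Longrightarrow> Tf absolutely_integrable_on K"
    and e: "1 \<le> p\<^sub>0" "0 \<le> i" "i < 1" "0 \<le> \<beta>" "\<beta> + i < 1 / p\<^sub>0" "r = 1 / (1 - i)" and \<eta>: "0 < \<eta>" and A: "0 \<le> A"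
    and form: "\<And>g Y. g \<in> test_functions \<Longrightarrow> 0 \<le> Y \<Longrightarrow> (\<And>S S0. sparse \<eta> S \<Longrightarrow> finite S0 \<Longrightarrow> S0 \<subseteq> S \<Longrightarrow>
        (\<Sum>Q\<in>S0. pavg p\<^sub>0 \<beta> f Q * pavg r 1 g Q) \<le> Y) \<Longrightarrow> norm (\<integral>x. Tf x * g x \<partial>lebesgue) \<le> A * Y"
    and FB: "\<And>G. G \<in> sets lebesgue \<Longrightarrow> bounded G \<Longrightarrow> 0 < wvol u G \<Longrightarrow> \<exists>G'\<subseteq>G. G' \<in> sets lebesgue \<and> wvol u G \<le> 2 * wvol u G' \<and>
        (\<forall>h :: real ^ 'n \<Rightarrow> 'k. h \<in> borel_measurable lebesgue \<longrightarrow> (\<exists>M. \<forall>x. norm (h x) \<le> M) \<longrightarrow> (\<forall>x. norm (h x) \<le> indicator G' x * u x) \<longrightarrow>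
          (\<forall>S S0. sparse \<eta> S \<longrightarrow> finite S0 \<longrightarrow> S0 \<subseteq> S \<longrightarrow> (\<Sum>Q\<in>S0. pavg p\<^sub>0 \<beta> f Q * pavg r 1 h Q) \<le> X * wvol u G powr (1 - 1 / q)))"
    and X: "0 \<le> X" and q: "1 \<le> q" and y: "0 < y"
  shows "ennreal y * epow (wmeas u {x. y < norm (Tf x)}) (1 / q) \<le> ennreal (4 * A * X)"
proof -
  note [measurable] = Tf(1) lfw_meas[OF u]
  have r1: "1 \<le> r" using e by simp
  obtain F Bd where Fb: "f \<in> borel_measurable lebesgue" "\<forall>x. norm (f x) \<le> F" "Bd \<in> sets lebesgue" "bounded Bd" "\<forall>x. x \<notin> Bd \<longrightarrow> f x = 0"
    by (rule test_function_facts[OF f])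
  define G where "G n = {x. y < norm (Tf x) \<and> (\<forall>j. \<bar>x $ j\<bar> < real n + 1) \<and> u x \<le> real n + 1}" for n :: nat
  define Bx where "Bx l = {x :: real ^ 'n. \<forall>j. \<bar>x $ j\<bar> < l}" for l :: real
  have BxB: "Bx l \<subseteq> cbox (\<chi> i. - l) (\<chi> i. l)" for l
    by (auto simp: Bx_def mem_box_cart abs_less_iff) (smt (verit))+
  have Bxs: "Bx l \<in> sets lebesgue" for l
  proof -
    have "Bx l = {x. \<forall>j\<in>UNIV. \<bar>x $ j\<bar> < l}" by (simp add: Bx_def)
    also have "\<dots> \<in> sets borel" by measurable
    finally show ?thesis by (metis sets_completionI_sets sets_lborel)
  qed
  have Bxb: "bounded (Bx l)" for l using BxB bounded_cbox bounded_subset by blast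
  have Gs: "G n \<in> sets lebesgue" for n
  proof -
    have "{x \<in> space lebesgue. y < norm (Tf x) \<and> u x \<le> real n + 1} \<in> sets lebesgue" by measurable
    moreover have "G n = {x \<in> space lebesgue. y < norm (Tf x) \<and> u x \<le> real n + 1} \<inter> Bx (real n + 1)" by (auto simp: G_def Bx_def)
    ultimately show ?thesis using Bxs by auto
  qed
  have GB: "G n \<subseteq> Bx (real n + 1)" for n by (auto simp: G_def Bx_def)
  have Gb: "bounded (G n)" for n using GB Bxb bounded_subset by blast
  have main: "y * wvol u (G n) powr (1 / q) \<le> 4 * A * X" for n
  proof (cases "wvol u (G n) = 0")
    case True
    then show ?thesis using A X by simp
  next
    case False
    then have g0: "0 < wvol u (G n)" using wvol_nonneg[OF u, of "G n"] by simp
    define l where "l = real n + 1"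
    have l: "0 < l" by (simp add: l_def)
    obtain G' where G': "G' \<subseteq> G n" "G' \<in> sets lebesgue" "wvol u (G n) \<le> 2 * wvol u G'"
      and FB': "\<And>h :: real ^ 'n \<Rightarrow> 'k. h \<in> borel_measurable lebesgue \<Longrightarrow> \<exists>M. \<forall>x. norm (h x) \<le> M \<Longrightarrow> \<forall>x. norm (h x) \<le> indicator G' x * u x \<Longrightarrow>
          (\<forall>S S0. sparse \<eta> S \<longrightarrow> finite S0 \<longrightarrow> S0 \<subseteq> S \<longrightarrow> (\<Sum>Q\<in>S0. pavg p\<^sub>0 \<beta> f Q * pavg r 1 h Q) \<le> X * wvol u (G n) powr (1 - 1 / q))"
      using FB[OF Gs Gb g0] by blast
    note [measurable] = G'(2)
    define Xh where "Xh = X * wvol u (G n) powr (1 - 1 / q)"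
    have Xh0: "0 \<le> Xh" using X by (simp add: Xh_def)
    \<comment> \<open>A normed field need not have a conjugation; \<open>|z| / z\<close> is the inverse phase, and 0 for \<open>z = 0\<close>.\<close>
    define h where "h x = (indicator G' x * u x * norm (Tf x)) *\<^sub>R inverse (Tf x)" for x
    have hm: "h \<in> borel_measurable lebesgue" unfolding h_def by measurable
    have u0: "0 \<le> u x" for x by (rule lfw_nonneg[OF u])
    have hu: "norm (h x) \<le> indicator G' x * u x" for x
      using u0[of x] by (cases "Tf x = 0") (auto simp: h_def norm_inverse indicator_def mult.assoc)
    have hl: "norm (h x) \<le> l" for x
    proof -
      have "indicator G' x * u x \<le> l" using G'(1) l u0[of x] by (auto simp: G_def l_def indicator_def)
      then show ?thesis using hu[of x] by linarith
    qed
    have h0: "h x = 0" if "l \<le> \<bar>x $ j\<bar>" for x j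
    proof -
      have "x \<notin> G'"
      proof
        assume "x \<in> G'"
        then have "\<forall>j. \<bar>x $ j\<bar> < l" using G'(1) by (auto simp: G_def l_def)
        then show False using that by (meson not_less)
      qed
      then show ?thesis by (simp add: h_def)
    qed
    have "\<exists>g. (\<forall>m. g m \<in> test_functions) \<and> (\<forall>m x. norm (g m x) \<le> l + 1) \<and> (\<forall>m x j. l \<le> \<bar>x $ j\<bar> \<longrightarrow> g m x = 0) \<and>
       (AE x in lebesgue. (\<lambda>m. g m x) \<longlonglongrightarrow> h x)"
      by (rule test_function_approximation[OF hm hl l]) (rule h0)
    then obtain g where g: "\<forall>m. g m \<in> test_functions" "\<forall>m x. norm (g m x) \<le> l + 1"
      "\<forall>m x j. l \<le> \<bar>x $ j\<bar> \<longrightarrow> g m x = 0" and gh: "AE x in lebesgue. (\<lambda>m. g m x) \<longlonglongrightarrow> h x"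
      by (elim exE conjE)
    have gt: "g m \<in> test_functions" and gl: "norm (g m x) \<le> l + 1" for m x using g(1,2) by blast+
    have g0': "g m x = 0" if "l \<le> \<bar>x $ j\<bar>" for m x j using g(3) that by blast
    have gm [measurable]: "g m \<in> borel_measurable lebesgue" for m by (rule test_function_facts[OF gt[of m]])
    note [measurable] = hm
    define K :: "(real ^ 'n) set" where "K = cbox (\<chi> i. - l) (\<chi> i. l)"
    have Kc: "compact K" by (simp add: K_def)
    have outK: "g m x = 0" "h x = 0" if "x \<notin> Bx l" for m x using that g0' h0 by (auto simp: Bx_def not_less)
    have BK: "Bx l \<subseteq> K" using BxB by (simp add: K_def)
    have Ti: "integrable lebesgue (\<lambda>x. indicator K x *\<^sub>R Tf x)" using Tf(2)[OF Kc] by (simp add: set_integrable_def)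
    have lim: "(\<lambda>m. \<integral>x. Tf x * g m x \<partial>lebesgue) \<longlonglongrightarrow> (\<integral>x. Tf x * h x \<partial>lebesgue)"
    proof (rule integral_dominated_convergence)
      show "integrable lebesgue (\<lambda>x. (l + 1) * norm (indicator K x *\<^sub>R Tf x))" by (intro integrable_mult_right integrable_norm Ti)
      show "AE x in lebesgue. (\<lambda>m. Tf x * g m x) \<longlonglongrightarrow> Tf x * h x" using gh by eventually_elim (intro tendsto_intros)
      show "AE x in lebesgue. norm (Tf x * g m x) \<le> (l + 1) * norm (indicator K x *\<^sub>R Tf x)" for m
      proof (rule AE_I2)
        fix x
        show "norm (Tf x * g m x) \<le> (l + 1) * norm (indicator K x *\<^sub>R Tf x)"
        proof (cases "x \<in> K")
          case True
          then show ?thesis using mult_right_mono[OF gl[of m x] norm_ge_zero[of "Tf x"]] by (simp add: norm_mult mult.commute)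
        next
          case False
          then show ?thesis using outK(1)[of x m] BK l by auto
        qed
      qed
    qed measurable
    define \<phi> where "\<phi> x = indicator G' x * u x * norm (Tf x)" for x
    have \<phi>0: "0 \<le> \<phi> x" for x using u0 by (simp add: \<phi>_def)
    have \<phi>i: "integrable lebesgue \<phi>"
    proof (rule Bochner_Integration.integrable_bound[where f = "\<lambda>x. l * norm (indicator K x *\<^sub>R Tf x)"])
      show "integrable lebesgue (\<lambda>x. l * norm (indicator K x *\<^sub>R Tf x))" by (intro integrable_mult_right integrable_norm Ti)
      show "\<phi> \<in> borel_measurable lebesgue" unfolding \<phi>_def by measurable
      show "AE x in lebesgue. norm (\<phi> x) \<le> norm (l * norm (indicator K x *\<^sub>R Tf x))"
      proof (rule AE_I2)
        fix x
        show "norm (\<phi> x) \<le> norm (l * norm (indicator K x *\<^sub>R Tf x))"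
        proof (cases "x \<in> G'")
          case True
          then have xG: "x \<in> G n" using G'(1) by blast
          then have "x \<in> K" using GB[of n] BK unfolding l_def by blast
          moreover have "u x \<le> l" using xG by (simp add: l_def G_def)
          ultimately have "x \<in> K" "u x \<le> l" by auto
          then show ?thesis using True u0[of x] l by (auto simp: \<phi>_def abs_mult intro!: mult_right_mono)
        qed (use l in \<open>auto simp: \<phi>_def\<close>)
      qed
    qed
    have TH: "(\<integral>x. Tf x * h x \<partial>lebesgue) = (\<integral>x. \<phi> x \<partial>lebesgue) *\<^sub>R 1"
    proof -
      have "Tf x * h x = \<phi> x *\<^sub>R 1" for x by (cases "Tf x = 0") (auto simp: h_def \<phi>_def)
      then show ?thesis using \<phi>i by simp
    qed
    have yG: "y * wvol u G' \<le> (\<integral>x. \<phi> x \<partial>lebesgue)"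
    proof -
      have "ennreal (y * wvol u G') = ennreal y * wmeas u G'"
        using y wmeas_eq_wvol[OF u G'(2) bounded_subset[OF Gb G'(1)]] by (simp add: ennreal_mult wvol_nonneg[OF u])
      also have "\<dots> = (\<integral>\<^sup>+x. ennreal y * (ennreal (u x) * indicator G' x) \<partial>lebesgue)"
        unfolding wmeas_def by (rule nn_integral_cmult[symmetric]) measurable
      also have "\<dots> \<le> (\<integral>\<^sup>+x. ennreal (\<phi> x) \<partial>lebesgue)"
      proof (intro nn_integral_mono)
        fix x
        show "ennreal y * (ennreal (u x) * indicator G' x) \<le> ennreal (\<phi> x)"
        proof (cases "x \<in> G'")
          case True
          then have "y \<le> norm (Tf x)" using G'(1) by (auto simp: G_def)
          then have "y * u x \<le> norm (Tf x) * u x" using u0 by (intro mult_right_mono) auto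
          then show ?thesis using True y u0[of x] by (auto simp: \<phi>_def ennreal_mult[symmetric] mult.commute intro!: ennreal_leI)
        qed simp
      qed
      also have "\<dots> = ennreal (\<integral>x. \<phi> x \<partial>lebesgue)" by (rule nn_integral_eq_integral[OF \<phi>i]) (simp add: \<phi>0)
      finally show ?thesis by (subst (asm) ennreal_le_iff) (auto intro: integral_nonneg_AE simp: \<phi>0)
    qed
    have "\<exists>X \<sigma>. 0 \<le> X \<and> 0 < \<sigma> \<and> (\<forall>S S0 Z. sparse \<eta> S \<longrightarrow> finite S0 \<longrightarrow> S0 \<subseteq> S \<longrightarrow> Z \<in> sets lebesgue \<longrightarrow> Z \<subseteq> Bx l \<longrightarrow>
        (\<Sum>Q\<in>S0. pavg p\<^sub>0 \<beta> f Q * pavg r 1 (indicator Z :: _ \<Rightarrow> real) Q) \<le> X * measure lebesgue Z powr \<sigma>)"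
      by (rule unweighted_form_bound[OF Fb(1) Fb(2)[rule_format] Fb(3,4) _ Bxs Bxb e \<eta>]) (use Fb(5) in blast)
    then obtain X1 \<sigma> where X1: "0 \<le> X1" "0 < \<sigma>" and UF0: "\<forall>S S0 Z. sparse \<eta> S \<longrightarrow> finite S0 \<longrightarrow> S0 \<subseteq> S \<longrightarrow> Z \<in> sets lebesgue \<longrightarrow> Z \<subseteq> Bx l \<longrightarrow>
        (\<Sum>Q\<in>S0. pavg p\<^sub>0 \<beta> f Q * pavg r 1 (indicator Z :: _ \<Rightarrow> real) Q) \<le> X1 * measure lebesgue Z powr \<sigma>"
      by (elim exE conjE)
    have UF: "(\<Sum>Q\<in>S0. pavg p\<^sub>0 \<beta> f Q * pavg r 1 (indicator Z :: _ \<Rightarrow> real) Q) \<le> X1 * measure lebesgue Z powr \<sigma>"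
      if "sparse \<eta> S" "finite S0" "S0 \<subseteq> S" "Z \<in> sets lebesgue" "Z \<subseteq> Bx l" for S S0 Z
      using UF0 that by (elim allE impE) assumption+
    have est: "norm (\<integral>x. Tf x * h x \<partial>lebesgue) \<le> A * (2 * Xh + 4 * (\<epsilon> * (X1 * measure lebesgue (Bx l) powr \<sigma>)))" if \<epsilon>: "0 < \<epsilon>" for \<epsilon>
    proof -
      define Z where "Z m = {x. \<epsilon> < norm (g m x - h x)}" for m
      have Zs [measurable]: "Z m \<in> sets lebesgue" for m
      proof -
        have "{x \<in> space lebesgue. \<epsilon> < norm (g m x - h x)} \<in> sets lebesgue" by measurable
        then show ?thesis by (simp add: Z_def)
      qed
      have ZB: "Z m \<subseteq> Bx l" for m using outK \<epsilon> by (fastforce simp: Z_def)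
      have Bl: "Bx l \<in> lmeasurable" by (rule bounded_set_imp_lmeasurable[OF Bxb Bxs])
      have Zl: "Z m \<in> lmeasurable" for m using bounded_set_imp_lmeasurable[OF bounded_subset[OF Bxb ZB] Zs] .
      have Z0: "(\<lambda>m. measure lebesgue (Z m)) \<longlonglongrightarrow> 0"
      proof -
        have "(\<lambda>m. \<integral>x. indicator (Z m) x \<partial>lebesgue) \<longlonglongrightarrow> (\<integral>x. (0::real) \<partial>(lebesgue :: (real ^ 'n) measure))"
        proof (rule integral_dominated_convergence[where w = "indicator (Bx l)" and s = "\<lambda>m. indicator (Z m)" and f = "\<lambda>_. 0 :: real"])
          show "integrable lebesgue (indicator (Bx l) :: _ \<Rightarrow> real)" using Bl Bxs by (simp add: fmeasurable_def)
          show "AE x in lebesgue. (\<lambda>m. indicator (Z m) x :: real) \<longlonglongrightarrow> 0" using gh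
          proof eventually_elim
            fix x assume "(\<lambda>m. g m x) \<longlonglongrightarrow> h x"
            then have "\<forall>\<^sub>F m in sequentially. dist (g m x) (h x) < \<epsilon>" using \<epsilon> by (rule tendstoD)
            then have "\<forall>\<^sub>F m in sequentially. indicator (Z m) x = (0::real)"
              by eventually_elim (auto simp: Z_def dist_norm)
            then show "(\<lambda>m. indicator (Z m) x :: real) \<longlonglongrightarrow> 0" by (rule tendsto_eventually)
          qed
          show "AE x in lebesgue. norm (indicator (Z m) x :: real) \<le> indicator (Bx l) x" for m
            using ZB[of m] by (intro AE_I2) (auto simp: indicator_def)
        qed measurable
        then show ?thesis using Zl by simp
      qed
      have bound: "norm (\<integral>x. Tf x * g m x \<partial>lebesgue) \<le> A * (2 * Xh + 4 * (\<epsilon> * (X1 * measure lebesgue (Bx l) powr \<sigma>)) + 4 * ((2 * l + 1) * (X1 * measure lebesgue (Z m) powr \<sigma>)))" for m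
      proof (rule form[OF gt])
        show "0 \<le> 2 * Xh + 4 * (\<epsilon> * (X1 * measure lebesgue (Bx l) powr \<sigma>)) + 4 * ((2 * l + 1) * (X1 * measure lebesgue (Z m) powr \<sigma>))"
          using Xh0 X1 \<epsilon> l by simp
        fix S S0 :: "(real ^ 'n) set set" assume S: "sparse \<eta> S" "finite S0" "S0 \<subseteq> S"
        have Sc: "Q \<in> cubes" if "Q \<in> S0" for Q
        proof -
          obtain D where "dyadic_grid D" "S \<subseteq> D" using S(1) unfolding sparse_def by blast
          then show ?thesis using dyadic_grid_facts(2) that S(3) by blast
        qed
        have p1: "pavg r 1 (g m) Q \<le> 2 * pavg r 1 h Q + 4 * (\<epsilon> * pavg r 1 (indicator (Bx l) :: _ \<Rightarrow> real) Q) + 4 * ((2 * l + 1) * pavg r 1 (indicator (Z m) :: _ \<Rightarrow> real) Q)"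
          if Q: "Q \<in> cubes" for Q
        proof -
          have lin: "x \<le> 2 * h + 4 * a + 4 * b" if "x \<le> 2 * (h' + e)" "h' = h" "e \<le> 2 * (a' + b')" "a' = a" "b' = b"
            for x h h' e a a' b b' :: real
          proof -
            have "x \<le> 2 * (h' + e)" by (rule that(1))
            also have "\<dots> \<le> 2 * (h + 2 * (a + b))" using that by (intro mult_left_mono add_mono) auto
            also have "\<dots> = 2 * h + 4 * a + 4 * b" by (simp add: algebra_simps)
            finally show ?thesis .
          qed
          have "pavg r 1 (g m) Q \<le> 2 * (pavg r 1 (\<lambda>x. norm (h x)) Q + pavg r 1 (\<lambda>x. norm (g m x - h x)) Q)"
          proof (rule pavg_le_add)
            show "norm (g m x) \<le> norm (h x) + norm (g m x - h x)" for x by (rule norm_triangle_sub)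
            show "(\<integral>\<^sup>+x\<in>Q. ennreal (norm (norm (h x)) powr r) \<partial>lebesgue) < \<infinity>"
              by (rule power_integral_finite[where F = l]) (use hl Q r1 in auto)
            show "(\<integral>\<^sup>+x\<in>Q. ennreal (norm (norm (g m x - h x)) powr r) \<partial>lebesgue) < \<infinity>"
            proof (rule power_integral_finite[where F = "2 * l + 1"])
              show "norm (norm (g m x - h x)) \<le> 2 * l + 1" for x using norm_triangle_ineq4[of "g m x" "h x"] gl[of m x] hl[of x] by simp
            qed (use Q r1 in auto)
          qed (use Q r1 in auto)
          moreover have "pavg r 1 (\<lambda>x. norm (h x)) Q = pavg r 1 h Q" by (simp add: pavg_def)
          moreover have "pavg r 1 (\<lambda>x. norm (g m x - h x)) Q \<le> 2 * (pavg r 1 (\<lambda>x. \<epsilon> * indicator (Bx l) x) Q + pavg r 1 (\<lambda>x. (2 * l + 1) * indicator (Z m) x) Q)"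
          proof (rule pavg_le_add)
            show "norm (norm (g m x - h x)) \<le> \<epsilon> * indicator (Bx l) x + (2 * l + 1) * indicator (Z m) x" for x
            proof (cases "x \<in> Z m")
              case True
              then show ?thesis using norm_triangle_ineq4[of "g m x" "h x"] gl[of m x] hl[of x] \<epsilon> l by (auto simp: indicator_def)
            next
              case False
              then show ?thesis using outK(1)[of x m] outK(2)[of x] by (cases "x \<in> Bx l") (auto simp: Z_def)
            qed
            show "(\<integral>\<^sup>+x\<in>Q. ennreal (norm (\<epsilon> * indicator (Bx l) x :: real) powr r) \<partial>lebesgue) < \<infinity>"
              by (rule power_integral_finite[where F = \<epsilon>]) (use \<epsilon> Q r1 in \<open>auto simp: indicator_def\<close>)
            show "(\<integral>\<^sup>+x\<in>Q. ennreal (norm ((2 * l + 1) * indicator (Z m) x :: real) powr r) \<partial>lebesgue) < \<infinity>"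
              by (rule power_integral_finite[where F = "2 * l + 1"]) (use l Q r1 in \<open>auto simp: indicator_def\<close>)
          qed (use Q r1 \<epsilon> l Bxs Zs in auto)
          moreover have "pavg r 1 (\<lambda>x. \<epsilon> * indicator (Bx l) x) Q = \<epsilon> * pavg r 1 (indicator (Bx l) :: _ \<Rightarrow> real) Q"
            using \<epsilon> Bxs Q r1 by (intro pavg_cmult) auto
          moreover have "pavg r 1 (\<lambda>x. (2 * l + 1) * indicator (Z m) x) Q = (2 * l + 1) * pavg r 1 (indicator (Z m) :: _ \<Rightarrow> real) Q"
            using l Zs Q r1 by (intro pavg_cmult) auto
          ultimately show ?thesis by (rule lin)
        qed
        have "(\<Sum>Q\<in>S0. pavg p\<^sub>0 \<beta> f Q * pavg r 1 (g m) Q)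
          \<le> (\<Sum>Q\<in>S0. pavg p\<^sub>0 \<beta> f Q * (2 * pavg r 1 h Q + 4 * (\<epsilon> * pavg r 1 (indicator (Bx l) :: _ \<Rightarrow> real) Q) + 4 * ((2 * l + 1) * pavg r 1 (indicator (Z m) :: _ \<Rightarrow> real) Q)))"
          by (intro sum_mono mult_left_mono p1 Sc pavg_nonneg)
        also have "\<dots> = 2 * (\<Sum>Q\<in>S0. pavg p\<^sub>0 \<beta> f Q * pavg r 1 h Q)
           + 4 * (\<epsilon> * (\<Sum>Q\<in>S0. pavg p\<^sub>0 \<beta> f Q * pavg r 1 (indicator (Bx l) :: _ \<Rightarrow> real) Q))
           + 4 * ((2 * l + 1) * (\<Sum>Q\<in>S0. pavg p\<^sub>0 \<beta> f Q * pavg r 1 (indicator (Z m) :: _ \<Rightarrow> real) Q))"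
          unfolding sum_distrib_left sum.distrib[symmetric] by (intro sum.cong refl) (simp add: algebra_simps)
        also have "\<dots> \<le> 2 * Xh + 4 * (\<epsilon> * (X1 * measure lebesgue (Bx l) powr \<sigma>)) + 4 * ((2 * l + 1) * (X1 * measure lebesgue (Z m) powr \<sigma>))"
        proof (intro add_mono mult_left_mono)
          show "(\<Sum>Q\<in>S0. pavg p\<^sub>0 \<beta> f Q * pavg r 1 h Q) \<le> Xh" unfolding Xh_def
            using FB'[OF hm] hl hu S by blast
        qed (use UF[OF S] Bxs Zs ZB \<epsilon> l in auto)
        finally show "(\<Sum>Q\<in>S0. pavg p\<^sub>0 \<beta> f Q * pavg r 1 (g m) Q)
          \<le> 2 * Xh + 4 * (\<epsilon> * (X1 * measure lebesgue (Bx l) powr \<sigma>)) + 4 * ((2 * l + 1) * (X1 * measure lebesgue (Z m) powr \<sigma>))" .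
      qed
      have "(\<lambda>m. A * (2 * Xh + 4 * (\<epsilon> * (X1 * measure lebesgue (Bx l) powr \<sigma>)) + 4 * ((2 * l + 1) * (X1 * measure lebesgue (Z m) powr \<sigma>))))
         \<longlonglongrightarrow> A * (2 * Xh + 4 * (\<epsilon> * (X1 * measure lebesgue (Bx l) powr \<sigma>)) + 4 * ((2 * l + 1) * (X1 * 0 powr \<sigma>)))"
        using X1 by (intro tendsto_intros tendsto_powr' Z0) auto
      from LIMSEQ_le[OF tendsto_norm[OF lim] this] bound show ?thesis by auto
    qed
    have "norm (\<integral>x. Tf x * h x \<partial>lebesgue) \<le> A * (2 * Xh)"
    proof (rule field_le_epsilon)
      fix d :: real assume d: "0 < d"
      define c where "c = A * (4 * (X1 * measure lebesgue (Bx l) powr \<sigma>))"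
      have c0: "0 \<le> c" using A X1 by (simp add: c_def)
      have "norm (\<integral>x. Tf x * h x \<partial>lebesgue) \<le> A * (2 * Xh) + d / (c + 1) * c"
        using est[of "d / (c + 1)"] d c0 by (simp add: c_def algebra_simps)
      also have "d / (c + 1) * c \<le> d" using d c0 by (simp add: field_simps)
      finally show "norm (\<integral>x. Tf x * h x \<partial>lebesgue) \<le> A * (2 * Xh) + d" by simp
    qed
    moreover have "norm (\<integral>x. Tf x * h x \<partial>lebesgue) = (\<integral>x. \<phi> x \<partial>lebesgue)"
    proof -
      have "0 \<le> (\<integral>x. \<phi> x \<partial>lebesgue)" by (rule integral_nonneg_AE) (simp add: \<phi>0)
      then show ?thesis by (simp add: TH)
    qed
    ultimately have "y * wvol u G' \<le> 2 * A * Xh" using yG by simp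
    moreover have "y * wvol u (G n) \<le> 2 * (y * wvol u G')" using G'(3) y by simp
    ultimately have "y * wvol u (G n) \<le> 4 * A * X * wvol u (G n) powr (1 - 1 / q)" by (simp add: Xh_def)
    moreover have "wvol u (G n) = wvol u (G n) powr (1 / q) * wvol u (G n) powr (1 - 1 / q)"
      using g0 by (simp add: powr_add[symmetric])
    ultimately have "y * wvol u (G n) powr (1 / q) * wvol u (G n) powr (1 - 1 / q) \<le> 4 * A * X * wvol u (G n) powr (1 - 1 / q)"
      by (simp add: mult.assoc)
    then show ?thesis using g0 by simp
  qed
  define Lv where "Lv = {x. y < norm (Tf x)}"
  have "wmeas u Lv \<le> ennreal ((4 * A * X / y) powr q)"
  proof -
    let ?M = "density lebesgue (\<lambda>x. ennreal (u x))"
    have Lvs: "Lv \<in> sets lebesgue"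
    proof -
      have "{x \<in> space lebesgue. y < norm (Tf x)} \<in> sets lebesgue" by measurable
      then show ?thesis by (simp add: Lv_def)
    qed
    have inc: "incseq G" by (auto simp: incseq_def G_def intro: less_le_trans order_trans)
    have UG: "(\<Union>n. G n) = Lv"
    proof
      show "Lv \<subseteq> (\<Union>n. G n)"
      proof
        fix x assume x: "x \<in> Lv"
        obtain n :: nat where n: "u x + norm x < real n" using reals_Archimedean2 by blast
        have "\<bar>x $ j\<bar> < real n + 1" for j using component_le_norm_cart[of x j] n lfw_nonneg[OF u, of x] by linarith
        moreover have "u x \<le> real n + 1" using n norm_ge_zero[of x] by linarith
        ultimately have "x \<in> G n" using x by (auto simp: G_def Lv_def)
        then show "x \<in> (\<Union>n. G n)" by blast
      qed
    qed (auto simp: G_def Lv_def)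
    have "(\<lambda>n. emeasure ?M (G n)) \<longlonglongrightarrow> emeasure ?M (\<Union>n. G n)"
      using inc Gs by (intro Lim_emeasure_incseq) auto
    moreover have "emeasure ?M (G n) \<le> ennreal ((4 * A * X / y) powr q)" for n
    proof -
      have "wvol u (G n) = (wvol u (G n) powr (1 / q)) powr q" using q wvol_nonneg[OF u] by (simp add: powr_powr)
      also have "\<dots> \<le> (4 * A * X / y) powr q" using main[of n] q y by (intro powr_mono2) (auto simp: field_simps)
      finally show ?thesis
        using wmeas_eq_wvol[OF u Gs Gb, of n] wmeas_eq_emeasure[OF lfw_meas[OF u] Gs, of n] by (simp add: ennreal_leI)
    qed
    ultimately have "emeasure ?M (\<Union>n. G n) \<le> ennreal ((4 * A * X / y) powr q)" by (intro LIMSEQ_le_const2) auto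
    then show ?thesis using wmeas_eq_emeasure[OF lfw_meas[OF u] Lvs] UG by simp
  qed
  then have "epow (wmeas u Lv) (1 / q) \<le> epow (ennreal ((4 * A * X / y) powr q)) (1 / q)" using q by (intro epow_mono) auto
  also have "\<dots> = ennreal (4 * A * X / y)" using A X q y by (simp add: epow_ennreal powr_powr)
  finally have "ennreal y * epow (wmeas u Lv) (1 / q) \<le> ennreal y * ennreal (4 * A * X / y)" by (rule mult_left_mono) simp
  also have "\<dots> = ennreal (4 * A * X)" using y A X by (simp add: ennreal_mult[symmetric])
  finally show ?thesis by (simp add: Lv_def)
qed

section \<open>Consequences of the weight conditions\<close>

lemma locally_integrable_measurable:
  fixes f :: "real ^ 'n \<Rightarrow> 'k::euclidean_space"
  assumes "locally_integrable f" shows "f \<in> borel_measurable lebesgue"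
proof (rule borel_measurable_LIMSEQ_metric)
  define K :: "nat \<Rightarrow> (real ^ 'n) set" where "K n = cball 0 (real n)" for n
  show "(\<lambda>x. indicator (K n) x *\<^sub>R f x) \<in> borel_measurable lebesgue" for n
  proof -
    have "f absolutely_integrable_on K n" using assms by (simp add: locally_integrable_def K_def)
    then show ?thesis by (simp add: set_integrable_def borel_measurable_integrable)
  qed
  fix x :: "real ^ 'n"
  obtain m :: nat where m: "norm x \<le> real m" using real_arch_simple by blast
  have "\<forall>\<^sub>F n in sequentially. indicator (K n) x *\<^sub>R f x = f x"
    using eventually_ge_at_top[of m] by eventually_elim (use m in \<open>auto simp: K_def\<close>)
  then show "(\<lambda>n. indicator (K n) x *\<^sub>R f x) \<longlonglongrightarrow> f x" by (rule tendsto_eventually)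
qed

lemma weight_locally_finite:
  fixes \<omega> :: "real ^ 'n \<Rightarrow> real"
  assumes "weight \<omega>" shows "locally_finite_weight \<omega>"
proof -
  have m: "\<omega> \<in> borel_measurable lebesgue" and nn: "0 \<le> \<omega> x" for x
    using assms locally_integrable_measurable by (auto simp: weight_def)
  have "wmeas \<omega> E < \<infinity>" if E: "E \<in> sets lebesgue" "bounded E" for E
  proof -
    obtain a where a: "E \<subseteq> cbox (- a) a" using bounded_subset_cbox_symmetric[OF E(2)] by blast
    have "\<omega> absolutely_integrable_on cbox (- a) a" using assms by (simp add: weight_def locally_integrable_def)
    then have "integrable lebesgue (\<lambda>x. indicator (cbox (- a) a) x *\<^sub>R \<omega> x)" by (simp add: set_integrable_def)
    then have f: "(\<integral>\<^sup>+x. ennreal (norm (indicator (cbox (- a) a) x *\<^sub>R \<omega> x)) \<partial>lebesgue) < \<infinity>"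
      by (simp add: integrable_iff_bounded)
    have "wmeas \<omega> E \<le> (\<integral>\<^sup>+x. ennreal (norm (indicator (cbox (- a) a) x *\<^sub>R \<omega> x)) \<partial>lebesgue)"
      unfolding wmeas_def using a nn by (intro nn_integral_mono) (auto simp: indicator_def)
    then show ?thesis using f by (rule order_le_less_trans)
  qed
  then show ?thesis using m nn by (simp add: locally_finite_weight_def)
qed

lemma locally_finite_wpow_le:
  assumes q: "locally_finite_weight (wpow w q)" and w: "w \<in> borel_measurable lebesgue" "\<And>x. 0 \<le> w x" and pq: "0 \<le> p" "p \<le> q"
  shows "locally_finite_weight (wpow w p)"
proof -
  note [measurable] = w(1)
  have "wmeas (wpow w p) E < \<infinity>" if E: "E \<in> sets lebesgue" "bounded E" for E
  proof -
    note [measurable] = E(1)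
    have "wmeas (wpow w p) E \<le> (\<integral>\<^sup>+x. ennreal 1 * indicator E x + ennreal (wpow w q x) * indicator E x \<partial>lebesgue)"
      unfolding wmeas_def
    proof (intro nn_integral_mono)
      fix x
      have "w x powr p \<le> 1 + w x powr q"
      proof (cases "w x \<le> 1")
        case True
        then have "w x powr p \<le> 1" using w(2) pq by (intro powr_le1) auto
        then show ?thesis by (smt (verit) powr_ge_zero)
      next
        case False
        then have "w x powr p \<le> w x powr q" using pq by (intro powr_mono) auto
        then show ?thesis by simp
      qed
      then have "ennreal (w x powr p) \<le> ennreal 1 + ennreal (w x powr q)"
        by (metis ennreal_leI ennreal_plus powr_ge_zero zero_le_one)
      then show "ennreal (wpow w p x) * indicator E x \<le> ennreal 1 * indicator E x + ennreal (wpow w q x) * indicator E x"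
        by (auto simp: indicator_def wpow_def)
    qed
    also have "\<dots> = wmeas (\<lambda>_. 1) E + wmeas (wpow w q) E"
      unfolding wmeas_def using lfw_meas[OF q] by (subst nn_integral_add) auto
    also have "\<dots> < \<infinity>" using wmeas_eq_wvol[OF locally_finite_weight_one E] wmeas_eq_wvol[OF q E] by simp
    finally show ?thesis .
  qed
  moreover have "wpow w p \<in> borel_measurable lebesgue" unfolding wpow_def by measurable
  ultimately show ?thesis by (simp add: locally_finite_weight_def wpow_def)
qed

text \<open>The quotient in \<open>AR_const\<close>, cleared of denominators. If \<open>|E|\<close> and \<open>u(Q)\<close> are positive, then so is \<open>v(E)\<close>,
  because the quotient would be infinite otherwise.\<close>

lemma AR_inequality:
  fixes w :: "real ^ 'n \<Rightarrow> real"
  assumes u: "locally_finite_weight (wpow w q)" and v: "locally_finite_weight (wpow w p)"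
    and e: "1 \<le> p\<^sub>0" "p\<^sub>0 \<le> p" "p \<le> q" and K: "AR_const (p / p\<^sub>0) (q / p\<^sub>0) (wpow w p\<^sub>0) = ennreal K" "0 \<le> K"
    and Q: "Q \<in> cubes" and E: "E \<in> sets lebesgue" "E \<subseteq> Q"
  shows "measure lebesgue E powr (1 / p\<^sub>0) * measure lebesgue Q powr (1 / p - 1 / q - 1 / p\<^sub>0) * wvol (wpow w q) Q powr (1 / q)
    \<le> K powr (1 / p\<^sub>0) * wvol (wpow w p) E powr (1 / p)"
proof (cases "measure lebesgue E = 0 \<or> wvol (wpow w q) Q = 0")
  case True
  then show ?thesis by auto
next
  case False
  define m where "m = measure lebesgue Q"
  define t where "t = measure lebesgue E"
  define U where "U = wvol (wpow w q) Q"
  define V where "V = wvol (wpow w p) E"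
  have pos: "0 < p\<^sub>0" "0 < p" "0 < q" using e by auto
  note Qf = cube_facts[OF Q]
  have Eb: "bounded E" using E Qf bounded_subset by blast
  have m: "0 < m" "emeasure lebesgue Q = ennreal m" using Qf by (auto simp: m_def)
  have El: "E \<in> lmeasurable" by (rule bounded_set_imp_lmeasurable[OF Eb E(1)])
  have t: "0 < t" "emeasure lebesgue E = ennreal t"
    using False El by (auto simp: t_def emeasure_eq_measure2 zero_less_measure_iff)
  have U: "0 < U" "wmeas (wpow w q) Q = ennreal U"
    using False wvol_nonneg[OF u, of Q] wmeas_eq_wvol[OF u Qf(1,2)] by (auto simp: U_def)
  have V: "0 \<le> V" "wmeas (wpow w p) E = ennreal V"
    using wvol_nonneg[OF v, of E] wmeas_eq_wvol[OF v E(1) Eb] by (auto simp: V_def)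
  have w1: "wpow (wpow w p\<^sub>0) (q / p\<^sub>0) = wpow w q" "wpow (wpow w p\<^sub>0) (p / p\<^sub>0) = wpow w p"
    using pos by (auto simp: wpow_def powr_powr)
  define a where "a = 1 - (1 / (p / p\<^sub>0) - 1 / (q / p\<^sub>0))"
  have "(emeasure lebesgue E / epow (emeasure lebesgue Q) a)
     * (epow (wmeas (wpow w q) Q) (1 / (q / p\<^sub>0)) / epow (wmeas (wpow w p) E) (1 / (p / p\<^sub>0))) \<le> AR_const (p / p\<^sub>0) (q / p\<^sub>0) (wpow w p\<^sub>0)"
    unfolding AR_const_def w1 a_def using Q E t
    by (intro SUP_upper2[OF Q] SUP_upper) auto
  then have le: "(ennreal t / ennreal (m powr a)) * (ennreal (U powr (p\<^sub>0 / q)) / ennreal (V powr (p\<^sub>0 / p))) \<le> ennreal K"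
    unfolding K(1) t(2) m(2) U(2) V(2) using t m U V by (simp add: epow_ennreal)
  have Vp: "0 < V"
  proof (rule ccontr)
    assume "\<not> 0 < V"
    then have "V = 0" using V by simp
    then have "(ennreal t / ennreal (m powr a)) * (ennreal (U powr (p\<^sub>0 / q)) / ennreal (V powr (p\<^sub>0 / p))) = \<infinity>"
      using t m U by (simp add: divide_ennreal ennreal_mult_eq_top_iff)
    then show False using le by (simp add: top_unique)
  qed
  have "t / m powr a * (U powr (p\<^sub>0 / q) / V powr (p\<^sub>0 / p)) \<le> K"
    using le t m U Vp K by (simp add: divide_ennreal ennreal_mult[symmetric])
  then have "t * U powr (p\<^sub>0 / q) \<le> K * (m powr a * V powr (p\<^sub>0 / p))"
    using m Vp by (simp add: field_simps)
  then have "(t * U powr (p\<^sub>0 / q)) powr (1 / p\<^sub>0) \<le> (K * (m powr a * V powr (p\<^sub>0 / p))) powr (1 / p\<^sub>0)"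
    using t U pos by (intro powr_mono2) auto
  then have "t powr (1 / p\<^sub>0) * U powr (1 / q) \<le> K powr (1 / p\<^sub>0) * (m powr (a / p\<^sub>0) * V powr (1 / p))"
    using t U K m Vp pos by (simp add: powr_mult powr_powr)
  then have "m powr (- (a / p\<^sub>0)) * (t powr (1 / p\<^sub>0) * U powr (1 / q)) \<le> m powr (- (a / p\<^sub>0)) * (K powr (1 / p\<^sub>0) * (m powr (a / p\<^sub>0) * V powr (1 / p)))"
    by (intro mult_left_mono) auto
  also have "\<dots> = K powr (1 / p\<^sub>0) * V powr (1 / p)" using m by (simp add: powr_minus field_simps)
  also have "- (a / p\<^sub>0) = 1 / p - 1 / q - 1 / p\<^sub>0" using pos by (simp add: a_def field_simps)
  finally show ?thesis by (simp add: t_def m_def U_def V_def ac_simps)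
qed

text \<open>If \<open>u\<close> vanished on one cube, then so would \<open>v\<close>; applying \<open>AR\<close> to this cube as a subset of larger and larger
  cubes, \<open>u\<close> would vanish almost everywhere.\<close>

lemma wvol_cube_pos:
  fixes w :: "real ^ 'n \<Rightarrow> real"
  assumes u: "locally_finite_weight (wpow w q)" and v: "locally_finite_weight (wpow w p)" and pq: "0 < p" "p \<le> q"
    and AR: "\<And>Q E. Q \<in> cubes \<Longrightarrow> E \<in> sets lebesgue \<Longrightarrow> E \<subseteq> Q \<Longrightarrow>
       measure lebesgue E powr a * measure lebesgue Q powr b * wvol (wpow w q) Q powr c \<le> \<kappa> * wvol (wpow w p) E powr (1 / p)"
    and ne: "wmeas (wpow w q) UNIV \<noteq> 0" and Q: "Q \<in> cubes"
  shows "0 < wvol (wpow w q) Q"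
proof (rule ccontr)
  assume "\<not> 0 < wvol (wpow w q) Q"
  then have uQ: "wvol (wpow w q) Q = 0" using wvol_nonneg[OF u, of Q] by simp
  note Qf = cube_facts[OF Q]
  have vQ: "wvol (wpow w p) Q = 0"
  proof -
    have "wvol (wpow w p) Q \<le> wvol (\<lambda>_. 1) Q powr (1 - p / q) * wvol (wpow w q) Q powr (p / q)"
      using pq by (intro wvol_holder[OF locally_finite_weight_one u v _ _ _ Qf(1,2)]) (auto simp: wpow_def powr_powr)
    then show ?thesis using uQ wvol_nonneg[OF v, of Q] by simp
  qed
  define B :: "nat \<Rightarrow> (real ^ 'n) set" where "B n = cube_at (\<chi> i. - (real n + 1)) (2 * (real n + 1))" for n
  have Bc: "B n \<in> cubes" for n :: nat unfolding cubes_def B_def by (intro CollectI exI conjI) (rule refl, simp)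
  have memB: "x \<in> B n" if "norm x < real n + 1" for n and x :: "real ^ 'n"
  proof -
    have "\<bar>x $ i\<bar> < real n + 1" for i using component_le_norm_cart[of x i] that by linarith
    then show ?thesis unfolding B_def cube_at_def by (auto simp: abs_less_iff) (smt (verit))+
  qed
  have "wvol (wpow w q) (B n) = 0" if "Q \<subseteq> B n" for n
  proof -
    have "measure lebesgue Q powr a * measure lebesgue (B n) powr b * wvol (wpow w q) (B n) powr c \<le> 0"
      using AR[OF Bc Qf(1) that] vQ pq by simp
    moreover have "0 < measure lebesgue Q powr a * measure lebesgue (B n) powr b" using Qf cube_facts[OF Bc, of n] by simp
    ultimately have "wvol (wpow w q) (B n) powr c \<le> 0" by (smt (verit) mult_pos_pos)
    then show ?thesis by simp
  qed
  moreover obtain n0 :: nat where n0: "\<And>x. x \<in> Q \<Longrightarrow> norm x < real n0"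
    using Qf(2) reals_Archimedean2 unfolding bounded_iff by (metis le_less_trans)
  ultimately have B0: "wvol (wpow w q) (B (n0 + n)) = 0" for n
  proof -
    assume *: "\<And>n. Q \<subseteq> B n \<Longrightarrow> wvol (wpow w q) (B n) = 0"
    have "Q \<subseteq> B (n0 + n)"
    proof
      fix x assume "x \<in> Q"
      then have "norm x < real (n0 + n) + 1" using n0[of x] by simp
      then show "x \<in> B (n0 + n)" by (rule memB)
    qed
    then show ?thesis by (rule *)
  qed
  have "wmeas (wpow w q) (B (n0 + n)) = 0" for n
    using B0[of n] wmeas_eq_wvol[OF u cube_facts(1,2)[OF Bc]] by simp
  then have nul: "B (n0 + n) \<in> null_sets (density lebesgue (\<lambda>x. ennreal (wpow w q x)))" for n
    using cube_facts(1)[OF Bc] wmeas_eq_emeasure[OF lfw_meas[OF u] cube_facts(1)[OF Bc]] by (simp add: null_sets_def)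
  have "(\<Union>n. B (n0 + n)) = UNIV"
  proof (rule UNIV_eq_I[symmetric])
    fix x :: "real ^ 'n"
    obtain n :: nat where "norm x < real n" using reals_Archimedean2 by blast
    then have "x \<in> B (n0 + n)" by (intro memB) simp
    then show "x \<in> (\<Union>n. B (n0 + n))" by blast
  qed
  then have "UNIV \<in> null_sets (density lebesgue (\<lambda>x. ennreal (wpow w q x)))"
    using null_sets_UN[of "\<lambda>n. B (n0 + n)", OF nul] by simp
  then show False using ne wmeas_eq_emeasure[OF lfw_meas[OF u], of UNIV] by (simp add: null_sets_def)
qed

text \<open>By Hoelder's inequality \<open>v(E) \<le> u(E)^(p/q) |E|^(1 - p/q)\<close>. Inserted in \<open>AR\<close>, this bounds \<open>u(Q)\<close> by
  \<open>u(E)\<close> times a power of \<open>|Q| / |E| \<le> 1 / \<delta>\<close>.\<close>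

lemma D_const_bound:
  fixes w :: "real ^ 'n \<Rightarrow> real"
  assumes u: "locally_finite_weight (wpow w q)" and v: "locally_finite_weight (wpow w p)" and e: "1 \<le> p\<^sub>0" "p\<^sub>0 \<le> p" "p \<le> q"
    and K: "0 \<le> K"
    and AR: "\<And>Q E. Q \<in> cubes \<Longrightarrow> E \<in> sets lebesgue \<Longrightarrow> E \<subseteq> Q \<Longrightarrow>
       measure lebesgue E powr (1 / p\<^sub>0) * measure lebesgue Q powr (1 / p - 1 / q - 1 / p\<^sub>0) * wvol (wpow w q) Q powr (1 / q) \<le> K powr (1 / p\<^sub>0) * wvol (wpow w p) E powr (1 / p)"
    and pos: "\<And>Q. Q \<in> cubes \<Longrightarrow> 0 < wvol (wpow w q) Q" and \<delta>: "0 < \<delta>" "\<delta> \<le> 1"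
  shows "\<exists>d. 1 \<le> d \<and> D_const \<delta> (wpow w q) = ennreal d \<and> d \<le> \<delta> powr (- (q * (1 / p\<^sub>0 - (1 / p - 1 / q)))) * K powr (q / p\<^sub>0) \<and>
     (\<forall>Q E. Q \<in> shifted_dyadic_cubes \<longrightarrow> E \<in> sets lebesgue \<longrightarrow> E \<subseteq> Q \<longrightarrow> \<delta> * measure lebesgue Q \<le> measure lebesgue E \<longrightarrow> wvol (wpow w q) Q \<le> d * wvol (wpow w q) E)"
proof -
  let ?u = "wpow w q"
  define \<beta> where "\<beta> = 1 / p - 1 / q"
  define M where "M = \<delta> powr (- (q * (1 / p\<^sub>0 - \<beta>))) * K powr (q / p\<^sub>0)"
  have ps: "0 < p\<^sub>0" "0 < p" "0 < q" using e by auto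
  have \<beta>0: "\<beta> \<le> 1 / p\<^sub>0" "0 \<le> \<beta>"
  proof -
    have "1 / p \<le> 1 / p\<^sub>0" using e ps by (intro divide_left_mono) auto
    moreover have "0 \<le> 1 / q" using ps by simp
    ultimately show "\<beta> \<le> 1 / p\<^sub>0" unfolding \<beta>_def by (smt (verit))
    show "0 \<le> \<beta>" unfolding \<beta>_def using e ps by (simp add: divide_left_mono)
  qed
  have sc: "Q \<in> cubes" if "Q \<in> shifted_dyadic_cubes" for Q :: "(real ^ 'n) set"
    using that shifted_grid_cubes by (auto simp: shifted_dyadic_cubes_eq)
  have key: "0 < wvol ?u E \<and> wvol ?u Q \<le> M * wvol ?u E"
    if Q: "Q \<in> shifted_dyadic_cubes" and E: "E \<in> sets lebesgue" "E \<subseteq> Q" "\<delta> * measure lebesgue Q \<le> measure lebesgue E" for Q E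
  proof -
    note Qf = cube_facts[OF sc[OF Q]]
    have Eb: "bounded E" using E Qf bounded_subset by blast
    define m where "m = measure lebesgue Q"
    define t where "t = measure lebesgue E"
    have m: "0 < m" using Qf by (simp add: m_def)
    have t: "\<delta> * m \<le> t" using E by (simp add: m_def t_def)
    then have t0: "0 < t" using m \<delta> by (meson less_le_trans mult_pos_pos)
    define U where "U = wvol ?u Q"
    define UE where "UE = wvol ?u E"
    have U0: "0 < U" using pos[OF sc[OF Q]] by (simp add: U_def)
    have UE0: "0 \<le> UE" by (simp add: UE_def wvol_nonneg[OF u])
    have "wvol (wpow w p) E \<le> wvol (\<lambda>_. 1) E powr (1 - p / q) * wvol ?u E powr (p / q)"
      using e ps by (intro wvol_holder[OF locally_finite_weight_one u v _ _ _ E(1) Eb]) (auto simp: wpow_def powr_powr)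
    then have "wvol (wpow w p) E powr (1 / p) \<le> (t powr (1 - p / q) * UE powr (p / q)) powr (1 / p)"
      using ps by (intro powr_mono2) (auto simp: wvol_one t_def UE_def wvol_nonneg[OF v])
    also have "\<dots> = t powr \<beta> * UE powr (1 / q)"
    proof -
      have "(1 - p / q) * (1 / p) = \<beta>" using ps by (simp add: \<beta>_def field_simps)
      then show ?thesis using ps t0 UE0 by (simp add: powr_mult powr_powr)
    qed
    finally have vE: "wvol (wpow w p) E powr (1 / p) \<le> t powr \<beta> * UE powr (1 / q)" .
    have "t powr (1 / p\<^sub>0) * m powr (\<beta> - 1 / p\<^sub>0) * U powr (1 / q) \<le> K powr (1 / p\<^sub>0) * (t powr \<beta> * UE powr (1 / q))"
      using AR[OF sc[OF Q] E(1,2)] mult_left_mono[OF vE, of "K powr (1 / p\<^sub>0)"]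
      by (simp add: t_def m_def U_def \<beta>_def)
    then have "(t powr (- \<beta>) * m powr (1 / p\<^sub>0 - \<beta>)) * (t powr (1 / p\<^sub>0) * m powr (\<beta> - 1 / p\<^sub>0) * U powr (1 / q))
      \<le> (t powr (- \<beta>) * m powr (1 / p\<^sub>0 - \<beta>)) * (K powr (1 / p\<^sub>0) * (t powr \<beta> * UE powr (1 / q)))"
      by (intro mult_left_mono) auto
    moreover have "(t powr (- \<beta>) * m powr (1 / p\<^sub>0 - \<beta>)) * (t powr (1 / p\<^sub>0) * m powr (\<beta> - 1 / p\<^sub>0) * U powr (1 / q)) = t powr (1 / p\<^sub>0 - \<beta>) * U powr (1 / q)"
    proof -
      have "t powr (- \<beta>) * t powr (1 / p\<^sub>0) = t powr (1 / p\<^sub>0 - \<beta>)" by (simp add: powr_add[symmetric])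
      moreover have "m powr (1 / p\<^sub>0 - \<beta>) * m powr (\<beta> - 1 / p\<^sub>0) = 1" using m by (simp add: powr_add[symmetric])
      moreover have "(t powr (- \<beta>) * m powr (1 / p\<^sub>0 - \<beta>)) * (t powr (1 / p\<^sub>0) * m powr (\<beta> - 1 / p\<^sub>0) * U powr (1 / q))
        = (t powr (- \<beta>) * t powr (1 / p\<^sub>0)) * (m powr (1 / p\<^sub>0 - \<beta>) * m powr (\<beta> - 1 / p\<^sub>0)) * U powr (1 / q)"
        by (simp only: mult_ac)
      ultimately show ?thesis by simp
    qed
    moreover have "(t powr (- \<beta>) * m powr (1 / p\<^sub>0 - \<beta>)) * (K powr (1 / p\<^sub>0) * (t powr \<beta> * UE powr (1 / q))) = m powr (1 / p\<^sub>0 - \<beta>) * (K powr (1 / p\<^sub>0) * UE powr (1 / q))"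
      using t0 by (simp add: powr_minus field_simps)
    ultimately have c1: "t powr (1 / p\<^sub>0 - \<beta>) * U powr (1 / q) \<le> m powr (1 / p\<^sub>0 - \<beta>) * (K powr (1 / p\<^sub>0) * UE powr (1 / q))" by simp
    have "(\<delta> * m) powr (1 / p\<^sub>0 - \<beta>) * U powr (1 / q) \<le> t powr (1 / p\<^sub>0 - \<beta>) * U powr (1 / q)"
      using t m \<delta> \<beta>0 by (intro mult_right_mono powr_mono2) auto
    also note c1
    finally have "m powr (1 / p\<^sub>0 - \<beta>) * (\<delta> powr (1 / p\<^sub>0 - \<beta>) * U powr (1 / q)) \<le> m powr (1 / p\<^sub>0 - \<beta>) * (K powr (1 / p\<^sub>0) * UE powr (1 / q))"
      using m \<delta> by (simp add: powr_mult ac_simps)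
    then have c2: "\<delta> powr (1 / p\<^sub>0 - \<beta>) * U powr (1 / q) \<le> K powr (1 / p\<^sub>0) * UE powr (1 / q)" using m by simp
    have UEp: "0 < UE"
    proof (rule ccontr)
      assume "\<not> 0 < UE"
      then have "UE = 0" using UE0 by simp
      then have "\<delta> powr (1 / p\<^sub>0 - \<beta>) * U powr (1 / q) \<le> 0" using c2 by simp
      moreover have "0 < \<delta> powr (1 / p\<^sub>0 - \<beta>) * U powr (1 / q)" using \<delta> U0 by simp
      ultimately show False by simp
    qed
    have "(\<delta> powr (1 / p\<^sub>0 - \<beta>) * U powr (1 / q)) powr q \<le> (K powr (1 / p\<^sub>0) * UE powr (1 / q)) powr q"
      using c2 ps by (intro powr_mono2) auto
    then have "\<delta> powr (q * (1 / p\<^sub>0 - \<beta>)) * U \<le> K powr (q / p\<^sub>0) * UE"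
      using ps U0 UE0 by (simp add: powr_mult powr_powr mult.commute)
    then have "\<delta> powr (- (q * (1 / p\<^sub>0 - \<beta>))) * (\<delta> powr (q * (1 / p\<^sub>0 - \<beta>)) * U) \<le> \<delta> powr (- (q * (1 / p\<^sub>0 - \<beta>))) * (K powr (q / p\<^sub>0) * UE)"
      by (intro mult_left_mono) auto
    moreover have "\<delta> powr (- (q * (1 / p\<^sub>0 - \<beta>))) * \<delta> powr (q * (1 / p\<^sub>0 - \<beta>)) = 1"
      using \<delta> by (simp only: powr_add[symmetric]) simp
    ultimately have "U \<le> M * UE" by (simp only: M_def mult.assoc[symmetric] mult_1_left)
    then show ?thesis using UEp by (simp add: U_def UE_def)
  qed
  have quot: "wmeas ?u Q / wmeas ?u E = ennreal (wvol ?u Q / wvol ?u E)"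
    if Q: "Q \<in> shifted_dyadic_cubes" and E: "E \<in> sets lebesgue" "E \<subseteq> Q" "\<delta> * measure lebesgue Q \<le> measure lebesgue E" for Q E
  proof -
    note Qf = cube_facts[OF sc[OF Q]]
    have Eb: "bounded E" using E Qf bounded_subset by blast
    show ?thesis using wmeas_eq_wvol[OF u Qf(1,2)] wmeas_eq_wvol[OF u E(1) Eb] key[OF Q E] wvol_nonneg[OF u, of Q]
      by (simp add: divide_ennreal)
  qed
  have em: "\<delta> * measure lebesgue Q \<le> measure lebesgue E \<longleftrightarrow> emeasure lebesgue E \<ge> ennreal \<delta> * emeasure lebesgue Q"
    if Q: "Q \<in> shifted_dyadic_cubes" and E: "E \<in> sets lebesgue" "E \<subseteq> Q" for Q E :: "(real ^ 'n) set"
  proof -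
    note Qf = cube_facts[OF sc[OF Q]]
    have "E \<in> lmeasurable" using E Qf bounded_subset by (intro bounded_set_imp_lmeasurable) blast+
    then show ?thesis using Qf(4) \<delta> by (simp add: emeasure_eq_measure2 ennreal_mult[symmetric])
  qed
  have le: "D_const \<delta> ?u \<le> ennreal M"
    unfolding D_const_def
  proof (intro SUP_least)
    fix Q E :: "(real ^ 'n) set"
    assume Q: "Q \<in> shifted_dyadic_cubes" and "E \<in> {E \<in> sets lebesgue. E \<subseteq> Q \<and> emeasure lebesgue E \<ge> ennreal \<delta> * emeasure lebesgue Q}"
    then have E0: "E \<in> sets lebesgue" "E \<subseteq> Q" "ennreal \<delta> * emeasure lebesgue Q \<le> emeasure lebesgue E" by blast+
    have E: "E \<in> sets lebesgue" "E \<subseteq> Q" "\<delta> * measure lebesgue Q \<le> measure lebesgue E"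
      by (rule E0(1), rule E0(2), rule iffD2[OF em[OF Q E0(1,2)] E0(3)])
    show "wmeas ?u Q / wmeas ?u E \<le> ennreal M"
      unfolding quot[OF Q E] using key[OF Q E] by (intro ennreal_leI) (simp add: divide_le_eq)
  qed
  define d where "d = enn2real (D_const \<delta> ?u)"
  have d: "D_const \<delta> ?u = ennreal d" "0 \<le> d" using order_le_less_trans[OF le ennreal_less_top] by (simp_all add: d_def)
  have ge: "wvol ?u Q / wvol ?u E \<le> d"
    if Q: "Q \<in> shifted_dyadic_cubes" and E: "E \<in> sets lebesgue" "E \<subseteq> Q" "\<delta> * measure lebesgue Q \<le> measure lebesgue E" for Q E
  proof -
    have "wmeas ?u Q / wmeas ?u E \<le> D_const \<delta> ?u"
      unfolding D_const_def using E iffD1[OF em[OF Q E(1,2)] E(3)] by (intro SUP_upper2[OF Q] SUP_upper) blast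
    then show ?thesis unfolding quot[OF Q E] d(1) using d(2) by (simp add: ennreal_le_iff)
  qed
  have "1 \<le> d"
  proof -
    define Q :: "(real ^ 'n) set" where "Q = cell (\<lambda>_. 0) 0 (\<lambda>_. 0)"
    have "(\<lambda>_. 0) \<in> (shifts :: ('n \<Rightarrow> nat) set)" by (simp add: shifts_def)
    moreover have "Q \<in> shifted_grid (\<lambda>_. 0)" unfolding shifted_grid_eq Q_def by blast
    ultimately have Q: "Q \<in> shifted_dyadic_cubes" unfolding shifted_dyadic_cubes_eq by blast
    note Qf = cube_facts[OF sc[OF Q]]
    have "wvol ?u Q / wvol ?u Q \<le> d" using Qf \<delta> by (intro ge[OF Q]) (auto simp: mult_le_cancel_right1)
    then show ?thesis using pos[OF sc[OF Q]] by simp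
  qed
  moreover have "d \<le> M" using le d by (simp add: M_def)
  moreover have "wvol ?u Q \<le> d * wvol ?u E" if "Q \<in> shifted_dyadic_cubes" "E \<in> sets lebesgue" "E \<subseteq> Q" "\<delta> * measure lebesgue Q \<le> measure lebesgue E" for Q E
    using ge[OF that] key[OF that] by (simp add: divide_le_eq)
  ultimately show ?thesis using d(1) by (intro exI[of _ d]) (auto simp: M_def \<beta>_def)
qed

section \<open>Weak type bound on test functions\<close>

text \<open>The sparse families supplied for \<open>f\<close> and \<open>g\<close> are unknown, and the sums over them are suprema of finite sums;
  hence the shape of \<open>bnd\<close>.\<close>

lemma pairing_bound_of_S_class:
  fixes T :: "(real ^ 'n \<Rightarrow> 'k::{real_normed_field, euclidean_space}) \<Rightarrow> (real ^ 'n \<Rightarrow> 'k)"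
  assumes S: "S_class \<alpha> p\<^sub>0 q\<^sub>0 N \<eta> A T" and r: "1 \<le> conj_exp q\<^sub>0"
    and fg: "f \<in> test_functions" "g \<in> test_functions" and Y: "0 \<le> Y"
    and bnd: "\<And>S S0. sparse \<eta> S \<Longrightarrow> finite S0 \<Longrightarrow> S0 \<subseteq> S \<Longrightarrow>
        (\<Sum>Q\<in>S0. pavg p\<^sub>0 (\<alpha> / (real CARD('n) * conj_exp q\<^sub>0)) f Q * pavg (conj_exp q\<^sub>0) 1 g Q) \<le> Y"
  shows "norm (\<integral>x. T f x * g x \<partial>lebesgue) \<le> max A 0 * real N * Y"
proof -
  have p0: "1 \<le> p\<^sub>0" and \<eta>: "0 < \<eta>" using S by (auto simp: S_class_def)
  obtain Sp where Sp: "\<forall>j<N. sparse \<eta> (Sp j)" and le: "ennreal (norm (\<integral>x. T f x * g x \<partial>lebesgue))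
          \<le> ennreal A * (\<Sum>j<N. \<Sum>\<^sub>\<infinity>Q\<in>Sp j. avg 0 p\<^sub>0 f Q * avg \<alpha> (conj_exp q\<^sub>0) g Q * emeasure lebesgue Q)"
    using S fg unfolding S_class_def by blast
  obtain F Bd where Fb: "f \<in> borel_measurable lebesgue" "\<forall>x. norm (f x) \<le> F" "Bd \<in> sets lebesgue" "bounded Bd" "\<forall>x. x \<notin> Bd \<longrightarrow> f x = 0"
    by (rule test_function_facts[OF fg(1)])
  obtain F' Bd' where Fb': "g \<in> borel_measurable lebesgue" "\<forall>x. norm (g x) \<le> F'" "Bd' \<in> sets lebesgue" "bounded Bd'" "\<forall>x. x \<notin> Bd' \<longrightarrow> g x = 0"
    by (rule test_function_facts[OF fg(2)])
  have one: "(\<Sum>\<^sub>\<infinity>Q\<in>Sp j. avg 0 p\<^sub>0 f Q * avg \<alpha> (conj_exp q\<^sub>0) g Q * emeasure lebesgue Q) \<le> ennreal Y" if j: "j < N" for j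
  proof -
    have sp: "sparse \<eta> (Sp j)" using Sp j by blast
    obtain D E where D: "laminar D" "D \<subseteq> cubes" "Sp j \<subseteq> D" by (rule sparse_facts[OF sp \<eta>])
    have "(\<Sum>\<^sub>\<infinity>Q\<in>Sp j. avg 0 p\<^sub>0 f Q * avg \<alpha> (conj_exp q\<^sub>0) g Q * emeasure lebesgue Q)
       = (SUP F\<in>{F. finite F \<and> F \<subseteq> Sp j}. \<Sum>Q\<in>F. avg 0 p\<^sub>0 f Q * avg \<alpha> (conj_exp q\<^sub>0) g Q * emeasure lebesgue Q)"
      by (rule nonneg_infsum_complete) simp
    also have "\<dots> \<le> ennreal Y"
    proof (rule SUP_least)
      fix S0 assume "S0 \<in> {F. finite F \<and> F \<subseteq> Sp j}"
      then have S0: "finite S0" "S0 \<subseteq> Sp j" by auto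
      have "(\<Sum>Q\<in>S0. avg 0 p\<^sub>0 f Q * avg \<alpha> (conj_exp q\<^sub>0) g Q * emeasure lebesgue Q)
         = (\<Sum>Q\<in>S0. ennreal (pavg p\<^sub>0 (\<alpha> / (real CARD('n) * conj_exp q\<^sub>0)) f Q * pavg (conj_exp q\<^sub>0) 1 g Q))"
      proof (intro sum.cong refl avg_product_eq_pavg)
        fix Q assume "Q \<in> S0"
        then show Qc: "Q \<in> cubes" using S0 D by blast
        show "(\<integral>\<^sup>+x\<in>Q. ennreal (norm (f x) powr p\<^sub>0) \<partial>lebesgue) < \<infinity>"
          by (rule power_integral_finite[OF Fb(2)[rule_format] Qc]) (use p0 in simp)
        show "(\<integral>\<^sup>+x\<in>Q. ennreal (norm (g x) powr conj_exp q\<^sub>0) \<partial>lebesgue) < \<infinity>"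
          by (rule power_integral_finite[OF Fb'(2)[rule_format] Qc]) (use r in simp)
      qed (use p0 r in auto)
      also have "\<dots> = ennreal (\<Sum>Q\<in>S0. pavg p\<^sub>0 (\<alpha> / (real CARD('n) * conj_exp q\<^sub>0)) f Q * pavg (conj_exp q\<^sub>0) 1 g Q)"
        by (rule sum_ennreal) (auto intro!: mult_nonneg_nonneg pavg_nonneg)
      also have "\<dots> \<le> ennreal Y" by (intro ennreal_leI bnd[OF sp S0])
      finally show "(\<Sum>Q\<in>S0. avg 0 p\<^sub>0 f Q * avg \<alpha> (conj_exp q\<^sub>0) g Q * emeasure lebesgue Q) \<le> ennreal Y" .
    qed
    finally show ?thesis .
  qed
  have "ennreal (norm (\<integral>x. T f x * g x \<partial>lebesgue)) \<le> ennreal A * (\<Sum>j<N. ennreal Y)"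
    by (rule order_trans[OF le]) (intro mult_left_mono sum_mono one, auto)
  also have "\<dots> = ennreal (max A 0 * real N * Y)"
    using Y by (cases "0 \<le> A") (auto simp: ennreal_mult ennreal_of_nat_eq_real_of_nat max_def ennreal_neg mult.assoc)
  finally show ?thesis using Y by simp
qed

text \<open>The level \<open>l\<close> is such that the cubes with average of \<open>f\<close> above it, from all shifted grids together, cover
  at most half of \<open>G\<close> in terms of \<open>u\<close>. Removing them from \<open>G\<close> caps the averages over all cubes that still matter. For \<open>\<eta> = 1\<close>
  the cubes are disjoint, and \<open>G\<close> can be kept.\<close>

lemma test_function_weak_bound:
  fixes T :: "(real ^ 'n \<Rightarrow> 'k::{real_normed_field, euclidean_space}) \<Rightarrow> (real ^ 'n \<Rightarrow> 'k)"
  assumes S: "S_class \<alpha> p\<^sub>0 q\<^sub>0 N \<eta> A T" and r: "r = conj_exp q\<^sub>0" "r = 1 / (1 - i)" "0 \<le> i" "i < 1"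
    and \<beta>: "\<beta> = \<alpha> / (real CARD('n) * r)" "\<beta> = 1 / p - 1 / q" "\<beta> + i < 1 / p\<^sub>0" and e: "1 \<le> p\<^sub>0" "p\<^sub>0 \<le> p" "p \<le> q"
    and u: "locally_finite_weight u" and v: "locally_finite_weight v" and pos: "\<And>Q. Q \<in> cubes \<Longrightarrow> 0 < wvol u Q" and \<kappa>: "0 < \<kappa>"
    and AR: "\<And>Q E. Q \<in> cubes \<Longrightarrow> E \<in> sets lebesgue \<Longrightarrow> E \<subseteq> Q \<Longrightarrow>
       measure lebesgue E powr (1 / p\<^sub>0) * measure lebesgue Q powr (\<beta> - 1 / p\<^sub>0) * wvol u Q powr (1 / q) \<le> \<kappa> * wvol v E powr (1 / p)"
    and d: "1 \<le> d" "\<And>Q E. Q \<in> shifted_dyadic_cubes \<Longrightarrow> E \<in> sets lebesgue \<Longrightarrow> E \<subseteq> Q \<Longrightarrow> \<eta> * measure lebesgue Q \<le> measure lebesgue E \<Longrightarrow> wvol u Q \<le> d * wvol u E"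
    and \<epsilon>: "0 < \<epsilon>" "q * \<epsilon> \<le> 1" and Kb: "0 \<le> Kb"
    and bs: "\<And>Q G (h :: real ^ 'n \<Rightarrow> 'k). Q \<in> shifted_dyadic_cubes \<Longrightarrow> G \<in> sets lebesgue \<Longrightarrow> \<forall>x. norm (h x) \<le> indicator G x * u x \<Longrightarrow>
       pavg r 1 h Q \<le> Kb * (wvol u (G \<inter> Q) / wvol u Q) powr (1 - 1 / q + \<epsilon>) * wvol u Q"
    and bc: "\<And>Q G (h :: real ^ 'n \<Rightarrow> 'k). Q \<in> cubes \<Longrightarrow> G \<in> sets lebesgue \<Longrightarrow> \<forall>x. norm (h x) \<le> indicator G x * u x \<Longrightarrow>
       pavg r 1 h Q \<le> Kb * (wvol u (G \<inter> Q) / wvol u Q) powr (1 - 1 / q) * wvol u Q"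
    and f: "f \<in> test_functions" and L: "0 < L" "ennreal \<kappa> * lorentz_p1 p v f \<le> ennreal L"
    and CX: "CX = 1 + 36 ^ CARD('n) * real (card (shifts :: ('n \<Rightarrow> nat) set)) * (6 ^ CARD('n) / ((1 - \<eta>) * \<eta>)) * (1 + 2 * real (card (shifts :: ('n \<Rightarrow> nat) set)))"
  shows "lorentz_weak q u (T f) \<le> ennreal (4 * (max A 0 * real N) * (CX * Kb * d * (1 + 1 / \<epsilon>) * L))"
proof -
  define Nc where "Nc = real (card (shifts :: ('n \<Rightarrow> nat) set))"
  have Nc: "1 \<le> Nc" using card_shifts[where 'n = 'n] by (simp add: Nc_def)
  have \<eta>: "0 < \<eta>" "\<eta> \<le> 1" and Tf: "locally_integrable (T f)" using S f by (auto simp: S_class_def)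
  have ps: "0 < p" "0 < q" "1 \<le> q" using e by auto
  have r1: "1 \<le> r" unfolding r(2) using r(3,4) by simp
  have \<beta>0: "0 \<le> \<beta>" unfolding \<beta>(2) using e ps by (simp add: divide_left_mono)
  have \<beta>1: "\<beta> \<le> 1"
  proof -
    have "1 / p \<le> 1" "0 \<le> 1 / q" using e ps by auto
    then show ?thesis unfolding \<beta>(2) by (smt (verit))
  qed
  obtain F Bd where Fb: "f \<in> borel_measurable lebesgue" "\<forall>x. norm (f x) \<le> F" "Bd \<in> sets lebesgue" "bounded Bd" "\<forall>x. x \<notin> Bd \<longrightarrow> f x = 0"
    by (rule test_function_facts[OF f])
  have fin: "(\<integral>\<^sup>+x\<in>Q. ennreal (norm (f x) powr p\<^sub>0) \<partial>lebesgue) < \<infinity>" if "Q \<in> cubes" for Q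
    by (rule power_integral_finite[OF Fb(2)[rule_format] that]) (use e in simp)
  have Nf: "ennreal \<kappa> * (\<integral>\<^sup>+y\<in>{0<..}. ennreal (wvol v (level f y \<inter> Bd) powr (1 / p)) \<partial>lborel) \<le> ennreal L"
  proof -
    have "(\<integral>\<^sup>+y\<in>{0<..}. ennreal (wvol v (level f y \<inter> Bd) powr (1 / p)) \<partial>lborel) = (\<integral>\<^sup>+y\<in>{0<..}. epow (wmeas v {x. y < norm (f x)}) (1 / p) \<partial>lborel)"
    proof (intro nn_integral_cong)
      fix y :: real
      show "ennreal (wvol v (level f y \<inter> Bd) powr (1 / p)) * indicator {0<..} y = epow (wmeas v {x. y < norm (f x)}) (1 / p) * indicator {0<..} y"
      proof (cases "0 < y")
        case True
        then have s: "{x. y < norm (f x)} = level f y \<inter> Bd" using Fb(5) by (force simp: level_def)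
        have "bounded (level f y \<inter> Bd)" using Fb(4) bounded_subset by blast
        then show ?thesis unfolding s
          using wmeas_eq_wvol[OF v, of "level f y \<inter> Bd"] level_sets[OF Fb(1)] Fb(3) wvol_nonneg[OF v] by (simp add: epow_ennreal)
      qed simp
    qed
    also have "\<dots> \<le> lorentz_p1 p v f"
    proof -
      have "1 \<le> ennreal p" using e by simp
      then show ?thesis unfolding lorentz_p1_def
        using mult_right_mono[of 1 "ennreal p" "\<integral>\<^sup>+y\<in>{0<..}. epow (wmeas v {x. y < norm (f x)}) (1 / p) \<partial>lborel"] by simp
    qed
    finally show ?thesis using L(2) by (meson mult_left_mono order_trans zero_le)
  qed
  have weak: "(\<Sum>Q\<in>F'. pavg p\<^sub>0 \<beta> f Q powr q * wvol u Q) \<le> L powr q" if F': "finite F'" "F' \<subseteq> cubes" "disjoint F'" for F'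
  proof (rule disjoint_cubes_pavg_sum[OF u v Fb(1,3,4) _ e \<kappa> _ fin AR Nf F'])
    show "f x = 0" if "x \<notin> Bd" for x using Fb(5) that by blast
  qed (use L in auto)
  define X where "X = CX * Kb * d * (1 + 1 / \<epsilon>) * L"
  have CX1: "1 \<le> CX" unfolding CX using \<eta> by (auto intro!: mult_nonneg_nonneg divide_nonneg_nonneg)
  have E1: "1 \<le> 1 + 1 / \<epsilon>" using \<epsilon> by simp
  have X0: "0 \<le> X" using CX1 Kb d(1) \<epsilon> L by (simp add: X_def)
  have FB: "\<exists>G'\<subseteq>G. G' \<in> sets lebesgue \<and> wvol u G \<le> 2 * wvol u G' \<and>
        (\<forall>h :: real ^ 'n \<Rightarrow> 'k. h \<in> borel_measurable lebesgue \<longrightarrow> (\<exists>M. \<forall>x. norm (h x) \<le> M) \<longrightarrow> (\<forall>x. norm (h x) \<le> indicator G' x * u x) \<longrightarrow>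
          (\<forall>S S0. sparse \<eta> S \<longrightarrow> finite S0 \<longrightarrow> S0 \<subseteq> S \<longrightarrow> (\<Sum>Q\<in>S0. pavg p\<^sub>0 \<beta> f Q * pavg r 1 h Q) \<le> X * wvol u G powr (1 - 1 / q)))"
    if G: "G \<in> sets lebesgue" "bounded G" "0 < wvol u G" for G
  proof (cases "\<eta> = 1")
    case True
    show ?thesis
    proof (intro exI[of _ G] conjI allI impI)
      show "wvol u G \<le> 2 * wvol u G" using G by simp
      fix h :: "real ^ 'n \<Rightarrow> 'k" and S S0 :: "(real ^ 'n) set set"
      assume h: "\<forall>x. norm (h x) \<le> indicator G x * u x" and sp: "sparse \<eta> S" "finite S0" "S0 \<subseteq> S"
      have dS: "disjoint S" using sp(1) True sparse_one_disjoint by simp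
      have S0d: "disjoint S0" using dS sp(3) by (auto simp: disjoint_def)
      have S0c: "S0 \<subseteq> cubes"
      proof -
        obtain D E where "laminar D" "D \<subseteq> cubes" "S \<subseteq> D" by (rule sparse_facts[OF sp(1) \<eta>(1)])
        then show ?thesis using sp(3) by blast
      qed
      have "(\<Sum>Q\<in>S0. pavg p\<^sub>0 \<beta> f Q * pavg r 1 h Q) \<le> Kb * (L * wvol u G powr (1 - 1 / q))"
        using S0c by (intro form_sum_disjoint[OF u pos sp(2) S0c S0d G(1,2)] pavg_nonneg weak sp(2) S0d bc G(1) h L(1) ps(3) Kb) auto
      also have "\<dots> \<le> X * wvol u G powr (1 - 1 / q)"
      proof -
        have "1 * (Kb * L) \<le> (CX * d * (1 + 1 / \<epsilon>)) * (Kb * L)"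
        proof (rule mult_right_mono)
          have "1 * 1 * 1 \<le> CX * d * (1 + 1 / \<epsilon>)" using CX1 d(1) E1 by (intro mult_mono) auto
          then show "1 \<le> CX * d * (1 + 1 / \<epsilon>)" by simp
        qed (use Kb L in auto)
        then have "Kb * L * wvol u G powr (1 - 1 / q) \<le> X * wvol u G powr (1 - 1 / q)"
          by (intro mult_right_mono) (auto simp: X_def mult_ac)
        then show ?thesis by (simp add: mult.assoc)
      qed
      finally show "(\<Sum>Q\<in>S0. pavg p\<^sub>0 \<beta> f Q * pavg r 1 h Q) \<le> X * wvol u G powr (1 - 1 / q)" .
    qed (use G in auto)
  next
    case False
    then have \<eta>1: "\<eta> < 1" using \<eta> by simp
    define c where "c = (2 * Nc) powr (1 / q)"
    define l where "l = c * L * wvol u G powr (- 1 / q)"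
    have c0: "0 < c" using Nc by (simp add: c_def)
    have l0: "0 < l" using c0 L G by (simp add: l_def)
    define \<Omega> where "\<Omega> = \<Union>{Q \<in> shifted_dyadic_cubes. l < pavg p\<^sub>0 \<beta> f Q}"
    have \<Omega>: "\<Omega> \<in> sets lebesgue" "wvol u (G \<inter> \<Omega>) \<le> Nc * (L / l) powr q"
      using exceptional_set[OF u G(1,2) weak L(1) ps(3) l0] by (auto simp: \<Omega>_def Nc_def)
    have "(L / l) powr q = wvol u G / (2 * Nc)"
    proof -
      have "L / l = wvol u G powr (1 / q) / c" using L c0 G by (simp add: l_def powr_minus field_simps)
      then show ?thesis using G Nc ps by (simp add: c_def powr_divide powr_powr)
    qed
    then have \<Omega>G: "wvol u (G \<inter> \<Omega>) \<le> wvol u G / 2" using \<Omega>(2) Nc by simp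
    define G' where "G' = G - G \<inter> \<Omega>"
    have G's: "G' \<in> sets lebesgue" "bounded G'" "G' \<subseteq> G" using G \<Omega>(1) bounded_subset[of G] by (auto simp: G'_def)
    have uG': "wvol u G' = wvol u G - wvol u (G \<inter> \<Omega>)"
      unfolding G'_def using G \<Omega>(1) by (intro wvol_diff[OF u]) auto
    have G'G: "wvol u G' \<le> wvol u G" using G G's by (intro wvol_mono[OF u]) auto
    show ?thesis
    proof (intro exI[of _ G'] conjI allI impI G's)
      show "wvol u G \<le> 2 * wvol u G'" using uG' \<Omega>G by simp
      fix h :: "real ^ 'n \<Rightarrow> 'k" and S S0 :: "(real ^ 'n) set set"
      assume hM: "\<exists>M. \<forall>x. norm (h x) \<le> M" and h: "\<forall>x. norm (h x) \<le> indicator G' x * u x"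
        and sp: "sparse \<eta> S" "finite S0" "S0 \<subseteq> S"
      obtain M where M: "\<And>x. norm (h x) \<le> M" using hM by blast
      have "(\<Sum>Q\<in>S0. pavg p\<^sub>0 \<beta> f Q * pavg r 1 h Q)
        \<le> 36 ^ CARD('n) * real (card (shifts :: ('n \<Rightarrow> nat) set)) * (6 ^ CARD('n) / ((1 - \<eta>) * \<eta>))
       * (Kb * (d * L * wvol u G' powr (1 - 1 / q) * ((1 + 1 / \<epsilon>) * (1 + c powr (q * \<epsilon>)))))"
      proof (rule sparse_form_bound[OF u pos sp(1) \<eta>(1) \<eta>1 d(2) _ G's(1,2) weak _ _ fin _ L(1) ps(3) \<epsilon>(1) c0 Kb e(1) r1 \<beta>0 \<beta>1 sp(2,3)])
        show "pavg r 1 h Q \<le> Kb * (wvol u (G' \<inter> Q) / wvol u Q) powr (1 - 1 / q + \<epsilon>) * wvol u Q" if "Q \<in> shifted_dyadic_cubes" for Q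
          by (rule bs[OF that G's(1) h])
        show "(\<integral>\<^sup>+x\<in>Q. ennreal (norm (h x) powr r) \<partial>lebesgue) < \<infinity>" if "Q \<in> cubes" for Q
          by (rule power_integral_finite[OF M that]) (use r1 in simp)
        fix Q :: "(real ^ 'n) set" assume Q: "Q \<in> shifted_dyadic_cubes" and pQ: "0 < wvol u (G' \<inter> Q)"
        have "pavg p\<^sub>0 \<beta> f Q \<le> l"
        proof (rule ccontr)
          assume "\<not> pavg p\<^sub>0 \<beta> f Q \<le> l"
          then have "Q \<subseteq> \<Omega>" using Q by (auto simp: \<Omega>_def)
          then have "G' \<inter> Q = {}" by (auto simp: G'_def)
          then show False using pQ by (simp add: wvol_def)
        qed
        also have "l \<le> c * L * wvol u G' powr (- 1 / q)"
        proof -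
          have Qs: "Q \<in> sets lebesgue" using Q shifted_grid_cubes cube_facts(1) by (auto simp: shifted_dyadic_cubes_eq)
          have "wvol u (G' \<inter> Q) \<le> wvol u G'" using G's Qs by (intro wvol_mono[OF u]) auto
          then have "0 < wvol u G'" using pQ by simp
          then have "wvol u G powr (- 1 / q) \<le> wvol u G' powr (- 1 / q)" using G'G ps by (intro powr_mono2') auto
          then show ?thesis unfolding l_def using c0 L by (intro mult_left_mono) auto
        qed
        finally show "pavg p\<^sub>0 \<beta> f Q \<le> c * L * wvol u G' powr (- 1 / q)" .
      qed (use d(1) in auto)
      also have "\<dots> \<le> X * wvol u G powr (1 - 1 / q)"
      proof -
        define P where "P = 36 ^ CARD('n) * Nc * (6 ^ CARD('n) / ((1 - \<eta>) * \<eta>))"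
        have P0: "0 \<le> P" using Nc \<eta> by (simp add: P_def)
        have cc: "c powr (q * \<epsilon>) \<le> 2 * Nc"
        proof -
          have "c powr (q * \<epsilon>) = (2 * Nc) powr (1 / q * (q * \<epsilon>))" unfolding c_def by (rule powr_powr)
          also have "\<dots> \<le> (2 * Nc) powr 1"
          proof (rule powr_mono)
            have "\<epsilon> \<le> q * \<epsilon>" using ps \<epsilon> mult_right_mono[of 1 q \<epsilon>] by simp
            then have "\<epsilon> \<le> 1" using \<epsilon>(2) by linarith
            then show "1 / q * (q * \<epsilon>) \<le> 1" using ps by simp
          qed (use Nc in simp)
          finally show ?thesis using Nc by simp
        qed
        have gg: "wvol u G' powr (1 - 1 / q) \<le> wvol u G powr (1 - 1 / q)"
          using G'G ps wvol_nonneg[OF u] by (intro powr_mono2) auto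
        have "P * (Kb * (d * L * wvol u G' powr (1 - 1 / q) * ((1 + 1 / \<epsilon>) * (1 + c powr (q * \<epsilon>)))))
           \<le> P * (Kb * (d * L * wvol u G powr (1 - 1 / q) * ((1 + 1 / \<epsilon>) * (1 + 2 * Nc))))"
          using P0 Kb d(1) L \<epsilon> cc gg Nc by (intro mult_left_mono mult_mono) auto
        also have "\<dots> = (P * (1 + 2 * Nc)) * (Kb * d * (1 + 1 / \<epsilon>) * L * wvol u G powr (1 - 1 / q))" by (simp only: mult_ac)
        also have "\<dots> \<le> CX * (Kb * d * (1 + 1 / \<epsilon>) * L * wvol u G powr (1 - 1 / q))"
        proof (rule mult_right_mono)
          show "P * (1 + 2 * Nc) \<le> CX" unfolding CX P_def Nc_def by simp
        qed (use Kb d(1) \<epsilon> L in auto)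
        also have "\<dots> = X * wvol u G powr (1 - 1 / q)" by (simp only: X_def mult_ac)
        finally show ?thesis by (simp only: P_def Nc_def)
      qed
      finally show "(\<Sum>Q\<in>S0. pavg p\<^sub>0 \<beta> f Q * pavg r 1 h Q) \<le> X * wvol u G powr (1 - 1 / q)" .
    qed
  qed
  show ?thesis
    unfolding lorentz_weak_def
  proof (rule SUP_least)
    fix y :: real assume "y \<in> {0<..}"
    then have y: "0 < y" by simp
    have "ennreal y * epow (wmeas u {x. y < norm (T f x)}) (1 / q) \<le> ennreal (4 * (max A 0 * real N) * X)"
    proof (rule weak_type_of_form_bound[OF u f locally_integrable_measurable[OF Tf] _ e(1) r(3,4) \<beta>0 \<beta>(3) r(2) \<eta>(1) _ _ FB X0 ps(3) y])
      show "T f absolutely_integrable_on K" if "compact K" for K using Tf that by (simp add: locally_integrable_def)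
      fix g :: "real ^ 'n \<Rightarrow> 'k" and Y assume g: "g \<in> test_functions" and Y: "0 \<le> Y" and b: "\<And>S S0. sparse \<eta> S \<Longrightarrow> finite S0 \<Longrightarrow> S0 \<subseteq> S \<Longrightarrow>
        (\<Sum>Q\<in>S0. pavg p\<^sub>0 \<beta> f Q * pavg r 1 g Q) \<le> Y"
      show "norm (\<integral>x. T f x * g x \<partial>lebesgue) \<le> max A 0 * real N * Y"
      proof (rule pairing_bound_of_S_class[OF S _ f g Y])
        show "1 \<le> conj_exp q\<^sub>0" using r1 r(1) by simp
        fix S S0 :: "(real ^ 'n) set set" assume "sparse \<eta> S" "finite S0" "S0 \<subseteq> S"
        then show "(\<Sum>Q\<in>S0. pavg p\<^sub>0 (\<alpha> / (real CARD('n) * conj_exp q\<^sub>0)) f Q * pavg (conj_exp q\<^sub>0) 1 g Q) \<le> Y"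
          using b unfolding \<beta>(1) r(1) by blast
      qed
    qed auto
    then show "ennreal y * epow (wmeas u {x. y < norm (T f x)}) (1 / q) \<le> ennreal (4 * (max A 0 * real N) * (CX * Kb * d * (1 + 1 / \<epsilon>) * L))"
      by (simp only: X_def)
  qed
qed

section \<open>Extension by density\<close>

lemma epow_add_le:
  assumes "1 \<le> q" shows "epow (a + b) (1 / q) \<le> epow a (1 / q) + epow b (1 / q)"
proof (cases "a = \<infinity> \<or> b = \<infinity>")
  case True
  then show ?thesis by (auto simp: epow_def)
next
  case False
  then obtain x y where xy: "a = ennreal x" "b = ennreal y" "0 \<le> x" "0 \<le> y" by (cases a; cases b) auto
  have "epow (a + b) (1 / q) = ennreal ((x + y) powr (1 / q))" using xy by (simp add: epow_ennreal flip: ennreal_plus)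
  also have "\<dots> \<le> ennreal (x powr (1 / q) + y powr (1 / q))" using xy assms by (intro ennreal_leI powr_add_le)
  also have "\<dots> = epow a (1 / q) + epow b (1 / q)" using xy by (simp add: epow_ennreal)
  finally show ?thesis .
qed

lemma level_quasi_triangle:
  fixes g f :: "real ^ 'n \<Rightarrow> 'k::{real_normed_vector, second_countable_topology}"
  assumes u: "locally_finite_weight u" and [measurable]: "g \<in> borel_measurable lebesgue" "f \<in> borel_measurable lebesgue" and q: "1 \<le> q"
  shows "epow (wmeas u {x. y < norm (g x)}) (1 / q)
    \<le> epow (wmeas u {x. y / 2 < norm (g x - f x)}) (1 / q) + epow (wmeas u {x. y / 2 < norm (f x)}) (1 / q)"
proof -
  define A where "A = {x \<in> space lebesgue. y / 2 < norm (g x - f x)}"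
  define B where "B = {x \<in> space lebesgue. y / 2 < norm (f x)}"
  define C where "C = {x \<in> space lebesgue. y < norm (g x)}"
  have s: "A \<in> sets lebesgue" "B \<in> sets lebesgue" "C \<in> sets lebesgue" unfolding A_def B_def C_def by measurable
  have "C \<subseteq> A \<union> B"
  proof
    fix x assume "x \<in> C"
    then have "y < norm (g x - f x) + norm (f x)" using norm_triangle_sub[of "g x" "f x"] by (simp add: C_def)
    then have "y / 2 < norm (g x - f x) \<or> y / 2 < norm (f x)" by (smt (verit) field_sum_of_halves)
    then show "x \<in> A \<union> B" by (auto simp: A_def B_def)
  qed
  then have "wmeas u C \<le> wmeas u A + wmeas u B"
    unfolding wmeas_eq_emeasure[OF lfw_meas[OF u] s(1)] wmeas_eq_emeasure[OF lfw_meas[OF u] s(2)] wmeas_eq_emeasure[OF lfw_meas[OF u] s(3)]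
    using s by (intro order_trans[OF emeasure_mono emeasure_subadditive]) auto
  then have "epow (wmeas u C) (1 / q) \<le> epow (wmeas u A + wmeas u B) (1 / q)" using q by (intro epow_mono) auto
  also have "\<dots> \<le> epow (wmeas u A) (1 / q) + epow (wmeas u B) (1 / q)" by (rule epow_add_le[OF q])
  finally show ?thesis by (simp add: A_def B_def C_def)
qed

lemma lorentz_weak_quasi_triangle:
  fixes g f :: "real ^ 'n \<Rightarrow> 'k::{real_normed_vector, second_countable_topology}"
  assumes "locally_finite_weight u" "g \<in> borel_measurable lebesgue" "f \<in> borel_measurable lebesgue" "1 \<le> q"
  shows "lorentz_weak q u g \<le> 2 * (lorentz_weak q u (\<lambda>x. g x - f x) + lorentz_weak q u f)"
  unfolding lorentz_weak_def[of q u g]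
proof (rule SUP_least)
  fix y :: real assume "y \<in> {0<..}"
  then have y: "0 < y / 2" by simp
  have up: "ennreal (y / 2) * epow (wmeas u {x. y / 2 < norm (k x)}) (1 / q) \<le> lorentz_weak q u k" for k :: "real ^ 'n \<Rightarrow> 'k"
    unfolding lorentz_weak_def using y by (intro SUP_upper) auto
  have "ennreal y = 2 * ennreal (y / 2)" using y ennreal_mult[of 2 "y / 2"] by simp
  then have "ennreal y * epow (wmeas u {x. y < norm (g x)}) (1 / q)
    \<le> 2 * (ennreal (y / 2) * (epow (wmeas u {x. y / 2 < norm (g x - f x)}) (1 / q) + epow (wmeas u {x. y / 2 < norm (f x)}) (1 / q)))"
    using level_quasi_triangle[OF assms, of y] by (simp add: mult.assoc mult_left_mono)
  also have "\<dots> \<le> 2 * (lorentz_weak q u (\<lambda>x. g x - f x) + lorentz_weak q u f)"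
    unfolding distrib_left[of "ennreal (y / 2)"] by (intro mult_left_mono add_mono up) auto
  finally show "ennreal y * epow (wmeas u {x. y < norm (g x)}) (1 / q) \<le> 2 * (lorentz_weak q u (\<lambda>x. g x - f x) + lorentz_weak q u f)" .
qed

lemma lorentz_p1_quasi_triangle:
  fixes g f :: "real ^ 'n \<Rightarrow> 'k::{real_normed_vector, second_countable_topology}"
  assumes u: "locally_finite_weight u" and gf: "g \<in> borel_measurable lebesgue" "f \<in> borel_measurable lebesgue" and q: "1 \<le> q"
  shows "lorentz_p1 q u g \<le> 2 * (lorentz_p1 q u (\<lambda>x. g x - f x) + lorentz_p1 q u f)"
proof -
  define H where "H k y = epow (wmeas u {x. y < norm (k x)}) (1 / q) * indicator {0<..} y" for k :: "real ^ 'n \<Rightarrow> 'k" and y :: real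
  have Hm: "H k \<in> borel_measurable borel" for k
  proof -
    define \<psi> where "\<psi> y = epow (wmeas u {x. y < norm (k x)}) (1 / q)" for y
    have anti: "\<psi> y' \<le> \<psi> y" if "y \<le> y'" for y y'
      unfolding \<psi>_def wmeas_def using that q by (intro epow_mono nn_integral_mono) (auto simp: indicator_def)
    have "\<psi> \<in> borel_measurable borel"
    proof (rule borel_measurableI_greater)
      fix t
      have "is_interval {y. t < \<psi> y}"
        unfolding is_interval_1 using anti by (auto intro: less_le_trans)
      then show "{x \<in> space borel. t < \<psi> x} \<in> sets borel" using real_interval_borel_measurable by simp
    qed
    then show ?thesis unfolding H_def \<psi>_def[symmetric] by simp
  qed
  have Hm2: "(\<lambda>y. H k (y / 2)) \<in> borel_measurable borel" for k
    by (rule measurable_compose[OF _ Hm]) simp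
  have half: "(\<integral>\<^sup>+y. H k (y / 2) \<partial>lborel) = 2 * (\<integral>\<^sup>+y. H k y \<partial>lborel)" for k
  proof -
    show ?thesis using nn_integral_real_affine[OF Hm2[of k], of 2 0] by simp
  qed
  have L: "lorentz_p1 q u k = ennreal q * (\<integral>\<^sup>+y. H k y \<partial>lborel)" for k by (simp add: lorentz_p1_def H_def)
  have "(\<integral>\<^sup>+y. H g y \<partial>lborel) \<le> (\<integral>\<^sup>+y. H (\<lambda>x. g x - f x) (y / 2) + H f (y / 2) \<partial>lborel)"
    using level_quasi_triangle[OF u gf q] by (intro nn_integral_mono) (auto simp: H_def indicator_def)
  also have "\<dots> = (\<integral>\<^sup>+y. H (\<lambda>x. g x - f x) (y / 2) \<partial>lborel) + (\<integral>\<^sup>+y. H f (y / 2) \<partial>lborel)"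
    using Hm2 by (intro nn_integral_add) simp_all
  also have "\<dots> = 2 * ((\<integral>\<^sup>+y. H (\<lambda>x. g x - f x) y \<partial>lborel) + (\<integral>\<^sup>+y. H f y \<partial>lborel))" by (simp add: half distrib_left)
  finally have "ennreal q * (\<integral>\<^sup>+y. H g y \<partial>lborel) \<le> ennreal q * (2 * ((\<integral>\<^sup>+y. H (\<lambda>x. g x - f x) y \<partial>lborel) + (\<integral>\<^sup>+y. H f y \<partial>lborel)))"
    by (rule mult_left_mono) simp
  then show ?thesis unfolding L by (simp add: distrib_left mult.left_commute)
qed

text \<open>Both Lorentz expressions satisfy the triangle inequality up to a factor 2; the limit uses each of them once,
  whence the factor 4.\<close>

lemma op_norm_le_of_test_functions:
  fixes T :: "(real ^ 'n \<Rightarrow> 'k::{real_normed_field, euclidean_space}) \<Rightarrow> (real ^ 'n \<Rightarrow> 'k)"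
  assumes u: "locally_finite_weight u" and v: "locally_finite_weight v" and pq: "1 \<le> p" "1 \<le> q"
    and Tm: "\<And>f. f \<in> test_functions \<Longrightarrow> T f \<in> borel_measurable lebesgue"
    and K: "K < \<infinity>" and test: "\<And>f. f \<in> test_functions \<Longrightarrow> lorentz_weak q u (T f) \<le> K * lorentz_p1 p v f"
  shows "op_norm (lorentz_p1 p v) (lorentz_weak q u) T \<le> 4 * K"
  unfolding op_norm_def
proof (rule Inf_lower, rule CollectI, intro allI impI)
  fix f h assume "density_extension (lorentz_p1 p v) (lorentz_weak q u) T f h"
  then obtain \<phi> where fm: "f \<in> borel_measurable lebesgue" and hm: "h \<in> borel_measurable lebesgue"
    and \<phi>: "\<And>k::nat. \<phi> k \<in> test_functions" and l1: "(\<lambda>k. lorentz_p1 p v (\<lambda>x. \<phi> k x - f x)) \<longlonglongrightarrow> 0"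
    and l2: "(\<lambda>k. lorentz_weak q u (\<lambda>x. T (\<phi> k) x - h x)) \<longlonglongrightarrow> 0"
    unfolding density_extension_def by blast
  have \<phi>m: "\<phi> k \<in> borel_measurable lebesgue" for k by (rule test_function_facts[OF \<phi>[of k]])
  have sym: "lorentz_weak q u (\<lambda>x. h x - T (\<phi> k) x) = lorentz_weak q u (\<lambda>x. T (\<phi> k) x - h x)" for k
    by (simp add: lorentz_weak_def norm_minus_commute)
  have "lorentz_weak q u h \<le> 2 * (lorentz_weak q u (\<lambda>x. T (\<phi> k) x - h x) + K * (2 * (lorentz_p1 p v (\<lambda>x. \<phi> k x - f x) + lorentz_p1 p v f)))" for k
  proof -
    have "lorentz_weak q u h \<le> 2 * (lorentz_weak q u (\<lambda>x. T (\<phi> k) x - h x) + lorentz_weak q u (T (\<phi> k)))"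
      using lorentz_weak_quasi_triangle[OF u hm Tm[OF \<phi>] pq(2), of k] by (simp add: sym)
    also have "\<dots> \<le> 2 * (lorentz_weak q u (\<lambda>x. T (\<phi> k) x - h x) + K * lorentz_p1 p v (\<phi> k))"
      by (intro mult_left_mono add_mono test \<phi>) auto
    also have "\<dots> \<le> 2 * (lorentz_weak q u (\<lambda>x. T (\<phi> k) x - h x) + K * (2 * (lorentz_p1 p v (\<lambda>x. \<phi> k x - f x) + lorentz_p1 p v f)))"
      by (intro mult_left_mono add_mono lorentz_p1_quasi_triangle[OF v \<phi>m fm pq(1)]) auto
    finally show ?thesis .
  qed
  moreover have "(\<lambda>k. 2 * (lorentz_weak q u (\<lambda>x. T (\<phi> k) x - h x) + K * (2 * (lorentz_p1 p v (\<lambda>x. \<phi> k x - f x) + lorentz_p1 p v f))))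
     \<longlonglongrightarrow> 2 * (0 + K * (2 * (0 + lorentz_p1 p v f)))"
    using K by (intro ennreal_tendsto_cmult tendsto_add l1 l2 tendsto_const) auto
  ultimately have "lorentz_weak q u h \<le> 2 * (0 + K * (2 * (0 + lorentz_p1 p v f)))"
    by (intro LIMSEQ_le_const) auto
  also have "\<dots> = 4 * K * lorentz_p1 p v f"
    by (simp add: mult.assoc[symmetric] mult.commute[of K 2])
  finally show "lorentz_weak q u h \<le> 4 * K * lorentz_p1 p v f" .
qed

section \<open>Local averages of the dual function\<close>

lemma bounded_subset_cube:
  fixes E :: "(real ^ 'n) set"
  assumes "bounded E" shows "\<exists>Q\<in>cubes. E \<subseteq> Q"
proof -
  obtain B where B: "\<And>x. x \<in> E \<Longrightarrow> norm x \<le> B" using assms by (auto simp: bounded_iff)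
  define l where "l = \<bar>B\<bar> + 1"
  define Q :: "(real ^ 'n) set" where "Q = cube_at (\<chi> i. - l) (2 * l)"
  have "Q \<in> cubes" unfolding cubes_def Q_def by (intro CollectI exI conjI) (rule refl, simp add: l_def)
  moreover have "x \<in> Q" if "x \<in> E" for x
  proof -
    have "\<bar>x $ i\<bar> < l" for i using component_le_norm_cart[of x i] B[OF that] by (simp add: l_def)
    then show ?thesis unfolding Q_def cube_at_def by (auto simp: abs_less_iff) (smt (verit))+
  qed
  ultimately show ?thesis by blast
qed

text \<open>A finite ratio of averages forces \<open>u^s\<close> to be integrable on cubes, and \<open>1 \<le> Rc\<close> is Jensen's inequality.\<close>

lemma reverse_holder_facts:
  fixes u :: "real ^ 'n \<Rightarrow> real"
  assumes u: "locally_finite_weight u" and pos: "\<And>Q. Q \<in> cubes \<Longrightarrow> 0 < wvol u Q" and s: "1 < s" and RH: "RH_const s u < \<infinity>"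
  shows "\<exists>Rc. 1 \<le> Rc \<and> RH_const s u = ennreal Rc \<and> locally_finite_weight (\<lambda>x. u x powr s) \<and>
    (\<forall>Q\<in>cubes. wvol (\<lambda>x. u x powr s) Q * measure lebesgue Q powr (s - 1) \<le> (Rc * wvol u Q) powr s)"
proof -
  let ?z = "\<lambda>x. u x powr s"
  define Rc where "Rc = enn2real (RH_const s u)"
  have Rc: "RH_const s u = ennreal Rc" "0 \<le> Rc" using RH by (auto simp: Rc_def)
  have u0: "0 \<le> u x" for x by (rule lfw_nonneg[OF u])
  have a1: "avg 0 1 u Q = ennreal (wvol u Q / measure lebesgue Q)" if Q: "Q \<in> cubes" for Q
  proof -
    note Qf = cube_facts[OF Q]
    have I: "(\<integral>\<^sup>+x\<in>Q. ennreal (norm (u x) powr 1) \<partial>lebesgue) = ennreal (wvol u Q)"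
      using wmeas_eq_wvol[OF u Qf(1,2)] u0 by (simp add: wmeas_def)
    show ?thesis using avg_eq_ennreal[OF Q, of u 1 0] I wvol_nonneg[OF u, of Q] Qf(3)
      by (simp add: powr_minus divide_inverse)
  qed
  have ratio: "avg 0 s u Q / avg 0 1 u Q \<le> ennreal Rc" if Q: "Q \<in> cubes" for Q
  proof -
    have "avg 0 s u Q / avg 0 1 u Q \<le> RH_const s u" using s Q by (auto simp: RH_const_def intro!: SUP_upper)
    then show ?thesis by (simp add: Rc)
  qed
  have fin: "wmeas ?z Q < \<infinity>" if Q: "Q \<in> cubes" for Q
  proof (rule ccontr)
    note Qf = cube_facts[OF Q]
    assume "\<not> wmeas ?z Q < \<infinity>"
    then have "(\<integral>\<^sup>+x\<in>Q. ennreal (norm (u x) powr s) \<partial>lebesgue) = \<infinity>"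
      using u0 by (simp add: wmeas_def less_top[symmetric])
    then have "avg 0 s u Q = \<infinity>" using Qf s unfolding avg_def by (simp add: epow_ennreal epow_def ennreal_top_divide)
    then have "avg 0 s u Q / avg 0 1 u Q = \<infinity>" unfolding a1[OF Q] by (simp add: ennreal_top_divide)
    then show False using ratio[OF Q] by (simp add: top_unique)
  qed
  have z: "locally_finite_weight ?z"
  proof -
    have "wmeas ?z E < \<infinity>" if E: "bounded E" for E
    proof -
      obtain Q where Q: "Q \<in> cubes" "E \<subseteq> Q" using bounded_subset_cube[OF E] by blast
      have "wmeas ?z E \<le> wmeas ?z Q" unfolding wmeas_def using Q(2) by (intro nn_integral_mono) (auto simp: indicator_def)
      then show ?thesis using fin[OF Q(1)] by (rule order_le_less_trans)
    qed
    moreover have "?z \<in> borel_measurable lebesgue" using lfw_meas[OF u] by measurable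
    ultimately show ?thesis by (simp add: locally_finite_weight_def)
  qed
  have main: "wvol ?z Q * measure lebesgue Q powr (s - 1) \<le> (Rc * wvol u Q) powr s" if Q: "Q \<in> cubes" for Q
  proof -
    note Qf = cube_facts[OF Q]
    define m where "m = measure lebesgue Q"
    have m: "0 < m" using Qf by (simp add: m_def)
    define Z where "Z = wvol ?z Q"
    define U where "U = wvol u Q"
    have Z: "0 \<le> Z" and U: "0 < U" using wvol_nonneg[OF z] pos[OF Q] by (auto simp: Z_def U_def)
    have I: "(\<integral>\<^sup>+x\<in>Q. ennreal (norm (u x) powr s) \<partial>lebesgue) = ennreal Z"
      using wmeas_eq_wvol[OF z Qf(1,2)] u0 by (simp add: wmeas_def Z_def)
    have "avg 0 s u Q = ennreal (Z powr (1 / s) * m powr (- (1 / s)))"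
      using avg_eq_ennreal[OF Q, of u s 0] I s Z by (simp add: m_def)
    then have "ennreal (Z powr (1 / s) * m powr (- (1 / s))) / ennreal (U / m) \<le> ennreal Rc"
      using ratio[OF Q] a1[OF Q] by (simp add: U_def m_def)
    then have "Z powr (1 / s) * m powr (- (1 / s)) / (U / m) \<le> Rc"
      using U m Rc by (simp add: divide_ennreal)
    then have "Z powr (1 / s) * m powr (- (1 / s)) * m \<le> Rc * U" using U m by (simp add: field_simps)
    then have "(Z powr (1 / s) * m powr (- (1 / s)) * m) powr s \<le> (Rc * U) powr s" using m s by (intro powr_mono2) auto
    moreover have "(Z powr (1 / s) * m powr (- (1 / s)) * m) powr s = Z * (m powr (- 1) * m powr s)"
      using Z m s by (simp add: powr_mult powr_powr)
    moreover have "m powr (- 1) * m powr s = m powr (s - 1)" by (simp only: powr_add[symmetric]) simp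
    ultimately have "Z * m powr (s - 1) \<le> (Rc * U) powr s" by (simp only:)
    then show ?thesis by (simp only: Z_def U_def m_def)
  qed
  have "1 \<le> Rc"
  proof -
    define Q :: "(real ^ 'n) set" where "Q = cell (\<lambda>_. 0) 0 (\<lambda>_. 0)"
    have Q: "Q \<in> cubes" unfolding Q_def by (rule cell_cubes)
    note Qf = cube_facts[OF Q]
    have "wvol u Q powr s \<le> (Rc * wvol u Q) powr s"
      using wvol_jensen[OF u z _ Qf(1,2)] main[OF Q] s by (meson less_imp_le order_trans)
    then have "wvol u Q \<le> Rc * wvol u Q"
      using pos[OF Q] Rc s powr_less_mono2[of s "Rc * wvol u Q" "wvol u Q"] by (force simp: not_le)
    then show ?thesis using pos[OF Q] by simp
  qed
  then show ?thesis using Rc z main by blast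
qed

text \<open>The decay of \<open>u^s\<close> with exponent \<open>\<delta> = (2 * Rc)^(- s) / ln (2 * d2)\<close>, fed into \<open>pavg_interpolation\<close>, gains
  \<open>\<epsilon> = \<delta> / (s q)\<close>; the cost \<open>1 / \<epsilon>\<close> is bounded by powers of the constants because a logarithm is below any
  power. For \<open>q\<^sub>0 = \<infinity>\<close> one has \<open>r = s = 1\<close> and the average of \<open>h\<close> is at most \<open>u(G \<inter> Q)\<close>,
  which is a gain of \<open>\<epsilon> = 1/q\<close>. The second estimate, without gain, serves cubes outside the shifted grids.\<close>

lemma local_average_bounds:
  fixes u :: "real ^ 'n \<Rightarrow> real" and q :: real and q\<^sub>0 :: ennreal
  assumes u: "locally_finite_weight u" and pos: "\<And>Q. Q \<in> cubes \<Longrightarrow> 0 < wvol u Q"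
    and q: "1 \<le> q" "ennreal q < q\<^sub>0" and s: "s = conj_exp (q\<^sub>0 / ennreal q)" and r: "r = conj_exp q\<^sub>0"
    and RH: "RH_const s u < \<infinity>" and d2: "1 \<le> d2"
    and dbl: "\<And>Q E. Q \<in> shifted_dyadic_cubes \<Longrightarrow> E \<in> sets lebesgue \<Longrightarrow> E \<subseteq> Q \<Longrightarrow> (1 / 2) ^ CARD('n) * measure lebesgue Q \<le> measure lebesgue E \<Longrightarrow> wvol u Q \<le> d2 * wvol u E"
  shows "\<exists>Rc \<epsilon>. 1 \<le> Rc \<and> RH_const s u = ennreal Rc \<and> 0 < \<epsilon> \<and> q * \<epsilon> \<le> 1 \<and>
     1 + 1 / \<epsilon> \<le> (1 + q + 4 * s * q * q * 2 powr s) * (Rc powr s * d2 powr (1 / q)) \<and>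
     (\<forall>Q G (h :: real ^ 'n \<Rightarrow> 'k::real_normed_vector). Q \<in> shifted_dyadic_cubes \<longrightarrow> G \<in> sets lebesgue \<longrightarrow> (\<forall>x. norm (h x) \<le> indicator G x * u x) \<longrightarrow>
       pavg r 1 h Q \<le> 4 * Rc powr (1 / q) * (wvol u (G \<inter> Q) / wvol u Q) powr (1 - 1 / q + \<epsilon>) * wvol u Q) \<and>
     (\<forall>Q G (h :: real ^ 'n \<Rightarrow> 'k). Q \<in> cubes \<longrightarrow> G \<in> sets lebesgue \<longrightarrow> (\<forall>x. norm (h x) \<le> indicator G x * u x) \<longrightarrow>
       pavg r 1 h Q \<le> 4 * Rc powr (1 / q) * (wvol u (G \<inter> Q) / wvol u Q) powr (1 - 1 / q) * wvol u Q)"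
proof (cases "q\<^sub>0 = \<infinity>")
  case True
  have s1: "s = 1" using True q by (simp add: s conj_exp_def ennreal_top_divide)
  have r1: "r = 1" using True by (simp add: r conj_exp_def)
  have d2q: "1 \<le> d2 powr (1 / q)" using d2 q by (intro ge_one_powr_ge_zero) auto
  have base: "pavg r 1 h Q \<le> 4 * ((wvol u (G \<inter> Q) / wvol u Q) * wvol u Q) \<and> 0 \<le> wvol u (G \<inter> Q) / wvol u Q \<and> wvol u (G \<inter> Q) / wvol u Q \<le> 1"
    if Q: "Q \<in> cubes" and G: "G \<in> sets lebesgue" and h: "\<forall>x. norm (h x) \<le> indicator G x * u x" for Q G and h :: "real ^ 'n \<Rightarrow> 'k"
  proof -
    note Qf = cube_facts[OF Q]
    have GQ: "G \<inter> Q \<in> sets lebesgue" "bounded (G \<inter> Q)" using G Qf bounded_subset[of Q] by auto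
    have le: "wvol u (G \<inter> Q) \<le> wvol u Q" using GQ Qf by (intro wvol_mono[OF u]) auto
    have "(\<integral>\<^sup>+x\<in>Q. ennreal (norm (h x) powr 1) \<partial>lebesgue) \<le> wmeas u (G \<inter> Q)"
      unfolding wmeas_def
    proof (intro nn_integral_mono)
      fix x
      have "ennreal (norm (h x)) \<le> ennreal (indicator G x * u x)" using h by (intro ennreal_leI) auto
      then show "ennreal (norm (h x) powr 1) * indicator Q x \<le> ennreal (u x) * indicator (G \<inter> Q) x"
        by (auto simp: indicator_def split: if_splits)
    qed
    also have "\<dots> = ennreal (wvol u (G \<inter> Q))" by (rule wmeas_eq_wvol[OF u GQ])
    finally have "enn2real (\<integral>\<^sup>+x\<in>Q. ennreal (norm (h x) powr 1) \<partial>lebesgue) \<le> wvol u (G \<inter> Q)"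
      by (intro enn2real_leI wvol_nonneg[OF u])
    then have "pavg r 1 h Q \<le> wvol u (G \<inter> Q)" using Qf by (simp add: pavg_def r1)
    also have "\<dots> \<le> 4 * wvol u (G \<inter> Q)" using wvol_nonneg[OF u, of "G \<inter> Q"] by simp
    finally show ?thesis using pos[OF Q] le wvol_nonneg[OF u, of "G \<inter> Q"] by simp
  qed
  have sc: "Q \<in> cubes" if "Q \<in> shifted_dyadic_cubes" for Q :: "(real ^ 'n) set"
    using that shifted_grid_cubes by (auto simp: shifted_dyadic_cubes_eq)
  have cost: "1 + 1 / (1 / q) \<le> (1 + q + 4 * s * q * q * 2 powr s) * (1 powr s * d2 powr (1 / q))"
  proof -
    have "1 + q \<le> (1 + q + 4 * s * q * q * 2 powr s) * 1" using q by (simp add: s1)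
    also have "\<dots> \<le> (1 + q + 4 * s * q * q * 2 powr s) * d2 powr (1 / q)"
      using q d2q by (intro mult_left_mono) (auto simp: s1)
    finally show ?thesis by simp
  qed
  have bs: "pavg r 1 h Q \<le> 4 * 1 powr (1 / q) * (wvol u (G \<inter> Q) / wvol u Q) powr (1 - 1 / q + 1 / q) * wvol u Q"
    if Q: "Q \<in> shifted_dyadic_cubes" and G: "G \<in> sets lebesgue" and h: "\<forall>x. norm (h x) \<le> indicator G x * u x" for Q G and h :: "real ^ 'n \<Rightarrow> 'k"
  proof -
    have "0 \<le> wvol u (G \<inter> Q) / wvol u Q" "pavg r 1 h Q \<le> 4 * (wvol u (G \<inter> Q) / wvol u Q * wvol u Q)"
      using base[OF sc[OF Q] G h] by blast+
    moreover have "1 - 1 / q + 1 / q = 1" by simp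
    ultimately show ?thesis by (simp only: powr_one powr_one_eq_one mult_1_right mult.assoc)
  qed
  have bc: "pavg r 1 h Q \<le> 4 * 1 powr (1 / q) * (wvol u (G \<inter> Q) / wvol u Q) powr (1 - 1 / q) * wvol u Q"
    if Q: "Q \<in> cubes" and G: "G \<in> sets lebesgue" and h: "\<forall>x. norm (h x) \<le> indicator G x * u x" for Q G and h :: "real ^ 'n \<Rightarrow> 'k"
  proof -
    define \<rho> where "\<rho> = wvol u (G \<inter> Q) / wvol u Q"
    have \<rho>: "0 \<le> \<rho>" "\<rho> \<le> 1" "pavg r 1 h Q \<le> 4 * (\<rho> * wvol u Q)" using base[OF Q G h] by (auto simp: \<rho>_def)
    have "\<rho> \<le> \<rho> powr (1 - 1 / q)"
    proof (cases "\<rho> = 0")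
      case False
      then have "\<rho> powr 1 \<le> \<rho> powr (1 - 1 / q)" using \<rho> q by (intro powr_mono') auto
      then show ?thesis using \<rho> by simp
    qed simp
    then have "4 * (\<rho> * wvol u Q) \<le> 4 * (\<rho> powr (1 - 1 / q) * wvol u Q)" using pos[OF Q] by (intro mult_left_mono mult_right_mono) auto
    then show ?thesis using \<rho>(3) by (simp add: \<rho>_def[symmetric] mult.assoc)
  qed
  have RH1: "RH_const s u = ennreal 1" by (simp add: RH_const_def s1)
  have "0 < 1 / q" "q * (1 / q) \<le> 1" using q by auto
  then show ?thesis using RH1 cost bs bc by (intro exI[of _ "1::real"] exI[of _ "1 / q"] conjI) (rule order_refl, assumption+, blast+)
next
  case False
  then obtain Q0 where Q0: "q\<^sub>0 = ennreal Q0" "0 \<le> Q0" by (cases q\<^sub>0) auto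
  have qQ: "q < Q0" using q Q0 by (simp add: ennreal_less_iff)
  have seq: "s = Q0 / (Q0 - q)"
  proof -
    have "q\<^sub>0 / ennreal q = ennreal (Q0 / q)" using Q0 q by (simp add: divide_ennreal)
    then have "s = (Q0 / q) / (Q0 / q - 1)" using Q0 q by (simp add: s conj_exp_def)
    also have "\<dots> = Q0 / (Q0 - q)" using q qQ by (simp add: field_simps)
    finally show ?thesis .
  qed
  have req: "r = Q0 / (Q0 - 1)" using Q0 by (simp add: r conj_exp_def)
  have s1: "1 < s" using q qQ by (simp add: seq)
  obtain Rc where Rc: "1 \<le> Rc" "RH_const s u = ennreal Rc" and z: "locally_finite_weight (\<lambda>x. u x powr s)"
    and RHQ: "\<forall>Q\<in>cubes. wvol (\<lambda>x. u x powr s) Q * measure lebesgue Q powr (s - 1) \<le> (Rc * wvol u Q) powr s"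
    using reverse_holder_facts[OF u pos s1 RH] by blast
  let ?z = "\<lambda>x. u x powr s"
  have sc: "Q \<in> cubes" if "Q \<in> shifted_dyadic_cubes" for Q :: "(real ^ 'n) set"
    using that shifted_grid_cubes by (auto simp: shifted_dyadic_cubes_eq)
  define c where "c = (2 * Rc) powr (- s)"
  have c: "0 < c" "c \<le> 1 / 2"
  proof -
    show "0 < c" using Rc by (simp add: c_def)
    have "2 powr 1 \<le> 2 powr s" using s1 by (intro powr_mono) auto
    also have "\<dots> \<le> (2 * Rc) powr s" using Rc s1 by (intro powr_mono2) auto
    finally have "2 \<le> (2 * Rc) powr s" by simp
    then show "c \<le> 1 / 2" unfolding c_def powr_minus_divide by (intro divide_left_mono) auto
  qed
  define \<delta> where "\<delta> = c / ln (2 * d2)"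
  define \<epsilon> where "\<epsilon> = \<delta> / (s * q)"
  have ln0: "2 / 3 \<le> ln (2 * d2)"
  proof -
    have "ln 2 \<le> ln (2 * d2)" using d2 by simp
    then show ?thesis using ln2_ge_two_thirds by linarith
  qed
  have \<delta>: "0 < \<delta>" "\<delta> \<le> 1" using c ln0 by (auto simp: \<delta>_def divide_le_eq)
  have \<epsilon>0: "0 < \<epsilon>" using \<delta> s1 q by (simp add: \<epsilon>_def)
  have q\<epsilon>: "q * \<epsilon> \<le> 1"
  proof -
    have "q * \<epsilon> = \<delta> / s" using q s1 by (simp add: \<epsilon>_def)
    also have "\<dots> \<le> 1" using \<delta> s1 by (simp add: divide_le_eq)
    finally show ?thesis .
  qed
  have d2q: "1 \<le> d2 powr (1 / q)" using d2 q by (intro ge_one_powr_ge_zero) auto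
  have Rs: "1 \<le> Rc powr s" using Rc s1 by (intro ge_one_powr_ge_zero) auto
  have cost: "1 + 1 / \<epsilon> \<le> (1 + q + 4 * s * q * q * 2 powr s) * (Rc powr s * d2 powr (1 / q))"
  proof -
    have "ln (2 * d2) \<le> (2 * d2) powr (1 / q) / (1 / q)" using d2 q by (intro ln_powr_bound) auto
    also have "\<dots> = q * (2 powr (1 / q) * d2 powr (1 / q))" using d2 q by (simp add: powr_mult)
    also have "\<dots> \<le> q * (2 powr 1 * d2 powr (1 / q))" using q by (intro mult_left_mono mult_right_mono powr_mono) auto
    finally have lnle: "ln (2 * d2) \<le> 2 * q * d2 powr (1 / q)" by simp
    have "1 / \<epsilon> = s * q * (ln (2 * d2) * (2 * Rc) powr s)"
      using s1 q Rc by (simp add: \<epsilon>_def \<delta>_def c_def powr_minus field_simps)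
    also have "\<dots> \<le> s * q * (2 * q * d2 powr (1 / q) * (2 * Rc) powr s)"
      using lnle s1 q by (intro mult_left_mono mult_right_mono) auto
    also have "\<dots> = 2 * s * q * q * 2 powr s * (Rc powr s * d2 powr (1 / q))" using Rc by (simp add: powr_mult mult_ac)
    finally have a: "1 / \<epsilon> \<le> 2 * s * q * q * 2 powr s * (Rc powr s * d2 powr (1 / q))" .
    have b: "1 \<le> Rc powr s * d2 powr (1 / q)" using mult_mono[OF Rs d2q] by simp
    have "1 + 1 / \<epsilon> \<le> 1 * (Rc powr s * d2 powr (1 / q)) + 2 * s * q * q * 2 powr s * (Rc powr s * d2 powr (1 / q))" using a b by simp
    also have "\<dots> = (1 + 2 * s * q * q * 2 powr s) * (Rc powr s * d2 powr (1 / q))" by (simp add: distrib_right)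
    also have "\<dots> \<le> (1 + q + 4 * s * q * q * 2 powr s) * (Rc powr s * d2 powr (1 / q))"
      using q s1 b by (intro mult_right_mono add_mono) auto
    finally show ?thesis .
  qed
  have half: "wvol ?z G \<le> (1 - c) * wvol ?z Q" if "Q \<in> cubes" "G \<in> sets lebesgue" "G \<subseteq> Q" "wvol u G \<le> wvol u Q / 2" for Q G
    unfolding c_def using that s1 Rc RHQ pos by (intro reverse_holder_half[OF u z]) auto
  have bs: "pavg r 1 h Q \<le> 4 * Rc powr (1 / q) * (wvol u (G \<inter> Q) / wvol u Q) powr (1 - 1 / q + \<epsilon>) * wvol u Q"
    if Q: "Q \<in> shifted_dyadic_cubes" and G: "G \<in> sets lebesgue" and h: "\<forall>x. norm (h x) \<le> indicator G x * u x" for Q G and h :: "real ^ 'n \<Rightarrow> 'k"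
  proof -
    obtain a where a: "a \<in> shifts" "Q \<in> shifted_grid a" using Q by (auto simp: shifted_dyadic_cubes_eq)
    note Qf = cube_facts[OF sc[OF Q]]
    define \<rho> where "\<rho> = wvol u (G \<inter> Q) / wvol u Q"
    have \<rho>0: "0 \<le> \<rho>" by (simp add: \<rho>_def wvol_nonneg[OF u])
    have "wvol ?z (G \<inter> Q) \<le> 4 * \<rho> powr \<delta> * wvol ?z Q"
      unfolding \<rho>_def \<delta>_def
    proof (rule decay_measurable[OF u z pos _ d2 c half a(2)])
      fix R R' assume R: "R \<in> shifted_grid a" "R' \<in> shifted_grid a" "R \<subseteq> R'" "measure lebesgue R' = 2 ^ CARD('n) * measure lebesgue R"
      have "R' \<in> shifted_dyadic_cubes" using R(2) a(1) by (auto simp: shifted_dyadic_cubes_eq)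
      moreover have "R \<in> sets lebesgue" by (rule cube_facts(1)[OF shifted_grid_cubes[OF R(1)]])
      ultimately show "wvol u R' \<le> d2 * wvol u R" using R by (intro dbl) (auto simp: power_one_over)
    qed (use G Qf in auto)
    then have "pavg r 1 h Q \<le> Rc powr (1 / q) * (4 * \<rho> powr \<delta>) powr (1 / (s * q)) * \<rho> powr (1 - 1 / q) * wvol u Q"
      unfolding \<rho>_def using G h RHQ sc[OF Q] pos[OF sc[OF Q]]
      by (intro pavg_interpolation[OF u z q(1) qQ req seq Rc(1)]) auto
    also have "(4 * \<rho> powr \<delta>) powr (1 / (s * q)) = 4 powr (1 / (s * q)) * \<rho> powr \<epsilon>"
      using \<rho>0 by (simp add: powr_mult powr_powr \<epsilon>_def)
    also have "Rc powr (1 / q) * (4 powr (1 / (s * q)) * \<rho> powr \<epsilon>) * \<rho> powr (1 - 1 / q) * wvol u Q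
       = 4 powr (1 / (s * q)) * (Rc powr (1 / q) * \<rho> powr (1 - 1 / q + \<epsilon>) * wvol u Q)"
      by (simp add: powr_add mult_ac)
    also have "\<dots> \<le> 4 powr 1 * (Rc powr (1 / q) * \<rho> powr (1 - 1 / q + \<epsilon>) * wvol u Q)"
    proof (intro mult_right_mono powr_mono)
      have "1 * 1 \<le> s * q" using s1 q by (intro mult_mono) auto
      then show "1 / (s * q) \<le> 1" by simp
    qed (use pos[OF sc[OF Q]] in auto)
    finally show ?thesis by (simp add: \<rho>_def mult_ac)
  qed
  have bc: "pavg r 1 h Q \<le> 4 * Rc powr (1 / q) * (wvol u (G \<inter> Q) / wvol u Q) powr (1 - 1 / q) * wvol u Q"
    if Q: "Q \<in> cubes" and G: "G \<in> sets lebesgue" and h: "\<forall>x. norm (h x) \<le> indicator G x * u x" for Q G and h :: "real ^ 'n \<Rightarrow> 'k"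
  proof -
    note Qf = cube_facts[OF Q]
    have "wvol ?z (G \<inter> Q) \<le> 1 * wvol ?z Q" using G Qf by (auto intro!: wvol_mono[OF z])
    then have "pavg r 1 h Q \<le> Rc powr (1 / q) * 1 powr (1 / (s * q)) * (wvol u (G \<inter> Q) / wvol u Q) powr (1 - 1 / q) * wvol u Q"
      using G h RHQ Q pos[OF Q]
      by (intro pavg_interpolation[OF u z q(1) qQ req seq Rc(1)]) auto
    also have "\<dots> \<le> 4 * (Rc powr (1 / q) * (wvol u (G \<inter> Q) / wvol u Q) powr (1 - 1 / q) * wvol u Q)"
      using pos[OF Q] by simp
    finally show ?thesis by (simp add: mult.assoc)
  qed
  show ?thesis using Rc \<epsilon>0 q\<epsilon> cost bs bc by blast
qed

section \<open>The weighted inequality\<close>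

theorem theorem1p1:
  fixes \<alpha> p q p\<^sub>0 \<eta> A :: real and q\<^sub>0 :: ennreal and N :: nat
  assumes "0 \<le> \<alpha>" "\<alpha> < real CARD('n::finite)"
    and "1 \<le> p\<^sub>0" "p\<^sub>0 \<le> p" "p \<le> q" "ennreal q < q\<^sub>0"
    and "1 / p - 1 / q = \<alpha> / (real CARD('n) * conj_exp q\<^sub>0)"
    and "0 < \<eta>" "\<eta> \<le> 1"
  defines "s \<equiv> conj_exp (q\<^sub>0 / ennreal q)"
  shows "\<exists>C::real.
    \<forall>(T :: (real ^ 'n \<Rightarrow> 'k::{real_normed_field, euclidean_space}) \<Rightarrow> (real ^ 'n \<Rightarrow> 'k))
     (w :: real ^ 'n \<Rightarrow> real).
      S_class \<alpha> p\<^sub>0 q\<^sub>0 N \<eta> A T \<longrightarrow> weight w \<longrightarrow>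
      AR_class (p / p\<^sub>0) (q / p\<^sub>0) (wpow w p\<^sub>0) \<longrightarrow> RH_class s (wpow w q) \<longrightarrow>
        op_norm (lorentz_p1 p (wpow w p)) (lorentz_weak q (wpow w q)) T
          \<le> ennreal C * epow (AR_const (p / p\<^sub>0) (q / p\<^sub>0) (wpow w p\<^sub>0)) (1 / p\<^sub>0)
              * epow (RH_const s (wpow w q)) (s + 1 / q)
              * D_const \<eta> (wpow w q)
              * epow (D_const ((1 / 2) ^ CARD('n)) (wpow w q)) (1 / q)
        \<and> D_const \<eta> (wpow w q)
          \<le> ennreal C * epow (AR_const (p / p\<^sub>0) (q / p\<^sub>0) (wpow w p\<^sub>0)) (q / p\<^sub>0)"
proof -
  have ps: "0 < p\<^sub>0" "0 < p" "0 < q" "1 \<le> p" "1 \<le> q" using assms(3-5) by auto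
  define i where "i = enn2real (1 / q\<^sub>0)"
  define r where "r = conj_exp q\<^sub>0"
  define \<beta> where "\<beta> = \<alpha> / (real CARD('n) * r)"
  have \<beta>pq: "\<beta> = 1 / p - 1 / q" using assms(7) by (simp add: \<beta>_def r_def)
  have ir: "r = 1 / (1 - i)" "0 \<le> i" "i < 1"
  proof (atomize (full), cases "q\<^sub>0 = \<infinity>")
    case True
    then show "r = 1 / (1 - i) \<and> 0 \<le> i \<and> i < 1" by (simp add: i_def r_def conj_exp_def)
  next
    case False
    then obtain Q0 where Q0: "q\<^sub>0 = ennreal Q0" "0 \<le> Q0" by (cases q\<^sub>0) auto
    have Q01: "1 < Q0" using assms(6) Q0 ps by (simp add: ennreal_less_iff)
    have "1 / q\<^sub>0 = ennreal (1 / Q0)" using Q0 Q01 divide_ennreal[of 1 Q0] by simp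
    then have i: "i = 1 / Q0" using Q01 by (simp add: i_def)
    have r: "r = Q0 / (Q0 - 1)" using Q0 by (simp add: r_def conj_exp_def)
    have "Q0 / (Q0 - 1) = 1 / (1 - 1 / Q0)" using Q01 by (simp add: field_simps)
    then show "r = 1 / (1 - i) \<and> 0 \<le> i \<and> i < 1" unfolding i r using Q01 by simp
  qed
  define CX where "CX = 1 + 36 ^ CARD('n) * real (card (shifts :: ('n \<Rightarrow> nat) set)) * (6 ^ CARD('n) / ((1 - \<eta>) * \<eta>)) * (1 + 2 * real (card (shifts :: ('n \<Rightarrow> nat) set)))"
  have CX1: "1 \<le> CX" unfolding CX_def using assms(8,9) by (auto intro!: mult_nonneg_nonneg divide_nonneg_nonneg)
  define A' where "A' = max A 0 * real N"
  have A'0: "0 \<le> A'" by (simp add: A'_def)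
  define Cb where "Cb = 1 + q + 4 * s * q * q * 2 powr s"
  define C1 where "C1 = 64 * (A' + 1) * CX * Cb"
  define C2 where "C2 = \<eta> powr (- (q * (1 / p\<^sub>0 - (1 / p - 1 / q))))"
  define C where "C = \<bar>C1\<bar> + C2"
  have C20: "0 \<le> C2" by (simp add: C2_def)
  have C: "C1 \<le> C" "C2 \<le> C" "0 \<le> C" using C20 unfolding C_def by linarith+
  show ?thesis
  proof (intro exI[of _ C] allI impI)
    fix T :: "(real ^ 'n \<Rightarrow> 'k) \<Rightarrow> (real ^ 'n \<Rightarrow> 'k)" and w :: "real ^ 'n \<Rightarrow> real"
    assume S: "S_class \<alpha> p\<^sub>0 q\<^sub>0 N \<eta> A T" and w: "weight w"
      and ARc: "AR_class (p / p\<^sub>0) (q / p\<^sub>0) (wpow w p\<^sub>0)" and RHc: "RH_class s (wpow w q)"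
    define u where "u = wpow w q"
    define v where "v = wpow w p"
    have w0: "w \<in> borel_measurable lebesgue" "\<And>x. 0 \<le> w x"
      using w locally_integrable_measurable by (auto simp: weight_def)
    have u: "locally_finite_weight u" using RHc weight_locally_finite by (auto simp: RH_class_def u_def)
    have v: "locally_finite_weight v" unfolding v_def
      using ps assms(5) by (intro locally_finite_wpow_le[OF u[unfolded u_def] w0]) auto
    define K where "K = enn2real (AR_const (p / p\<^sub>0) (q / p\<^sub>0) (wpow w p\<^sub>0))"
    have K: "AR_const (p / p\<^sub>0) (q / p\<^sub>0) (wpow w p\<^sub>0) = ennreal K" "0 \<le> K"
      using ARc by (auto simp: AR_class_def K_def)
    have AR: "measure lebesgue E powr (1 / p\<^sub>0) * measure lebesgue Q powr (1 / p - 1 / q - 1 / p\<^sub>0) * wvol u Q powr (1 / q)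
        \<le> K powr (1 / p\<^sub>0) * wvol v E powr (1 / p)" if "Q \<in> cubes" "E \<in> sets lebesgue" "E \<subseteq> Q" for Q E
      unfolding u_def v_def
      by (rule AR_inequality[OF u[unfolded u_def] v[unfolded v_def] assms(3-5) K that])
    show "op_norm (lorentz_p1 p (wpow w p)) (lorentz_weak q (wpow w q)) T
          \<le> ennreal C * epow (AR_const (p / p\<^sub>0) (q / p\<^sub>0) (wpow w p\<^sub>0)) (1 / p\<^sub>0)
              * epow (RH_const s (wpow w q)) (s + 1 / q)
              * D_const \<eta> (wpow w q)
              * epow (D_const ((1 / 2) ^ CARD('n)) (wpow w q)) (1 / q)
        \<and> D_const \<eta> (wpow w q)
          \<le> ennreal C * epow (AR_const (p / p\<^sub>0) (q / p\<^sub>0) (wpow w p\<^sub>0)) (q / p\<^sub>0)"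
    \<comment> \<open>If \<open>w\<close> vanishes almost everywhere, both bounds hold because \<open>0 / 0 = 0\<close> makes \<open>D_const\<close> vanish.\<close>
    proof (cases "wmeas u UNIV = 0")
      case True
      have z: "wmeas u E = 0" for E
      proof -
        have "wmeas u E \<le> wmeas u UNIV" unfolding wmeas_def by (intro nn_integral_mono) (auto simp: indicator_def)
        then show ?thesis using True by simp
      qed
      have l0: "lorentz_weak q u h = 0" for h :: "real ^ 'n \<Rightarrow> 'k"
        by (simp add: lorentz_weak_def z epow_def)
      have "D_const \<eta> u \<le> 0" unfolding D_const_def z by (intro SUP_least) simp
      then have "D_const \<eta> u = 0" by simp
      moreover have "op_norm (lorentz_p1 p v) (lorentz_weak q u) T \<le> X" for X
        unfolding op_norm_def by (rule Inf_lower) (simp add: l0)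
      ultimately show ?thesis unfolding u_def v_def by (metis zero_le)
    next
      case False
      have pos: "0 < wvol u Q" if "Q \<in> cubes" for Q
        unfolding u_def using False AR ps assms(5) that
        by (intro wvol_cube_pos[OF u[unfolded u_def] v[unfolded v_def]]) (auto simp: u_def v_def)
      have D: "\<exists>d. 1 \<le> d \<and> D_const \<delta> u = ennreal d \<and> d \<le> \<delta> powr (- (q * (1 / p\<^sub>0 - (1 / p - 1 / q)))) * K powr (q / p\<^sub>0) \<and>
         (\<forall>Q E. Q \<in> shifted_dyadic_cubes \<longrightarrow> E \<in> sets lebesgue \<longrightarrow> E \<subseteq> Q \<longrightarrow> \<delta> * measure lebesgue Q \<le> measure lebesgue E \<longrightarrow> wvol u Q \<le> d * wvol u E)"
        if \<delta>: "0 < \<delta>" "\<delta> \<le> 1" for \<delta>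
        unfolding u_def
      proof (rule D_const_bound[OF u[unfolded u_def] v[unfolded v_def] assms(3-5) K(2) _ _ \<delta>])
        show "measure lebesgue E powr (1 / p\<^sub>0) * measure lebesgue Q powr (1 / p - 1 / q - 1 / p\<^sub>0) * wvol (wpow w q) Q powr (1 / q)
          \<le> K powr (1 / p\<^sub>0) * wvol (wpow w p) E powr (1 / p)" if "Q \<in> cubes" "E \<in> sets lebesgue" "E \<subseteq> Q" for Q E
          using AR[OF that] by (simp only: u_def v_def)
        show "0 < wvol (wpow w q) Q" if "Q \<in> cubes" for Q using pos[OF that] by (simp only: u_def)
      qed
      obtain d where d: "1 \<le> d" "D_const \<eta> u = ennreal d" "d \<le> C2 * K powr (q / p\<^sub>0)"
        and dE: "\<forall>Q E. Q \<in> shifted_dyadic_cubes \<longrightarrow> E \<in> sets lebesgue \<longrightarrow> E \<subseteq> Q \<longrightarrow> \<eta> * measure lebesgue Q \<le> measure lebesgue E \<longrightarrow> wvol u Q \<le> d * wvol u E"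
        using D[OF assms(8,9)] unfolding C2_def by (elim exE conjE)
      have n2: "0 < (1 / 2 :: real) ^ CARD('n)" "(1 / 2 :: real) ^ CARD('n) \<le> 1" by (simp_all add: power_le_one)
      obtain d2 where d2: "1 \<le> d2" "D_const ((1 / 2) ^ CARD('n)) u = ennreal d2"
        and dE2: "\<forall>Q E. Q \<in> shifted_dyadic_cubes \<longrightarrow> E \<in> sets lebesgue \<longrightarrow> E \<subseteq> Q \<longrightarrow> (1 / 2) ^ CARD('n) * measure lebesgue Q \<le> measure lebesgue E \<longrightarrow> wvol u Q \<le> d2 * wvol u E"
        using D[OF n2] by (elim exE conjE)
      have RHf: "RH_const s u < \<infinity>"
        using RHc by (auto simp: RH_class_def u_def RH_const_def split: if_splits)
      have "\<exists>Rc \<epsilon>. 1 \<le> Rc \<and> RH_const s u = ennreal Rc \<and> 0 < \<epsilon> \<and> q * \<epsilon> \<le> 1 \<and>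
        1 + 1 / \<epsilon> \<le> (1 + q + 4 * s * q * q * 2 powr s) * (Rc powr s * d2 powr (1 / q)) \<and>
        (\<forall>Q G (h :: real ^ 'n \<Rightarrow> 'k). Q \<in> shifted_dyadic_cubes \<longrightarrow> G \<in> sets lebesgue \<longrightarrow> (\<forall>x. norm (h x) \<le> indicator G x * u x) \<longrightarrow>
           pavg r 1 h Q \<le> 4 * Rc powr (1 / q) * (wvol u (G \<inter> Q) / wvol u Q) powr (1 - 1 / q + \<epsilon>) * wvol u Q) \<and>
        (\<forall>Q G (h :: real ^ 'n \<Rightarrow> 'k). Q \<in> cubes \<longrightarrow> G \<in> sets lebesgue \<longrightarrow> (\<forall>x. norm (h x) \<le> indicator G x * u x) \<longrightarrow>
           pavg r 1 h Q \<le> 4 * Rc powr (1 / q) * (wvol u (G \<inter> Q) / wvol u Q) powr (1 - 1 / q) * wvol u Q)"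
      proof (rule local_average_bounds[OF u _ ps(5) assms(6) s_def[THEN meta_eq_to_obj_eq] r_def RHf d2(1)])
        show "wvol u Q \<le> d2 * wvol u E" if "Q \<in> shifted_dyadic_cubes" "E \<in> sets lebesgue" "E \<subseteq> Q" "(1 / 2) ^ CARD('n) * measure lebesgue Q \<le> measure lebesgue E" for Q E
          using dE2 that by (elim allE impE) assumption+
      qed (rule pos)
      then obtain Rc \<epsilon> where Rc: "1 \<le> Rc" "RH_const s u = ennreal Rc" and \<epsilon>: "0 < \<epsilon>" "q * \<epsilon> \<le> 1"
        and cost: "1 + 1 / \<epsilon> \<le> Cb * (Rc powr s * d2 powr (1 / q))"
        and bs: "\<forall>Q G (h :: real ^ 'n \<Rightarrow> 'k). Q \<in> shifted_dyadic_cubes \<longrightarrow> G \<in> sets lebesgue \<longrightarrow> (\<forall>x. norm (h x) \<le> indicator G x * u x) \<longrightarrow>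
           pavg r 1 h Q \<le> 4 * Rc powr (1 / q) * (wvol u (G \<inter> Q) / wvol u Q) powr (1 - 1 / q + \<epsilon>) * wvol u Q"
        and bc: "\<forall>Q G (h :: real ^ 'n \<Rightarrow> 'k). Q \<in> cubes \<longrightarrow> G \<in> sets lebesgue \<longrightarrow> (\<forall>x. norm (h x) \<le> indicator G x * u x) \<longrightarrow>
           pavg r 1 h Q \<le> 4 * Rc powr (1 / q) * (wvol u (G \<inter> Q) / wvol u Q) powr (1 - 1 / q) * wvol u Q"
        unfolding Cb_def by (elim exE conjE)
      define \<kappa> where "\<kappa> = K powr (1 / p\<^sub>0)"
      have Kpos: "0 < K"
      proof (rule ccontr)
        assume "\<not> 0 < K"
        then have K0: "K = 0" using K(2) by simp
        define Q :: "(real ^ 'n) set" where "Q = cell (\<lambda>_. 0) 0 (\<lambda>_. 0)"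
        have Q: "Q \<in> cubes" unfolding Q_def by (rule cell_cubes)
        note Qf = cube_facts[OF Q]
        have "0 < measure lebesgue Q powr (1 / p\<^sub>0) * measure lebesgue Q powr (1 / p - 1 / q - 1 / p\<^sub>0) * wvol u Q powr (1 / q)"
          using Qf pos[OF Q] by simp
        then show False using AR[OF Q Qf(1) order_refl] K0 by simp
      qed
      have \<kappa>: "0 < \<kappa>" using Kpos by (simp add: \<kappa>_def)
      define cc where "cc = 4 * (A' + 1) * (CX * (4 * Rc powr (1 / q)) * d * (1 + 1 / \<epsilon>))"
      have cc: "0 < cc" unfolding cc_def using A'0 CX1 Rc d(1) \<epsilon> by (intro mult_pos_pos) (auto simp: add_pos_pos)
      have st: "\<beta> + i < 1 / p\<^sub>0" using S by (simp add: S_class_def i_def \<beta>_def r_def)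
      have testL: "lorentz_weak q u (T f) \<le> ennreal (cc * L)"
        if f: "f \<in> test_functions" and L: "0 < L" "ennreal \<kappa> * lorentz_p1 p v f \<le> ennreal L" for f L
      proof -
        have "lorentz_weak q u (T f) \<le> ennreal (4 * (max A 0 * real N) * (CX * (4 * Rc powr (1 / q)) * d * (1 + 1 / \<epsilon>) * L))"
        proof (rule test_function_weak_bound[OF S r_def ir \<beta>_def \<beta>pq st assms(3-5) u v pos \<kappa> _ d(1) _ \<epsilon> _ _ _ f L CX_def])
          show "measure lebesgue E powr (1 / p\<^sub>0) * measure lebesgue Q powr (\<beta> - 1 / p\<^sub>0) * wvol u Q powr (1 / q) \<le> \<kappa> * wvol v E powr (1 / p)"
            if "Q \<in> cubes" "E \<in> sets lebesgue" "E \<subseteq> Q" for Q E using AR[OF that] by (simp add: \<kappa>_def \<beta>pq)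
        qed (use dE bs bc Rc in auto)
        also have "\<dots> \<le> ennreal (cc * L)"
        proof (rule ennreal_leI)
          have "4 * A' * (CX * (4 * Rc powr (1 / q)) * d * (1 + 1 / \<epsilon>) * L) \<le> 4 * (A' + 1) * (CX * (4 * Rc powr (1 / q)) * d * (1 + 1 / \<epsilon>) * L)"
            using CX1 Rc d(1) \<epsilon> L by (intro mult_right_mono) auto
          then show "4 * (max A 0 * real N) * (CX * (4 * Rc powr (1 / q)) * d * (1 + 1 / \<epsilon>) * L) \<le> cc * L"
            by (simp add: A'_def cc_def mult.assoc)
        qed
        finally show ?thesis .
      qed
      \<comment> \<open>The norm of \<open>f\<close> may be 0, whereas \<open>L\<close> is positive; so the norm is approached from above.\<close>
      have test: "lorentz_weak q u (T f) \<le> ennreal (cc * \<kappa>) * lorentz_p1 p v f" if f: "f \<in> test_functions" for f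
      proof (cases "lorentz_p1 p v f")
        case (real l)
        have "lorentz_weak q u (T f) \<le> ennreal (cc * \<kappa> * l)"
        proof (rule ennreal_le_epsilon)
          fix e :: real assume e: "0 < e"
          have "lorentz_weak q u (T f) \<le> ennreal (cc * (\<kappa> * l + e / cc))"
            using real \<kappa> e cc by (intro testL[OF f]) (auto simp: ennreal_mult[symmetric] add_nonneg_pos intro!: ennreal_leI)
          also have "cc * (\<kappa> * l + e / cc) = cc * \<kappa> * l + e" using cc by (simp add: distrib_left)
          also have "ennreal (cc * \<kappa> * l + e) = ennreal (cc * \<kappa> * l) + ennreal e" using cc \<kappa> real e by (intro ennreal_plus) auto
          finally show "lorentz_weak q u (T f) \<le> ennreal (cc * \<kappa> * l) + ennreal e" .
        qed
        then show ?thesis using real cc \<kappa> by (simp add: ennreal_mult)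
      next
        case top
        then show ?thesis using cc \<kappa> by (simp add: ennreal_mult_top)
      qed
      have "op_norm (lorentz_p1 p v) (lorentz_weak q u) T \<le> 4 * ennreal (cc * \<kappa>)"
      proof (rule op_norm_le_of_test_functions[OF u v ps(4,5) _ _ test])
        show "T f \<in> borel_measurable lebesgue" if "f \<in> test_functions" for f
          using S that locally_integrable_measurable by (auto simp: S_class_def)
      qed auto
      also have "\<dots> = ennreal (4 * (cc * \<kappa>))" using cc \<kappa> by (simp add: ennreal_mult)
      also have "\<dots> \<le> ennreal (C * \<kappa> * Rc powr (s + 1 / q) * d * d2 powr (1 / q))"
      proof (rule ennreal_leI)
        have "4 * (cc * \<kappa>) = (64 * (A' + 1) * CX * Rc powr (1 / q) * d * \<kappa>) * (1 + 1 / \<epsilon>)" by (simp add: cc_def)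
        also have "\<dots> \<le> (64 * (A' + 1) * CX * Rc powr (1 / q) * d * \<kappa>) * (Cb * (Rc powr s * d2 powr (1 / q)))"
          using A'0 CX1 d(1) \<kappa> by (intro mult_left_mono cost) auto
        also have "\<dots> = C1 * (\<kappa> * Rc powr (s + 1 / q) * d * d2 powr (1 / q))" by (simp add: C1_def powr_add mult_ac)
        also have "\<dots> \<le> C * (\<kappa> * Rc powr (s + 1 / q) * d * d2 powr (1 / q))"
          using C(1) \<kappa> d(1) by (intro mult_right_mono) auto
        finally show "4 * (cc * \<kappa>) \<le> C * \<kappa> * Rc powr (s + 1 / q) * d * d2 powr (1 / q)" by (simp add: mult.assoc)
      qed
      also have "\<dots> = ennreal C * epow (ennreal K) (1 / p\<^sub>0) * epow (ennreal Rc) (s + 1 / q) * ennreal d * epow (ennreal d2) (1 / q)"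
        using C(3) K(2) Rc(1) d(1) d2(1) by (simp add: epow_ennreal \<kappa>_def ennreal_mult)
      finally have "op_norm (lorentz_p1 p v) (lorentz_weak q u) T
         \<le> ennreal C * epow (ennreal K) (1 / p\<^sub>0) * epow (ennreal Rc) (s + 1 / q) * ennreal d * epow (ennreal d2) (1 / q)" .
      moreover have "ennreal d \<le> ennreal C * epow (ennreal K) (q / p\<^sub>0)"
      proof -
        have "d \<le> C * K powr (q / p\<^sub>0)" using d(3) C(2) mult_right_mono[of C2 C "K powr (q / p\<^sub>0)"] by simp
        then have "ennreal d \<le> ennreal (C * K powr (q / p\<^sub>0))" by (rule ennreal_leI)
        then show ?thesis using C(3) K(2) by (simp add: epow_ennreal ennreal_mult)
      qed
      ultimately show ?thesis using K(1) Rc(2) d(2) d2(2) by (simp add: u_def v_def)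
    qed
  qed
qed

end
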